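(* Let $D>1$ be a square-free integer with $D\equiv1\pmod 4$, let $n\ge1$ and let $\nu\bmod n$ satisfy $\nu^2\equiv D\pmod n$. Let $(x_j)_{j\ge1}$ be the sequence of points $\frac{\mu}{m}\in\mathbb{T}=\mathbb{R}/\mathbb{Z}$, one for each pair $(m,\mu\bmod m)$ with $m$ a positive integer, $\mu^2\equiv D\pmod m$, $m\equiv0\pmod n$ and $\mu\equiv\nu\pmod n$, listed in order of nondecreasing $m$ (points with equal $m$ in arbitrary order). For $N\ge1$ and a bounded interval $I\subseteq\mathbb{R}$ set $$R^2_{N,\nu,n}(I)=\frac1N\#\{1\le i\ne j\le N: x_i-x_j\in N^{-1}I+\mathbb{Z}\}.$$ Then there exists an even and continuous function $\omega_{D,\nu,n}:\mathbb{R}\to\mathbb{R}_{\ge0}$ such that for every bounded interval $I\subseteq\mathbb{R}$, $$\lim_{N\to\infty}R^2_{N,\nu,n}(I)=\int_I\omega_{D,\nu,n}(t)\,dt.$$ *)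

theory Defs
  imports
    "HOL-Analysis.Analysis"
    "HOL-Number_Theory.Cong"
    "HOL-Computational_Algebra.Squarefree"
begin

text \<open>A residue class \<open>\<mu> mod m\<close> is represented by its unique member with \<open>0 \<le> \<mu> < m\<close>. The
  condition \<open>\<mu> \<equiv> \<nu> (mod n)\<close> does not depend on the representative because \<open>n dvd m\<close>.\<close>

definition root_pairs :: "int \<Rightarrow> int \<Rightarrow> int \<Rightarrow> (int \<times> int) set" where
  "root_pairs D \<nu> n =
     {(m, \<mu>). m > 0 \<and> 0 \<le> \<mu> \<and> \<mu> < m \<and> [\<mu>\<^sup>2 = D] (mod m) \<and> [m = 0] (mod n) \<and> [\<mu> = \<nu>] (mod n)}"

text \<open>Indices start at 1; the value at index 0 is irrelevant.\<close>

definition root_enumeration :: "int \<Rightarrow> int \<Rightarrow> int \<Rightarrow> (nat \<Rightarrow> int \<times> int) \<Rightarrow> bool" where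
  "root_enumeration D \<nu> n e \<longleftrightarrow>
     bij_betw e {1..} (root_pairs D \<nu> n) \<and> (\<forall>i\<ge>1. \<forall>j\<ge>i. fst (e i) \<le> fst (e j))"

text \<open>Points of \<open>\<real>/\<int>\<close> are given by real representatives.\<close>

definition root_point :: "int \<times> int \<Rightarrow> real" where
  "root_point p = real_of_int (snd p) / real_of_int (fst p)"

text \<open>The condition \<open>x i - x j \<in> N\<^sup>-\<^sup>1 I + \<int>\<close> is invariant under integer shifts
  of the \<open>x i\<close>, so this is a function of the points modulo 1.\<close>

definition pair_correlation :: "(nat \<Rightarrow> real) \<Rightarrow> nat \<Rightarrow> real set \<Rightarrow> real" where
  "pair_correlation x N I =
     real (card {(i, j). i \<in> {1..N} \<and> j \<in> {1..N} \<and> i \<noteq> j \<and>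
                   x i - x j \<in> {t / real N + of_int k | t k. t \<in> I}}) / real N"

end

theory Submission
  imports Defs "HOL-Real_Asymp.Real_Asymp"
begin

text \<open>A pair \<open>(m, \<mu>)\<close> corresponds to the quadratic form \<open>m x\<^sup>2 + 2 \<mu> x y + c y\<^sup>2\<close> with \<open>\<mu>\<^sup>2 - m c = D\<close>, and the
  forms with \<open>n dvd m\<close> and \<open>\<mu> \<equiv> \<nu>\<close> modulo \<open>n\<close> are permuted by \<open>\<Gamma>\<^sub>0(n)\<close>. For two forms \<open>Q\<^sub>1, Q\<^sub>2\<close> moved by a
  matrix with first column \<open>v\<close> the new moduli are \<open>Q\<^sub>i(v)\<close>, and the difference of the new points \<open>\<mu> / m\<close> is
  \<open>K(v) / (Q\<^sub>1(v) Q\<^sub>2(v))\<close> for a third quadratic form \<open>K\<close>. Hence the close pairs in one \<open>\<Gamma>\<^sub>0(n)\<close>-orbit of pairs are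
  counted by the primitive vectors in \<open>\<surd>M\<close> times a fixed bounded plane region, and their number is
  asymptotic to \<open>M\<close> times a constant times its area. In the isotropic coordinates of \<open>Q\<^sub>1\<close> this area
  is the integral of an explicit continuous density. Reduction theory shows that pairs whose moduli are comparable
  to \<open>M\<close> lie in finitely many orbits and that roots are well spaced, which makes the sum over all orbits
  converge uniformly. The number of roots with modulus at most \<open>M\<close> is counted by the same method, with a
  fundamental sector for the automorphs coming from Pell's equation; this translates \<open>M\<close> into \<open>N\<close>.\<close>

text \<open>An orbit yields only the limit of a count, hence the integral of its density, whereas a
  continuous limit needs the sum of the densities to converge uniformly on compact sets. The bridge
  is that a density at \<open>t\<close> is at most a constant, depending only on a bound for |t|,
  times its own integral over a slightly longer interval; finite sums of such integrals are limits
  of counts and stay bounded. High narrow peaks at 0 could ruin this estimate. Integrality excludes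
  them: the joint invariant \<open>2 h1 h2 - a1 c2 - a2 c1\<close> of two distinct forms is an
  integer different from \<open>2 D\<close>, so at distance at least 1 from it, and a density then
  either vanishes on [-1, 1] or varies by a bounded factor on [0, 1]. Orbits carry the pairs whose
  first modulus is the smaller one; the opposite order contributes the reflected density, which
  makes the limit even. The first root of a pair is kept in [0, 1) and the second form carries the
  integer shift, so that closeness modulo 1 becomes closeness of rational numbers.\<close>

section \<open>Integer points of a residue class in dilated plane regions\<close>

lemma lattice_cell_floor:
  fixes X :: real and i n p :: int
  assumes "X > 0" "n > 0"
  shows "p = i + n * \<lfloor>(X * x - i) / n\<rfloor> \<longleftrightarrow> [p = i] (mod n) \<and> p / X \<le> x \<and> x < (p + n) / X"
proof
  assume p: "p = i + n * \<lfloor>(X * x - i) / n\<rfloor>"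
  define k where "k = \<lfloor>(X * x - i) / n\<rfloor>"
  have "real_of_int k \<le> (X * x - i) / n" "(X * x - i) / n < k + 1"
    unfolding k_def by linarith+
  hence k: "real_of_int (i + n * k) \<le> X * x" "X * x < i + n * k + n"
    using assms by (auto simp: field_simps)
  have p': "p = i + n * k" using p k_def by simp
  have "[p = i] (mod n)" using p' by (simp add: cong_def)
  thus "[p = i] (mod n) \<and> p / X \<le> x \<and> x < (p + n) / X"
    using k assms unfolding p' by (auto simp: field_simps)
next
  assume h: "[p = i] (mod n) \<and> p / X \<le> x \<and> x < (p + n) / X"
  then obtain k where k: "p = i + n * k" by (metis cong_iff_lin cong_sym mult.commute)
  have "real_of_int (i + n * k) \<le> X * x" "X * x < real_of_int (i + n * k + n)"
    using h assms unfolding k by (auto simp: field_simps)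
  hence "\<lfloor>(X * x - i) / n\<rfloor> = k"
    using assms by (intro floor_unique) (auto simp: field_simps)
  thus "p = i + n * \<lfloor>(X * x - i) / n\<rfloor>" using k by simp
qed

definition scaled_points :: "real \<Rightarrow> (real \<times> real) set \<Rightarrow> (int \<times> int) set" where
  "scaled_points X \<Omega> = {v. (fst v / X, snd v / X) \<in> \<Omega>}"

lemma bounded_coords:
  fixes \<Omega> :: "(real \<times> real) set"
  assumes "bounded \<Omega>"
  obtains B where "B > 0" "\<And>x y. (x, y) \<in> \<Omega> \<Longrightarrow> \<bar>x\<bar> \<le> B \<and> \<bar>y\<bar> \<le> B"
proof -
  obtain B where B: "B > 0" "\<And>z. z \<in> \<Omega> \<Longrightarrow> norm z \<le> B"
    using assms by (auto simp: bounded_pos)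
  have "\<bar>x\<bar> \<le> B \<and> \<bar>y\<bar> \<le> B" if "(x, y) \<in> \<Omega>" for x y
    using B(2)[OF that] norm_fst_le[of x y] norm_snd_le[of y x] by auto
  thus ?thesis using B(1) that by blast
qed

lemma scaled_points_subset:
  assumes "X > 0" "\<And>x y. (x, y) \<in> \<Omega> \<Longrightarrow> \<bar>x\<bar> \<le> B \<and> \<bar>y\<bar> \<le> B"
  shows "scaled_points X \<Omega> \<subseteq> {-\<lfloor>B * X\<rfloor>..\<lfloor>B * X\<rfloor>} \<times> {-\<lfloor>B * X\<rfloor>..\<lfloor>B * X\<rfloor>}"
proof
  fix v assume "v \<in> scaled_points X \<Omega>"
  hence "\<bar>fst v / X\<bar> \<le> B \<and> \<bar>snd v / X\<bar> \<le> B"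
    using assms(2)[of "fst v / X" "snd v / X"] unfolding scaled_points_def by blast
  hence "real_of_int \<bar>fst v\<bar> \<le> B * X" "real_of_int \<bar>snd v\<bar> \<le> B * X"
    using assms(1) by (auto simp: abs_mult field_simps)
  hence "\<bar>fst v\<bar> \<le> \<lfloor>B * X\<rfloor>" "\<bar>snd v\<bar> \<le> \<lfloor>B * X\<rfloor>" by linarith+
  thus "v \<in> {-\<lfloor>B * X\<rfloor>..\<lfloor>B * X\<rfloor>} \<times> {-\<lfloor>B * X\<rfloor>..\<lfloor>B * X\<rfloor>}"
    by (cases v) (auto simp: abs_le_iff)
qed

lemma finite_scaled_points: "X > 0 \<Longrightarrow> bounded \<Omega> \<Longrightarrow> finite (scaled_points X \<Omega>)"
  by (metis bounded_coords scaled_points_subset finite_subset finite_SigmaI finite_atLeastAtMost_int)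

lemma measure_half_open_box:
  fixes a b c d :: real
  assumes "a \<le> b" "c \<le> d"
  shows "emeasure lborel ({a..<b} \<times> {c..<d}) = ennreal ((b - a) * (d - c))"
proof -
  have "emeasure (lborel \<Otimes>\<^sub>M lborel) ({a..<b} \<times> {c..<d}) = ennreal (b - a) * ennreal (d - c)"
    using assms by (subst lborel.emeasure_pair_measure_Times) (auto)
  thus ?thesis using assms by (simp add: lborel_prod ennreal_mult)
qed

text \<open>Rounding every real point down to the corner of its cell turns the count into an area:
  the cells of side \<open>n / X\<close> at the counted points are disjoint, and their union is the
  set \<open>E X\<close> of points whose corner lies in \<open>\<Omega>\<close>. As the cells
  shrink, the indicator of \<open>E X\<close> tends to that of \<open>\<Omega>\<close> off the
  frontier.\<close>

lemma lattice_count: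
  fixes i j n :: int and \<Omega> :: "(real \<times> real) set"
  assumes n: "n > 0" and bd: "bounded \<Omega>" and meas: "\<Omega> \<in> sets borel"
    and fr: "emeasure lborel (frontier \<Omega>) = 0"
  shows "((\<lambda>X. card {v \<in> scaled_points X \<Omega>. [fst v = i] (mod n) \<and> [snd v = j] (mod n)} / X\<^sup>2)
           \<longlongrightarrow> measure lborel \<Omega> / (real_of_int n)\<^sup>2) at_top"
proof -
  obtain B where B: "B > 0" "\<And>x y. (x, y) \<in> \<Omega> \<Longrightarrow> \<bar>x\<bar> \<le> B \<and> \<bar>y\<bar> \<le> B"
    using bounded_coords[OF bd] by metis
  \<comment> \<open>\<open>fl k X\<close> rounds \<open>x\<close> down to the nearest
    \<open>p / X\<close> with \<open>p\<close> congruent to \<open>k\<close> modulo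
    \<open>n\<close>; the half-open cells between consecutive such points tile the line.\<close>
  define fl where "fl k X x = real_of_int (k + n * \<lfloor>(X * x - real_of_int k) / n\<rfloor>) / X" for k :: int and X x :: real
  define \<phi> where "\<phi> X z = (fl i X (fst z), fl j X (snd z))" for X z
  define S where "S X = {v \<in> scaled_points X \<Omega>. [fst v = i] (mod n) \<and> [snd v = j] (mod n)}" for X
  define E where "E X = {z. \<phi> X z \<in> \<Omega>}" for X
  define cell where "cell X v = {fst v / X..<(fst v + n) / X} \<times> {snd v / X..<(snd v + n) / X}"
    for X :: real and v :: "int \<times> int"
  have finS: "finite (S X)" if "X > 0" for X
    unfolding S_def using finite_scaled_points[OF that bd] by auto
  have Eq: "E X = (\<Union>v\<in>S X. cell X v)" if X: "X > 0" for X
  proof (intro set_eqI)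
    fix z :: "real \<times> real"
    define p where "p = i + n * \<lfloor>(X * fst z - i) / n\<rfloor>"
    define q where "q = j + n * \<lfloor>(X * snd z - j) / n\<rfloor>"
    have "z \<in> (\<Union>v\<in>S X. cell X v) \<longleftrightarrow> (\<exists>v\<in>S X. fst v = p \<and> snd v = q)"
    proof -
      have "z \<in> cell X v \<longleftrightarrow> fst v = p \<and> snd v = q" if "v \<in> S X" for v
      proof -
        have "[fst v = i] (mod n)" "[snd v = j] (mod n)" using that unfolding S_def by auto
        thus ?thesis
          unfolding p_def q_def lattice_cell_floor[OF X n]
          unfolding cell_def by (cases z) auto
      qed
      thus ?thesis by blast
    qed
    also have "\<dots> \<longleftrightarrow> (p, q) \<in> S X" by force
    also have "\<dots> \<longleftrightarrow> z \<in> E X"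
    proof -
      have "[p = i] (mod n)" "[q = j] (mod n)" unfolding p_def q_def by (auto simp: cong_def)
      moreover have "\<phi> X z = (p / X, q / X)" by (simp add: \<phi>_def fl_def p_def q_def)
      ultimately show ?thesis unfolding S_def E_def scaled_points_def by simp
    qed
    finally show "z \<in> E X \<longleftrightarrow> z \<in> (\<Union>v\<in>S X. cell X v)" by blast
  qed
  have mE: "measure lborel (E X) = card (S X) * ((real_of_int n)\<^sup>2 / X\<^sup>2)" if X: "X > 0" for X
  proof -
    have disj: "disjoint_family_on (cell X) (S X)"
    proof (unfold disjoint_family_on_def, intro ballI impI)
      fix v w assume vw: "v \<in> S X" "w \<in> S X" "v \<noteq> w"
      have cell_eq: "fst u = i + n * \<lfloor>(X * fst z - i) / n\<rfloor> \<and> snd u = j + n * \<lfloor>(X * snd z - j) / n\<rfloor>"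
        if "z \<in> cell X u" "u \<in> S X" for z u
        using that
        by (intro conjI lattice_cell_floor[OF X n, THEN iffD2])
           (auto simp: S_def cell_def)
      have "v = w" if z: "z \<in> cell X v" "z \<in> cell X w" for z
        using cell_eq[OF z(1) vw(1)] cell_eq[OF z(2) vw(2)] by (simp add: prod_eq_iff)
      thus "cell X v \<inter> cell X w = {}" using vw by blast
    qed
    have c: "emeasure lborel (cell X v) = ennreal ((real_of_int n)\<^sup>2 / X\<^sup>2)" for v
      unfolding cell_def using X n
      by (subst measure_half_open_box) (auto simp: field_simps power2_eq_square)
    have sc: "cell X v \<in> sets lborel" for v unfolding cell_def by (auto intro!: borel_Times)
    have "measure lborel (E X) = (\<Sum>v\<in>S X. measure lborel (cell X v))"
      unfolding Eq[OF X]
      by (rule measure_finite_Union) (use finS[OF X] disj sc c in auto)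
    also have "\<dots> = (\<Sum>v\<in>S X. (real_of_int n)\<^sup>2 / X\<^sup>2)"
      by (intro sum.cong refl) (simp add: measure_def c)
    finally show ?thesis by simp
  qed
  have fl1: "\<bar>fl k X x - x\<bar> \<le> n / X" if X: "X > 0" for k X x
  proof -
    have "k + n * \<lfloor>(X * x - k) / n\<rfloor> = k + n * \<lfloor>(X * x - real_of_int k) / n\<rfloor>" by simp
    from lattice_cell_floor[OF X n, THEN iffD1, OF this] show ?thesis
      unfolding fl_def using X by (auto simp: abs_le_iff add_divide_distrib)
  qed
  have flim: "((\<lambda>X. fl k X x) \<longlongrightarrow> x) at_top" for k x
  proof -
    have "((\<lambda>X. fl k X x - x) \<longlongrightarrow> 0) at_top"
    proof (rule Lim_null_comparison)
      show "\<forall>\<^sub>F X in at_top. norm (fl k X x - x) \<le> n / X"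
        using eventually_gt_at_top[of 0] by eventually_elim (use fl1 in auto)
      show "((\<lambda>X. real_of_int n / X) \<longlongrightarrow> 0) at_top"
        by (intro tendsto_divide_0[OF tendsto_const] filterlim_at_top_imp_at_infinity filterlim_ident)
    qed
    thus ?thesis by (simp add: LIM_zero_iff)
  qed
  have \<phi>lim: "((\<lambda>X. \<phi> X z) \<longlongrightarrow> z) at_top" for z
    unfolding \<phi>_def using tendsto_Pair[OF flim[of i "fst z"] flim[of j "snd z"]] by simp
  \<comment> \<open>Rounding moves a coordinate by at most \<open>n / X\<close>, so for
    \<open>X \<ge> 1\<close> the box of half-side \<open>B + n\<close> contains every
    \<open>E X\<close> and its indicator dominates.\<close>
  have lim: "((\<lambda>X. \<integral>z. indicator (E X) z \<partial>lborel) \<longlongrightarrow> (\<integral>z. indicator \<Omega> z \<partial>lborel :: real)) at_top"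
  proof (rule integral_dominated_convergence_at_top[where w = "indicator (cbox (-(B+n), -(B+n)) (B+n, B+n))"])
    show "indicator \<Omega> \<in> borel_measurable lborel" using meas by auto
    show "integrable lborel (indicator (cbox (-(B+n), -(B+n)) (B+n, B+n)) :: real \<times> real \<Rightarrow> real)"
      by (intro integrable_real_indicator emeasure_lborel_cbox_finite) auto
    have fm: "fl k X \<in> borel_measurable borel" for k X
      unfolding fl_def by measurable
    have "\<phi> X \<in> borel \<rightarrow>\<^sub>M borel" for X
    proof -
      have "(\<lambda>z. (fl i X (fst z), fl j X (snd z))) \<in> borel_measurable borel"
        by (intro borel_measurable_Pair measurable_compose[OF _ fm] borel_measurable_continuous_onI continuous_intros)
      thus ?thesis unfolding \<phi>_def .
    qed
    hence "E X \<in> sets borel" for X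
      using measurable_sets[of "\<phi> X" borel borel \<Omega>] meas unfolding E_def by (simp add: vimage_def)
    thus "indicator (E X) \<in> borel_measurable lborel" for X :: real by auto
    show "\<forall>\<^sub>F X in at_top. AE z in lborel. norm (indicator (E X) z :: real)
        \<le> indicator (cbox (-(B+n), -(B+n)) (B+n, B+n)) z"
      using eventually_ge_at_top[of "1::real"]
    proof eventually_elim
      case (elim X)
      have "real_of_int n / X \<le> n" using elim n by (simp add: field_simps)
      have "z \<in> cbox (-(B+n), -(B+n)) (B+n, B+n)" if "z \<in> E X" for z
      proof -
        have "\<bar>fl i X (fst z)\<bar> \<le> B" "\<bar>fl j X (snd z)\<bar> \<le> B"
          using that B(2) unfolding E_def \<phi>_def by auto
        hence "\<bar>fst z\<bar> \<le> B + n" "\<bar>snd z\<bar> \<le> B + n"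
          using fl1[of X i "fst z"] fl1[of X j "snd z"] elim \<open>real_of_int n / X \<le> n\<close> by linarith+
        thus ?thesis by (cases z) (auto simp: cbox_Pair_eq)
      qed
      thus ?case by (intro always_eventually) (auto simp: indicator_def)
    qed
    have "AE z in lborel. z \<notin> frontier \<Omega>"
      using fr by (intro AE_not_in null_setsI) auto
    thus "AE z in lborel. ((\<lambda>X. indicator (E X) z) \<longlongrightarrow> (indicator \<Omega> z :: real)) at_top"
    proof eventually_elim
      case (elim z)
      consider "z \<in> interior \<Omega>" | "z \<in> - closure \<Omega>" using elim by (auto simp: frontier_def)
      thus ?case
      proof cases
        case 1
        have "\<forall>\<^sub>F X in at_top. \<phi> X z \<in> interior \<Omega>"
          by (rule topological_tendstoD[OF \<phi>lim open_interior 1])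
        hence "\<forall>\<^sub>F X in at_top. indicator (E X) z = (1::real)"
          by eventually_elim (use interior_subset[of \<Omega>] in \<open>auto simp: E_def indicator_def\<close>)
        moreover have "indicator \<Omega> z = (1::real)" using 1 interior_subset by (auto simp: indicator_def)
        ultimately show ?thesis by (simp add: tendsto_eventually)
      next
        case 2
        have "\<forall>\<^sub>F X in at_top. \<phi> X z \<in> - closure \<Omega>"
          by (rule topological_tendstoD[OF \<phi>lim _ 2]) auto
        hence "\<forall>\<^sub>F X in at_top. indicator (E X) z = (0::real)"
          by eventually_elim (use closure_subset in \<open>auto simp: E_def indicator_def\<close>)
        moreover have "indicator \<Omega> z = (0::real)" using 2 closure_subset by (auto simp: indicator_def)
        ultimately show ?thesis by (simp add: tendsto_eventually)
      qed
    qed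
  qed
  have lim': "((\<lambda>X. measure lborel (E X)) \<longlongrightarrow> measure lborel \<Omega>) at_top"
    using lim by simp
  have "((\<lambda>X. measure lborel (E X) / (real_of_int n)\<^sup>2) \<longlongrightarrow> measure lborel \<Omega> / (real_of_int n)\<^sup>2) at_top"
    using n by (intro tendsto_intros lim') auto
  moreover have "\<forall>\<^sub>F X in at_top. measure lborel (E X) / (real_of_int n)\<^sup>2 = card (S X) / X\<^sup>2"
    using eventually_gt_at_top[of 0]
    by eventually_elim (use n in \<open>auto simp: mE\<close>)
  ultimately show ?thesis unfolding S_def[symmetric] by (rule Lim_transform_eventually)
qed


section \<open>The density of primitive vectors\<close>

text \<open>If \<open>f\<close> tends to \<open>s\<close>, the relation forces
  \<open>s * (1 + Z) = \<kappa>\<close>, where \<open>Z\<close> is the sum of all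
  \<open>c d\<close>. The limit exists because the error \<open>f - s\<close> satisfies the same
  relation with a right side tending to 0, and each use of it multiplies the eventual bound of the
  error by \<open>Z < 1\<close>.\<close>

lemma contraction_limit:
  fixes f g :: "real \<Rightarrow> real" and c :: "nat \<Rightarrow> real" and N :: "real \<Rightarrow> nat"
  assumes f: "\<And>X. X > 0 \<Longrightarrow> 0 \<le> f X \<and> f X \<le> K"
    and g: "(g \<longlongrightarrow> \<kappa>) at_top"
    and c0: "\<And>d. c d \<ge> 0" and csum: "summable c" and Z1: "suminf c < 1"
    and N: "filterlim N at_top at_top"
    and eq: "\<And>X. X > 0 \<Longrightarrow> f X = g X - (\<Sum>d<N X. c d * f (X / (real d + 2)))"
  shows "(f \<longlongrightarrow> \<kappa> / (1 + suminf c)) at_top"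
proof -
  define Z where "Z = suminf c"
  have Z0: "Z \<ge> 0" unfolding Z_def by (rule suminf_nonneg[OF csum c0])
  define s where "s = \<kappa> / (1 + Z)"
  define e where "e X = f X - s" for X
  define K' where "K' = \<bar>K\<bar> + \<bar>s\<bar> + 1"
  define u where "u X = (g X - \<kappa>) + s * (Z - (\<Sum>d<N X. c d))" for X
  have K'0: "K' > 0" unfolding K'_def by simp
  have ks: "\<kappa> = s * (1 + Z)" using Z0 unfolding s_def by simp
  have eb: "\<bar>e X\<bar> \<le> K'" if "X > 0" for X using f[OF that] unfolding e_def K'_def by linarith
  have ee: "e X = u X - (\<Sum>d<N X. c d * e (X / (real d + 2)))" if "X > 0" for X
    unfolding e_def u_def using eq[OF that] ks
    by (simp add: right_diff_distrib sum_subtractf sum_distrib_left algebra_simps)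
  have partial_le: "(\<Sum>d<m. c d) \<le> Z" for m
    unfolding Z_def by (rule sum_le_suminf[OF csum]) (auto simp: c0)
  have u0: "(u \<longlongrightarrow> 0) at_top"
  proof -
    have "(\<lambda>m. \<Sum>d<m. c d) \<longlonglongrightarrow> Z" unfolding Z_def by (rule summable_LIMSEQ[OF csum])
    hence "((\<lambda>X. \<Sum>d<N X. c d) \<longlongrightarrow> Z) at_top" by (rule filterlim_compose[OF _ N])
    hence "(u \<longlongrightarrow> (\<kappa> - \<kappa>) + s * (Z - Z)) at_top" unfolding u_def by (intro tendsto_intros g)
    thus ?thesis by simp
  qed
  \<comment> \<open>In the first \<open>P\<close> terms the argument \<open>X / (d + 2)\<close> is
    still large and the eventual bound \<open>a\<close> applies; the remaining \<open>c d\<close>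
    are so small in total that the global bound \<open>K'\<close> suffices.\<close>
  have step: "\<forall>\<^sub>F X in at_top. \<bar>e X\<bar> \<le> Z * a + \<epsilon>" if a: "\<forall>\<^sub>F X in at_top. \<bar>e X\<bar> \<le> a" and \<epsilon>: "\<epsilon> > 0" for a \<epsilon>
  proof -
    have a0: "a \<ge> 0" using eventually_happens[OF a] by (metis abs_ge_zero order_trans trivial_limit_at_top_linorder)
    obtain X0 where X0: "\<And>X. X \<ge> X0 \<Longrightarrow> \<bar>e X\<bar> \<le> a" using a unfolding eventually_at_top_linorder by blast
    have "(\<lambda>m. \<Sum>d<m. c d) \<longlonglongrightarrow> Z" unfolding Z_def by (rule summable_LIMSEQ[OF csum])
    hence "\<forall>\<^sub>F m in sequentially. (\<Sum>d<m. c d) > Z - \<epsilon> / (2 * K')"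
      by (rule order_tendstoD) (use \<epsilon> K'0 in auto)
    then obtain P where P: "(\<Sum>d<P. c d) > Z - \<epsilon> / (2 * K')" by (meson eventually_happens trivial_limit_sequentially)
    have "\<forall>\<^sub>F X in at_top. \<bar>u X\<bar> < \<epsilon> / 2"
      using tendstoD[OF u0, of "\<epsilon>/2"] \<epsilon> by (simp add: dist_real_def)
    moreover have "\<forall>\<^sub>F X in at_top. X \<ge> (real P + 2) * \<bar>X0\<bar>" by (rule eventually_ge_at_top)
    moreover have "\<forall>\<^sub>F X in at_top. X > (0::real)" by (rule eventually_gt_at_top)
    ultimately show ?thesis
    proof eventually_elim
      case (elim X)
      have term_le: "\<bar>c d * e (X / (real d + 2))\<bar> \<le> c d * a + K' * (if d < P then 0 else c d)" for d
      proof (cases "d < P")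
        case True
        have "(real d + 2) * \<bar>X0\<bar> \<le> X" using True elim(2) by (smt (verit) abs_ge_zero mult_right_mono of_nat_less_iff)
        hence "\<bar>X0\<bar> \<le> X / (real d + 2)" by (simp add: field_simps)
        hence "X0 \<le> X / (real d + 2)" by linarith
        thus ?thesis using X0 c0[of d] True by (simp add: abs_mult mult_left_mono)
      next
        case False
        have "\<bar>e (X / (real d + 2))\<bar> \<le> K'" using elim by (intro eb) auto
        thus ?thesis using False c0[of d] a0
          by (simp add: abs_mult) (smt (verit) mult.commute mult_left_mono mult_nonneg_nonneg)
      qed
      have tail: "(\<Sum>d<N X. if d < P then 0 else c d) + (\<Sum>d<P. c d) \<le> Z"
      proof -
        have "(\<Sum>d<N X. if d < P then 0 else c d) \<le> (\<Sum>d<N X + P. if d < P then 0 else c d)"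
          by (rule sum_mono2) (auto simp: c0)
        moreover have "(\<Sum>d<P. c d) = (\<Sum>d<N X + P. if d < P then c d else 0)"
          by (rule sum.mono_neutral_cong_left) auto
        moreover have "(\<Sum>d<N X + P. if d < P then 0 else c d) + (\<Sum>d<N X + P. if d < P then c d else 0)
            = (\<Sum>d<N X + P. c d)"
          unfolding sum.distrib[symmetric] by (rule sum.cong) auto
        ultimately show ?thesis using partial_le[of "N X + P"] by linarith
      qed
      have "\<bar>\<Sum>d<N X. c d * e (X / (real d + 2))\<bar> \<le> (\<Sum>d<N X. c d * a + K' * (if d < P then 0 else c d))"
        by (rule order_trans[OF sum_abs sum_mono]) (rule term_le)
      also have "\<dots> = (\<Sum>d<N X. c d) * a + K' * (\<Sum>d<N X. if d < P then 0 else c d)"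
        by (simp add: sum.distrib sum_distrib_left sum_distrib_right)
      also have "\<dots> \<le> Z * a + K' * (\<epsilon> / (2 * K'))"
        using tail P a0 K'0 partial_le[of "N X"] by (intro add_mono mult_right_mono mult_left_mono) auto
      finally have "\<bar>\<Sum>d<N X. c d * e (X / (real d + 2))\<bar> \<le> Z * a + \<epsilon> / 2" using K'0 by simp
      thus ?case using ee[OF elim(3)] elim(1) by linarith
    qed
  qed
  have iter: "\<forall>\<^sub>F X in at_top. \<bar>e X\<bar> \<le> Z ^ k * K' + \<delta>" if \<delta>: "\<delta> > 0" for k \<delta>
  proof (induction k)
    case 0
    show ?case using eventually_gt_at_top[of 0] by eventually_elim (use eb \<delta> in fastforce)
  next
    case (Suc k)
    \<comment> \<open>With this slack
      \<open>Z * (Z ^ k * K' + \<delta>) + (1 - Z) * \<delta>\<close> is exactly the next bound, so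
      the errors do not accumulate.\<close>
    have "(1 - Z) * \<delta> > 0" using Z1 \<delta> unfolding Z_def by simp
    from step[OF Suc this] show ?case by (simp add: algebra_simps)
  qed
  have "(e \<longlongrightarrow> 0) at_top"
  proof (rule tendstoI)
    fix \<delta> :: real assume \<delta>: "\<delta> > 0"
    have "(\<lambda>k. Z ^ k * K') \<longlonglongrightarrow> 0 * K'"
      using Z0 Z1 unfolding Z_def by (intro tendsto_intros LIMSEQ_power_zero) auto
    hence "\<forall>\<^sub>F k in sequentially. Z ^ k * K' < \<delta> / 2" using \<delta> by (intro order_tendstoD) auto
    then obtain k where k: "Z ^ k * K' < \<delta> / 2" by (meson eventually_happens trivial_limit_sequentially)
    have "\<delta> / 2 > 0" using \<delta> by simp
    from iter[OF this, of k] show "\<forall>\<^sub>F X in at_top. dist (e X) 0 < \<delta>"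
      by eventually_elim (use k in \<open>simp add: dist_real_def\<close>)
  qed
  hence "(f \<longlongrightarrow> s) at_top" unfolding e_def by (simp add: LIM_zero_iff)
  thus ?thesis unfolding s_def Z_def .
qed

definition prim_points :: "int \<Rightarrow> real \<Rightarrow> (real \<times> real) set \<Rightarrow> (int \<times> int) set" where
  "prim_points n X \<Omega> = {v \<in> scaled_points X \<Omega>. coprime (fst v) (snd v) \<and> n dvd snd v}"

lemma finite_prim_points: "X > 0 \<Longrightarrow> bounded \<Omega> \<Longrightarrow> finite (prim_points n X \<Omega>)"
  unfolding prim_points_def using finite_scaled_points by auto

text \<open>The value is \<open>pi\<^sup>2 / 6 - 1\<close>, for which the crude bound
  \<open>pi < 3.3\<close> suffices.\<close>

lemma sum_inverse_squares_from_2: "summable (\<lambda>d. 1 / (real d + 2)\<^sup>2)" "(\<Sum>d. 1 / (real d + 2)\<^sup>2) < 1"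
proof -
  have "(\<lambda>d. 1 / (real (Suc d) + 1)\<^sup>2) sums (pi\<^sup>2 / 6 - 1)"
    using inverse_squares_sums by (subst sums_Suc_iff) (simp add: add.commute)
  hence s: "(\<lambda>d. 1 / (real d + 2)\<^sup>2) sums (pi\<^sup>2 / 6 - 1)" by (simp add: add_ac)
  thus "summable (\<lambda>d. 1 / (real d + 2)\<^sup>2)" by (rule sums_summable)
  have "pi < 3.3" using pi_less_4 pi_approx by simp
  hence "pi\<^sup>2 < 3.3\<^sup>2" using pi_gt_zero by (intro power_strict_mono) auto
  thus "(\<Sum>d. 1 / (real d + 2)\<^sup>2) < 1" using sums_unique[OF s] by (simp add: power2_eq_square)
qed

text \<open>Every vector \<open>(p, q)\<close> with \<open>n dvd q\<close> and \<open>p\<close> prime to \<open>n\<close> is uniquely \<open>d\<close> times a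
  primitive one with \<open>d\<close> prime to \<open>n\<close>; since the sum of \<open>1 / d\<^sup>2\<close> over \<open>d \<ge> 2\<close> is less than \<open>1\<close>,
  this relation is a contraction which determines the density of the primitive vectors.\<close>

lemma prim_count:
  fixes n :: int
  assumes n: "n > 0"
  shows "\<exists>\<delta>>0. \<forall>\<Omega>. bounded \<Omega> \<longrightarrow> \<Omega> \<in> sets borel \<longrightarrow> emeasure lborel (frontier \<Omega>) = 0 \<longrightarrow>
     ((\<lambda>X. card (prim_points n X \<Omega>) / X\<^sup>2) \<longlongrightarrow> \<delta> * measure lborel \<Omega>) at_top"
proof -
  define cp :: "nat \<Rightarrow> real" where "cp d = (if coprime (int d) n then 1 else 0)" for d
  define c where "c d = cp (d + 2) / (real d + 2)\<^sup>2" for d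
  define I where "I = {i \<in> {0..<n}. coprime i n}"
  \<comment> \<open>The residue 1 lies in \<open>{0..<n}\<close> only for \<open>n > 1\<close>; for
    \<open>n = 1\<close> the residue prime to \<open>n\<close> is 0.\<close>
  have "(if n = 1 then 0 else 1) \<in> I" using n by (auto simp: I_def)
  hence I0: "card I > 0" by (subst card_gt_0_iff) (auto simp: I_def intro: finite_subset[of _ "{0..<n}"])
  have c01: "0 \<le> c d" "c d \<le> 1 / (real d + 2)\<^sup>2" for d unfolding c_def cp_def by auto
  have csum: "summable c"
    by (rule summable_comparison_test'[OF sum_inverse_squares_from_2(1), of 0]) (use c01 in auto)
  have "suminf c \<le> (\<Sum>d. 1 / (real d + 2)\<^sup>2)"
    by (intro suminf_le csum sum_inverse_squares_from_2(1) c01)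
  hence Z1: "suminf c < 1" using sum_inverse_squares_from_2(2) by linarith
  have Z0: "suminf c \<ge> 0" using csum c01 by (intro suminf_nonneg) auto
  define \<delta> where "\<delta> = card I / (real_of_int n)\<^sup>2 / (1 + suminf c)"
  have "((\<lambda>X. card (prim_points n X \<Omega>) / X\<^sup>2) \<longlongrightarrow> \<delta> * measure lborel \<Omega>) at_top"
    if bd: "bounded \<Omega>" and meas: "\<Omega> \<in> sets borel" and fr: "emeasure lborel (frontier \<Omega>) = 0" for \<Omega>
  proof -
    obtain B where B: "B > 0" "\<And>x y. (x, y) \<in> \<Omega> \<Longrightarrow> \<bar>x\<bar> \<le> B \<and> \<bar>y\<bar> \<le> B"
      using bounded_coords[OF bd] by metis
    define N where "N X = nat \<lfloor>B * X\<rfloor>" for X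
    define f where "f X = card (prim_points n X \<Omega>) / X\<^sup>2" for X
    \<comment> \<open>\<open>L X\<close> admits imprimitive vectors but asks the first coordinate to
      be prime to \<open>n\<close>; up to the origin it is a union of residue classes, to which
      \<open>lattice_count\<close> applies.\<close>
    define L where "L X = {v \<in> scaled_points X \<Omega>. coprime (fst v) n \<and> n dvd snd v \<and> v \<noteq> (0, 0)}" for X
    define g where "g X = card (L X) / X\<^sup>2" for X
    define pr where "pr d X = (\<lambda>v. (int d * fst v, int d * snd v)) ` prim_points n (X / d) \<Omega>" for d X
    have fin: "finite (scaled_points X \<Omega>)" if "X > 0" for X using finite_scaled_points[OF that bd] .
    have box: "\<bar>fst v\<bar> \<le> int (N X) \<and> \<bar>snd v\<bar> \<le> int (N X)" if "v \<in> scaled_points X \<Omega>" "X > 0" for v X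
      using scaled_points_subset[OF that(2) B(2)] that(1) unfolding N_def
      by (cases v) (fastforce simp: abs_le_iff)
    have f_bd: "0 \<le> f X \<and> f X \<le> 9 * B\<^sup>2" if X: "X > 0" for X
    proof (cases "N X = 0")
      case True
      have "prim_points n X \<Omega> = {}"
        using box[OF _ X] True unfolding prim_points_def by fastforce
      thus ?thesis unfolding f_def by simp
    next
      case False
      let ?m = "int (N X)"
      have "prim_points n X \<Omega> \<subseteq> {-?m..?m} \<times> {-?m..?m}"
        using box[OF _ X] unfolding prim_points_def by (fastforce simp: abs_le_iff)
      hence "card (prim_points n X \<Omega>) \<le> card ({-?m..?m} \<times> {-?m..?m})" by (intro card_mono) auto
      also have "\<dots> = (2 * N X + 1)\<^sup>2" by (simp add: card_cartesian_product power2_eq_square nat_add_distrib nat_mult_distrib)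
      also have "\<dots> \<le> (3 * N X)\<^sup>2" using False by (intro power_mono) auto
      finally have "real (card (prim_points n X \<Omega>)) \<le> real ((3 * N X)\<^sup>2)" by (simp only: of_nat_le_iff)
      also have "\<dots> = (3 * real (N X))\<^sup>2" by simp
      also have "\<dots> \<le> (3 * (B * X))\<^sup>2" unfolding N_def using X B(1)
        by (intro power_mono mult_left_mono) (auto simp: of_nat_nat)
      finally show ?thesis unfolding f_def using X by (simp add: field_simps power_mult_distrib)
    qed
    \<comment> \<open>Division by the gcd \<open>d\<close>: it is prime to \<open>n\<close> because
      it divides the first coordinate, hence \<open>n\<close> also divides the second coordinate of
      the quotient.\<close>
    have L_eq: "L X = (\<Union>d\<in>{d \<in> {1..N X}. coprime (int d) n}. pr d X)" if X: "X > 0" for X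
    proof (intro equalityI subsetI)
      fix v assume v: "v \<in> L X"
      obtain p q where pq: "v = (p, q)" by (cases v)
      define d where "d = nat (gcd p q)"
      have nz: "p \<noteq> 0 \<or> q \<noteq> 0" using v pq unfolding L_def by auto
      hence d: "d \<ge> 1" "int d = gcd p q" unfolding d_def by (auto simp: Suc_le_eq)
      obtain p' q' where p'q': "p = gcd p q * p'" "q = gcd p q * q'" "coprime p' q'"
        using nz by (metis gcd_coprime_exists gcd_eq_0_iff mult.commute)
      have cop: "coprime p n" "n dvd q" "(p, q) \<in> scaled_points X \<Omega>" using v pq unfolding L_def by auto
      have dn: "coprime (int d) n" using cop(1) d(2) by (metis coprime_divisors dvd_refl gcd_dvd1)
      have "int d \<le> int (N X)"
      proof (cases "p = 0")
        case True
        hence "gcd p q \<le> \<bar>q\<bar>" using nz by simp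
        thus ?thesis using box[OF cop(3) X] d(2) by auto
      next
        case False
        hence "gcd p q \<le> \<bar>p\<bar>" by (metis abs_gcd_int dvd_imp_le_int gcd_dvd1)
        thus ?thesis using box[OF cop(3) X] d(2) by auto
      qed
      moreover have "v \<in> pr d X"
      proof -
        have "n dvd q'" using cop(2) p'q'(2) d(2) dn
          by (metis coprime_commute coprime_dvd_mult_right_iff)
        moreover have "(p', q') \<in> scaled_points (X / d) \<Omega>"
          using cop(3) d p'q' unfolding scaled_points_def
          by (simp add: mult.commute) (metis d(2) mult.commute of_int_mult of_int_of_nat_eq)
        ultimately have "(p', q') \<in> prim_points n (X / d) \<Omega>" using p'q'(3) unfolding prim_points_def by auto
        thus ?thesis unfolding pr_def pq using p'q'(1,2) d(2) by (intro image_eqI[of _ _ "(p', q')"]) auto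
      qed
      ultimately show "v \<in> (\<Union>d\<in>{d \<in> {1..N X}. coprime (int d) n}. pr d X)" using d(1) dn by auto
    next
      fix v assume "v \<in> (\<Union>d\<in>{d \<in> {1..N X}. coprime (int d) n}. pr d X)"
      then obtain d p q where d: "d \<ge> 1" "coprime (int d) n" "(p, q) \<in> prim_points n (X / d) \<Omega>"
        "v = (int d * p, int d * q)" unfolding pr_def by auto
      have pq: "coprime p q" "n dvd q" "(p, q) \<in> scaled_points (X / d) \<Omega>" using d(3) unfolding prim_points_def by auto
      have "coprime p n" using pq(1,2) by (meson coprime_divisors dvd_refl)
      hence "coprime (int d * p) n" using d(2) by simp
      moreover have "(int d * p, int d * q) \<in> scaled_points X \<Omega>"
        using pq(3) d(1) unfolding scaled_points_def by (simp add: mult.commute)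
      moreover have "p \<noteq> 0 \<or> q \<noteq> 0" using pq(1) by auto
      ultimately show "v \<in> L X" unfolding L_def d(4) using pq(2) d(1) by auto
    qed
    have L_card: "card (L X) = (\<Sum>d=1..N X. cp d * card (prim_points n (X / d) \<Omega>))" if X: "X > 0" for X
    proof -
      have "card (L X) = (\<Sum>d\<in>{d \<in> {1..N X}. coprime (int d) n}. card (pr d X))"
        unfolding L_eq[OF X]
      proof (rule card_UN_disjoint)
        show "\<forall>d\<in>{d \<in> {1..N X}. coprime (int d) n}. finite (pr d X)"
          unfolding pr_def using finite_prim_points[OF _ bd] X by auto
        show "\<forall>d\<in>{d \<in> {1..N X}. coprime (int d) n}. \<forall>d'\<in>{d \<in> {1..N X}. coprime (int d) n}.
            d \<noteq> d' \<longrightarrow> pr d X \<inter> pr d' X = {}"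
        proof (intro ballI impI)
          have gcd_pr: "gcd (fst v) (snd v) = int d" if "v \<in> pr d X" for v d
            using that unfolding pr_def prim_points_def by (auto simp: gcd_mult_distrib_int[symmetric] coprime_iff_gcd_eq_1)
          fix d d' :: nat assume "d \<noteq> d'"
          thus "pr d X \<inter> pr d' X = {}" using gcd_pr by (metis disjoint_iff of_nat_eq_iff)
        qed
      qed auto
      also have "\<dots> = (\<Sum>d\<in>{d \<in> {1..N X}. coprime (int d) n}. card (prim_points n (X / d) \<Omega>))"
        unfolding pr_def by (intro sum.cong refl card_image) (auto simp: inj_on_def)
      finally have "real (card (L X)) = (\<Sum>d\<in>{d \<in> {1..N X}. coprime (int d) n}. card (prim_points n (X / d) \<Omega>))"
        by simp
      also have "\<dots> = (\<Sum>d=1..N X. cp d * card (prim_points n (X / d) \<Omega>))"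
        unfolding cp_def of_nat_sum by (rule sum.mono_neutral_cong_left) auto
      finally show ?thesis .
    qed
    \<comment> \<open>The term \<open>d = 1\<close> of the decomposition of \<open>L X\<close> is
      \<open>f X\<close> itself; the other factors \<open>d \<ge> 2\<close> are shifted by 2 so as
      to start at 0.\<close>
    have eq: "f X = g X - (\<Sum>d<N X - 1. c d * f (X / (real d + 2)))" if X: "X > 0" for X
    proof -
      have cp1: "cp 1 = 1" unfolding cp_def by simp
      have "g X = (\<Sum>d=1..N X. cp d / d\<^sup>2 * f (X / d))"
        unfolding g_def L_card[OF X] f_def sum_divide_distrib
        by (rule sum.cong) (auto simp: power_divide)
      also have "\<dots> = (\<Sum>d<N X. cp (Suc d) / (Suc d)\<^sup>2 * f (X / Suc d))"
        by (rule sum.reindex_bij_witness[of _ Suc "\<lambda>d. d - 1"]) auto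
      finally have gX: "g X = (\<Sum>d<N X. cp (Suc d) / (Suc d)\<^sup>2 * f (X / Suc d))" .
      show ?thesis
      proof (cases "N X")
        case 0
        hence "prim_points n X \<Omega> = {}" using box[OF _ X] unfolding prim_points_def by fastforce
        thus ?thesis using gX 0 unfolding f_def by simp
      next
        case (Suc k)
        have "g X = cp 1 * f X + (\<Sum>d<k. cp (d + 2) / (real d + 2)\<^sup>2 * f (X / (real d + 2)))"
          unfolding gX Suc sum.lessThan_Suc_shift by (simp add: add_ac)
        thus ?thesis using Suc cp1 unfolding c_def by simp
      qed
    qed
    have Nlim: "filterlim (\<lambda>X. N X - 1) at_top at_top"
    proof (unfold filterlim_at_top, intro allI)
      fix m :: nat
      show "\<forall>\<^sub>F X in at_top. m \<le> N X - 1"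
        using eventually_ge_at_top[of "(real m + 2) / B"]
      proof eventually_elim
        case (elim X)
        hence "real m + 2 \<le> B * X" using B(1) by (simp add: field_simps)
        hence "int m + 2 \<le> \<lfloor>B * X\<rfloor>" by linarith
        thus ?case unfolding N_def by linarith
      qed
    qed
    have glim: "(g \<longlongrightarrow> card I / (real_of_int n)\<^sup>2 * measure lborel \<Omega>) at_top"
    proof -
      define Si where "Si X i = {v \<in> scaled_points X \<Omega>. [fst v = i] (mod n) \<and> [snd v = 0] (mod n)}" for X i
      define z where "z X = real (card (L X)) - (\<Sum>i\<in>I. real (card (Si X i)))" for X
      have Si_un: "{v \<in> scaled_points X \<Omega>. coprime (fst v) n \<and> n dvd snd v} = (\<Union>i\<in>I. Si X i)" for X
      proof (intro set_eqI iffI)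
        fix v assume v: "v \<in> {v \<in> scaled_points X \<Omega>. coprime (fst v) n \<and> n dvd snd v}"
        have "fst v mod n \<in> I" using v n unfolding I_def by auto
        moreover have "v \<in> Si X (fst v mod n)" using v unfolding Si_def by (auto simp: cong_def)
        ultimately show "v \<in> (\<Union>i\<in>I. Si X i)" by blast
      next
        fix v assume "v \<in> (\<Union>i\<in>I. Si X i)"
        then obtain i where i: "coprime i n" "v \<in> scaled_points X \<Omega>" "[fst v = i] (mod n)" "[snd v = 0] (mod n)"
          unfolding I_def Si_def by auto
        have "coprime (fst v) n" using i(1,3) by (metis cong_imp_coprime cong_sym)
        thus "v \<in> {v \<in> scaled_points X \<Omega>. coprime (fst v) n \<and> n dvd snd v}"
          using i by (auto simp: cong_0_iff)
      qed
      \<comment> \<open>\<open>L X\<close> omits the origin, which belongs to one of the classes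
        only for \<open>n = 1\<close>; the discrepancy is at most one point.\<close>
      have zb: "\<bar>z X\<bar> \<le> 1" if X: "X > 0" for X
      proof -
        let ?T = "{v \<in> scaled_points X \<Omega>. coprime (fst v) n \<and> n dvd snd v}"
        have "card ?T = (\<Sum>i\<in>I. card (Si X i))"
          unfolding Si_un
        proof (rule card_UN_disjoint)
          show "finite I" using I0 card_gt_0_iff by blast
          show "\<forall>i\<in>I. finite (Si X i)" unfolding Si_def using fin[OF X] by auto
          show "\<forall>i\<in>I. \<forall>j\<in>I. i \<noteq> j \<longrightarrow> Si X i \<inter> Si X j = {}"
            unfolding I_def Si_def by (auto simp: cong_def)
        qed
        moreover have "card (?T - {(0,0)}) = card (L X)"
          by (rule arg_cong[of _ _ card]) (auto simp: L_def)
        moreover have "card ?T - 1 \<le> card (?T - {(0,0)})" "card (?T - {(0,0)}) \<le> card ?T"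
          using fin[OF X] by (auto simp: card_Diff_singleton_if intro: card_mono)
        ultimately show ?thesis unfolding z_def of_nat_sum[symmetric] by linarith
      qed
      have z0: "((\<lambda>X. z X / X\<^sup>2) \<longlongrightarrow> 0) at_top"
      proof (rule Lim_null_comparison)
        show "\<forall>\<^sub>F X in at_top. norm (z X / X\<^sup>2) \<le> 1 / X\<^sup>2"
          using eventually_gt_at_top[of 0] by eventually_elim (use zb in \<open>auto simp: divide_right_mono\<close>)
        show "((\<lambda>X::real. 1 / X\<^sup>2) \<longlongrightarrow> 0) at_top" by real_asymp
      qed
      have "((\<lambda>X. (\<Sum>i\<in>I. card (Si X i) / X\<^sup>2) + z X / X\<^sup>2) \<longlongrightarrow> (\<Sum>i\<in>I. measure lborel \<Omega> / (real_of_int n)\<^sup>2) + 0) at_top"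
        unfolding Si_def by (intro tendsto_add tendsto_sum lattice_count n bd meas fr z0)
      moreover have "(\<Sum>i\<in>I. card (Si X i) / X\<^sup>2) + z X / X\<^sup>2 = g X" for X
        unfolding g_def z_def by (simp add: sum_divide_distrib[symmetric] diff_divide_distrib)
      ultimately show ?thesis by (simp add: algebra_simps)
    qed
    have "(f \<longlongrightarrow> card I / (real_of_int n)\<^sup>2 * measure lborel \<Omega> / (1 + suminf c)) at_top"
      by (rule contraction_limit[OF f_bd glim c01(1) csum Z1 Nlim eq])
    thus ?thesis unfolding f_def \<delta>_def by (simp add: mult.commute)
  qed
  moreover have "\<delta> > 0" unfolding \<delta>_def using I0 n Z0 by auto
  ultimately show ?thesis by blast
qed

section \<open>Integral binary forms and the action of Gamma0(n)\<close>

type_synonym form = "int \<times> int \<times> int"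
type_synonym mat = "int \<times> int \<times> int \<times> int"

text \<open>The triple \<open>(a, h, c)\<close> stands for the quadratic form \<open>a x\<^sup>2 + 2 h x y + c y\<^sup>2\<close>, the quadruple
  \<open>(p, r, q, s)\<close> for the matrix with columns \<open>(p, q)\<close> and \<open>(r, s)\<close>.\<close>

fun qf :: "form \<Rightarrow> int \<Rightarrow> int \<Rightarrow> int" where
  "qf (a, h, c) x y = a * x * x + 2 * h * x * y + c * y * y"

fun dsc :: "form \<Rightarrow> int" where
  "dsc (a, h, c) = h * h - a * c"

fun act :: "form \<Rightarrow> mat \<Rightarrow> form" where
  "act (a, h, c) (p, r, q, s) =
     (a * p * p + 2 * h * p * q + c * q * q, a * p * r + h * (p * s + q * r) + c * q * s,
      a * r * r + 2 * h * r * s + c * s * s)"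

fun mmul :: "mat \<Rightarrow> mat \<Rightarrow> mat" where
  "mmul (p, r, q, s) (p', r', q', s') =
     (p * p' + r * q', p * r' + r * s', q * p' + s * q', q * r' + s * s')"

fun minv :: "mat \<Rightarrow> mat" where
  "minv (p, r, q, s) = (s, - r, - q, p)"

definition Gamma0 :: "int \<Rightarrow> mat set" where
  "Gamma0 n = {(p, r, q, s). p * s - r * q = 1 \<and> n dvd q}"

lemma act_mmul: "act Q (mmul g g') = act (act Q g) g'"
  by (cases Q; cases g; cases g') (auto simp: algebra_simps)

lemma act_one: "act Q (1, 0, 0, 1) = Q"
  by (cases Q) auto

lemma mmul_assoc: "mmul (mmul f g) h = mmul f (mmul g h)"
  by (cases f; cases g; cases h) (auto simp: algebra_simps)

lemma mmul_one: "mmul g (1, 0, 0, 1) = g" "mmul (1, 0, 0, 1) g = g"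
  by (cases g; simp)+

lemma minv_cancel:
  assumes "g \<in> Gamma0 n"
  shows "mmul g (minv g) = (1, 0, 0, 1)" "mmul (minv g) g = (1, 0, 0, 1)"
  using assms by (cases g; auto simp: Gamma0_def algebra_simps)+

lemma Gamma0_mmul: "g \<in> Gamma0 n \<Longrightarrow> g' \<in> Gamma0 n \<Longrightarrow> mmul g g' \<in> Gamma0 n"
proof (cases g; cases g')
  fix p r q s p' r' q' s'
  assume "g \<in> Gamma0 n" "g' \<in> Gamma0 n" and g: "g = (p, r, q, s)" "g' = (p', r', q', s')"
  hence h: "p * s - r * q = 1" "p' * s' - r' * q' = 1" "n dvd q" "n dvd q'" unfolding Gamma0_def by auto
  have "(p * p' + r * q') * (q * r' + s * s') - (p * r' + r * s') * (q * p' + s * q')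
      = (p * s - r * q) * (p' * s' - r' * q')" by algebra
  thus "mmul g g' \<in> Gamma0 n" using h unfolding g Gamma0_def by auto
qed

lemma Gamma0_minv: "g \<in> Gamma0 n \<Longrightarrow> minv g \<in> Gamma0 n"
  by (cases g) (auto simp: Gamma0_def algebra_simps)

lemma Gamma0_one: "(1, 0, 0, 1) \<in> Gamma0 n"
  unfolding Gamma0_def by auto

lemma act_minv: "g \<in> Gamma0 n \<Longrightarrow> act (act Q g) (minv g) = Q" "g \<in> Gamma0 n \<Longrightarrow> act (act Q (minv g)) g = Q"
  by (simp_all add: act_mmul[symmetric] minv_cancel act_one)

lemma dsc_act: "g \<in> Gamma0 n \<Longrightarrow> dsc (act Q g) = dsc Q"
proof (cases Q; cases g)
  fix a h c p r q s
  assume "g \<in> Gamma0 n" and g: "Q = (a, h, c)" "g = (p, r, q, s)"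
  hence "p * s - r * q = 1" unfolding Gamma0_def by auto
  moreover have "dsc (act Q g) = dsc Q * (p * s - r * q)\<^sup>2" unfolding g by simp algebra
  ultimately show ?thesis by simp
qed

lemma act_translation: "act (a, h, c) (1, k, 0, 1) = (a, h + k * a, a * k * k + 2 * h * k + c)"
  by simp

lemma coprime_completion:
  fixes p q :: int
  assumes "coprime p q"
  obtains r s where "p * s - r * q = 1"
proof -
  obtain u v where "u * p + v * q = 1" using assms by (metis bezout_int coprime_iff_gcd_eq_1)
  hence "p * u - (- v) * q = 1" by (simp add: algebra_simps)
  thus ?thesis using that by blast
qed

locale root_setup =
  fixes D n \<nu> :: int
  assumes D1: "D > 1" and nonsquare: "\<And>k. k * k \<noteq> D" and n1: "n \<ge> 1"
begin

definition rforms :: "form set" where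
  "rforms = {(a, h, c). h * h - a * c = D \<and> n dvd a \<and> n dvd (h - \<nu>)}"

text \<open>Since \<open>p s + q r = 1 + 2 q r\<close>, the new middle coefficient minus
  \<open>\<nu>\<close> is \<open>a p r + q (2 h r + c s) + (h - \<nu>)\<close>, and \<open>n\<close>
  divides every summand.\<close>

lemma rforms_act:
  assumes "Q \<in> rforms" "g \<in> Gamma0 n"
  shows "act Q g \<in> rforms"
proof -
  obtain a h c where Q: "Q = (a, h, c)" by (cases Q)
  obtain p r q s where g: "g = (p, r, q, s)" by (cases g)
  have det: "p * s - r * q = 1" "n dvd q" using assms(2) unfolding g Gamma0_def by auto
  have Q': "h * h - a * c = D" "n dvd a" "n dvd h - \<nu>" using assms(1) unfolding Q rforms_def by auto
  have "dsc (act Q g) = D" using dsc_act[OF assms(2), of Q] Q' unfolding Q by simp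
  moreover have "a * p * r + h * (p * s + q * r) + c * q * s - \<nu>
      = a * (p * r) + q * (2 * h * r + c * s) + (h - \<nu>)"
    using det(1) by algebra
  moreover have "n dvd a * (p * r) + q * (2 * h * r + c * s) + (h - \<nu>)"
    by (intro dvd_add dvd_mult2 Q' det)
  ultimately have "n dvd a * p * r + h * (p * s + q * r) + c * q * s - \<nu>" "dsc (act Q g) = D" by metis+
  moreover have "n dvd a * p * p + 2 * h * p * q + c * q * q"
    using Q' det by (intro dvd_add) auto
  ultimately show ?thesis using Q' det unfolding Q g rforms_def by simp
qed

text \<open>For \<open>u \<noteq> 0\<close> the number \<open>u\<close> divides \<open>t\<close>,
  and the quotient would be a square root of \<open>D\<close>.\<close>

lemma square_multiple:
  fixes t u :: int
  assumes "t * t = D * (u * u)"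
  shows "u = 0" "t = 0"
proof -
  show "u = 0"
  proof (rule ccontr)
    assume u: "u \<noteq> 0"
    have "u\<^sup>2 dvd t\<^sup>2" using assms by (simp add: power2_eq_square)
    hence "u dvd t" by simp
    then obtain k where "t = u * k" by blast
    hence "u * u * (k * k) = u * u * D" using assms by (simp add: algebra_simps)
    thus False using u nonsquare by simp
  qed
  thus "t = 0" using assms by simp
qed

text \<open>Completing the square, \<open>a * Q\<close> is
  \<open>(a x + h y)\<^sup>2 - D y\<^sup>2\<close>, which vanishes only at the origin since
  \<open>D\<close> is not a square.\<close>

lemma qf_eq_0:
  assumes "dsc Q = D" "qf Q x y = 0"
  shows "x = 0 \<and> y = 0"
proof -
  obtain a h c where Q: "Q = (a, h, c)" by (cases Q)
  have "(a * x + h * y) * (a * x + h * y) = a * qf Q x y + dsc Q * (y * y)" unfolding Q by simp algebra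
  hence y: "y = 0" "a * x + h * y = 0" using square_multiple[of "a * x + h * y" y] assms by auto
  have "a \<noteq> 0" using assms(1) nonsquare[of h] unfolding Q by auto
  thus ?thesis using y by auto
qed

subsection \<open>Simultaneous reduction\<close>

lemma form_le_definite:
  fixes a h c a1 h1 k T x y :: int
  assumes "a1 > 0" "h * h - a * c = D" "a1 \<le> k * a" "a \<le> k * a1" "\<bar>h * a1 - h1 * a\<bar> \<le> T * a" "k \<ge> 1"
  shows "a1 * \<bar>qf (a, h, c) x y\<bar> \<le> (2 * k + 2 * T * T * k + D * k) * ((a1 * x + h1 * y)\<^sup>2 + y\<^sup>2)"
proof -
  have a: "a > 0" using assms(1,3,6) by (smt (verit) mult_nonneg_nonpos)
  define X where "X = a1 * x + h1 * y"
  define e where "e = h * a1 - h1 * a"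
  have T: "T \<ge> 0" using assms(5) a by (smt (verit) mult_neg_pos)
  \<comment> \<open>The completed square, with \<open>a1 (a x + h y) = a X + e y\<close>
    substituted.\<close>
  have id: "a * a1 * (a1 * qf (a, h, c) x y) = (a * X + e * y)\<^sup>2 - D * (a1 * a1 * (y * y))"
    unfolding X_def e_def assms(2)[symmetric] by (simp add: power2_eq_square) algebra
  have e2: "e * e \<le> T * T * (a * a)"
    using assms(5) abs_mult_self_eq[of e] mult_mono[of "\<bar>e\<bar>" "T * a" "\<bar>e\<bar>" "T * a"] T a
    unfolding e_def by (simp add: algebra_simps)
  have "(a * X + e * y)\<^sup>2 \<le> 2 * (a * X)\<^sup>2 + 2 * (e * y)\<^sup>2"
    using zero_le_power2[of "a * X - e * y"] by (simp add: power2_eq_square algebra_simps)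
  also have "\<dots> \<le> 2 * (a * a) * (X * X) + 2 * (T * T * (a * a)) * (y * y)"
    using mult_right_mono[OF e2, of "y * y"] by (simp add: power2_eq_square algebra_simps)
  also have "\<dots> = a * a * (2 * (X * X) + 2 * T * T * (y * y))" by (simp add: algebra_simps)
  also have "\<dots> \<le> a * (k * a1) * (2 * (X * X) + 2 * T * T * (y * y))"
    using assms(4) a T by (intro mult_right_mono mult_left_mono) auto
  finally have 1: "(a * X + e * y)\<^sup>2 \<le> a * a1 * (2 * k * (X * X) + 2 * T * T * k * (y * y))" by (simp add: algebra_simps)
  have "D * (a1 * a1 * (y * y)) \<le> D * (a1 * (k * a) * (y * y))"
    using assms(1,3) D1 by (intro mult_left_mono mult_right_mono) auto
  hence 2: "D * (a1 * a1 * (y * y)) \<le> a * a1 * (D * k * (y * y))" by (simp add: algebra_simps)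
  have "a * a1 * (a1 * \<bar>qf (a, h, c) x y\<bar>) = \<bar>a * a1 * (a1 * qf (a, h, c) x y)\<bar>"
    using a assms(1) by (simp add: abs_mult)
  also have "\<dots> \<le> (a * X + e * y)\<^sup>2 + D * (a1 * a1 * (y * y))"
    unfolding id using D1 by (smt (verit) mult_nonneg_nonneg zero_le_power2 zero_le_square)
  also have "\<dots> \<le> a * a1 * (2 * k * (X * X) + 2 * T * T * k * (y * y) + D * k * (y * y))"
    using 1 2 by (simp add: algebra_simps)
  finally have "a1 * \<bar>qf (a, h, c) x y\<bar> \<le> 2 * k * (X * X) + 2 * T * T * k * (y * y) + D * k * (y * y)"
    using a assms(1) by simp
  also have "\<dots> \<le> (2 * k + 2 * T * T * k + D * k) * (X * X + y * y)"
  proof -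
    have "0 \<le> (2 * T * T * k + D * k) * (X * X) + 2 * k * (y * y)"
      using T assms(6) D1 by simp
    thus ?thesis by (simp add: algebra_simps)
  qed
  finally show ?thesis unfolding X_def by (simp add: power2_eq_square)
qed

text \<open>Lagrange reduction of the comparison form, whose determinant is
  \<open>a1\<^sup>2\<close>: a minimal primitive vector is completed to a basis and the second
  vector is reduced by the first. The product bound follows from
  \<open>|2 bl| \<le> \<alpha> \<le> P r s\<close> and
  \<open>\<alpha> * P r s = bl\<^sup>2 + a1\<^sup>2\<close>.\<close>

lemma reduced_basis:
  fixes a1 h1 :: int
  assumes "a1 > 0"
  defines "P \<equiv> \<lambda>x y. (a1 * x + h1 * y)\<^sup>2 + y\<^sup>2"
  obtains p q r s where "p * s - r * q = 1" "P p q \<le> P r s" "3 * P p q * P r s \<le> 4 * a1\<^sup>2"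
proof -
  have P0: "P x y \<ge> 0" for x y unfolding P_def by simp
  have "\<exists>v. coprime (fst v) (snd v) \<and> (\<forall>w. coprime (fst w) (snd w) \<longrightarrow> nat (P (fst v) (snd v)) \<le> nat (P (fst w) (snd w)))"
    using ex_has_least_nat[of "\<lambda>v. coprime (fst v) (snd v)" "(1, 0)" "\<lambda>v. nat (P (fst v) (snd v))"] by auto
  then obtain p q where pq: "coprime p q" and minn: "\<And>x y. coprime x y \<Longrightarrow> nat (P p q) \<le> nat (P x y)"
    by auto
  have min: "P p q \<le> P x y" if "coprime x y" for x y
    using minn[OF that] P0[of x y] P0[of p q] by simp
  obtain r0 s0 where rs0: "p * s0 - r0 * q = 1" using coprime_completion[OF pq] .
  define \<alpha> where "\<alpha> = P p q"
  define bl where "bl = (\<lambda>r s. (a1 * p + h1 * q) * (a1 * r + h1 * s) + q * s)"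
  have \<alpha>0: "\<alpha> > 0"
  proof -
    have "a1 * p + h1 * q \<noteq> 0 \<or> q \<noteq> 0" using pq assms(1) by auto
    thus ?thesis unfolding \<alpha>_def P_def by (smt (verit) zero_le_power2 zero_less_power2)
  qed
  \<comment> \<open>Rounding to a nearest integer, so that the inner product \<open>bl r s\<close>
    of the two vectors becomes at most \<open>\<alpha> / 2\<close> in absolute value.\<close>
  define j where "j = - ((2 * bl r0 s0 + \<alpha>) div (2 * \<alpha>))"
  define r where "r = r0 + j * p"
  define s where "s = s0 + j * q"
  have det: "p * s - r * q = 1" using rs0 unfolding r_def s_def by (simp add: algebra_simps)
  have bl: "bl r s = bl r0 s0 + j * \<alpha>"
    unfolding r_def s_def bl_def \<alpha>_def P_def by (simp add: algebra_simps power2_eq_square)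
  have "2 * bl r s + \<alpha> = (2 * bl r0 s0 + \<alpha>) mod (2 * \<alpha>)"
    unfolding bl j_def by (simp add: minus_mult_div_eq_mod[symmetric] algebra_simps)
  moreover have "0 \<le> (2 * bl r0 s0 + \<alpha>) mod (2 * \<alpha>)" "(2 * bl r0 s0 + \<alpha>) mod (2 * \<alpha>) < 2 * \<alpha>" using \<alpha>0 by auto
  ultimately have "\<bar>2 * bl r s\<bar> \<le> \<alpha>" by linarith
  hence b2: "4 * (bl r s * bl r s) \<le> \<alpha> * \<alpha>"
    using mult_mono[of "\<bar>2 * bl r s\<bar>" \<alpha> "\<bar>2 * bl r s\<bar>" \<alpha>] \<alpha>0 abs_mult_self_eq[of "2 * bl r s"] by simp
  have "coprime r s" by (rule coprimeI) (metis det dvd_diff dvd_mult dvd_mult2)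
  hence le: "\<alpha> \<le> P r s" using min unfolding \<alpha>_def by auto
  have "\<alpha> * P r s = bl r s * bl r s + a1\<^sup>2 * (p * s - r * q)\<^sup>2"
    unfolding \<alpha>_def P_def bl_def by (simp add: power2_eq_square) algebra
  hence "4 * (\<alpha> * P r s) \<le> 4 * a1\<^sup>2 + \<alpha> * P r s"
    using b2 det mult_left_mono[OF le, of \<alpha>] \<alpha>0 by simp
  hence "3 * P p q * P r s \<le> 4 * a1\<^sup>2" unfolding \<alpha>_def by simp
  thus ?thesis using that det le unfolding \<alpha>_def by blast
qed

text \<open>The matrix is fixed before \<open>(a, h, c)\<close> and depends on
  \<open>(a1, h1, c1)\<close> only: this is what later reduces both members of a pair at once. Its
  columns are the reduced basis of the definite form; once the longer vector satisfies
  \<open>P r s \<le> 2 * C * a1\<close>, all admissible forms are bounded on the basis.\<close>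

lemma bounded_reduction:
  fixes k T :: int
  assumes "k \<ge> 1" "T \<ge> 0"
  shows "\<exists>B. \<forall>a1 h1 c1. a1 > 0 \<longrightarrow> h1 * h1 - a1 * c1 = D \<longrightarrow> (\<exists>g\<in>Gamma0 1. \<forall>a h c.
     h * h - a * c = D \<longrightarrow> a1 \<le> k * a \<longrightarrow> a \<le> k * a1 \<longrightarrow> \<bar>h * a1 - h1 * a\<bar> \<le> T * a \<longrightarrow>
     act (a, h, c) g \<in> {-B..B} \<times> {-B..B} \<times> {-B..B})"
proof -
  define C where "C = 2 * k + 2 * T * T * k + D * k"
  have C1: "C \<ge> 1"
  proof -
    have "0 \<le> 2 * T * T * k" "0 \<le> D * k" using assms D1 by auto
    thus ?thesis unfolding C_def using assms(1) by linarith
  qed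
  have "\<exists>g\<in>Gamma0 1. \<forall>a h c.
     h * h - a * c = D \<longrightarrow> a1 \<le> k * a \<longrightarrow> a \<le> k * a1 \<longrightarrow> \<bar>h * a1 - h1 * a\<bar> \<le> T * a \<longrightarrow>
     act (a, h, c) g \<in> {-(12 * C * C)..12 * C * C} \<times> {-(12 * C * C)..12 * C * C} \<times> {-(12 * C * C)..12 * C * C}"
    if a1: "a1 > 0" and d1: "h1 * h1 - a1 * c1 = D" for a1 h1 c1
  proof -
    define P where "P x y = (a1 * x + h1 * y)\<^sup>2 + y\<^sup>2" for x y
    obtain p q r s where det: "p * s - r * q = 1" and le: "P p q \<le> P r s" and pr: "3 * P p q * P r s \<le> 4 * a1\<^sup>2"
      using reduced_basis[OF a1, of h1] unfolding P_def by metis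
    have bound: "a1 * \<bar>qf (a, h, c) x y\<bar> \<le> C * P x y"
      if "h * h - a * c = D" "a1 \<le> k * a" "a \<le> k * a1" "\<bar>h * a1 - h1 * a\<bar> \<le> T * a" for a h c x y
      using form_le_definite[OF a1 that assms(1)] unfolding C_def P_def .
    \<comment> \<open>A nonzero integer is at least 1 in absolute value. As \<open>P\<close>
      dominates \<open>(a1, h1, c1)\<close> itself, this bounds the minimum of \<open>P\<close> from
      below, and the product bound then bounds \<open>P r s\<close> from above.\<close>
    have "qf (a1, h1, c1) p q \<noteq> 0" using qf_eq_0[of "(a1, h1, c1)" p q] d1 det by auto
    hence "a1 * 1 \<le> a1 * \<bar>qf (a1, h1, c1) p q\<bar>" using a1 by (intro mult_left_mono) auto
    also have "\<dots> \<le> C * P p q" by (rule bound) (use d1 a1 assms in auto)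
    finally have a1C: "a1 \<le> C * P p q" by simp
    have Prs0: "P r s \<ge> 0" unfolding P_def by simp
    have "3 * a1 * P r s \<le> 3 * (C * P p q) * P r s" using a1C Prs0 by (intro mult_right_mono mult_left_mono) auto
    also have "\<dots> = C * (3 * P p q * P r s)" by simp
    also have "\<dots> \<le> C * (4 * a1\<^sup>2)" using pr C1 by (intro mult_left_mono) auto
    finally have "a1 * (3 * P r s) \<le> a1 * (4 * C * a1)" by (simp add: power2_eq_square algebra_simps)
    hence "3 * P r s \<le> 4 * C * a1" using a1 by (subst (asm) mult_le_cancel_left_pos) auto
    moreover have "0 \<le> C * a1" using C1 a1 by simp
    ultimately have Prs: "P r s \<le> 2 * C * a1" using Prs0 by linarith
    have Psum: "P (p + r) (q + s) \<le> 2 * P p q + 2 * P r s"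
    proof -
      have "2 * P p q + 2 * P r s - P (p + r) (q + s) = P (p - r) (q - s)"
        unfolding P_def by (simp add: power2_eq_square algebra_simps)
      moreover have "P (p - r) (q - s) \<ge> 0" unfolding P_def by simp
      ultimately show ?thesis by linarith
    qed
    have "act (a, h, c) (p, r, q, s) \<in> {-(12 * C * C)..12 * C * C} \<times> {-(12 * C * C)..12 * C * C} \<times> {-(12 * C * C)..12 * C * C}"
      if Q: "h * h - a * c = D" "a1 \<le> k * a" "a \<le> k * a1" "\<bar>h * a1 - h1 * a\<bar> \<le> T * a" for a h c
    proof -
      have *: "\<bar>qf (a, h, c) x y\<bar> \<le> 8 * C * C" if "P x y \<le> 8 * C * a1" for x y
      proof -
        have "a1 * \<bar>qf (a, h, c) x y\<bar> \<le> C * P x y" by (rule bound[OF Q])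
        also have "\<dots> \<le> C * (8 * C * a1)" using that C1 by (intro mult_left_mono) auto
        finally have "a1 * \<bar>qf (a, h, c) x y\<bar> \<le> a1 * (8 * C * C)" by (simp add: algebra_simps)
        thus ?thesis using a1 by simp
      qed
      define \<alpha> \<beta>' \<gamma> where "\<alpha> = qf (a, h, c) p q" and "\<beta>' = a * p * r + h * (p * s + q * r) + c * q * s"
        and "\<gamma> = qf (a, h, c) r s"
      have Ca: "C * a1 \<ge> 0" using C1 a1 by simp
      have 1: "\<bar>\<alpha>\<bar> \<le> 8 * C * C" unfolding \<alpha>_def by (rule *) (use le Prs Ca in linarith)
      have 2: "\<bar>\<gamma>\<bar> \<le> 8 * C * C" unfolding \<gamma>_def by (rule *) (use Prs Ca in linarith)
      \<comment> \<open>The middle coefficient is recovered from the values at the two basis vectors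
        and at their sum, whose size the parallelogram law controls.\<close>
      have 3: "\<bar>qf (a, h, c) (p + r) (q + s)\<bar> \<le> 8 * C * C" by (rule *) (use Psum le Prs Ca in linarith)
      have "qf (a, h, c) (p + r) (q + s) = \<alpha> + 2 * \<beta>' + \<gamma>"
        unfolding \<alpha>_def \<beta>'_def \<gamma>_def by (simp add: algebra_simps)
      hence "\<bar>\<beta>'\<bar> \<le> 12 * C * C" using 1 2 3 by linarith
      moreover have "act (a, h, c) (p, r, q, s) = (\<alpha>, \<beta>', \<gamma>)" unfolding \<alpha>_def \<beta>'_def \<gamma>_def by simp
      moreover have "0 \<le> C * C" by simp
      ultimately show ?thesis using 1 2 by auto
    qed
    moreover have "(p, r, q, s) \<in> Gamma0 1" using det unfolding Gamma0_def by simp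
    ultimately show ?thesis by blast
  qed
  thus ?thesis by blast
qed

text \<open>Two matrices that agree modulo \<open>n\<close> differ by an element of \<open>\<Gamma>\<^sub>0(n)\<close>, so finitely many
  correcting factors suffice.\<close>

lemma finite_reduction:
  fixes k T :: int
  assumes "k \<ge> 1" "T \<ge> 0"
  shows "\<exists>F. finite F \<and> (\<forall>a1 h1 c1. a1 > 0 \<longrightarrow> h1 * h1 - a1 * c1 = D \<longrightarrow> (\<exists>g\<in>Gamma0 n. \<forall>a h c.
     h * h - a * c = D \<longrightarrow> a1 \<le> k * a \<longrightarrow> a \<le> k * a1 \<longrightarrow> \<bar>h * a1 - h1 * a\<bar> \<le> T * a \<longrightarrow>
     act (a, h, c) g \<in> F))"
proof -
  obtain B where B: "\<forall>a1 h1 c1. a1 > 0 \<longrightarrow> h1 * h1 - a1 * c1 = D \<longrightarrow> (\<exists>g\<in>Gamma0 1. \<forall>a h c.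
     h * h - a * c = D \<longrightarrow> a1 \<le> k * a \<longrightarrow> a \<le> k * a1 \<longrightarrow> \<bar>h * a1 - h1 * a\<bar> \<le> T * a \<longrightarrow>
     act (a, h, c) g \<in> {-B..B} \<times> {-B..B} \<times> {-B..B})"
    using bounded_reduction[OF assms] by blast
  \<comment> \<open>The second row modulo \<open>n\<close> suffices, because the lower left entry of
    \<open>g\<close> times the inverse of \<open>g'\<close> is \<open>q s' - s q'\<close>.\<close>
  define res :: "mat \<Rightarrow> int \<times> int" where "res = (\<lambda>(p, r, q, s). (q mod n, s mod n))"
  define rep where "rep \<rho> = (SOME g. g \<in> Gamma0 1 \<and> res g = \<rho>)" for \<rho>
  define F where "F = (\<lambda>(Q, \<rho>). act Q (minv (rep \<rho>))) ` (({-B..B} \<times> {-B..B} \<times> {-B..B}) \<times> ({0..<n} \<times> {0..<n}))"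
  have "\<exists>g\<in>Gamma0 n. \<forall>a h c.
     h * h - a * c = D \<longrightarrow> a1 \<le> k * a \<longrightarrow> a \<le> k * a1 \<longrightarrow> \<bar>h * a1 - h1 * a\<bar> \<le> T * a \<longrightarrow>
     act (a, h, c) g \<in> F" if hyp: "a1 > 0" "h1 * h1 - a1 * c1 = D" for a1 h1 c1
  proof -
    obtain g where g: "g \<in> Gamma0 1" and gB: "\<And>a h c.
     h * h - a * c = D \<Longrightarrow> a1 \<le> k * a \<Longrightarrow> a \<le> k * a1 \<Longrightarrow> \<bar>h * a1 - h1 * a\<bar> \<le> T * a \<Longrightarrow>
     act (a, h, c) g \<in> {-B..B} \<times> {-B..B} \<times> {-B..B}" using B hyp by blast
    have rep: "rep (res g) \<in> Gamma0 1 \<and> res (rep (res g)) = res g"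
      unfolding rep_def by (rule someI[of _ g]) (use g in auto)
    have res_in: "res g \<in> {0..<n} \<times> {0..<n}" using n1 unfolding res_def by (cases g) auto
    have "mmul g (minv (rep (res g))) \<in> Gamma0 n"
    proof -
      obtain p r q s where gg: "g = (p, r, q, s)" by (cases g)
      obtain p' r' q' s' where g': "rep (res g) = (p', r', q', s')" by (cases "rep (res g)")
      have m: "[q' = q] (mod n)" "[s' = s] (mod n)" using rep unfolding g' unfolding gg res_def by (auto simp: cong_def)
      have "mmul g (minv (rep (res g))) \<in> Gamma0 1" using g rep by (intro Gamma0_mmul Gamma0_minv) auto
      moreover have "[q * s' + s * (- q') = q * s + s * (- q)] (mod n)"
        using m by (intro cong_add cong_mult cong_refl) (auto simp: cong_minus_minus_iff)
      hence "n dvd q * s' + s * (- q')" by (simp add: cong_0_iff mult.commute)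
      ultimately show ?thesis unfolding g' unfolding gg Gamma0_def by auto
    qed
    moreover have "act (a, h, c) (mmul g (minv (rep (res g)))) \<in> F"
      if "h * h - a * c = D" "a1 \<le> k * a" "a \<le> k * a1" "\<bar>h * a1 - h1 * a\<bar> \<le> T * a" for a h c
      unfolding act_mmul F_def using gB[OF that] res_in by (intro image_eqI[of _ _ "(act (a, h, c) g, res g)"]) auto
    ultimately show ?thesis by blast
  qed
  moreover have "finite F" unfolding F_def by auto
  ultimately show ?thesis by blast
qed

subsection \<open>Pell's equation\<close>

text \<open>Dirichlet's argument: good approximations to sqrt D give infinitely many pairs of
  bounded norm; two of them agree in their norm \<open>k\<close> and in their residues modulo
  \<open>k\<close>, and their quotient is an element of Z[sqrt D] of norm 1.\<close>

lemma pell_exists: "\<exists>t u. t > 0 \<and> u > 0 \<and> t * t - D * (u * u) = 1"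
proof -
  define S where "S = {(p, q). q > 0 \<and> p > 0 \<and> \<bar>p * p - D * (q * q)\<bar> \<le> 4 * D}"
  define R where "R = sqrt (real_of_int D)"
  have R1: "R > 1" "R * R = D" "R \<le> D"
  proof -
    show "R > 1" "R * R = D" unfolding R_def using D1 by auto
    have "R * 1 \<le> R * R" using \<open>R > 1\<close> by (intro mult_left_mono) auto
    thus "R \<le> D" using \<open>R * R = D\<close> by simp
  qed
  have nz: "of_int q * R \<noteq> of_int p" if "q > 0" for p q :: int
  proof
    assume "of_int q * R = of_int p"
    hence "(of_int q * R) * (of_int q * R) = of_int (p * p)" by simp
    moreover have "(of_int q * R) * (of_int q * R) = R * R * (of_int q * of_int q)" by algebra
    ultimately have "of_int (p * p) = real_of_int (D * (q * q))" using R1(2) by simp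
    hence "p * p = D * (q * q)" by (simp only: of_int_eq_iff)
    thus False using square_multiple that by auto
  qed
  \<comment> \<open>The approximation keeps the norm at most \<open>2 * D + 1\<close> in absolute
    value; the bound \<open>4 * D\<close> in \<open>S\<close> is a convenient majorant.\<close>
  have S_from: "(h, k) \<in> S" if "k > 0" "\<bar>of_int k * R - of_int h\<bar> < 1 / real N" "k \<le> int N" "N > 0" for h k N
  proof -
    have N1: "1 / real N \<le> 1" using that(4) by simp
    have "of_int k * R > 1"
      using that(1) R1(1) mult_right_mono[of 1 "real_of_int k" R] by linarith
    hence h0: "h > 0" using that(2) N1 by (smt (verit) of_int_0_less_iff)
    have "\<bar>real_of_int (h * h - D * (k * k))\<bar> = \<bar>of_int k * R - of_int h\<bar> * \<bar>of_int k * R + of_int h\<bar>"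
    proof -
      have "real_of_int (h * h - D * (k * k)) = - ((of_int k * R - of_int h) * (of_int k * R + of_int h))"
        using R1(2) by (simp add: algebra_simps)
      thus ?thesis by (simp add: abs_mult)
    qed
    also have "\<dots> \<le> 1 / real N * (2 * (of_int k * R) + 1)"
    proof (rule mult_mono)
      show "\<bar>real_of_int k * R + of_int h\<bar> \<le> 2 * (of_int k * R) + 1"
        using that(2) N1 h0 \<open>of_int k * R > 1\<close> by linarith
    qed (use that(2) in auto)
    also have "\<dots> \<le> 1 / real N * (2 * (real N * D) + real N)"
    proof -
      have "of_int k * R \<le> real N * D" using that R1 by (intro mult_mono) auto
      thus ?thesis using that(4) by (intro mult_left_mono) auto
    qed
    also have "\<dots> = 2 * D + 1" using that(4) by (simp add: field_simps)
    finally have "\<bar>h * h - D * (k * k)\<bar> \<le> 2 * D + 1" by linarith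
    thus ?thesis unfolding S_def using that(1) h0 D1 by auto
  qed
  \<comment> \<open>Were \<open>S\<close> finite, the distances \<open>|q R - p|\<close> would have
    a positive minimum, which a finer approximation beats.\<close>
  have "infinite S"
  proof
    assume fin: "finite S"
    define \<epsilon> where "\<epsilon> = Min (insert 1 ((\<lambda>(p, q). \<bar>of_int q * R - of_int p\<bar>) ` S))"
    have "\<epsilon> > 0" unfolding \<epsilon>_def using fin nz by (subst Min_gr_iff) (auto simp: S_def)
    then obtain N :: nat where N: "N > 0" "1 / real N < \<epsilon>"
      using reals_Archimedean[of \<epsilon>] by (metis inverse_eq_divide zero_less_Suc)
    obtain h k where hk: "0 < k" "k \<le> int N" "\<bar>of_int k * R - of_int h\<bar> < 1 / real N"
      using Dirichlet_approx[OF N(1)] by metis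
    have "(h, k) \<in> S" using S_from[OF hk(1,3,2) N(1)] .
    hence "\<epsilon> \<le> \<bar>of_int k * R - of_int h\<bar>" unfolding \<epsilon>_def using fin by (intro Min_le) force+
    thus False using hk(3) N(2) by linarith
  qed
  define f :: "int \<times> int \<Rightarrow> int \<times> int \<times> int"
    where "f = (\<lambda>(p, q). (p * p - D * (q * q), p mod (p * p - D * (q * q)), q mod (p * p - D * (q * q))))"
  have "f ` S \<subseteq> {-(4*D)..4*D} \<times> {-(4*D)..4*D} \<times> {-(4*D)..4*D}"
  proof
    fix y assume "y \<in> f ` S"
    then obtain p q where pq: "y = f (p, q)" "(p, q) \<in> S" by auto
    define k where "k = p * p - D * (q * q)"
    have k: "k \<noteq> 0" "\<bar>k\<bar> \<le> 4 * D" using pq(2) square_multiple[of p q] unfolding S_def k_def by auto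
    have "\<bar>p mod k\<bar> < \<bar>k\<bar>" "\<bar>q mod k\<bar> < \<bar>k\<bar>" using k(1) by (auto intro: abs_mod_less)
    thus "y \<in> {-(4*D)..4*D} \<times> {-(4*D)..4*D} \<times> {-(4*D)..4*D}"
      using k(2) unfolding pq(1) f_def k_def[symmetric] by (auto simp: k_def[symmetric])
  qed
  hence "finite (f ` S)" by (rule finite_subset) auto
  then obtain a0 where "a0 \<in> S" "infinite {a \<in> S. f a = f a0}" using pigeonhole_infinite[OF \<open>infinite S\<close>] by blast
  hence a0: "a0 \<in> S" and "infinite ({a \<in> S. f a = f a0} - {a0})" by auto
  hence "{a \<in> S. f a = f a0} - {a0} \<noteq> {}" by (metis finite.emptyI)
  then obtain a1 where a01: "a1 \<in> S" "a0 \<in> S" "f a1 = f a0" "a1 \<noteq> a0" using a0 by blast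
  obtain p q p' q' where pq: "a0 = (p, q)" "a1 = (p', q')" by (cases a0, cases a1)
  define k where "k = p * p - D * (q * q)"
  have k': "p' * p' - D * (q' * q') = k" using a01(3) unfolding pq f_def k_def by auto
  have pos: "p > 0" "q > 0" "p' > 0" "q' > 0" using a01 unfolding pq S_def by auto
  have k0: "k \<noteq> 0" using square_multiple[of p q] pos unfolding k_def by auto
  have cg: "[p' = p] (mod k)" "[q' = q] (mod k)"
    using a01(3) k' unfolding pq f_def k_def by (auto simp: cong_def)
  \<comment> \<open>These are, up to sign, the coordinates of one element times the conjugate of the
    other; divisibility by \<open>k\<close> makes the quotient integral.\<close>
  have "[p * p' - D * (q * q') = p * p - D * (q * q)] (mod k)" "[p * q' - p' * q = p * q - p * q] (mod k)"
    using cg by (intro cong_diff cong_mult cong_refl; simp)+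
  hence "k dvd p * p' - D * (q * q')" "k dvd p * q' - p' * q"
    unfolding k_def[symmetric] by (auto simp: cong_0_iff cong_def dvd_eq_mod_eq_0)
  then obtain t u where tu: "p * p' - D * (q * q') = k * t" "p * q' - p' * q = k * u" by (auto elim!: dvdE)
  have "(k * t) * (k * t) - D * ((k * u) * (k * u)) = (p * p - D * (q * q)) * (p' * p' - D * (q' * q'))"
    unfolding tu[symmetric] by algebra
  hence "k * k * (t * t - D * (u * u)) = k * k * 1" using k' unfolding k_def by (simp add: algebra_simps)
  hence tu1: "t * t - D * (u * u) = 1" using k0 by simp
  \<comment> \<open>\<open>u = 0\<close> would make the two pairs proportional, and equal norms with
    positivity would make them equal.\<close>
  have "u \<noteq> 0"
  proof
    assume "u = 0"
    hence e: "p * q' = p' * q" using tu(2) by simp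
    have "q' * q' * k = q * q * k"
    proof -
      have "q' * q' * k = (p * q') * (p * q') - D * (q * q) * (q' * q')" unfolding k_def by algebra
      also have "\<dots> = q * q * (p' * p' - D * (q' * q'))" unfolding e by algebra
      finally show ?thesis using k' by simp
    qed
    hence "q' * q' = q * q" using k0 by simp
    hence "q' = q" using pos by (simp add: square_eq_iff)
    thus False using e pos a01(4) unfolding pq by simp
  qed
  moreover have "t \<noteq> 0" using tu1 D1 by (smt (verit) mult_eq_0_iff mult_nonneg_nonneg zero_le_square)
  ultimately show ?thesis using tu1 by (intro exI[of _ "\<bar>t\<bar>"] exI[of _ "\<bar>u\<bar>"]) auto
qed

end

subsection \<open>First columns and roots\<close>

definition col :: "mat \<Rightarrow> int \<times> int" where
  "col g = (fst g, fst (snd (snd g)))"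

fun app :: "mat \<Rightarrow> int \<times> int \<Rightarrow> int \<times> int" where
  "app (p, r, q, s) (x, y) = (p * x + r * y, q * x + s * y)"

lemma col_mmul: "col (mmul \<sigma> g) = app \<sigma> (col g)"
  by (cases \<sigma>; cases g) (simp add: col_def)

lemma col_translation: "col (mmul g (1, k, 0, 1)) = col g"
  by (cases g) (simp add: col_def)

text \<open>The quotient of the matrices fixes the first basis vector and has determinant 1, so it
  is a translation.\<close>

lemma same_column:
  assumes "g \<in> Gamma0 n" "g' \<in> Gamma0 n" "col g = col g'"
  obtains k where "g' = mmul g (1, k, 0, 1)"
proof -
  obtain p r q s where g: "g = (p, r, q, s)" by (cases g)
  obtain p' r' q' s' where g': "g' = (p', r', q', s')" by (cases g')
  have h: "p * s - r * q = 1" "p * s' - r' * q = 1" "p' = p" "q' = q"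
    using assms unfolding g g' col_def Gamma0_def by auto
  have "p * (s * r' - r * s') + r = r'" "q * (s * r' - r * s') + s = s'" using h(1,2) by algebra+
  hence "g' = mmul g (1, s * r' - r * s', 0, 1)" unfolding g g' using h by simp
  thus ?thesis using that by blast
qed

lemma coprime_col:
  assumes "g \<in> Gamma0 n"
  shows "coprime (fst (col g)) (snd (col g))" "n dvd snd (col g)"
proof -
  obtain p r q s where g: "g = (p, r, q, s)" by (cases g)
  have h: "p * s - r * q = 1" using assms unfolding g Gamma0_def by auto
  have "coprime p q" by (rule coprimeI) (metis h dvd_diff dvd_mult dvd_mult2)
  thus "coprime (fst (col g)) (snd (col g))" unfolding g col_def by simp
  show "n dvd snd (col g)" using assms unfolding g col_def Gamma0_def by auto
qed

text \<open>The scalar -1 acts trivially on forms and reverses columns; it serves to choose the sign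
  of a column vector.\<close>

definition mneg :: "mat \<Rightarrow> mat" where
  "mneg g = mmul (-1, 0, 0, -1) g"

lemma mneg: "act Q (mneg g) = act Q g" "g \<in> Gamma0 n \<Longrightarrow> mneg g \<in> Gamma0 n"
  "col (mneg g) = (- fst (col g), - snd (col g))"
  by (cases Q; cases g; simp add: mneg_def Gamma0_def col_def)+

definition root_of :: "form \<Rightarrow> int \<times> int" where
  "root_of Q = (fst Q, fst (snd Q) mod fst Q)"

lemma root_of_translation: "root_of (act Q (1, k, 0, 1)) = root_of Q"
  by (cases Q) (simp add: root_of_def)

text \<open>The discriminant determines the third coefficient from the first two. Roots are
  therefore the translation classes of forms with positive leading coefficient.\<close>

lemma root_of_eq:
  assumes "root_of Q = root_of Q'" "dsc Q = dsc Q'" "fst Q \<noteq> 0"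
  obtains k where "Q' = act Q (1, k, 0, 1)"
proof -
  obtain a h c where Q: "Q = (a, h, c)" by (cases Q)
  obtain a' h' c' where Q': "Q' = (a', h', c')" by (cases Q')
  have a: "a' = a" "h mod a = h' mod a" "a \<noteq> 0" using assms unfolding Q Q' root_of_def by auto
  then obtain k where k: "h' = h + k * a" by (metis mod_eqE add.commute diff_add_cancel mult.commute add_diff_cancel_left')
  have "a * c' = a * (a * k * k + 2 * h * k + c)"
    using assms(2) a unfolding Q Q' k by simp algebra
  hence "c' = a * k * k + 2 * h * k + c" using a by simp
  hence "Q' = act Q (1, k, 0, 1)" unfolding Q Q' using a k by simp
  thus ?thesis using that by blast
qed

text \<open>Invariance says that the Gram matrix times \<open>\<sigma>\<close> equals the inverse
  transpose of \<open>\<sigma>\<close> times the Gram matrix; the two equations compare the first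
  columns.\<close>

lemma automorph_eqs:
  assumes "act (a, h, c) (p, r, q, s) = (a, h, c)" "p * s - r * q = (1::int)"
  shows "a * s = a * p + 2 * h * q" "a * r = - c * q"
proof -
  have e: "a * p * p + 2 * h * p * q + c * q * q = a" "a * p * r + h * (p * s + q * r) + c * q * s = h"
    using assms(1) by auto
  have "a * s - h * q = (a * p * p + 2 * h * p * q + c * q * q) * s - (a * p * r + h * (p * s + q * r) + c * q * s) * q"
    using e by simp
  also have "\<dots> = (a * p + h * q) * (p * s - r * q)" by algebra
  finally show "a * s = a * p + 2 * h * q" unfolding assms(2) by simp
  have "p * h - r * a = p * (a * p * r + h * (p * s + q * r) + c * q * s) - r * (a * p * p + 2 * h * p * q + c * q * q)"
    using e by simp
  also have "\<dots> = (h * p + c * q) * (p * s - r * q)" by algebra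
  finally show "a * r = - c * q" unfolding assms(2) by (simp add: algebra_simps)
qed

context root_setup
begin

text \<open>Two completions of a column differ by a translation, so the arbitrary choice does not
  affect the root of the moved form.\<close>

definition comp :: "int \<times> int \<Rightarrow> mat" where
  "comp v = (SOME g. g \<in> Gamma0 n \<and> col g = v)"

lemma comp:
  assumes "coprime (fst v) (snd v)" "n dvd snd v"
  shows "comp v \<in> Gamma0 n" "col (comp v) = v"
proof -
  obtain r s where "fst v * s - r * snd v = 1" using coprime_completion[OF assms(1)] .
  hence "(fst v, r, snd v, s) \<in> Gamma0 n \<and> col (fst v, r, snd v, s) = v"
    using assms(2) unfolding Gamma0_def col_def by auto
  from someI[of "\<lambda>g. g \<in> Gamma0 n \<and> col g = v", OF this]
  show "comp v \<in> Gamma0 n" "col (comp v) = v" unfolding comp_def by auto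
qed

lemma comp_col:
  assumes "g \<in> Gamma0 n"
  obtains k where "comp (col g) = mmul g (1, k, 0, 1)"
  using same_column[OF assms comp(1)[OF coprime_col[OF assms]]] comp(2)[OF coprime_col[OF assms]]
  by metis

lemma dsc_rforms: "Q \<in> rforms \<Longrightarrow> dsc Q = D"
  unfolding rforms_def by auto

definition form_of :: "int \<times> int \<Rightarrow> form" where
  "form_of \<rho> = (fst \<rho>, snd \<rho>, (snd \<rho> * snd \<rho> - D) div fst \<rho>)"

lemma form_of:
  assumes "\<rho> \<in> root_pairs D \<nu> n"
  shows "form_of \<rho> \<in> rforms" "fst (form_of \<rho>) = fst \<rho>" "fst \<rho> > 0" "root_of (form_of \<rho>) = \<rho>"
proof -
  obtain m \<mu> where \<rho>: "\<rho> = (m, \<mu>)" by (cases \<rho>)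
  have h: "m > 0" "0 \<le> \<mu>" "\<mu> < m" "m dvd \<mu> * \<mu> - D" "n dvd m" "n dvd \<mu> - \<nu>"
    using assms unfolding \<rho> root_pairs_def by (auto simp: cong_iff_dvd_diff power2_eq_square cong_0_iff)
  show "form_of \<rho> \<in> rforms" using h unfolding form_of_def rforms_def \<rho> by simp
  show "fst (form_of \<rho>) = fst \<rho>" "fst \<rho> > 0" "root_of (form_of \<rho>) = \<rho>"
    using h unfolding form_of_def root_of_def \<rho> by simp_all
qed

lemma root_of_in:
  assumes "Q \<in> rforms" "fst Q > 0"
  shows "root_of Q \<in> root_pairs D \<nu> n"
proof -
  obtain a h c where Q: "Q = (a, h, c)" by (cases Q)
  have h: "h * h - a * c = D" "n dvd a" "n dvd h - \<nu>" "a > 0" using assms unfolding Q rforms_def by auto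
  have "[(h mod a)\<^sup>2 = h\<^sup>2] (mod a)" by (intro cong_pow) (simp add: cong_def)
  moreover have "[h\<^sup>2 = D] (mod a)" unfolding cong_iff_dvd_diff power2_eq_square h(1)[symmetric] by simp
  ultimately have "[(h mod a)\<^sup>2 = D] (mod a)" by (rule cong_trans)
  moreover have "[h mod a = h] (mod n)" using h(2) by (simp add: cong_def mod_mod_cancel)
  hence "[h mod a = \<nu>] (mod n)" using h(3) by (metis cong_iff_dvd_diff cong_trans)
  ultimately show ?thesis unfolding Q root_of_def root_pairs_def using h by (auto simp: cong_0_iff)
qed

definition equivf :: "form \<Rightarrow> form \<Rightarrow> bool" where
  "equivf Q Q' \<longleftrightarrow> (\<exists>g\<in>Gamma0 n. Q' = act Q g)"

lemma equivf_refl: "equivf Q Q"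
  unfolding equivf_def using Gamma0_one act_one by metis

lemma equivf_sym: "equivf Q Q' \<Longrightarrow> equivf Q' Q"
  unfolding equivf_def using Gamma0_minv act_minv by metis

lemma equivf_trans: "equivf Q Q' \<Longrightarrow> equivf Q' Q'' \<Longrightarrow> equivf Q Q''"
  unfolding equivf_def using Gamma0_mmul act_mmul by metis

subsection \<open>Isotropic coordinates\<close>

text \<open>\<open>xi\<close> and \<open>eta\<close> are conjugate linear factors over Q(sqrt D):
  their product is \<open>fst Q\<close> times the form. Automorphs act diagonally in these
  coordinates.\<close>

definition xi :: "form \<Rightarrow> real \<Rightarrow> real \<Rightarrow> real" where
  "xi Q x y = real_of_int (fst Q) * x + (real_of_int (fst (snd Q)) + sqrt (real_of_int D)) * y"

definition eta :: "form \<Rightarrow> real \<Rightarrow> real \<Rightarrow> real" where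
  "eta Q x y = real_of_int (fst Q) * x + (real_of_int (fst (snd Q)) - sqrt (real_of_int D)) * y"

fun rqf :: "form \<Rightarrow> real \<Rightarrow> real \<Rightarrow> real" where
  "rqf (a, h, c) x y = real_of_int a * x * x + 2 * real_of_int h * x * y + real_of_int c * y * y"

lemma rqf_of_int: "rqf Q (real_of_int p) (real_of_int q) = real_of_int (qf Q p q)"
  by (cases Q) simp

lemma sqD: "sqrt (real_of_int D) * sqrt (real_of_int D) = real_of_int D" "sqrt (real_of_int D) > 1"
  using D1 by auto

lemma xi_eta:
  assumes "dsc Q = D"
  shows "xi Q x y * eta Q x y = real_of_int (fst Q) * rqf Q x y"
proof -
  obtain a h c where Q: "Q = (a, h, c)" by (cases Q)
  have "real_of_int D = real_of_int h * real_of_int h - real_of_int a * real_of_int c"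
    using assms unfolding Q by (metis dsc.simps of_int_diff of_int_mult)
  hence s: "sqrt D * sqrt D = real_of_int h * real_of_int h - real_of_int a * real_of_int c" using sqD(1) by simp
  show ?thesis unfolding xi_def eta_def Q rqf.simps fst_conv snd_conv using s by algebra
qed

lemma xi_eta_inj:
  assumes "fst Q \<noteq> 0" "xi Q x y = xi Q x' y'" "eta Q x y = eta Q x' y'"
  shows "x = x' \<and> y = y'"
proof -
  have "xi Q x y - eta Q x y = 2 * sqrt D * y" for x y unfolding xi_def eta_def by (simp add: algebra_simps)
  hence "2 * sqrt D * y = 2 * sqrt D * y'" using assms(2,3) by metis
  hence "y = y'" using sqD(2) by simp
  thus ?thesis using assms unfolding xi_def by simp
qed

lemma xi_eta_solve:
  fixes u v :: real
  assumes "fst Q \<noteq> 0"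
  defines "y \<equiv> (u - v) / (2 * sqrt D)"
  defines "x \<equiv> (u - (real_of_int (fst (snd Q)) + sqrt D) * y) / real_of_int (fst Q)"
  shows "xi Q x y = u" "eta Q x y = v"
proof -
  show xi: "xi Q x y = u" unfolding xi_def x_def using assms(1) by simp
  have "xi Q x y - eta Q x y = 2 * sqrt D * y" unfolding xi_def eta_def by (simp add: algebra_simps)
  also have "\<dots> = u - v" unfolding y_def using sqD(2) by simp
  finally show "eta Q x y = v" using xi by simp
qed

text \<open>The linear factors are eigenvectors. The eigenvalue \<open>\<kappa>\<close> is
  \<open>xi\<close> at the first column divided by \<open>xi\<close> at \<open>(1, 0)\<close>; its
  conjugate is its inverse because the form takes the value \<open>a\<close> at the first
  column.\<close>

lemma automorph_scaling:
  assumes "act Q \<sigma> = Q" "\<sigma> \<in> Gamma0 n" "dsc Q = D"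
  obtains \<kappa> where "\<kappa> \<noteq> 0"
    "\<And>x y. xi Q (real_of_int (fst (app \<sigma> (x, y)))) (real_of_int (snd (app \<sigma> (x, y)))) = \<kappa> * xi Q x y"
    "\<And>x y. eta Q (real_of_int (fst (app \<sigma> (x, y)))) (real_of_int (snd (app \<sigma> (x, y)))) = eta Q x y / \<kappa>"
proof -
  obtain a h c where Q: "Q = (a, h, c)" by (cases Q)
  obtain p r q s where g: "\<sigma> = (p, r, q, s)" by (cases \<sigma>)
  have det: "p * s - r * q = 1" using assms(2) unfolding g Gamma0_def by auto
  have e: "a * p * p + 2 * h * p * q + c * q * q = a" "a * p * r + h * (p * s + q * r) + c * q * s = h"
    using assms(1) unfolding g Q by auto
  have a0: "a \<noteq> 0" using assms(3) nonsquare[of h] unfolding Q by auto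
  note i1 = automorph_eqs(1)[OF assms(1)[unfolded Q g] det] and i2 = automorph_eqs(2)[OF assms(1)[unfolded Q g] det]
  have dd: "h * h - a * c = D" using assms(3) unfolding Q by simp
  define w where "w = sqrt (real_of_int D)"
  have w: "w * w = real_of_int h * real_of_int h - real_of_int a * real_of_int c"
    using sqD(1) dd unfolding w_def by (metis of_int_diff of_int_mult)
  define A H C P R S T where "A = real_of_int a" and "H = real_of_int h" and "C = real_of_int c"
    and "P = real_of_int p" and "R = real_of_int r" and "S = real_of_int q" and "T = real_of_int s"
  have A0: "A \<noteq> 0" using a0 unfolding A_def by simp
  have r1: "A * T = A * P + 2 * H * S" using i1 unfolding A_def T_def P_def H_def S_def
    by (metis of_int_add of_int_mult of_int_numeral)
  have r2: "A * R = - C * S" using i2 unfolding A_def R_def C_def S_def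
    by (metis of_int_minus of_int_mult)
  have r3: "A * P * P + 2 * H * P * S + C * S * S = A" using e(1) unfolding A_def H_def P_def S_def C_def
    by (metis of_int_add of_int_mult of_int_numeral)
  have w': "w * w = H * H - A * C" using w unfolding A_def H_def C_def by simp
  define \<kappa> where "\<kappa> = (A * P + (H + w) * S) / A"
  define \<kappa>' where "\<kappa>' = (A * P + (H - w) * S) / A"
  have Ak: "A * \<kappa> = A * P + (H + w) * S" "A * \<kappa>' = A * P + (H - w) * S" unfolding \<kappa>_def \<kappa>'_def using A0 by auto
  have "A * A * (\<kappa> * \<kappa>') = (A * P + (H + w) * S) * (A * P + (H - w) * S)"
    unfolding Ak[symmetric] by algebra
  also have "\<dots> = A * (A * P * P + 2 * H * P * S + C * S * S)" using w' by algebra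
  also have "\<dots> = A * A" unfolding r3 ..
  finally have kk: "\<kappa> * \<kappa>' = 1" using A0 by simp
  have "A * (A * R + (H + w) * T) = A * (\<kappa> * (H + w))"
  proof -
    have "A * (\<kappa> * (H + w)) = (A * P + (H + w) * S) * (H + w)" unfolding Ak(1)[symmetric] by algebra
    thus ?thesis using r1 r2 w' by algebra
  qed
  hence x2: "A * R + (H + w) * T = \<kappa> * (H + w)" using A0 by simp
  have "A * (A * R + (H - w) * T) = A * (\<kappa>' * (H - w))"
  proof -
    have "A * (\<kappa>' * (H - w)) = (A * P + (H - w) * S) * (H - w)" unfolding Ak(2)[symmetric] by algebra
    thus ?thesis using r1 r2 w' by algebra
  qed
  hence y2: "A * R + (H - w) * T = \<kappa>' * (H - w)" using A0 by simp
  have xx: "xi Q (real_of_int (fst (app \<sigma> (x, y)))) (real_of_int (snd (app \<sigma> (x, y)))) = \<kappa> * xi Q x y" for x y :: int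
  proof -
    have "xi Q (real_of_int (fst (app \<sigma> (x, y)))) (real_of_int (snd (app \<sigma> (x, y))))
        = (A * P + (H + w) * S) * x + (A * R + (H + w) * T) * y"
      unfolding xi_def Q g A_def H_def P_def S_def R_def T_def w_def by (simp add: algebra_simps)
    also have "\<dots> = \<kappa> * (A * x + (H + w) * y)" unfolding x2 Ak(1)[symmetric] by algebra
    finally show ?thesis unfolding xi_def Q A_def H_def w_def by simp
  qed
  have yy: "eta Q (real_of_int (fst (app \<sigma> (x, y)))) (real_of_int (snd (app \<sigma> (x, y)))) = \<kappa>' * eta Q x y" for x y :: int
  proof -
    have "eta Q (real_of_int (fst (app \<sigma> (x, y)))) (real_of_int (snd (app \<sigma> (x, y))))
        = (A * P + (H - w) * S) * x + (A * R + (H - w) * T) * y"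
      unfolding eta_def Q g A_def H_def P_def S_def R_def T_def w_def by (simp add: algebra_simps)
    also have "\<dots> = \<kappa>' * (A * x + (H - w) * y)" unfolding y2 Ak(2)[symmetric] by algebra
    finally show ?thesis unfolding eta_def Q A_def H_def w_def by simp
  qed
  have k0: "\<kappa> \<noteq> 0" using kk by auto
  have "\<kappa>' = 1 / \<kappa>" using kk k0 by (simp add: field_simps)
  thus ?thesis using that[OF k0 xx] yy by simp
qed

end

subsection \<open>Null frontiers\<close>

text \<open>Fubini over horizontal lines. The line \<open>y = 0\<close> is exempt because some of
  the polynomials to be treated, such as \<open>xi - eta\<close>, vanish on all of it.\<close>

lemma null_slices:
  fixes S :: "(real \<times> real) set"
  assumes "closed S" "\<And>y. y \<noteq> 0 \<Longrightarrow> finite {x. (x, y) \<in> S}"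
  shows "emeasure lborel S = 0"
proof -
  have m: "S \<in> sets (lborel \<Otimes>\<^sub>M lborel)" unfolding lborel_prod using assms(1) by simp
  have "emeasure (lborel \<Otimes>\<^sub>M lborel) S = (\<integral>\<^sup>+y. emeasure lborel ((\<lambda>x. (x, y)) -` S) \<partial>lborel)"
    by (rule lborel_pair.emeasure_pair_measure_alt2[OF m])
  also have "\<dots> = (\<integral>\<^sup>+y. 0 \<partial>(lborel :: real measure))"
  proof (rule nn_integral_cong_AE)
    have "AE y in lborel. y \<noteq> (0::real)" by (rule AE_lborel_singleton)
    thus "AE y in lborel. emeasure lborel ((\<lambda>x. (x, y)) -` S) = 0"
    proof eventually_elim
      case (elim y)
      have "finite ((\<lambda>x. (x, y)) -` S)" using assms(2)[OF elim] by (simp add: vimage_def)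
      thus ?case by (rule emeasure_lborel_countable[OF countable_finite])
    qed
  qed
  finally show ?thesis by (simp add: lborel_prod)
qed

text \<open>Where no \<open>f i\<close> vanishes all signs are locally constant, so such a point is
  interior to the set or to its complement; the frontier lies in finitely many null zero sets.
  Describing a region by signs treats strict and weak inequalities alike.\<close>

lemma frontier_sign_conditions:
  fixes f :: "'i \<Rightarrow> (real \<times> real) \<Rightarrow> real"
  assumes fin: "finite I" and cont: "\<And>i. i \<in> I \<Longrightarrow> continuous_on UNIV (f i)"
    and slices: "\<And>i y. i \<in> I \<Longrightarrow> y \<noteq> 0 \<Longrightarrow> finite {x. f i (x, y) = 0}"
    and det: "\<And>z w. (\<And>i. i \<in> I \<Longrightarrow> sgn (f i z) = sgn (f i w)) \<Longrightarrow> z \<in> \<Omega> \<longleftrightarrow> w \<in> \<Omega>"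
  shows "emeasure lborel (frontier \<Omega>) = 0"
proof -
  define Z where "Z = (\<Union>i\<in>I. {z. f i z = 0})"
  have cZ: "closed {z. f i z = 0}" if "i \<in> I" for i
    using cont[OF that] by (intro closed_Collect_eq) auto
  have "frontier \<Omega> \<subseteq> Z"
  proof (rule ccontr)
    assume "\<not> frontier \<Omega> \<subseteq> Z"
    then obtain z where z: "z \<in> frontier \<Omega>" "\<And>i. i \<in> I \<Longrightarrow> f i z \<noteq> 0" unfolding Z_def by auto
    define U where "U = (\<Inter>i\<in>I. {w. 0 < f i w * f i z})"
    have "open U" unfolding U_def
      by (intro open_INT fin ballI open_Collect_less continuous_intros cont)
    moreover have "z \<in> U" unfolding U_def using z(2) by (auto simp: zero_less_mult_iff linorder_neq_iff)
    moreover have same: "w \<in> \<Omega> \<longleftrightarrow> z \<in> \<Omega>" if "w \<in> U" for w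
      by (rule det) (use that in \<open>auto simp: U_def sgn_if zero_less_mult_iff\<close>)
    ultimately have "z \<in> interior \<Omega> \<or> z \<in> interior (- \<Omega>)"
      by (metis ComplI interiorI subsetI)
    thus False using z(1) by (auto simp: frontier_def interior_complement)
  qed
  moreover have "emeasure lborel Z = 0"
  proof -
    have "closed Z" unfolding Z_def using cZ fin by auto
    moreover have "finite {x. (x, y) \<in> Z}" if "y \<noteq> 0" for y
    proof -
      have "{x. (x, y) \<in> Z} = (\<Union>i\<in>I. {x. f i (x, y) = 0})" unfolding Z_def by auto
      thus ?thesis using slices that fin by auto
    qed
    ultimately show ?thesis by (rule null_slices)
  qed
  moreover have "Z \<in> sets lborel" unfolding Z_def using cZ fin by auto
  ultimately show ?thesis using emeasure_mono[of "frontier \<Omega>" Z lborel] by auto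
qed

lemma finite_poly_zeros:
  fixes f :: "real \<Rightarrow> real"
  assumes "\<And>x. f x = poly P x" "P \<noteq> 0"
  shows "finite {x. f x = 0}"
  using poly_roots_finite[OF assms(2)] assms(1) by simp

subsection \<open>The number of roots\<close>

text \<open>Moving each element into the other window by a multiple of the period is injective,
  because two elements of a half-open window of length \<open>E\<close> never differ by a nonzero
  multiple of \<open>E\<close>.\<close>

lemma periodic_card_le:
  fixes A :: "real set"
  assumes E: "E > 0" and add: "\<And>x. x \<in> A \<Longrightarrow> x + E \<in> A" "\<And>x. x \<in> A \<Longrightarrow> x - E \<in> A"
    and fin: "finite (A \<inter> {y..<y + E})"
  shows "card (A \<inter> {x..<x + E}) \<le> card (A \<inter> {y..<y + E})" "finite (A \<inter> {x..<x + E})"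
proof -
  have int: "z + E * of_int k \<in> A" if "z \<in> A" for z k
  proof (induction k rule: int_induct[of _ 0])
    case (step1 i) thus ?case using add(1)[of "z + E * of_int i"] by (simp add: algebra_simps)
  next
    case (step2 i) thus ?case using add(2)[of "z + E * of_int i"] by (simp add: algebra_simps)
  qed (use that in simp)
  define f where "f z = z + E * of_int \<lceil>(y - z) / E\<rceil>" for z
  have range: "f z \<in> {y..<y + E}" for z
  proof -
    define c :: real where "c = of_int \<lceil>(y - z) / E\<rceil>"
    have "(y - z) / E \<le> c" "c < (y - z) / E + 1" unfolding c_def by linarith+
    hence "y - z \<le> E * c" "E * c < y - z + E" using E by (auto simp: field_simps)
    thus ?thesis unfolding f_def c_def[symmetric] by auto
  qed
  have inj: "inj_on f (A \<inter> {x..<x + E})"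
  proof (rule inj_onI)
    fix z z' assume zz: "z \<in> A \<inter> {x..<x + E}" "z' \<in> A \<inter> {x..<x + E}" "f z = f z'"
    define k where "k = \<lceil>(y - z') / E\<rceil> - \<lceil>(y - z) / E\<rceil>"
    have k: "z - z' = E * of_int k" using zz(3) unfolding f_def k_def by (simp add: algebra_simps)
    moreover have "\<bar>z - z'\<bar> < E" using zz by auto
    ultimately have "E * \<bar>of_int k\<bar> < E * 1" using E by (simp add: abs_mult)
    hence "k = 0" using E by (simp del: of_int_abs add: of_int_abs[symmetric])
    thus "z = z'" using k by simp
  qed
  have sub: "f ` (A \<inter> {x..<x + E}) \<subseteq> A \<inter> {y..<y + E}" using range int unfolding f_def by auto
  show "card (A \<inter> {x..<x + E}) \<le> card (A \<inter> {y..<y + E})" by (rule card_inj_on_le[OF inj sub fin])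
  show "finite (A \<inter> {x..<x + E})" using inj sub fin by (meson finite_imageD finite_subset)
qed

lemma sgn_eq_iffs:
  fixes x y :: real
  assumes "sgn x = sgn y"
  shows "(0 < x \<longleftrightarrow> 0 < y) \<and> (0 \<le> x \<longleftrightarrow> 0 \<le> y)"
  using assms by (metis linorder_not_le sgn_less sgn_greater)

lemma app_mmul: "app (mmul \<sigma> \<tau>) v = app \<sigma> (app \<tau> v)"
  by (cases \<sigma>; cases \<tau>; cases v) (simp add: algebra_simps)

lemma app_one: "app (1, 0, 0, 1) v = v"
  by (cases v) simp

context root_setup
begin

definition xv :: "form \<Rightarrow> int \<times> int \<Rightarrow> real" where "xv Q v = xi Q (real_of_int (fst v)) (real_of_int (snd v))"
definition ev :: "form \<Rightarrow> int \<times> int \<Rightarrow> real" where "ev Q v = eta Q (real_of_int (fst v)) (real_of_int (snd v))"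

text \<open>The logarithms of the \<open>xi\<close>-eigenvalues of those automorphs in
  \<open>Gamma0 n\<close> whose eigenvalues are positive, an additive group. A period and the number
  of elements in one window stand in for a generator.\<close>

definition aut :: "form \<Rightarrow> real set" where
  "aut Q = {z. \<exists>\<sigma>\<in>Gamma0 n. act Q \<sigma> = Q \<and> (\<forall>v. xv Q (app \<sigma> v) = exp z * xv Q v \<and> ev Q (app \<sigma> v) = ev Q v / exp z)}"

lemma aut_zero: "0 \<in> aut Q"
  unfolding aut_def by (rule CollectI, rule bexI[of _ "(1, 0, 0, 1)"]) (simp_all add: act_one app_one Gamma0_one)

lemma aut_add:
  assumes "z \<in> aut Q" "z' \<in> aut Q"
  shows "z + z' \<in> aut Q"
proof -
  obtain \<sigma> where s: "\<sigma> \<in> Gamma0 n" "act Q \<sigma> = Q" "\<And>v. xv Q (app \<sigma> v) = exp z * xv Q v" "\<And>v. ev Q (app \<sigma> v) = ev Q v / exp z"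
    using assms(1) unfolding aut_def by blast
  obtain \<tau> where t: "\<tau> \<in> Gamma0 n" "act Q \<tau> = Q" "\<And>v. xv Q (app \<tau> v) = exp z' * xv Q v" "\<And>v. ev Q (app \<tau> v) = ev Q v / exp z'"
    using assms(2) unfolding aut_def by blast
  have "xv Q (app (mmul \<sigma> \<tau>) v) = exp (z + z') * xv Q v \<and> ev Q (app (mmul \<sigma> \<tau>) v) = ev Q v / exp (z + z')" for v
    unfolding app_mmul s(3,4) t(3,4) by (simp add: exp_add)
  moreover have "act Q (mmul \<sigma> \<tau>) = Q" using s t by (simp add: act_mmul)
  ultimately show ?thesis unfolding aut_def using Gamma0_mmul[OF s(1) t(1)] by blast
qed

lemma aut_minus:
  assumes "z \<in> aut Q"
  shows "- z \<in> aut Q"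
proof -
  obtain \<sigma> where s: "\<sigma> \<in> Gamma0 n" "act Q \<sigma> = Q" "\<And>v. xv Q (app \<sigma> v) = exp z * xv Q v" "\<And>v. ev Q (app \<sigma> v) = ev Q v / exp z"
    using assms(1) unfolding aut_def by blast
  have c: "app \<sigma> (app (minv \<sigma>) v) = v" for v
    by (simp add: app_mmul[symmetric] minv_cancel[OF s(1)] app_one)
  have a: "act Q (minv \<sigma>) = Q" using act_minv(1)[OF s(1), of Q] s(2) by simp
  have "xv Q (app (minv \<sigma>) v) = exp (- z) * xv Q v" "ev Q (app (minv \<sigma>) v) = ev Q v / exp (- z)" for v
    using s(3)[of "app (minv \<sigma>) v"] s(4)[of "app (minv \<sigma>) v"] unfolding c by (simp_all add: exp_minus field_simps)
  thus ?thesis unfolding aut_def using Gamma0_minv[OF s(1)] a by (auto intro!: bexI[of _ "minv \<sigma>"])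
qed

text \<open>A solution of Pell's equation gives \<open>(a, h, c)\<close> the automorph with columns
  \<open>(t - h u, a u)\<close> and \<open>(- c u, t + h u)\<close>. It lies in
  \<open>Gamma0 n\<close> because \<open>n\<close> divides \<open>a\<close>, and its eigenvalue
  \<open>t + u * sqrt D\<close> is the same for all forms, hence a common period.\<close>

lemma aut_period: "\<exists>E>0. \<forall>Q\<in>rforms. E \<in> aut Q"
proof -
  obtain t u where tu: "t > 0" "u > 0" "t * t - D * (u * u) = 1" using pell_exists by blast
  define w where "w = sqrt (real_of_int D)"
  define \<epsilon> where "\<epsilon> = of_int t + of_int u * w"
  have w: "w * w = D" "w > 1" using sqD unfolding w_def by auto
  have "real_of_int u * w > 0" using tu w by simp
  hence e1: "\<epsilon> > 1" unfolding \<epsilon>_def using tu(1) by (smt (verit) of_int_1_le_iff)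
  have ee: "\<epsilon> * (of_int t - of_int u * w) = 1"
  proof -
    have "\<epsilon> * (of_int t - of_int u * w) = of_int (t * t - D * (u * u))"
      unfolding \<epsilon>_def using w(1) by (simp add: algebra_simps)
    thus ?thesis using tu(3) by simp
  qed
  have inv: "of_int t - of_int u * w = 1 / \<epsilon>" using ee e1 by (simp add: field_simps)
  have "ln \<epsilon> \<in> aut Q" if Q: "Q \<in> rforms" for Q
  proof -
    obtain a h c where Qe: "Q = (a, h, c)" by (cases Q)
    have q: "h * h - a * c = D" "n dvd a" using Q unfolding Qe rforms_def by auto
    define \<sigma> where "\<sigma> = (t - h * u, - c * u, a * u, t + h * u)"
    have "(t - h * u) * (t + h * u) - (- c * u) * (a * u) = t * t - (h * h - a * c) * (u * u)" by algebra
    hence s: "\<sigma> \<in> Gamma0 n" using tu(3) q unfolding \<sigma>_def Gamma0_def by simp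
    have pell: "t * t - (h * h - a * c) * (u * u) = 1" using tu(3) q by simp
    have act: "act Q \<sigma> = Q"
    proof -
      have "a * (t - h * u) * (t - h * u) + 2 * h * (t - h * u) * (a * u) + c * (a * u) * (a * u) = a"
        "a * (t - h * u) * (- c * u) + h * ((t - h * u) * (t + h * u) + a * u * (- c * u)) + c * (a * u) * (t + h * u) = h"
        "a * (- c * u) * (- c * u) + 2 * h * (- c * u) * (t + h * u) + c * (t + h * u) * (t + h * u) = c"
        using pell by algebra+
      thus ?thesis unfolding \<sigma>_def Qe by simp
    qed
    have ww: "w * w = real_of_int h * real_of_int h - real_of_int a * real_of_int c"
      using w(1) q(1) by (metis of_int_diff of_int_mult)
    have id: "real_of_int a * ((of_int t - of_int h * of_int u) * X + (- of_int c * of_int u) * Y)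
        + (of_int h + w') * (of_int a * of_int u * X + (of_int t + of_int h * of_int u) * Y)
        = (of_int t + of_int u * w') * (of_int a * X + (of_int h + w') * Y)"
      if "w' * w' = real_of_int h * real_of_int h - real_of_int a * real_of_int c" for w' X Y :: real
      using that by algebra
    have x: "xv Q (app \<sigma> v) = \<epsilon> * xv Q v" for v
      using id[OF ww, of "fst v" "snd v"]
      unfolding xv_def xi_def Qe \<sigma>_def w_def[symmetric] \<epsilon>_def by (cases v) simp
    have "ev Q (app \<sigma> v) = (of_int t - of_int u * w) * ev Q v" for v
      using id[of "- w" "fst v" "snd v"] ww
      unfolding ev_def eta_def Qe \<sigma>_def w_def[symmetric] by (cases v) simp
    note x this
    hence "xv Q (app \<sigma> v) = exp (ln \<epsilon>) * xv Q v \<and> ev Q (app \<sigma> v) = ev Q v / exp (ln \<epsilon>)" for v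
      using e1 inv by simp
    thus ?thesis unfolding aut_def using s act by blast
  qed
  moreover have "ln \<epsilon> > 0" using e1 by simp
  ultimately show ?thesis by blast
qed

text \<open>For \<open>fst Q > 0\<close> the form is positive at \<open>v\<close> exactly when the
  two coordinates have the same nonzero sign; asking both to be positive selects one of
  \<open>v\<close> and \<open>-v\<close>.\<close>

definition vecs :: "form \<Rightarrow> (int \<times> int) set" where
  "vecs Q = {v. coprime (fst v) (snd v) \<and> n dvd snd v \<and> xv Q v > 0 \<and> ev Q v > 0}"

definition vroot :: "form \<Rightarrow> int \<times> int \<Rightarrow> int \<times> int" where
  "vroot Q v = root_of (act Q (comp v))"

lemma xv_ev: "dsc Q = D \<Longrightarrow> xv Q v * ev Q v = of_int (fst Q) * of_int (qf Q (fst v) (snd v))"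
  unfolding xv_def ev_def by (simp add: xi_eta rqf_of_int)

lemma xv_ev_inj:
  assumes "fst Q \<noteq> 0" "xv Q v = xv Q v'" "ev Q v = ev Q v'"
  shows "v = v'"
  using xi_eta_inj[OF assms(1) assms(2,3)[unfolded xv_def ev_def]] by (simp add: prod_eq_iff)

lemma fst_act_col: "fst (act Q g) = qf Q (fst (col g)) (snd (col g))"
  by (cases g; cases Q) (simp add: col_def)

lemma fst_vroot: "v \<in> vecs Q \<Longrightarrow> fst (vroot Q v) = qf Q (fst v) (snd v)"
  unfolding vroot_def root_of_def using fst_act_col[of Q "comp v"] comp(2)[of v] by (simp add: vecs_def)

lemma vroot_col:
  assumes "g \<in> Gamma0 n"
  shows "vroot Q (col g) = root_of (act Q g)"
proof -
  obtain k where "comp (col g) = mmul g (1, k, 0, 1)" using comp_col[OF assms] .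
  thus ?thesis unfolding vroot_def by (simp add: act_mmul root_of_translation)
qed

lemma qf_pos_vecs:
  assumes "dsc Q = D" "fst Q > 0" "v \<in> vecs Q"
  shows "qf Q (fst v) (snd v) > 0"
proof -
  have "xv Q v * ev Q v > 0" using assms(3) unfolding vecs_def by simp
  thus ?thesis unfolding xv_ev[OF assms(1)] using assms(2) by (simp add: zero_less_mult_iff)
qed

text \<open>If two vectors have the same root, the forms moved by their completions differ by a
  translation, so an automorph carries one vector to the other; its eigenvalue is positive since
  both have positive \<open>xi\<close>. Conversely an automorph leaves the form, hence the root,
  unchanged.\<close>

lemma vroot_fibre:
  assumes Q: "dsc Q = D" "fst Q > 0" and v0: "v0 \<in> vecs Q"
  shows "v \<in> vecs Q \<and> vroot Q v = vroot Q v0 \<longleftrightarrow> (\<exists>z\<in>aut Q. xv Q v = exp z * xv Q v0 \<and> ev Q v = ev Q v0 / exp z)"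
proof
  assume A: "v \<in> vecs Q \<and> vroot Q v = vroot Q v0"
  have cv: "comp v \<in> Gamma0 n" "col (comp v) = v" using A comp unfolding vecs_def by auto
  have c0: "comp v0 \<in> Gamma0 n" "col (comp v0) = v0" using v0 comp unfolding vecs_def by auto
  have "fst (act Q (comp v)) \<noteq> 0"
    using qf_pos_vecs[OF Q, of v] A unfolding fst_act_col cv(2) by auto
  moreover have "dsc (act Q (comp v)) = dsc (act Q (comp v0))" using dsc_act cv(1) c0(1) by auto
  ultimately obtain k where k: "act Q (comp v0) = act (act Q (comp v)) (1, k, 0, 1)"
    using root_of_eq A unfolding vroot_def by metis
  define \<tau> where "\<tau> = mmul (comp v) (1, k, 0, 1)"
  have \<tau>: "\<tau> \<in> Gamma0 n" "col \<tau> = v" unfolding \<tau>_def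
    using cv by (auto intro!: Gamma0_mmul simp: col_translation) (simp add: Gamma0_def)
  define \<sigma> where "\<sigma> = mmul \<tau> (minv (comp v0))"
  have \<sigma>: "\<sigma> \<in> Gamma0 n" unfolding \<sigma>_def using \<tau> c0 by (intro Gamma0_mmul Gamma0_minv)
  have "act Q \<tau> = act Q (comp v0)" unfolding \<tau>_def k act_mmul ..
  hence act: "act Q \<sigma> = Q" unfolding \<sigma>_def act_mmul using act_minv(1)[OF c0(1)] by simp
  have "mmul \<sigma> (comp v0) = \<tau>" unfolding \<sigma>_def by (simp add: mmul_assoc minv_cancel[OF c0(1)] mmul_one)
  hence app: "app \<sigma> v0 = v" using col_mmul[of \<sigma> "comp v0"] c0(2) \<tau>(2) by simp
  obtain \<kappa> where \<kappa>: "\<kappa> \<noteq> 0"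
    "\<And>x y. xi Q (real_of_int (fst (app \<sigma> (x, y)))) (real_of_int (snd (app \<sigma> (x, y)))) = \<kappa> * xi Q x y"
    "\<And>x y. eta Q (real_of_int (fst (app \<sigma> (x, y)))) (real_of_int (snd (app \<sigma> (x, y)))) = eta Q x y / \<kappa>"
    using automorph_scaling[OF act \<sigma> Q(1)] by blast
  have \<kappa>': "xv Q (app \<sigma> w) = \<kappa> * xv Q w" "ev Q (app \<sigma> w) = ev Q w / \<kappa>" for w
    using \<kappa>(2,3)[of "fst w" "snd w"] unfolding xv_def ev_def by auto
  have "\<kappa> * xv Q v0 > 0" using \<kappa>'(1)[of v0] app A unfolding vecs_def by simp
  hence \<kappa>0: "\<kappa> > 0" using v0 unfolding vecs_def by (simp add: zero_less_mult_iff)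
  hence "ln \<kappa> \<in> aut Q" unfolding aut_def using \<sigma> act \<kappa>' by auto
  moreover have "xv Q v = exp (ln \<kappa>) * xv Q v0 \<and> ev Q v = ev Q v0 / exp (ln \<kappa>)"
    using \<kappa>'[of v0] \<kappa>0 app by simp
  ultimately show "\<exists>z\<in>aut Q. xv Q v = exp z * xv Q v0 \<and> ev Q v = ev Q v0 / exp z" by blast
next
  assume "\<exists>z\<in>aut Q. xv Q v = exp z * xv Q v0 \<and> ev Q v = ev Q v0 / exp z"
  then obtain z where z: "z \<in> aut Q" "xv Q v = exp z * xv Q v0" "ev Q v = ev Q v0 / exp z" by blast
  obtain \<sigma> where s: "\<sigma> \<in> Gamma0 n" "act Q \<sigma> = Q" "\<And>v. xv Q (app \<sigma> v) = exp z * xv Q v" "\<And>v. ev Q (app \<sigma> v) = ev Q v / exp z"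
    using z(1) unfolding aut_def by blast
  have v: "v = app \<sigma> v0" by (rule xv_ev_inj[of Q]) (use Q z s in auto)
  have c0: "comp v0 \<in> Gamma0 n" "col (comp v0) = v0" using v0 comp unfolding vecs_def by auto
  have g: "mmul \<sigma> (comp v0) \<in> Gamma0 n" using s(1) c0 by (intro Gamma0_mmul)
  have cg: "col (mmul \<sigma> (comp v0)) = v" unfolding col_mmul c0 v ..
  have "v \<in> vecs Q" using coprime_col[OF g] z v0 unfolding cg vecs_def by simp
  moreover have "vroot Q v = vroot Q v0"
    using vroot_col[OF g, of Q] unfolding cg act_mmul s(2) vroot_def .
  ultimately show "v \<in> vecs Q \<and> vroot Q v = vroot Q v0" by blast
qed

text \<open>An automorph with logarithm \<open>z\<close> multiplies \<open>xi / eta\<close> by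
  \<open>exp (2 * z)\<close>, so the half-open angular condition cuts out one period
  \<open>E\<close>; the last condition says that the form is at most 1.\<close>

definition sector :: "form \<Rightarrow> real \<Rightarrow> (real \<times> real) set" where
  "sector Q E = {z. 0 < xi Q (fst z) (snd z) \<and> 0 < eta Q (fst z) (snd z) \<and> eta Q (fst z) (snd z) \<le> xi Q (fst z) (snd z)
     \<and> xi Q (fst z) (snd z) < exp (2 * E) * eta Q (fst z) (snd z) \<and> xi Q (fst z) (snd z) * eta Q (fst z) (snd z) \<le> fst Q}"

lemma xi_scale: "xi Q (x / X) (y / X) = xi Q x y / X" "eta Q (x / X) (y / X) = eta Q x y / X"
  unfolding xi_def eta_def by (simp_all add: add_divide_distrib)

lemma xi_eta_bound:
  assumes "fst Q \<noteq> 0" "\<And>z. z \<in> S \<Longrightarrow> \<bar>xi Q (fst z) (snd z)\<bar> \<le> B \<and> \<bar>eta Q (fst z) (snd z)\<bar> \<le> B"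
  shows "bounded S"
proof -
  define w where "w = sqrt (real_of_int D)"
  define B' where "B' = (B + (\<bar>real_of_int (fst (snd Q))\<bar> + w) * B) / \<bar>real_of_int (fst Q)\<bar>"
  have w: "w > 1" using sqD unfolding w_def by auto
  have "norm z \<le> B' + B" if "z \<in> S" for z
  proof -
    obtain x y where z: "z = (x, y)" by (cases z)
    have b: "\<bar>xi Q x y\<bar> \<le> B" "\<bar>eta Q x y\<bar> \<le> B" using assms(2)[OF that] unfolding z by auto
    have "2 * w * y = xi Q x y - eta Q x y" unfolding xi_def eta_def w_def by (simp add: algebra_simps)
    hence "\<bar>2 * w * y\<bar> \<le> 2 * B" using b by linarith
    hence wy: "w * \<bar>y\<bar> \<le> B" using w by (simp add: abs_mult)
    moreover have "1 * \<bar>y\<bar> \<le> w * \<bar>y\<bar>" using w by (intro mult_right_mono) auto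
    ultimately have y: "\<bar>y\<bar> \<le> B" by simp
    have "real_of_int (fst Q) * x = xi Q x y - (real_of_int (fst (snd Q)) + w) * y" unfolding xi_def w_def by simp
    hence "\<bar>real_of_int (fst Q)\<bar> * \<bar>x\<bar> \<le> \<bar>xi Q x y\<bar> + \<bar>real_of_int (fst (snd Q)) + w\<bar> * \<bar>y\<bar>"
      by (metis abs_mult abs_triangle_ineq4)
    also have "\<dots> \<le> B + (\<bar>real_of_int (fst (snd Q))\<bar> + w) * B"
      using b y w by (intro add_mono mult_mono) auto
    finally have "\<bar>x\<bar> \<le> B'" unfolding B'_def using assms(1) by (simp add: field_simps)
    thus ?thesis unfolding z using y norm_Pair_le[of x y] by simp
  qed
  thus ?thesis unfolding bounded_iff by blast
qed

lemma sector_region: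
  assumes Q: "fst Q > 0" and E: "E > 0"
  shows "bounded (sector Q E)" "sector Q E \<in> sets borel" "emeasure lborel (frontier (sector Q E)) = 0"
    "measure lborel (sector Q E) > 0"
proof -
  define a where "a = real_of_int (fst Q)"
  have a0: "a > 0" using Q unfolding a_def by simp
  show bd: "bounded (sector Q E)"
  proof (rule xi_eta_bound[of Q _ "sqrt (exp (2 * E) * a)"])
    fix z assume z: "z \<in> sector Q E"
    define u v where "u = xi Q (fst z) (snd z)" and "v = eta Q (fst z) (snd z)"
    have uv: "0 < u" "0 < v" "v \<le> u" "u < exp (2 * E) * v" "u * v \<le> a"
      using z unfolding sector_def u_def v_def a_def by auto
    have "u * u \<le> u * (exp (2 * E) * v)" using uv by (intro mult_left_mono) auto
    also have "\<dots> = exp (2 * E) * (u * v)" by simp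
    also have "\<dots> \<le> exp (2 * E) * a" using uv by (intro mult_left_mono) auto
    finally have "u \<le> sqrt (exp (2 * E) * a)" by (intro real_le_rsqrt) (simp add: power2_eq_square)
    thus "\<bar>xi Q (fst z) (snd z)\<bar> \<le> sqrt (exp (2 * E) * a) \<and> \<bar>eta Q (fst z) (snd z)\<bar> \<le> sqrt (exp (2 * E) * a)"
      using uv unfolding u_def v_def by auto
  qed (use Q in auto)
  have cont: "continuous_on UNIV (\<lambda>z. xi Q (fst z) (snd z))" "continuous_on UNIV (\<lambda>z. eta Q (fst z) (snd z))"
    unfolding xi_def eta_def by (intro continuous_intros)+
  have [measurable]: "(\<lambda>z. xi Q (fst z) (snd z)) \<in> borel_measurable borel" "(\<lambda>z. eta Q (fst z) (snd z)) \<in> borel_measurable borel"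
    using cont by (auto intro: borel_measurable_continuous_onI)
  show meas: "sector Q E \<in> sets borel" unfolding sector_def by measurable
  define f :: "nat \<Rightarrow> real \<times> real \<Rightarrow> real" where "f i z = [xi Q (fst z) (snd z), eta Q (fst z) (snd z), xi Q (fst z) (snd z) - eta Q (fst z) (snd z),
    exp (2 * E) * eta Q (fst z) (snd z) - xi Q (fst z) (snd z), a - xi Q (fst z) (snd z) * eta Q (fst z) (snd z)] ! i" for i z
  show fr: "emeasure lborel (frontier (sector Q E)) = 0"
  proof (rule frontier_sign_conditions[of "{..<5}" f])
    fix i :: nat assume "i \<in> {..<5}"
    hence i: "i = 0 \<or> i = 1 \<or> i = 2 \<or> i = 3 \<or> i = 4" by auto
    show "continuous_on UNIV (f i)"
      using i by (elim disjE; simp add: f_def; intro continuous_intros cont)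
    fix y :: real assume y: "y \<noteq> 0"
    let ?h = "real_of_int (fst (snd Q))" and ?w = "sqrt (real_of_int D)"
    have w: "?w > 1" using sqD by auto
    have e1: "exp (2 * E) - 1 > 0" using E by simp
    show "finite {x. f i (x, y) = 0}"
      using i
    proof (elim disjE)
      assume "i = 0"
      thus ?thesis
        by (intro finite_poly_zeros[of _ "[:(?h + ?w) * y, a:]"]) (use a0 in \<open>auto simp: f_def xi_def a_def\<close>)
    next
      assume "i = 1"
      thus ?thesis
        by (intro finite_poly_zeros[of _ "[:(?h - ?w) * y, a:]"]) (use a0 in \<open>auto simp: f_def eta_def a_def\<close>)
    next
      assume "i = 2"
      thus ?thesis
        by (intro finite_poly_zeros[of _ "[:2 * ?w * y:]"]) (use y w in \<open>auto simp: f_def xi_def eta_def a_def algebra_simps\<close>)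
    next
      assume "i = 3"
      thus ?thesis
        by (intro finite_poly_zeros[of _ "[:exp (2 * E) * ((?h - ?w) * y) - (?h + ?w) * y, (exp (2 * E) - 1) * a:]"])
           (use a0 e1 in \<open>auto simp: f_def xi_def eta_def a_def algebra_simps\<close>)
    next
      assume "i = 4"
      thus ?thesis
        by (intro finite_poly_zeros[of _ "[:a:] - [:(?h + ?w) * y, a:] * [:(?h - ?w) * y, a:]"])
           (use a0 in \<open>auto simp: f_def xi_def eta_def a_def algebra_simps\<close>)
    qed
  next
    fix z z' assume "\<And>i. i \<in> {..<5::nat} \<Longrightarrow> sgn (f i z) = sgn (f i z')"
    hence "(0 < f i z \<longleftrightarrow> 0 < f i z') \<and> (0 \<le> f i z \<longleftrightarrow> 0 \<le> f i z')" if "i < 5" for i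
      using that by (intro sgn_eq_iffs) auto
    from this[of 0] this[of 1] this[of 2] this[of 3] this[of 4]
    have "0 < f 0 z \<and> 0 < f 1 z \<and> 0 \<le> f 2 z \<and> 0 < f 3 z \<and> 0 \<le> f 4 z
        \<longleftrightarrow> 0 < f 0 z' \<and> 0 < f 1 z' \<and> 0 \<le> f 2 z' \<and> 0 < f 3 z' \<and> 0 \<le> f 4 z'" by simp
    moreover have "z \<in> sector Q E \<longleftrightarrow> 0 < f 0 z \<and> 0 < f 1 z \<and> 0 \<le> f 2 z \<and> 0 < f 3 z \<and> 0 \<le> f 4 z" for z
      unfolding sector_def f_def a_def by simp
    ultimately show "z \<in> sector Q E \<longleftrightarrow> z' \<in> sector Q E" by blast
  qed auto
  define U where "U = {z. 0 < xi Q (fst z) (snd z) \<and> 0 < eta Q (fst z) (snd z) \<and> eta Q (fst z) (snd z) < xi Q (fst z) (snd z)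
     \<and> xi Q (fst z) (snd z) < exp (2 * E) * eta Q (fst z) (snd z) \<and> xi Q (fst z) (snd z) * eta Q (fst z) (snd z) < a}"
  have opU: "open U" unfolding U_def
    by (intro open_Collect_conj open_Collect_less continuous_intros cont)
  have US: "U \<subseteq> sector Q E" unfolding U_def sector_def a_def by auto
  \<comment> \<open>The point with coordinates \<open>exp E * s\<close> and \<open>s\<close>
    satisfies all conditions strictly: its ratio is \<open>exp E\<close> and its product is
    \<open>a / 2\<close>.\<close>
  define s where "s = sqrt (a / (2 * exp E))"
  have s0: "s > 0" "s * s = a / (2 * exp E)" unfolding s_def using a0 by auto
  have "exp E * s * s = a / 2" using s0(2) by (simp add: mult.assoc)
  moreover have "exp E > 1" "exp (2 * E) = exp E * exp E" using E by (auto simp: exp_add[symmetric])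
  ultimately have "\<exists>z. z \<in> U"
    using xi_eta_solve[of Q "exp E * s" s] Q s0 a0 unfolding U_def
    by (intro exI[of _ "((exp E * s - (fst (snd Q) + sqrt D) * ((exp E * s - s) / (2 * sqrt D))) / fst Q, (exp E * s - s) / (2 * sqrt D))"])
       (auto simp: mult.assoc)
  hence "U \<noteq> {}" by auto
  hence "emeasure lborel U \<noteq> 0" using open_not_negligible[OF opU] opU
    by (auto simp: negligible_iff_emeasure0)
  moreover have "emeasure lborel U \<le> emeasure lborel (sector Q E)" using US meas by (intro emeasure_mono) auto
  moreover have "emeasure lborel (sector Q E) < \<infinity>" using bd by (rule emeasure_bounded_finite)
  ultimately show "measure lborel (sector Q E) > 0"
    by (metis emeasure_eq_ennreal_measure ennreal_0 infinity_ennreal_def le_zero_eq less_irrefl zero_less_measure_iff top.not_eq_extremum)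
qed

end

context root_setup
begin

lemma finite_roots_le: "finite {\<rho> \<in> root_pairs D \<nu> n. real_of_int (fst \<rho>) \<le> M}"
proof (rule finite_subset)
  show "{\<rho> \<in> root_pairs D \<nu> n. real_of_int (fst \<rho>) \<le> M} \<subseteq> {0..\<lfloor>M\<rfloor>} \<times> {0..\<lfloor>M\<rfloor>}"
    unfolding root_pairs_def by (auto simp: le_floor_iff intro: order_trans[of _ "real_of_int _"])
qed auto

lemma equivf_root_of:
  assumes "Q \<in> rforms" "fst Q > 0"
  shows "equivf Q (form_of (root_of Q))"
proof -
  have r: "root_of Q \<in> root_pairs D \<nu> n" by (rule root_of_in[OF assms])
  have "root_of Q = root_of (form_of (root_of Q))" using form_of(4)[OF r] by simp
  moreover have "dsc Q = dsc (form_of (root_of Q))" using dsc_rforms assms form_of(1)[OF r] by simp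
  ultimately obtain k where "form_of (root_of Q) = act Q (1, k, 0, 1)" using root_of_eq assms by (metis less_irrefl)
  thus ?thesis unfolding equivf_def by (intro bexI[of _ "(1, k, 0, 1)"]) (auto simp: Gamma0_def)
qed

lemma vecs_exists:
  assumes Q: "Q \<in> rforms" "fst Q > 0" and \<rho>: "\<rho> \<in> root_pairs D \<nu> n" "equivf Q (form_of \<rho>)"
  obtains v where "v \<in> vecs Q" "vroot Q v = \<rho>"
proof -
  obtain g where g: "g \<in> Gamma0 n" "form_of \<rho> = act Q g" using \<rho>(2) unfolding equivf_def by blast
  have pos: "xv Q (col g) * ev Q (col g) > 0"
    using form_of(2,3)[OF \<rho>(1)] Q(2) unfolding xv_ev[OF dsc_rforms[OF Q(1)]] fst_act_col[symmetric] g(2)[symmetric] by simp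
  note witness = that
  have *: "thesis" if g': "g' \<in> Gamma0 n" "act Q g' = act Q g" "xv Q (col g') > 0" for g'
  proof (rule witness)
    have "xv Q (col g') * ev Q (col g') > 0"
      using form_of(2,3)[OF \<rho>(1)] Q(2) unfolding xv_ev[OF dsc_rforms[OF Q(1)]] fst_act_col[symmetric] g'(2) g(2)[symmetric] by simp
    hence "ev Q (col g') > 0" using g'(3) by (simp add: zero_less_mult_iff)
    thus "col g' \<in> vecs Q" using coprime_col[OF g'(1)] g'(3) unfolding vecs_def by simp
    show "vroot Q (col g') = \<rho>" using vroot_col[OF g'(1), of Q] g'(2) g(2) form_of(4)[OF \<rho>(1)] by simp
  qed
  show ?thesis
  proof (cases "xv Q (col g) > 0")
    case True thus ?thesis using *[OF g(1)] by simp
  next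
    case False
    have "xv Q (col (mneg g)) = - xv Q (col g)" unfolding xv_def xi_def mneg(3) by simp
    moreover have "xv Q (col g) \<noteq> 0" using pos by auto
    ultimately show ?thesis using *[OF mneg(2)[OF g(1)] mneg(1)] False by simp
  qed
qed

lemma prim_points_sector:
  assumes "dsc Q = D" "fst Q > 0" "M > 0"
  shows "prim_points n (sqrt M) (sector Q E) =
    {v \<in> vecs Q. ev Q v \<le> xv Q v \<and> xv Q v < exp (2 * E) * ev Q v \<and> real_of_int (qf Q (fst v) (snd v)) \<le> M}"
proof -
  define X where "X = sqrt M"
  have X: "X > 0" "X * X = M" unfolding X_def using assms(3) by auto
  have "v \<in> scaled_points X (sector Q E) \<longleftrightarrow> xv Q v > 0 \<and> ev Q v > 0 \<and> ev Q v \<le> xv Q v \<and> xv Q v < exp (2 * E) * ev Q v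
      \<and> real_of_int (qf Q (fst v) (snd v)) \<le> M" for v
  proof -
    have "xv Q v / X * (ev Q v / X) \<le> fst Q \<longleftrightarrow> xv Q v * ev Q v \<le> fst Q * M"
      using X assms(3) by (simp add: pos_divide_le_eq)
    also have "\<dots> \<longleftrightarrow> real_of_int (qf Q (fst v) (snd v)) \<le> M"
      unfolding xv_ev[OF assms(1)] using assms(2) by simp
    finally show ?thesis using X unfolding scaled_points_def sector_def
      by (simp add: xi_scale xv_def[symmetric] ev_def[symmetric] divide_le_cancel divide_less_cancel zero_less_divide_iff)
  qed
  thus ?thesis unfolding prim_points_def vecs_def X_def by blast
qed

text \<open>Every root of the class is reached from the same number \<open>\<kappa>\<close> of
  vectors in the sector, the number of elements of \<open>aut Q\<close> in a window of length
  \<open>E\<close>.\<close>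

lemma class_count:
  assumes Q: "Q \<in> rforms" "fst Q > 0" and E: "E > 0" "E \<in> aut Q"
  obtains \<kappa> :: nat where "\<kappa> > 0"
    "\<And>M. M > 0 \<Longrightarrow> card {\<rho> \<in> root_pairs D \<nu> n. equivf Q (form_of \<rho>) \<and> real_of_int (fst \<rho>) \<le> M} * \<kappa>
        = card (prim_points n (sqrt M) (sector Q E))"
proof -
  note dQ = dsc_rforms[OF Q(1)]
  have bd: "bounded (sector Q E)" using sector_region[OF Q(2) E(1)] by auto
  define Fib where "Fib v0 = {v \<in> vecs Q. vroot Q v = vroot Q v0 \<and> ev Q v \<le> xv Q v \<and> xv Q v < exp (2 * E) * ev Q v}" for v0
  \<comment> \<open>In terms of the logarithm \<open>z\<close> of the automorph taking
    \<open>v0\<close> to \<open>v\<close>, the sector condition says that \<open>z\<close> lies in a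
    half-open window of length \<open>E\<close> whose left end depends on \<open>v0\<close>.\<close>
  have fibre: "bij_betw (\<lambda>v. ln (xv Q v / xv Q v0)) (Fib v0)
      (aut Q \<inter> {(ln (ev Q v0) - ln (xv Q v0)) / 2..<(ln (ev Q v0) - ln (xv Q v0)) / 2 + E})" if v0: "v0 \<in> vecs Q" for v0
  proof -
    define x0 where "x0 = (ln (ev Q v0) - ln (xv Q v0)) / 2"
    have pos: "xv Q v0 > 0" "ev Q v0 > 0" using v0 unfolding vecs_def by auto
    have cond: "ev Q v \<le> xv Q v \<and> xv Q v < exp (2 * E) * ev Q v \<longleftrightarrow> z \<in> {x0..<x0 + E}"
      if "xv Q v = exp z * xv Q v0" "ev Q v = ev Q v0 / exp z" for v z
    proof -
      have xp: "xv Q v > 0" "ev Q v > 0" "exp (2 * E) * ev Q v > 0" using that pos by auto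
      have l: "ln (xv Q v) = z + ln (xv Q v0)" "ln (ev Q v) = ln (ev Q v0) - z"
        "ln (exp (2 * E) * ev Q v) = 2 * E + (ln (ev Q v0) - z)"
        unfolding that using pos by (auto simp: ln_mult ln_div)
      have "ev Q v \<le> xv Q v \<longleftrightarrow> ln (ev Q v) \<le> ln (xv Q v)" "xv Q v < exp (2 * E) * ev Q v \<longleftrightarrow> ln (xv Q v) < ln (exp (2 * E) * ev Q v)"
        using xp by auto
      moreover have "z \<in> {x0..<x0 + E} \<longleftrightarrow> ln (ev Q v0) - z \<le> z + ln (xv Q v0) \<and> z + ln (xv Q v0) < 2 * E + (ln (ev Q v0) - z)"
        unfolding x0_def by (auto simp: field_simps)
      ultimately show ?thesis unfolding l by blast
    qed
    have mem: "v \<in> Fib v0 \<longleftrightarrow> (\<exists>z\<in>aut Q \<inter> {x0..<x0 + E}. xv Q v = exp z * xv Q v0 \<and> ev Q v = ev Q v0 / exp z)" for v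
      unfolding Fib_def using vroot_fibre[OF dQ Q(2) v0, of v] cond by blast
    have lnz: "ln (xv Q v / xv Q v0) = z" if "xv Q v = exp z * xv Q v0" for v z using that pos by simp
    show ?thesis unfolding x0_def[symmetric]
    proof (rule bij_betw_imageI)
      show "inj_on (\<lambda>v. ln (xv Q v / xv Q v0)) (Fib v0)"
      proof (rule inj_onI)
        fix v v' assume v: "v \<in> Fib v0" "v' \<in> Fib v0" "ln (xv Q v / xv Q v0) = ln (xv Q v' / xv Q v0)"
        obtain z where z: "xv Q v = exp z * xv Q v0" "ev Q v = ev Q v0 / exp z" using v(1) mem by blast
        obtain z' where z': "xv Q v' = exp z' * xv Q v0" "ev Q v' = ev Q v0 / exp z'" using v(2) mem by blast
        have "z = z'" using v(3) lnz[OF z(1)] lnz[OF z'(1)] by simp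
        thus "v = v'" using z z' Q(2) by (intro xv_ev_inj[of Q]) auto
      qed
      show "(\<lambda>v. ln (xv Q v / xv Q v0)) ` Fib v0 = aut Q \<inter> {x0..<x0 + E}"
      proof (intro equalityI subsetI)
        fix y assume "y \<in> (\<lambda>v. ln (xv Q v / xv Q v0)) ` Fib v0"
        thus "y \<in> aut Q \<inter> {x0..<x0 + E}" using mem lnz by auto
      next
        fix z assume z: "z \<in> aut Q \<inter> {x0..<x0 + E}"
        obtain \<sigma> where s: "\<And>v. xv Q (app \<sigma> v) = exp z * xv Q v" "\<And>v. ev Q (app \<sigma> v) = ev Q v / exp z"
          using z unfolding aut_def by blast
        have "app \<sigma> v0 \<in> Fib v0" using mem s z by blast
        thus "z \<in> (\<lambda>v. ln (xv Q v / xv Q v0)) ` Fib v0" using lnz[OF s(1)] by (metis image_eqI)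
      qed
    qed
  qed
  have fst_eq: "real_of_int (qf Q (fst v) (snd v)) = fst (vroot Q v)" if "v \<in> vecs Q" for v
    using fst_vroot[OF that] by simp
  have finFib: "finite (Fib v0)" if "v0 \<in> vecs Q" for v0
  proof (rule finite_subset)
    have pos: "real_of_int (fst (vroot Q v0)) > 0" using qf_pos_vecs[OF dQ Q(2) that] fst_vroot[OF that] by simp
    show "Fib v0 \<subseteq> prim_points n (sqrt (fst (vroot Q v0))) (sector Q E)"
      unfolding prim_points_sector[OF dQ Q(2) pos] Fib_def using fst_eq by auto
    show "finite (prim_points n (sqrt (fst (vroot Q v0))) (sector Q E))"
      by (rule finite_prim_points[OF _ bd]) (use pos in simp)
  qed
  have per: "z + E \<in> aut Q" "z - E \<in> aut Q" if "z \<in> aut Q" for z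
    using aut_add[OF that E(2)] aut_add[OF that aut_minus[OF E(2)]] by auto
  obtain v1 where v1: "v1 \<in> vecs Q" using vecs_exists[OF Q root_of_in[OF Q] equivf_root_of[OF Q]] by blast
  have fin0: "finite (aut Q \<inter> {y..<y + E})" for y
    using periodic_card_le(2)[OF E(1) per] bij_betw_finite[OF fibre[OF v1]] finFib[OF v1] by blast
  define \<kappa> where "\<kappa> = card (aut Q \<inter> {0..<0 + E})"
  have "0 \<in> aut Q \<inter> {0..<0 + E}" using aut_zero E by simp
  hence \<kappa>0: "\<kappa> > 0" unfolding \<kappa>_def using fin0[of 0] card_gt_0_iff by blast
  \<comment> \<open>By periodicity all windows contain equally many elements of
    \<open>aut Q\<close>, so all fibres have the same size.\<close>
  have cF: "card (Fib v0) = \<kappa>" if "v0 \<in> vecs Q" for v0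
    unfolding \<kappa>_def bij_betw_same_card[OF fibre[OF that]]
    by (intro antisym periodic_card_le(1) E(1) per fin0)
  have "card {\<rho> \<in> root_pairs D \<nu> n. equivf Q (form_of \<rho>) \<and> real_of_int (fst \<rho>) \<le> M} * \<kappa>
        = card (prim_points n (sqrt M) (sector Q E))" if M: "M > 0" for M
  proof -
    define A where "A = {\<rho> \<in> root_pairs D \<nu> n. equivf Q (form_of \<rho>) \<and> real_of_int (fst \<rho>) \<le> M}"
    define P where "P = prim_points n (sqrt M) (sector Q E)"
    have P: "P = {v \<in> vecs Q. ev Q v \<le> xv Q v \<and> xv Q v < exp (2 * E) * ev Q v \<and> real_of_int (qf Q (fst v) (snd v)) \<le> M}"
      unfolding P_def by (rule prim_points_sector[OF dQ Q(2) M])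
    have finP: "finite P" unfolding P_def by (rule finite_prim_points[OF _ bd]) (use M in simp)
    have in_A: "vroot Q v \<in> A" if "v \<in> P" for v
    proof -
      have v: "v \<in> vecs Q" "real_of_int (qf Q (fst v) (snd v)) \<le> M" using that unfolding P by auto
      have c: "comp v \<in> Gamma0 n" "col (comp v) = v" using v(1) comp unfolding vecs_def by auto
      have f: "act Q (comp v) \<in> rforms" "fst (act Q (comp v)) > 0"
        using rforms_act[OF Q(1) c(1)] qf_pos_vecs[OF dQ Q(2) v(1)] unfolding fst_act_col c(2) by auto
      have "equivf Q (act Q (comp v))" unfolding equivf_def using c by blast
      hence "equivf Q (form_of (vroot Q v))" unfolding vroot_def using equivf_root_of[OF f] equivf_trans by blast
      thus ?thesis unfolding A_def using root_of_in[OF f] v fst_eq[OF v(1)] unfolding vroot_def by auto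
    qed
    have "card P = (\<Sum>\<rho>\<in>A. card {v \<in> P. vroot Q v = \<rho>})"
    proof -
      have "P = (\<Union>\<rho>\<in>A. {v \<in> P. vroot Q v = \<rho>})" using in_A by auto
      moreover have "card (\<Union>\<rho>\<in>A. {v \<in> P. vroot Q v = \<rho>}) = (\<Sum>\<rho>\<in>A. card {v \<in> P. vroot Q v = \<rho>})"
      proof (rule card_UN_disjoint)
        show "finite A" by (rule finite_subset[OF _ finite_roots_le[of M]]) (auto simp: A_def)
      qed (use finP in auto)
      ultimately show ?thesis by simp
    qed
    also have "\<dots> = (\<Sum>\<rho>\<in>A. \<kappa>)"
    proof (rule sum.cong[OF refl])
      fix \<rho> assume \<rho>: "\<rho> \<in> A"
      obtain v0 where v0: "v0 \<in> vecs Q" "vroot Q v0 = \<rho>" using vecs_exists[OF Q, of \<rho>] \<rho> unfolding A_def by blast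
      have "{v \<in> P. vroot Q v = \<rho>} = Fib v0" unfolding P Fib_def v0(2) using fst_eq \<rho> unfolding A_def by auto
      thus "card {v \<in> P. vroot Q v = \<rho>} = \<kappa>" using cF[OF v0(1)] by simp
    qed
    finally show ?thesis unfolding A_def P_def by simp
  qed
  thus ?thesis using that \<kappa>0 by blast
qed

lemma class_limit:
  assumes Q: "Q \<in> rforms" "fst Q > 0"
  shows "\<exists>c>0. ((\<lambda>M. card {\<rho> \<in> root_pairs D \<nu> n. equivf Q (form_of \<rho>) \<and> real_of_int (fst \<rho>) \<le> M} / M) \<longlongrightarrow> c) at_top"
proof -
  obtain E where E: "E > 0" "E \<in> aut Q" using aut_period Q by blast
  note R = sector_region[OF Q(2) E(1)]
  obtain \<kappa> :: nat where \<kappa>: "\<kappa> > 0"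
    "\<And>M. M > 0 \<Longrightarrow> card {\<rho> \<in> root_pairs D \<nu> n. equivf Q (form_of \<rho>) \<and> real_of_int (fst \<rho>) \<le> M} * \<kappa>
        = card (prim_points n (sqrt M) (sector Q E))" using class_count[OF Q E] by blast
  have "n > 0" using n1 by simp
  from prim_count[OF this] obtain \<delta> where \<delta>: "\<delta> > 0"
    "((\<lambda>X. card (prim_points n X (sector Q E)) / X\<^sup>2) \<longlongrightarrow> \<delta> * measure lborel (sector Q E)) at_top"
    using R by blast
  have "((\<lambda>M. card (prim_points n (sqrt M) (sector Q E)) / (sqrt M)\<^sup>2 / \<kappa>) \<longlongrightarrow> \<delta> * measure lborel (sector Q E) / \<kappa>) at_top"
    using \<kappa>(1) by (intro tendsto_divide tendsto_const filterlim_compose[OF \<delta>(2) sqrt_at_top]) auto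
  moreover have "\<forall>\<^sub>F M in at_top. card (prim_points n (sqrt M) (sector Q E)) / (sqrt M)\<^sup>2 / \<kappa>
      = card {\<rho> \<in> root_pairs D \<nu> n. equivf Q (form_of \<rho>) \<and> real_of_int (fst \<rho>) \<le> M} / M"
    using eventually_gt_at_top[of 0]
    by eventually_elim (use \<kappa>(1) in \<open>simp add: \<kappa>(2)[symmetric]\<close>)
  ultimately have "((\<lambda>M. card {\<rho> \<in> root_pairs D \<nu> n. equivf Q (form_of \<rho>) \<and> real_of_int (fst \<rho>) \<le> M} / M)
      \<longlongrightarrow> \<delta> * measure lborel (sector Q E) / \<kappa>) at_top" by (rule Lim_transform_eventually)
  thus ?thesis using \<delta>(1) R(4) \<kappa>(1) by (intro exI[of _ "\<delta> * measure lborel (sector Q E) / \<kappa>"]) auto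
qed

lemma root_count:
  assumes "[\<nu>\<^sup>2 = D] (mod n)"
  shows "\<exists>c>0. ((\<lambda>M. card {\<rho> \<in> root_pairs D \<nu> n. real_of_int (fst \<rho>) \<le> M} / M) \<longlongrightarrow> c) at_top"
proof -
  define RP where "RP = root_pairs D \<nu> n"
  define cls where "cls Q = {\<rho> \<in> RP. equivf Q (form_of \<rho>)}" for Q
  define Cl where "Cl = (\<lambda>\<rho>. cls (form_of \<rho>)) ` RP"
  have cls_eq: "cls Q = cls Q'" if "equivf Q Q'" for Q Q'
    unfolding cls_def using that equivf_sym equivf_trans by blast
  have finCl: "finite Cl"
  proof -
    \<comment> \<open>For the number of classes each form is reduced by the matrix chosen for
      itself, hence the parameters \<open>k = 1\<close> and \<open>T = 0\<close>.\<close>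
    obtain F where F: "finite F" "\<forall>a1 h1 c1. a1 > 0 \<longrightarrow> h1 * h1 - a1 * c1 = D \<longrightarrow> (\<exists>g\<in>Gamma0 n. \<forall>a h c.
     h * h - a * c = D \<longrightarrow> a1 \<le> 1 * a \<longrightarrow> a \<le> 1 * a1 \<longrightarrow> \<bar>h * a1 - h1 * a\<bar> \<le> 0 * a \<longrightarrow>
     act (a, h, c) g \<in> F)" using finite_reduction[of 1 0] by blast
    have "Cl \<subseteq> cls ` F"
    proof
      fix C assume "C \<in> Cl"
      then obtain \<rho> where \<rho>: "\<rho> \<in> RP" "C = cls (form_of \<rho>)" unfolding Cl_def by auto
      obtain a h c where Q: "form_of \<rho> = (a, h, c)" by (cases "form_of \<rho>")
      have "a > 0" "h * h - a * c = D" using form_of[of \<rho>] dsc_rforms \<rho>(1) unfolding Q RP_def by auto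
      then obtain g where g: "g \<in> Gamma0 n" "act (a, h, c) g \<in> F" using F(2) by fastforce
      have "C = cls (act (a, h, c) g)" unfolding \<rho>(2) Q by (rule cls_eq) (use g in \<open>auto simp: equivf_def\<close>)
      thus "C \<in> cls ` F" using g(2) by blast
    qed
    thus ?thesis using F(1) finite_surj by blast
  qed
  \<comment> \<open>A root of modulus \<open>n\<close> exists, so there is at least one class and
    the total density is positive.\<close>
  have "(n, \<nu> mod n) \<in> RP"
  proof -
    have "[(\<nu> mod n)\<^sup>2 = \<nu>\<^sup>2] (mod n)" by (intro cong_pow) (simp add: cong_def)
    hence "[(\<nu> mod n)\<^sup>2 = D] (mod n)" using assms cong_trans by blast
    thus ?thesis unfolding RP_def root_pairs_def using n1 by (auto simp: cong_def)
  qed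
  hence ne: "Cl \<noteq> {}" unfolding Cl_def by auto
  have lim: "\<exists>c>0. ((\<lambda>M. card {\<rho> \<in> C. real_of_int (fst \<rho>) \<le> M} / M) \<longlongrightarrow> c) at_top" if C: "C \<in> Cl" for C
  proof -
    obtain \<rho> where \<rho>: "\<rho> \<in> RP" "C = cls (form_of \<rho>)" using C unfolding Cl_def by auto
    have "{\<rho> \<in> C. real_of_int (fst \<rho>) \<le> M} = {\<rho>' \<in> root_pairs D \<nu> n. equivf (form_of \<rho>) (form_of \<rho>') \<and> real_of_int (fst \<rho>') \<le> M}" for M
      unfolding \<rho>(2) cls_def RP_def by auto
    thus ?thesis using class_limit[of "form_of \<rho>"] form_of[of \<rho>] \<rho>(1) unfolding RP_def by simp
  qed
  hence "\<forall>C\<in>Cl. \<exists>c. c > 0 \<and> ((\<lambda>M. card {\<rho> \<in> C. real_of_int (fst \<rho>) \<le> M} / M) \<longlongrightarrow> c) at_top" by blast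
  from bchoice[OF this] obtain c where
    "\<forall>C\<in>Cl. c C > 0 \<and> ((\<lambda>M. card {\<rho> \<in> C. real_of_int (fst \<rho>) \<le> M} / M) \<longlongrightarrow> c C) at_top" by blast
  hence c: "\<And>C. C \<in> Cl \<Longrightarrow> c C > 0"
    "\<And>C. C \<in> Cl \<Longrightarrow> ((\<lambda>M. card {\<rho> \<in> C. real_of_int (fst \<rho>) \<le> M} / M) \<longlongrightarrow> c C) at_top" by auto
  have "card {\<rho> \<in> RP. real_of_int (fst \<rho>) \<le> M} = (\<Sum>C\<in>Cl. card {\<rho> \<in> C. real_of_int (fst \<rho>) \<le> M})" for M
  proof -
    have sub: "C \<subseteq> RP" if "C \<in> Cl" for C using that unfolding Cl_def cls_def by auto
    have "{\<rho> \<in> RP. real_of_int (fst \<rho>) \<le> M} = (\<Union>C\<in>Cl. {\<rho> \<in> C. real_of_int (fst \<rho>) \<le> M})"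
    proof -
      have "\<rho> \<in> cls (form_of \<rho>)" if "\<rho> \<in> RP" for \<rho> using that equivf_refl unfolding cls_def by auto
      thus ?thesis using sub unfolding Cl_def by blast
    qed
    moreover have "card (\<Union>C\<in>Cl. {\<rho> \<in> C. real_of_int (fst \<rho>) \<le> M}) = (\<Sum>C\<in>Cl. card {\<rho> \<in> C. real_of_int (fst \<rho>) \<le> M})"
    proof (rule card_UN_disjoint[OF finCl])
      show "\<forall>C\<in>Cl. finite {\<rho> \<in> C. real_of_int (fst \<rho>) \<le> M}"
        using finite_roots_le[of M] sub unfolding RP_def by (auto intro: finite_subset[rotated])
      show "\<forall>C\<in>Cl. \<forall>C'\<in>Cl. C \<noteq> C' \<longrightarrow> {\<rho> \<in> C. real_of_int (fst \<rho>) \<le> M} \<inter> {\<rho> \<in> C'. real_of_int (fst \<rho>) \<le> M} = {}"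
      proof (intro ballI impI)
        fix C C' assume CC: "C \<in> Cl" "C' \<in> Cl" "C \<noteq> C'"
        obtain \<rho>1 \<rho>2 where e: "C = cls (form_of \<rho>1)" "C' = cls (form_of \<rho>2)" using CC unfolding Cl_def by auto
        have False if "\<rho> \<in> C" "\<rho> \<in> C'" for \<rho>
        proof -
          have "equivf (form_of \<rho>1) (form_of \<rho>2)"
            using that equivf_sym equivf_trans unfolding e cls_def by blast
          thus False using CC(3) cls_eq unfolding e by blast
        qed
        thus "{\<rho> \<in> C. real_of_int (fst \<rho>) \<le> M} \<inter> {\<rho> \<in> C'. real_of_int (fst \<rho>) \<le> M} = {}" by blast
      qed
    qed
    ultimately show ?thesis by simp
  qed
  hence eq: "card {\<rho> \<in> RP. real_of_int (fst \<rho>) \<le> M} / M = (\<Sum>C\<in>Cl. card {\<rho> \<in> C. real_of_int (fst \<rho>) \<le> M} / M)" for M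
    by (simp add: sum_divide_distrib)
  have "((\<lambda>M. card {\<rho> \<in> RP. real_of_int (fst \<rho>) \<le> M} / M) \<longlongrightarrow> (\<Sum>C\<in>Cl. c C)) at_top"
    unfolding eq by (intro tendsto_sum c(2))
  moreover have "(\<Sum>C\<in>Cl. c C) > 0" using c(1) finCl ne by (intro sum_pos) auto
  ultimately show ?thesis unfolding RP_def by blast
qed

end

subsection \<open>The area of the region of a pair\<close>

text \<open>The substitution \<open>t = j / (\<kappa> * v\<^sup>2)\<close> on a ray, under which
  \<open>\<kappa> * v\<^sup>2 \<le> 1\<close> becomes \<open>j \<le> t\<close>. Both integrals are
  evaluated by antiderivatives.\<close>

lemma nn_integral_scaled_linear:
  fixes \<kappa> j \<alpha> \<beta> :: real
  assumes \<kappa>: "\<kappa> > 0" and j: "j > 0" and \<alpha>: "0 \<le> \<alpha>"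
  shows "(\<integral>\<^sup>+v. (if v > 0 \<and> \<kappa> * (v * v) \<le> 1 \<and> \<alpha> * (\<kappa> * (v * v)) \<le> j \<and> j \<le> \<beta> * (\<kappa> * (v * v)) then ennreal v else 0) \<partial>lborel)
    = (\<integral>\<^sup>+t. (if \<alpha> \<le> t \<and> t \<le> \<beta> \<and> j \<le> t then ennreal (1 / (2 * \<kappa>) * (j / (t * t))) else 0) \<partial>lborel)"
proof -
  \<comment> \<open>\<open>\<alpha>'\<close> merges the two lower bounds
    \<open>\<alpha> \<le> t\<close> and \<open>j \<le> t\<close>.\<close>
  define \<alpha>' where "\<alpha>' = max \<alpha> j"
  have \<alpha>': "\<alpha>' > 0" "\<alpha> \<le> \<alpha>'" "j \<le> \<alpha>'" unfolding \<alpha>'_def using j by auto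
  have lo: "\<kappa> * (v * v) \<le> 1 \<and> \<alpha> * (\<kappa> * (v * v)) \<le> j \<longleftrightarrow> \<alpha>' * (\<kappa> * (v * v)) \<le> j" for v
  proof -
    have "j * (\<kappa> * (v * v)) \<le> j \<longleftrightarrow> \<kappa> * (v * v) \<le> 1" using j by simp
    thus ?thesis unfolding \<alpha>'_def by (auto simp: max_def) (smt (verit) \<kappa> mult_right_mono zero_le_square mult_nonneg_nonneg)+
  qed
  show ?thesis
  proof (cases "\<alpha>' \<le> \<beta>")
    case False
    have "\<not> (v > 0 \<and> \<kappa> * (v * v) \<le> 1 \<and> \<alpha> * (\<kappa> * (v * v)) \<le> j \<and> j \<le> \<beta> * (\<kappa> * (v * v)))" for v
    proof
      assume h: "v > 0 \<and> \<kappa> * (v * v) \<le> 1 \<and> \<alpha> * (\<kappa> * (v * v)) \<le> j \<and> j \<le> \<beta> * (\<kappa> * (v * v))"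
      have "\<alpha>' * (\<kappa> * (v * v)) \<le> \<beta> * (\<kappa> * (v * v))" using h lo[of v] by linarith
      moreover have "\<kappa> * (v * v) > 0" using h \<kappa> by simp
      hence "\<beta> * (\<kappa> * (v * v)) < \<alpha>' * (\<kappa> * (v * v))" using False by (intro mult_strict_right_mono) auto
      ultimately show False by linarith
    qed
    hence e1: "(v > 0 \<and> \<kappa> * (v * v) \<le> 1 \<and> \<alpha> * (\<kappa> * (v * v)) \<le> j \<and> j \<le> \<beta> * (\<kappa> * (v * v))) = False" for v by blast
    have e2: "(\<alpha> \<le> t \<and> t \<le> \<beta> \<and> j \<le> t) = False" for t using False unfolding \<alpha>'_def by auto
    show ?thesis unfolding e1 e2 if_False ..
  next
    case True
    define x1 x2 where "x1 = sqrt (j / (\<beta> * \<kappa>))" and "x2 = sqrt (j / (\<alpha>' * \<kappa>))"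
    have \<beta>: "\<beta> > 0" using True \<alpha>' by linarith
    have x1: "x1 > 0" "x1 * x1 = j / (\<beta> * \<kappa>)" unfolding x1_def using j \<beta> \<kappa> by auto
    have x2: "x2 > 0" "x2 * x2 = j / (\<alpha>' * \<kappa>)" unfolding x2_def using j \<alpha>' \<kappa> by auto
    have x12: "x1 \<le> x2" unfolding x1_def x2_def
      using True j \<kappa> \<alpha>' \<beta> by (intro real_sqrt_le_mono divide_left_mono mult_right_mono) auto
    have c1: "j \<le> \<beta> * (\<kappa> * (v * v)) \<longleftrightarrow> x1 \<le> v" if "v > 0" for v
    proof -
      have "x1 \<le> v \<longleftrightarrow> x1 * x1 \<le> v * v" using x1(1) that by (metis abs_le_square_iff abs_of_pos power2_eq_square)
      also have "\<dots> \<longleftrightarrow> j \<le> \<beta> * (\<kappa> * (v * v))" unfolding x1(2) using \<beta> \<kappa> by (simp add: pos_divide_le_eq algebra_simps)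
      finally show ?thesis by simp
    qed
    have c2: "\<alpha>' * (\<kappa> * (v * v)) \<le> j \<longleftrightarrow> v \<le> x2" if "v > 0" for v
    proof -
      have "v \<le> x2 \<longleftrightarrow> v * v \<le> x2 * x2" using x2(1) that by (metis abs_le_square_iff abs_of_pos power2_eq_square)
      also have "\<dots> \<longleftrightarrow> \<alpha>' * (\<kappa> * (v * v)) \<le> j" unfolding x2(2) using \<alpha>' \<kappa> by (simp add: pos_le_divide_eq algebra_simps)
      finally show ?thesis by simp
    qed
    have set: "v > 0 \<and> \<kappa> * (v * v) \<le> 1 \<and> \<alpha> * (\<kappa> * (v * v)) \<le> j \<and> j \<le> \<beta> * (\<kappa> * (v * v)) \<longleftrightarrow> v \<in> {x1..x2}" for v
    proof (cases "v > 0")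
      case True
      have "v > 0 \<and> \<kappa> * (v * v) \<le> 1 \<and> \<alpha> * (\<kappa> * (v * v)) \<le> j \<and> j \<le> \<beta> * (\<kappa> * (v * v)) \<longleftrightarrow> v > 0 \<and> \<alpha>' * (\<kappa> * (v * v)) \<le> j \<and> j \<le> \<beta> * (\<kappa> * (v * v))"
        using lo[of v] by blast
      also have "\<dots> \<longleftrightarrow> v \<in> {x1..x2}" using c1[OF True] c2[OF True] True by auto
      finally show ?thesis .
    next
      case False thus ?thesis using x1 by auto
    qed
    have "(\<integral>\<^sup>+v. (if v > 0 \<and> \<kappa> * (v * v) \<le> 1 \<and> \<alpha> * (\<kappa> * (v * v)) \<le> j \<and> j \<le> \<beta> * (\<kappa> * (v * v)) then ennreal v else 0) \<partial>lborel)
       = (\<integral>\<^sup>+v. ennreal v * indicator {x1..x2} v \<partial>lborel)"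
      unfolding set by (intro nn_integral_cong) (auto simp: indicator_def)
    also have "\<dots> = ennreal (x2 * x2 / 2 - x1 * x1 / 2)"
      by (rule nn_integral_FTC_Icc[where F = "\<lambda>v. v * v / 2"]) (use x1 x12 in \<open>auto intro!: derivative_eq_intros\<close>)
    also have "x2 * x2 / 2 - x1 * x1 / 2 = - (1 / (2 * \<kappa>) * (j / \<beta>)) - - (1 / (2 * \<kappa>) * (j / \<alpha>'))"
      unfolding x1(2) x2(2) by (simp add: field_simps)
    also have "ennreal \<dots> = (\<integral>\<^sup>+t. ennreal (1 / (2 * \<kappa>) * (j / (t * t))) * indicator {\<alpha>'..\<beta>} t \<partial>lborel)"
      by (rule nn_integral_FTC_Icc[where F = "\<lambda>t. - (1 / (2 * \<kappa>) * (j / t))", symmetric])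
         (use True \<alpha>' \<kappa> j in \<open>auto intro!: derivative_eq_intros\<close>)
    also have "\<dots> = (\<integral>\<^sup>+t. (if \<alpha> \<le> t \<and> t \<le> \<beta> \<and> j \<le> t then ennreal (1 / (2 * \<kappa>) * (j / (t * t))) else 0) \<partial>lborel)"
      unfolding \<alpha>'_def by (intro nn_integral_cong) (auto simp: indicator_def)
    finally show ?thesis .
  qed
qed

text \<open>The map has determinant \<open>- 2 * s * a\<close>. It is treated as two one-dimensional
  affine substitutions with Fubini between them: the second coordinate is \<open>u - 2 s y\<close>,
  and then \<open>u = (h + s) y + a x\<close>.\<close>

lemma linear_area:
  fixes S :: "(real \<times> real) set" and a h s :: real
  assumes S: "S \<in> sets borel" and a: "a > 0" and s: "s > 0"
  shows "emeasure lborel S = ennreal (2 * s * a) * emeasure lborel {z. (a * fst z + (h + s) * snd z, a * fst z + (h - s) * snd z) \<in> S}"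
proof -
  define T where "T = {z :: real \<times> real. (a * fst z + (h + s) * snd z, a * fst z + (h - s) * snd z) \<in> S}"
  have Sm[measurable]: "S \<in> sets (borel \<Otimes>\<^sub>M borel)" using S unfolding borel_prod .
  have "(\<lambda>z. (a * fst z + (h + s) * snd z, a * fst z + (h - s) * snd z)) \<in> borel_measurable (borel :: (real \<times> real) measure)"
    by (intro borel_measurable_continuous_onI continuous_intros)
  from measurable_sets[OF this S] have T: "T \<in> sets borel" unfolding T_def by (simp add: vimage_def)
  have Tm[measurable]: "T \<in> sets (borel \<Otimes>\<^sub>M borel)" using T unfolding borel_prod .
  have 1: "emeasure lborel T = (\<integral>\<^sup>+y. \<integral>\<^sup>+x. indicator T (x, y) \<partial>lborel \<partial>lborel)"
    by (subst lborel_pair.nn_integral_snd) (auto simp: lborel_prod T intro!: borel_measurable_indicator)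
  have 2: "emeasure lborel S = (\<integral>\<^sup>+u. \<integral>\<^sup>+v. indicator S (u, v) \<partial>lborel \<partial>lborel)"
    by (subst lborel.nn_integral_fst) (auto simp: lborel_prod S intro!: borel_measurable_indicator)
  have "(\<integral>\<^sup>+u. \<integral>\<^sup>+v. indicator S (u, v) \<partial>lborel \<partial>lborel) = (\<integral>\<^sup>+u. ennreal (2 * s) * (\<integral>\<^sup>+y. indicator S (u, u + (- (2 * s)) * y) \<partial>lborel) \<partial>lborel)"
    using s by (intro nn_integral_cong) (subst nn_integral_real_affine[of _ "- (2 * s)"], auto)
  also have "\<dots> = ennreal (2 * s) * (\<integral>\<^sup>+u. \<integral>\<^sup>+y. indicator S (u, u + (- (2 * s)) * y) \<partial>lborel \<partial>lborel)"
    by (rule nn_integral_cmult) measurable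
  also have "(\<integral>\<^sup>+u. \<integral>\<^sup>+y. indicator S (u, u + (- (2 * s)) * y) \<partial>lborel \<partial>lborel) = (\<integral>\<^sup>+y. \<integral>\<^sup>+u. indicator S (u, u + (- (2 * s)) * y) \<partial>lborel \<partial>lborel)"
    by (rule lborel_pair.Fubini'[symmetric]) measurable
  also have "\<dots> = (\<integral>\<^sup>+y. ennreal a * (\<integral>\<^sup>+x. indicator T (x, y) \<partial>lborel) \<partial>lborel)"
  proof (rule nn_integral_cong)
    fix y :: real
    have eq: "indicator S ((h + s) * y + a * x, ((h + s) * y + a * x) + (- (2 * s)) * y) = (indicator T (x, y) :: ennreal)" for x
      unfolding T_def by (simp add: indicator_def algebra_simps)
    have "(\<integral>\<^sup>+u. indicator S (u, u + (- (2 * s)) * y) \<partial>lborel)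
      = ennreal \<bar>a\<bar> * (\<integral>\<^sup>+x. indicator S ((h + s) * y + a * x, ((h + s) * y + a * x) + (- (2 * s)) * y) \<partial>lborel)"
      by (rule nn_integral_real_affine) (use a in auto)
    thus "(\<integral>\<^sup>+u. indicator S (u, u + (- (2 * s)) * y) \<partial>lborel) = ennreal a * (\<integral>\<^sup>+x. indicator T (x, y) \<partial>lborel)"
      unfolding eq using a by simp
  qed
  also have "\<dots> = ennreal a * emeasure lborel T" unfolding 1 by (rule nn_integral_cmult) measurable
  finally have "emeasure lborel S = ennreal (2 * s) * (ennreal a * emeasure lborel T)" unfolding 2 .
  also have "\<dots> = ennreal (2 * s * a) * emeasure lborel T"
    using a s ennreal_mult[of "2 * s" a] by (simp only: mult.assoc[symmetric])
  finally show ?thesis unfolding T_def .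
qed

text \<open>\<open>A u\<^sup>2 + 2 B u v + C v\<^sup>2\<close> is \<open>2 * s * a\<close> times the
  second form in the isotropic coordinates \<open>u\<close>, \<open>v\<close> of the first;
  \<open>s\<close> stands for sqrt D and \<open>a\<close> for the leading coefficient of the first
  form. The relation for \<open>A * C\<close> expresses that both forms have discriminant
  \<open>D\<close>.\<close>

locale pair_area =
  fixes s a A B C :: real
  assumes s0: "s > 0" and a0: "a > 0" and AC: "A * C = B * B - s * s" and AC0: "A * C \<noteq> 0"
begin

text \<open>On the ray \<open>u = l v\<close> in the isotropic coordinates of \<open>Q\<^sub>1\<close>, the quotient \<open>Q\<^sub>2 / Q\<^sub>1\<close> equals \<open>g l / s\<close> and
  \<open>K / Q\<^sub>1\<close> equals \<open>j l\<close>.\<close>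

definition g where "g l = B + (A * l + C / l) / 2" for l :: real
definition j where "j l = (A * l - C / l) / 2" for l :: real
text \<open>\<open>mm\<close> is the lower bound for \<open>g\<close> that results from
  \<open>s \<le> g\<close> and from the hyperbola \<open>(g - B)\<^sup>2 - j\<^sup>2 = A * C\<close>
  on its branch \<open>g > B\<close>; \<open>GG t\<close> is the value of \<open>g\<close> on this
  branch where \<open>j = t\<close>. As \<open>g\<close> has derivative \<open>j l / l\<close>, the
  integral of \<open>j / (l * g)\<close> between these values is \<open>LL t\<close>, cut off at
  0.\<close>

definition mm where "mm = max s (B + sqrt (max 0 (A * C)))"
definition GG where "GG t = B + sqrt (max 0 (t * t + A * C))" for t :: real
definition LL where "LL t = ln (max (GG t) mm) - ln mm" for t :: real

lemma mm0: "mm \<ge> s" "mm > 0" "mm - B > 0" "A * C \<le> (mm - B) * (mm - B)" "sqrt (max 0 (A * C)) \<le> mm - B"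
proof -
  show "mm \<ge> s" unfolding mm_def by simp
  thus "mm > 0" using s0 by simp
  show le: "sqrt (max 0 (A * C)) \<le> mm - B" unfolding mm_def by simp
  have "0 \<le> sqrt (max 0 (A * C))" by simp
  hence "sqrt (max 0 (A * C)) * sqrt (max 0 (A * C)) \<le> (mm - B) * (mm - B)" using le by (intro mult_mono) linarith+
  thus "A * C \<le> (mm - B) * (mm - B)" by simp
  show "mm - B > 0"
  proof (cases "A * C > 0")
    case True thus ?thesis using le by (smt (verit) real_sqrt_gt_zero)
  next
    case False
    hence "B * B < s * s" using AC AC0 by linarith
    hence "B < s" using s0 by (metis abs_less_iff abs_of_pos power2_eq_square power2_less_imp_less abs_le_square_iff not_less real_sqrt_abs2 real_sqrt_less_iff)
    thus ?thesis using \<open>mm \<ge> s\<close> by linarith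
  qed
qed

lemma gj: "l > 0 \<Longrightarrow> (g l - B) * (g l - B) - j l * j l = A * C" "l > 0 \<Longrightarrow> (g l - B) + j l = A * l"
proof -
  assume l: "l > 0"
  have "(g l - B) * (g l - B) - j l * j l = (A * l) * (C / l)" unfolding g_def j_def by (simp add: field_simps)
  thus "(g l - B) * (g l - B) - j l * j l = A * C" using l by simp
  show "(g l - B) + j l = A * l" unfolding g_def j_def by (simp add: field_simps)
qed

text \<open>For \<open>C > 0\<close> both terms make \<open>j\<close> negative. For
  \<open>C < 0\<close> the number \<open>z = g - B\<close> is negative with
  \<open>z\<^sup>2 > B\<^sup>2 - s\<^sup>2\<close>, while \<open>s \<le> g\<close> gives
  \<open>|z| \<le> B - s\<close>; together they force \<open>B < s\<close>, against
  \<open>s \<le> g < B\<close>.\<close>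

lemma lambda_set_empty:
  assumes "A < 0" "l > 0" "s \<le> g l" "0 < j l"
  shows False
proof (cases "C > 0")
  case True
  have "A * l < 0" "C / l > 0" using assms True by (auto simp: mult_neg_pos)
  thus False using assms(4) unfolding j_def by simp
next
  case False
  hence C: "C < 0" using AC0 by (metis linorder_neqE_linordered_idom mult_zero_right)
  define z where "z = g l - B"
  have "A * l < 0" "C / l < 0" using assms C by (auto simp: mult_neg_pos divide_neg_pos)
  hence z: "z < 0" unfolding z_def g_def by simp
  have "z * z = j l * j l + A * C" using gj(1)[OF assms(2)] unfolding z_def by simp
  moreover have "j l * j l > 0" using assms(4) by simp
  ultimately have "z * z > B * B - s * s" using AC by linarith
  moreover have "(- z) * (- z) \<le> (B - s) * (B - s)" using assms(3) z unfolding z_def by (intro mult_mono) auto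
  ultimately have "s * (B - s) < 0" by (simp add: algebra_simps)
  hence "B < s" using s0 by (simp add: mult_less_0_iff)
  thus False using assms(3) z unfolding z_def by linarith
qed

text \<open>The integrand is the derivative of \<open>ln (g l)\<close>. For \<open>A > 0\<close> the
  set of integration is, up to finitely many points, an interval on which \<open>g\<close> increases
  from \<open>mm\<close> to \<open>GG t\<close>, or it is empty.\<close>

lemma lambda_integral:
  assumes t: "t > 0"
  shows "(\<integral>\<^sup>+l. (if l > 0 \<and> s \<le> g l \<and> 0 < j l \<and> j l \<le> t then ennreal (j l / (l * g l)) else 0) \<partial>lborel)
     = ennreal (if A > 0 then LL t else 0)"
proof (cases "A > 0")
  case False
  hence "A < 0" using AC0 by (metis linorder_neqE_linordered_idom mult_zero_left)
  hence e: "(l > 0 \<and> s \<le> g l \<and> 0 < j l \<and> j l \<le> t) = False" for l using lambda_set_empty by blast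
  show ?thesis unfolding e if_False using False by simp
next
  case A: True
  define z1 where "z1 = mm - B"
  have z1: "z1 > 0" "A * C \<le> z1 * z1" "sqrt (max 0 (A * C)) \<le> z1" using mm0 unfolding z1_def by auto
  have inS: "z1 \<le> g l - B \<and> g l \<le> GG t" if S: "l > 0" "s \<le> g l" "0 < j l" "j l \<le> t" for l
  proof
    define z where "z = g l - B"
    have z2: "z * z = j l * j l + A * C" using gj(1)[OF S(1)] unfolding z_def by simp
    have zpos: "z > 0"
    proof (cases "C > 0")
      case True
      have "A * l > 0" "C / l > 0" using A True S by auto
      thus ?thesis unfolding z_def g_def by simp
    next
      case False
      hence "A * C < 0" using A AC0 by (metis linorder_neqE_linordered_idom mult_zero_right zero_less_mult_pos mult_pos_neg)
      hence "B * B < s * s" using AC by linarith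
      hence "B < s" using s0 by (meson abs_ge_self abs_less_iff mult_mono not_less order.strict_trans1 less_imp_le)
      thus ?thesis using S(2) unfolding z_def by linarith
    qed
    have "A * C \<le> z * z" using z2 by simp
    hence "sqrt (max 0 (A * C)) \<le> z" using zpos by (intro real_le_lsqrt) (auto simp: power2_eq_square)
    thus "z1 \<le> g l - B" using S(2) unfolding z1_def mm_def z_def by simp
    have "j l * j l \<le> t * t" using S by (intro mult_mono) auto
    hence "z * z \<le> max 0 (t * t + A * C)" using z2 by linarith
    hence "z \<le> sqrt (max 0 (t * t + A * C))" by (intro real_le_rsqrt) (simp add: power2_eq_square)
    thus "g l \<le> GG t" unfolding GG_def z_def by simp
  qed
  show ?thesis
  proof (cases "GG t < mm")
    case True
    hence e: "(l > 0 \<and> s \<le> g l \<and> 0 < j l \<and> j l \<le> t) = False" for l using inS[of l] unfolding z1_def by force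
    have "LL t = 0" unfolding LL_def using True by simp
    thus ?thesis unfolding e if_False by simp
  next
    case G: False
    define z2 where "z2 = GG t - B"
    have z12: "z1 \<le> z2" unfolding z1_def z2_def using G by simp
    \<comment> \<open>\<open>Lam\<close> inverts \<open>g - B\<close> on the branch
      \<open>j \<ge> 0\<close>, where \<open>A l = (g - B) + j\<close> and
      \<open>j = sqrt ((g - B)\<^sup>2 - A C)\<close>.\<close>
    define Lam where "Lam z = (z + sqrt (z * z - A * C)) / A" for z
    have mono: "Lam z \<le> Lam z'" if "z1 \<le> z" "z \<le> z'" for z z'
    proof -
      have "z * z \<le> z' * z'" using that z1 by (intro mult_mono) auto
      thus ?thesis unfolding Lam_def using A that by (intro divide_right_mono add_mono real_sqrt_le_mono) auto
    qed
    have gLam: "g (Lam z) = B + z" "Lam z > 0" if "z1 \<le> z" for z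
    proof -
      have zz: "A * C \<le> z * z" "z > 0" using that z1 mult_mono[of z1 z z1 z] by linarith+
      define r where "r = sqrt (z * z - A * C)"
      have r: "r \<ge> 0" "r * r = z * z - A * C" unfolding r_def using zz by auto
      have Al: "A * Lam z = z + r" unfolding Lam_def r_def using A by simp
      show pos: "Lam z > 0" using Al zz r A by (metis add_pos_nonneg zero_less_mult_pos)
      have "(A * Lam z) * (z - r) = A * C" unfolding Al using r(2) by (simp add: algebra_simps)
      hence "Lam z * (z - r) = C" using A by (metis mult.assoc mult_left_cancel less_irrefl)
      hence "C / Lam z = z - r" using pos by (simp add: field_simps)
      thus "g (Lam z) = B + z" unfolding g_def Al by simp
    qed
    define l1 l2 where "l1 = Lam z1" and "l2 = Lam z2"
    have l1: "l1 > 0" "g l1 = mm" and l2: "g l2 = GG t" and l12: "l1 \<le> l2"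
      using gLam[of z1] gLam[of z2] mono[of z1 z2] z12 unfolding l1_def l2_def z1_def z2_def by auto
    have Cl1: "C \<le> A * (l1 * l1)"
    proof -
      have "z1 \<le> A * l1" unfolding l1_def Lam_def using A z1 by simp
      hence "z1 * z1 \<le> (A * l1) * (A * l1)" using z1 by (intro mult_mono) auto
      hence "A * C \<le> A * (A * (l1 * l1))" using z1(2) by (simp add: algebra_simps)
      thus ?thesis using A by simp
    qed
    have Cl: "C \<le> A * (l * l')" if "l1 \<le> l" "l1 \<le> l'" for l l'
    proof -
      have "l1 * l1 \<le> l * l'" using that l1 by (intro mult_mono) auto
      thus ?thesis using Cl1 A by (meson less_imp_le mult_left_mono order_trans)
    qed
    have jnn: "j l \<ge> 0" if "l1 \<le> l" for l
      using Cl[OF that that] that l1 unfolding j_def by (simp add: field_simps)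
    have gmono: "g l \<le> g l'" if "l1 \<le> l" "l \<le> l'" for l l'
    proof -
      have pos: "l > 0" "l' > 0" using that l1 by auto
      have "g l' - g l = (l' - l) * (A * (l * l') - C) / (2 * (l * l'))"
        unfolding g_def using pos by (simp add: field_simps)
      moreover have "(l' - l) * (A * (l * l') - C) / (2 * (l * l')) \<ge> 0"
        using that pos Cl[of l l'] by (intro divide_nonneg_nonneg mult_nonneg_nonneg) auto
      ultimately show ?thesis by linarith
    qed
    \<comment> \<open>The zeros of \<open>j\<close> are set aside because the closed interval may
      contain one at its left end; there are finitely many.\<close>
    have iff: "l > 0 \<and> s \<le> g l \<and> 0 < j l \<and> j l \<le> t \<longleftrightarrow> l \<in> {l1..l2}" if "j l \<noteq> 0" for l
    proof
      assume S: "l > 0 \<and> s \<le> g l \<and> 0 < j l \<and> j l \<le> t"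
      define z where "z = g l - B"
      have z: "z1 \<le> z" "z \<le> z2" using inS[of l] S unfolding z_def z2_def by auto
      have "z * z - A * C = j l * j l" using gj(1)[of l] S unfolding z_def by simp
      hence "sqrt (z * z - A * C) = j l" using S by simp
      hence "l = Lam z" unfolding Lam_def using gj(2)[of l] S A unfolding z_def by (simp add: field_simps)
      thus "l \<in> {l1..l2}" unfolding l1_def l2_def using mono z by auto
    next
      assume l: "l \<in> {l1..l2}"
      have "mm \<le> g l" "g l \<le> GG t" using gmono[of l1 l] gmono[of l l2] l l1 l2 by auto
      hence z: "z1 \<le> g l - B" "g l - B \<le> sqrt (max 0 (t * t + A * C))" unfolding z1_def GG_def by auto
      have "(g l - B) * (g l - B) \<le> sqrt (max 0 (t * t + A * C)) * sqrt (max 0 (t * t + A * C))"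
        using z z1 by (intro mult_mono) auto
      hence "(g l - B) * (g l - B) \<le> max 0 (t * t + A * C)" by simp
      moreover have "(g l - B) * (g l - B) > 0" using z z1 by simp
      ultimately have "(g l - B) * (g l - B) \<le> t * t + A * C" by linarith
      hence "j l * j l \<le> t * t" using gj(1)[of l] l l1 by simp
      hence "j l \<le> t" using t by (metis abs_le_square_iff abs_of_pos power2_eq_square abs_ge_self order_trans)
      thus "l > 0 \<and> s \<le> g l \<and> 0 < j l \<and> j l \<le> t" using jnn[of l] that l l1 \<open>mm \<le> g l\<close> mm0(1) by auto
    qed
    have fin: "finite {l. j l = 0}"
    proof (rule finite_subset)
      show "{l. j l = 0} \<subseteq> insert 0 {l. poly [:-C, 0, A:] l = 0}"
        unfolding j_def by (auto simp: field_simps)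
      show "finite (insert 0 {l. poly [:-C, 0, A:] l = 0})" using A poly_roots_finite[of "[:-C, 0, A:]"] by simp
    qed
    have jm[measurable]: "j \<in> borel_measurable borel" "g \<in> borel_measurable borel" unfolding j_def g_def by measurable
    have "(\<integral>\<^sup>+l. (if l > 0 \<and> s \<le> g l \<and> 0 < j l \<and> j l \<le> t then ennreal (j l / (l * g l)) else 0) \<partial>lborel)
        = (\<integral>\<^sup>+l. ennreal (j l / (l * g l)) * indicator {l1..l2} l \<partial>lborel)"
    proof (rule nn_integral_cong_AE)
      have "{l. j l = 0} \<in> null_sets lborel" using fin by (intro finite_imp_null_set_lborel)
      hence "AE l in lborel. j l \<noteq> 0" using AE_not_in by fastforce
      thus "AE l in lborel. (if l > 0 \<and> s \<le> g l \<and> 0 < j l \<and> j l \<le> t then ennreal (j l / (l * g l)) else 0)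
          = ennreal (j l / (l * g l)) * indicator {l1..l2} l"
        by eventually_elim (use iff in \<open>auto simp: indicator_def\<close>)
    qed
    also have "\<dots> = ennreal (ln (g l2) - ln (g l1))"
    proof (rule nn_integral_FTC_Icc[where F = "\<lambda>l. ln (g l)"])
      show "(\<lambda>l. j l / (l * g l)) \<in> borel_measurable borel" by measurable
      fix l assume l: "l \<in> {l1..l2}"
      have pos: "l > 0" "g l > 0" using l l1 gmono[of l1 l] mm0(2) by auto
      have "(g has_real_derivative j l / l) (at l)"
        unfolding g_def j_def using pos by (auto intro!: derivative_eq_intros simp: field_simps)
      from DERIV_chain2[OF DERIV_ln_divide[OF pos(2)] this]
      show "((\<lambda>l. ln (g l)) has_real_derivative j l / (l * g l)) (at l)" by (simp add: field_simps)
      show "0 \<le> j l / (l * g l)" using pos jnn[of l] l by auto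
    qed (rule l12)
    also have "ln (g l2) - ln (g l1) = LL t" unfolding l1 l2 LL_def using G by (simp add: max_def)
    finally show ?thesis using A by simp
  qed
qed

end

context pair_area
begin

text \<open>In the isotropic coordinates of \<open>Q1\<close>, \<open>NN\<close> is
  \<open>2 * s * a * Q2\<close>, \<open>KK\<close> is \<open>K\<close> and \<open>RR\<close> is the
  product \<open>Q1 * Q2\<close>.\<close>

definition NN where "NN u v = A * u * u + 2 * B * u * v + C * v * v" for u v :: real
definition KK where "KK u v = (A * u * u - C * v * v) / (2 * a)" for u v :: real
definition RR where "RR u v = (u * v / a) * (NN u v / (2 * s * a))" for u v :: real

text \<open>The part where \<open>t = K / (Q1 Q2)\<close> is positive; the negative part is obtained
  later by exchanging the two coordinates.\<close>

definition Reg where "Reg \<alpha> \<beta> = {z. fst z > 0 \<and> snd z > 0 \<and> 2 * s * (fst z * snd z) \<le> NN (fst z) (snd z)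
  \<and> NN (fst z) (snd z) \<le> 2 * s * a \<and> 0 < KK (fst z) (snd z)
  \<and> \<alpha> * RR (fst z) (snd z) \<le> KK (fst z) (snd z) \<and> KK (fst z) (snd z) \<le> \<beta> * RR (fst z) (snd z)}" for \<alpha> \<beta> :: real

definition Full where "Full \<alpha> \<beta> = {z. fst z > 0 \<and> snd z > 0 \<and> 2 * s * (fst z * snd z) \<le> NN (fst z) (snd z)
  \<and> NN (fst z) (snd z) \<le> 2 * s * a
  \<and> \<alpha> * RR (fst z) (snd z) \<le> KK (fst z) (snd z) \<and> KK (fst z) (snd z) \<le> \<beta> * RR (fst z) (snd z)}" for \<alpha> \<beta> :: real

lemma borel_fns[measurable]:
  "(\<lambda>z. NN (fst z) (snd z)) \<in> borel_measurable (borel :: (real \<times> real) measure)"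
  "(\<lambda>z. KK (fst z) (snd z)) \<in> borel_measurable (borel :: (real \<times> real) measure)"
  "(\<lambda>z. RR (fst z) (snd z)) \<in> borel_measurable (borel :: (real \<times> real) measure)"
  unfolding NN_def KK_def RR_def
  by (intro borel_measurable_continuous_onI continuous_intros; use s0 a0 in simp)+

lemma borel_regions: "Reg \<alpha> \<beta> \<in> sets borel" "Full \<alpha> \<beta> \<in> sets borel"
proof -
  have [measurable]: "(fst :: real \<times> real \<Rightarrow> real) \<in> borel_measurable borel" "(snd :: real \<times> real \<Rightarrow> real) \<in> borel_measurable borel"
    by (intro borel_measurable_continuous_onI continuous_intros)+
  show "Reg \<alpha> \<beta> \<in> sets borel" "Full \<alpha> \<beta> \<in> sets borel" unfolding Reg_def Full_def by measurable
qed

text \<open>On the ray \<open>u = v l\<close> the form \<open>Q2\<close> is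
  \<open>(l * g l / (s * a)) * v\<^sup>2\<close> and \<open>K / Q1\<close> is the constant
  \<open>j l\<close>, so the bounds on \<open>K / (Q1 Q2)\<close> compare \<open>j l\<close> with
  multiples of \<open>v\<^sup>2\<close>.\<close>

lemma Reg_slice:
  assumes v: "v > 0"
  shows "(v * l, v) \<in> Reg \<alpha> \<beta> \<longleftrightarrow> l > 0 \<and> s \<le> g l \<and> 0 < j l \<and> (l * g l / (s * a)) * (v * v) \<le> 1
     \<and> \<alpha> * ((l * g l / (s * a)) * (v * v)) \<le> j l \<and> j l \<le> \<beta> * ((l * g l / (s * a)) * (v * v))"
proof (cases "l > 0")
  case False
  thus ?thesis unfolding Reg_def using v by (auto simp: zero_less_mult_iff)
next
  case l: True
  define c where "c = v * v * l"
  have c0: "c > 0" unfolding c_def using v l by simp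
  have N: "NN (v * l) v = 2 * c * g l" unfolding NN_def g_def c_def using l by (simp add: field_simps)
  have K: "KK (v * l) v = c / a * j l" unfolding KK_def j_def c_def using l a0 by (simp add: field_simps)
  have k: "(l * g l / (s * a)) * (v * v) = c * g l / (s * a)" unfolding c_def by (simp add: field_simps)
  have R: "RR (v * l) v = c / a * (c * g l / (s * a))" unfolding RR_def N c_def using s0 a0 by (simp add: field_simps)
  have ca: "c / a > 0" using c0 a0 by simp
  have 1: "2 * s * (v * l * v) \<le> NN (v * l) v \<longleftrightarrow> s \<le> g l"
  proof -
    have "2 * s * (v * l * v) = 2 * c * s" unfolding c_def by simp
    hence "2 * s * (v * l * v) \<le> NN (v * l) v \<longleftrightarrow> 2 * c * s \<le> 2 * c * g l" by (simp only: N)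
    also have "\<dots> \<longleftrightarrow> s \<le> g l" using c0 by simp
    finally show ?thesis .
  qed
  have 2: "NN (v * l) v \<le> 2 * s * a \<longleftrightarrow> c * g l / (s * a) \<le> 1" unfolding N using s0 a0 by (simp add: field_simps)
  have 3: "0 < KK (v * l) v \<longleftrightarrow> 0 < j l" unfolding K using ca by (metis zero_less_mult_pos mult_pos_pos)
  have 4: "\<alpha> * RR (v * l) v \<le> KK (v * l) v \<longleftrightarrow> \<alpha> * (c * g l / (s * a)) \<le> j l"
  proof -
    have "\<alpha> * RR (v * l) v = c / a * (\<alpha> * (c * g l / (s * a)))" unfolding R by simp
    thus ?thesis unfolding K using ca by (simp only: mult_le_cancel_left_pos)
  qed
  have 5: "KK (v * l) v \<le> \<beta> * RR (v * l) v \<longleftrightarrow> j l \<le> \<beta> * (c * g l / (s * a))"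
  proof -
    have "\<beta> * RR (v * l) v = c / a * (\<beta> * (c * g l / (s * a)))" unfolding R by simp
    thus ?thesis unfolding K using ca by (simp only: mult_le_cancel_left_pos)
  qed
  show ?thesis unfolding Reg_def mem_Collect_eq fst_conv snd_conv 1 2 3 4 5 k using v l by auto
qed

text \<open>On each ray the variable \<open>v\<close> is replaced by \<open>t = K / (Q1 Q2)\<close>;
  after exchanging the integrals, the one over the slope \<open>l\<close> is \<open>LL t\<close>,
  and the common factor is \<open>s a / (2 t\<^sup>2)\<close>.\<close>

lemma Reg_area:
  assumes \<alpha>: "0 \<le> \<alpha>"
  shows "emeasure lborel (Reg \<alpha> \<beta>) = (\<integral>\<^sup>+t. (if \<alpha> \<le> t \<and> t \<le> \<beta> \<and> 0 < t
     then ennreal (2 * a * s * (if A > 0 then LL t / (4 * (t * t)) else 0)) else 0) \<partial>lborel)"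
proof -
  have Rm[measurable]: "Reg \<alpha> \<beta> \<in> sets (borel \<Otimes>\<^sub>M borel)" using borel_regions(1) unfolding borel_prod .
  have gm[measurable]: "g \<in> borel_measurable borel" and jm[measurable]: "j \<in> borel_measurable borel"
    unfolding g_def j_def by measurable
  have "emeasure lborel (Reg \<alpha> \<beta>) = (\<integral>\<^sup>+v. \<integral>\<^sup>+u. indicator (Reg \<alpha> \<beta>) (u, v) \<partial>lborel \<partial>lborel)"
    by (subst lborel_pair.nn_integral_snd) (auto simp: lborel_prod borel_regions intro!: borel_measurable_indicator)
  also have "\<dots> = (\<integral>\<^sup>+v. \<integral>\<^sup>+l. (if v > 0 then ennreal v * indicator (Reg \<alpha> \<beta>) (v * l, v) else 0) \<partial>lborel \<partial>lborel)"
  proof (rule nn_integral_cong)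
    fix v :: real
    show "(\<integral>\<^sup>+u. indicator (Reg \<alpha> \<beta>) (u, v) \<partial>lborel) = (\<integral>\<^sup>+l. (if v > 0 then ennreal v * indicator (Reg \<alpha> \<beta>) (v * l, v) else 0) \<partial>lborel)"
    proof (cases "v > 0")
      case True
      have "(\<integral>\<^sup>+u. indicator (Reg \<alpha> \<beta>) (u, v) \<partial>lborel) = ennreal \<bar>v\<bar> * (\<integral>\<^sup>+l. indicator (Reg \<alpha> \<beta>) (0 + v * l, v) \<partial>lborel)"
        by (rule nn_integral_real_affine) (use True in auto)
      thus ?thesis using True by (simp add: nn_integral_cmult)
    next
      case False
      hence "(indicator (Reg \<alpha> \<beta>) (u, v) :: ennreal) = 0" for u unfolding Reg_def by simp
      thus ?thesis using False by simp
    qed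
  qed
  also have "\<dots> = (\<integral>\<^sup>+l. \<integral>\<^sup>+v. (if v > 0 then ennreal v * indicator (Reg \<alpha> \<beta>) (v * l, v) else 0) \<partial>lborel \<partial>lborel)"
    by (rule lborel_pair.Fubini') measurable
  also have "\<dots> = (\<integral>\<^sup>+l. \<integral>\<^sup>+t. (if (\<alpha> \<le> t \<and> t \<le> \<beta> \<and> 0 < t) \<and> l > 0 \<and> s \<le> g l \<and> 0 < j l \<and> j l \<le> t
      then ennreal (s * a / (2 * (t * t))) * ennreal (j l / (l * g l)) else 0) \<partial>lborel \<partial>lborel)"
  proof (rule nn_integral_cong)
    fix l :: real
    show "(\<integral>\<^sup>+v. (if v > 0 then ennreal v * indicator (Reg \<alpha> \<beta>) (v * l, v) else 0) \<partial>lborel)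
      = (\<integral>\<^sup>+t. (if (\<alpha> \<le> t \<and> t \<le> \<beta> \<and> 0 < t) \<and> l > 0 \<and> s \<le> g l \<and> 0 < j l \<and> j l \<le> t
      then ennreal (s * a / (2 * (t * t))) * ennreal (j l / (l * g l)) else 0) \<partial>lborel)"
    proof (cases "l > 0 \<and> s \<le> g l \<and> 0 < j l")
      case False
      have "(if v > 0 then ennreal v * indicator (Reg \<alpha> \<beta>) (v * l, v) else 0) = 0" for v
        using False Reg_slice[of v l] by (auto simp: indicator_def)
      moreover have e: "((\<alpha> \<le> t \<and> t \<le> \<beta> \<and> 0 < t) \<and> l > 0 \<and> s \<le> g l \<and> 0 < j l \<and> j l \<le> t) = False" for t using False by blast
      ultimately show ?thesis unfolding e by simp
    next
      case True
      define \<kappa> where "\<kappa> = l * g l / (s * a)"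
      have gl: "g l > 0" using True s0 by linarith
      have \<kappa>: "\<kappa> > 0" unfolding \<kappa>_def using True gl s0 a0 by simp
      have "(\<integral>\<^sup>+v. (if v > 0 then ennreal v * indicator (Reg \<alpha> \<beta>) (v * l, v) else 0) \<partial>lborel)
        = (\<integral>\<^sup>+v. (if v > 0 \<and> \<kappa> * (v * v) \<le> 1 \<and> \<alpha> * (\<kappa> * (v * v)) \<le> j l \<and> j l \<le> \<beta> * (\<kappa> * (v * v)) then ennreal v else 0) \<partial>lborel)"
        by (intro nn_integral_cong) (use True Reg_slice[of _ l] in \<open>auto simp: indicator_def \<kappa>_def\<close>)
      also have "\<dots> = (\<integral>\<^sup>+t. (if \<alpha> \<le> t \<and> t \<le> \<beta> \<and> j l \<le> t then ennreal (1 / (2 * \<kappa>) * (j l / (t * t))) else 0) \<partial>lborel)"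
        by (rule nn_integral_scaled_linear) (use \<kappa> True \<alpha> in auto)
      also have "\<dots> = (\<integral>\<^sup>+t. (if (\<alpha> \<le> t \<and> t \<le> \<beta> \<and> 0 < t) \<and> l > 0 \<and> s \<le> g l \<and> 0 < j l \<and> j l \<le> t
          then ennreal (s * a / (2 * (t * t))) * ennreal (j l / (l * g l)) else 0) \<partial>lborel)"
      proof (rule nn_integral_cong)
        fix t :: real
        have "ennreal (1 / (2 * \<kappa>) * (j l / (t * t))) = ennreal (s * a / (2 * (t * t))) * ennreal (j l / (l * g l))"
          using True gl s0 a0 unfolding \<kappa>_def by (subst ennreal_mult[symmetric]) (auto simp: field_simps)
        thus "(if \<alpha> \<le> t \<and> t \<le> \<beta> \<and> j l \<le> t then ennreal (1 / (2 * \<kappa>) * (j l / (t * t))) else 0)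
          = (if (\<alpha> \<le> t \<and> t \<le> \<beta> \<and> 0 < t) \<and> l > 0 \<and> s \<le> g l \<and> 0 < j l \<and> j l \<le> t
          then ennreal (s * a / (2 * (t * t))) * ennreal (j l / (l * g l)) else 0)"
          using True by auto
      qed
      finally show ?thesis .
    qed
  qed
  also have "\<dots> = (\<integral>\<^sup>+t. \<integral>\<^sup>+l. (if (\<alpha> \<le> t \<and> t \<le> \<beta> \<and> 0 < t) \<and> l > 0 \<and> s \<le> g l \<and> 0 < j l \<and> j l \<le> t
      then ennreal (s * a / (2 * (t * t))) * ennreal (j l / (l * g l)) else 0) \<partial>lborel \<partial>lborel)"
    by (rule lborel_pair.Fubini') measurable
  also have "\<dots> = (\<integral>\<^sup>+t. (if \<alpha> \<le> t \<and> t \<le> \<beta> \<and> 0 < t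
     then ennreal (2 * a * s * (if A > 0 then LL t / (4 * (t * t)) else 0)) else 0) \<partial>lborel)"
  proof (rule nn_integral_cong)
    fix t :: real
    show "(\<integral>\<^sup>+l. (if (\<alpha> \<le> t \<and> t \<le> \<beta> \<and> 0 < t) \<and> l > 0 \<and> s \<le> g l \<and> 0 < j l \<and> j l \<le> t
      then ennreal (s * a / (2 * (t * t))) * ennreal (j l / (l * g l)) else 0) \<partial>lborel) = (if \<alpha> \<le> t \<and> t \<le> \<beta> \<and> 0 < t
     then ennreal (2 * a * s * (if A > 0 then LL t / (4 * (t * t)) else 0)) else 0)"
    proof (cases "\<alpha> \<le> t \<and> t \<le> \<beta> \<and> 0 < t")
      case True
      have LL0: "LL t \<ge> 0" unfolding LL_def using mm0 by simp
      have "(\<integral>\<^sup>+l. (if (\<alpha> \<le> t \<and> t \<le> \<beta> \<and> 0 < t) \<and> l > 0 \<and> s \<le> g l \<and> 0 < j l \<and> j l \<le> t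
        then ennreal (s * a / (2 * (t * t))) * ennreal (j l / (l * g l)) else 0) \<partial>lborel)
        = (\<integral>\<^sup>+l. ennreal (s * a / (2 * (t * t))) * (if l > 0 \<and> s \<le> g l \<and> 0 < j l \<and> j l \<le> t then ennreal (j l / (l * g l)) else 0) \<partial>lborel)"
        using True by (intro nn_integral_cong) auto
      also have "\<dots> = ennreal (s * a / (2 * (t * t))) * ennreal (if A > 0 then LL t else 0)"
        by (subst nn_integral_cmult) (use True in \<open>auto simp: lambda_integral\<close>)
      also have "\<dots> = ennreal (2 * a * s * (if A > 0 then LL t / (4 * (t * t)) else 0))"
        using s0 a0 LL0 True by (subst ennreal_mult[symmetric]) (auto simp: field_simps)
      finally show ?thesis using True by simp
    next
      case False
      hence e: "((\<alpha> \<le> t \<and> t \<le> \<beta> \<and> 0 < t) \<and> P) = False" for P by blast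
      show ?thesis unfolding e using False by auto
    qed
  qed
  finally show ?thesis .
qed

end

lemma emeasure_swap:
  fixes S :: "(real \<times> real) set"
  assumes "S \<in> sets borel"
  shows "emeasure lborel {z. (snd z, fst z) \<in> S} = emeasure lborel S"
proof -
  define T where "T = {z. (snd z, fst z) \<in> S}"
  have "(\<lambda>z. (snd z, fst z)) \<in> borel_measurable (borel :: (real \<times> real) measure)"
    by (intro borel_measurable_continuous_onI continuous_intros)
  from measurable_sets[OF this assms] have T: "T \<in> sets borel" unfolding T_def by (simp add: vimage_def)
  have "emeasure lborel T = (\<integral>\<^sup>+v. \<integral>\<^sup>+u. indicator T (u, v) \<partial>lborel \<partial>lborel)"
    by (subst lborel_pair.nn_integral_snd) (auto simp: lborel_prod T intro!: borel_measurable_indicator)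
  also have "\<dots> = (\<integral>\<^sup>+v. \<integral>\<^sup>+u. indicator S (v, u) \<partial>lborel \<partial>lborel)"
    unfolding T_def by (simp add: indicator_def)
  also have "\<dots> = emeasure lborel S"
    by (subst lborel.nn_integral_fst) (auto simp: lborel_prod assms intro!: borel_measurable_indicator)
  finally show ?thesis unfolding T_def .
qed

section \<open>Continuity and size of the density\<close>

text \<open>Filling the removable singularity allows the density for \<open>B > s\<close> to be
  written by one formula that is continuous at 0.\<close>

definition ln_quot :: "real \<Rightarrow> real" where
  "ln_quot z = (if z = 0 then 1 else ln (1 + z) / z)"

lemma ln_quot_bounds: "z \<ge> 0 \<Longrightarrow> ln_quot z \<le> 1" "z \<ge> 0 \<Longrightarrow> 1 / (1 + z) \<le> ln_quot z"
proof -
  assume z: "z \<ge> 0"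
  show "ln_quot z \<le> 1" using z ln_add_one_self_le_self[of z] unfolding ln_quot_def by (auto simp: divide_le_eq)
  have "ln (1 / (1 + z)) \<le> 1 / (1 + z) - 1" using z by (intro ln_le_minus_one) auto
  hence "z / (1 + z) \<le> ln (1 + z)" using z by (simp add: ln_div field_simps)
  thus "1 / (1 + z) \<le> ln_quot z" using z unfolding ln_quot_def by (auto simp: field_simps)
qed

lemma continuous_on_ln_quot: "continuous_on {0..} ln_quot"
proof (unfold continuous_on_eq_continuous_within, intro ballI)
  fix z :: real assume z: "z \<in> {0..}"
  show "continuous (at z within {0..}) ln_quot"
  proof (cases "z = 0")
    case True
    have "((\<lambda>z::real. ln (1 + z) / z) \<longlongrightarrow> 1) (at_right 0)" by real_asymp
    hence "(ln_quot \<longlongrightarrow> 1) (at_right 0)"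
      by (rule Lim_transform_eventually)
         (use eventually_at_right_less[of "0::real"] in \<open>auto simp: ln_quot_def elim!: eventually_mono\<close>)
    thus ?thesis using True by (simp add: continuous_within ln_quot_def at_within_Ici_at_right)
  next
    case False
    hence z0: "z > 0" using z by simp
    have "isCont (\<lambda>z. ln (1 + z) / z) z" using z0 by (intro continuous_intros) auto
    moreover have "\<forall>\<^sub>F x in nhds z. ln_quot x = ln (1 + x) / x"
      using eventually_nhds_in_open[of "{0<..}" z] z0 by (auto simp: ln_quot_def elim!: eventually_mono)
    ultimately have "isCont ln_quot z" by (simp add: isCont_cong)
    thus ?thesis by (rule continuous_at_imp_continuous_at_within)
  qed
qed

lemma integral_ge_on_unit:
  fixes f :: "real \<Rightarrow> real"
  assumes "continuous_on UNIV f" "\<And>x. f x \<ge> 0" "l \<le> c" "c + 1 \<le> u" "\<And>x. c \<le> x \<Longrightarrow> x \<le> c + 1 \<Longrightarrow> v \<le> f x"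
  shows "v \<le> integral {l..u} f"
proof -
  have int: "f integrable_on {x..y}" for x y
    using assms(1) by (intro integrable_continuous_interval continuous_on_subset[OF assms(1)]) auto
  have "integral {c..c + 1} (\<lambda>_. v) \<le> integral {c..c + 1} f"
    by (rule integral_le) (use int assms in auto)
  also have "\<dots> \<le> integral {l..u} f" by (rule integral_subset_le) (use int assms in auto)
  finally show ?thesis by simp
qed

text \<open>For a pair of forms \<open>2 * s * B\<close> is an integer, the joint invariant
  \<open>bb\<close>, while \<open>2 * s * s\<close> is \<open>2 * D\<close>; they are distinct
  integers. The alternatives are \<open>B < s\<close> and \<open>B > s\<close> with a
  margin.\<close>

locale pair_area_gap = pair_area +
  assumes gap: "1 \<le> 2 * s * s - 2 * s * B \<or> 1 \<le> 2 * s * B - 2 * s * s"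
begin

definition kk where "kk = sqrt (max 0 (A * C))"

text \<open>Exchanging \<open>u\<close> and \<open>v\<close> reverses the sign of \<open>K\<close>
  and exchanges \<open>A\<close> with \<open>C\<close>, which gives the branch \<open>t < 0\<close>.
  For \<open>A > 0\<close> and \<open>B > s\<close> the value at 0 is the limit of
  \<open>LL t / (4 * t\<^sup>2)\<close>; for \<open>B < s\<close> the density vanishes near
  0.\<close>

definition dens :: "real \<Rightarrow> real" where
  "dens t = (if t > 0 then (if A > 0 then LL t / (4 * (t * t)) else 0)
     else if t < 0 then (if C > 0 then LL (- t) / (4 * (t * t)) else 0)
     else (if A > 0 \<and> B > s then 1 / (8 * kk * (B + kk)) else 0))"

sublocale swap: pair_area s a C B A
  by unfold_locales (use s0 a0 AC AC0 in \<open>auto simp: mult.commute\<close>)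

lemma swap_LL: "swap.LL t = LL t"
  unfolding swap.LL_def LL_def swap.GG_def GG_def swap.mm_def mm_def by (simp add: mult.commute)

lemma LL_nonneg: "LL t \<ge> 0"
  unfolding LL_def using mm0 by simp

lemma LL_mono: "0 \<le> x \<Longrightarrow> x \<le> y \<Longrightarrow> LL x \<le> LL y"
proof -
  assume xy: "0 \<le> x" "x \<le> y"
  have "x * x \<le> y * y" using xy by (intro mult_mono) auto
  hence "GG x \<le> GG y" unfolding GG_def by (simp add: max_def)
  hence "max (GG x) mm \<le> max (GG y) mm" by auto
  thus ?thesis unfolding LL_def using mm0(2) by simp
qed

lemma LL_continuous: "continuous_on S LL"
proof -
  have "max (GG t) mm \<noteq> 0" for t using mm0(2) by (simp add: max_def)
  thus ?thesis unfolding LL_def GG_def by (intro continuous_intros) auto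
qed

text \<open>Here \<open>A * C = (B - s) * (B + s) \<ge> 2 * s * (B - s) \<ge> 1\<close>, so
  \<open>A\<close> and \<open>C\<close> have the same sign and \<open>mm = B + kk\<close>. With
  \<open>r\<^sup>2 = t\<^sup>2 + kk\<^sup>2\<close> the quotient \<open>(B + r) / (B + kk)\<close>
  is \<open>1 + t\<^sup>2 / ((r + kk) * (B + kk))\<close>, which exhibits the factor cancelling
  \<open>t\<^sup>2\<close> in the denominator.\<close>

lemma dens_large_B:
  assumes B: "1 \<le> 2 * s * B - 2 * s * s"
  shows "B > s" "kk \<ge> 1" "A > 0 \<longleftrightarrow> C > 0"
    "A > 0 \<Longrightarrow> dens t = ln_quot (t * t / ((sqrt (t * t + kk * kk) + kk) * (B + kk))) / (4 * ((sqrt (t * t + kk * kk) + kk) * (B + kk)))"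
proof -
  have "2 * s * (B - s) \<ge> 1" using B by (simp add: algebra_simps)
  hence "2 * s * (B - s) > 0" by linarith
  hence Bs: "B - s > 0" using s0 by (simp add: zero_less_mult_iff)
  thus "B > s" by simp
  have "A * C = (B - s) * (B + s)" using AC by (simp add: algebra_simps)
  moreover have "(B - s) * (2 * s) \<le> (B - s) * (B + s)" using Bs s0 by (intro mult_left_mono) auto
  ultimately have AC1: "A * C \<ge> 1" using \<open>2 * s * (B - s) \<ge> 1\<close> by (simp add: algebra_simps)
  thus k1: "kk \<ge> 1" unfolding kk_def by (simp add: max_def)
  have kk2: "kk * kk = A * C" unfolding kk_def using AC1 by (simp add: max_def)
  show "A > 0 \<longleftrightarrow> C > 0" using AC1 by (smt (verit) mult_neg_pos mult_pos_neg mult_nonneg_nonpos mult_nonpos_nonneg)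
  have mm: "mm = B + kk" unfolding mm_def kk_def[symmetric] using Bs k1 by simp
  assume A: "A > 0"
  define r where "r = sqrt (t * t + kk * kk)"
  have r: "r \<ge> kk" "r * r = t * t + kk * kk" unfolding r_def using k1 by (auto intro: real_le_rsqrt simp: power2_eq_square)
  have G: "GG u = B + sqrt (u * u + kk * kk)" for u unfolding GG_def kk2 using AC1 by (simp add: max_def)
  have LLt: "LL u = ln (1 + u * u / ((sqrt (u * u + kk * kk) + kk) * (B + kk)))" for u
  proof -
    define q where "q = sqrt (u * u + kk * kk)"
    have q: "q \<ge> kk" "q * q = u * u + kk * kk" unfolding q_def using k1 by (auto intro: real_le_rsqrt simp: power2_eq_square)
    have "LL u = ln (B + q) - ln (B + kk)" unfolding LL_def G mm q_def[symmetric] using q by (simp add: max_def)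
    also have "\<dots> = ln ((B + q) / (B + kk))" using q k1 Bs s0 by (simp add: ln_div)
    also have "(B + q) / (B + kk) = 1 + u * u / ((q + kk) * (B + kk))"
    proof -
      have p: "B + kk > 0" "q + kk > 0" using q k1 Bs s0 by linarith+
      have "u * u = (q - kk) * (q + kk)" using q(2) by (simp add: algebra_simps)
      hence "u * u / ((q + kk) * (B + kk)) = (q - kk) / (B + kk)" using p by simp
      thus ?thesis using p by (simp add: field_simps)
    qed
    finally show ?thesis unfolding q_def .
  qed
  define W where "W = (r + kk) * (B + kk)"
  have W0: "W > 0" unfolding W_def using r k1 Bs s0 by simp
  have C: "C > 0" using A \<open>A > 0 \<longleftrightarrow> C > 0\<close> by simp
  have main: "dens t = ln_quot (t * t / W) / (4 * W)"
  proof (cases "t = 0")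
    case True
    have "r = kk" unfolding r_def True using k1 by simp
    hence "W = 2 * kk * (B + kk)" unfolding W_def by simp
    thus ?thesis unfolding dens_def ln_quot_def using True A Bs by simp
  next
    case False
    have "dens t = LL t / (4 * (t * t))"
      unfolding dens_def using False A C LLt[of t] LLt[of "- t"] by auto
    also have "LL t = ln (1 + t * t / W)" unfolding LLt W_def r_def ..
    also have "ln (1 + t * t / W) / (4 * (t * t)) = ln_quot (t * t / W) / (4 * W)"
      unfolding ln_quot_def using False W0 by simp
    finally show ?thesis .
  qed
  thus "dens t = ln_quot (t * t / ((sqrt (t * t + kk * kk) + kk) * (B + kk))) / (4 * ((sqrt (t * t + kk * kk) + kk) * (B + kk)))"
    unfolding W_def r_def .
qed

text \<open>\<open>(s - B)\<^sup>2 - A * C = 2 * s\<^sup>2 - 2 * s * B \<ge> 1 \<ge>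
  t\<^sup>2\<close>, hence \<open>GG t \<le> s \<le> mm\<close>.\<close>

lemma LL_small_B:
  assumes "1 \<le> 2 * s * s - 2 * s * B" "\<bar>t\<bar> \<le> 1"
  shows "LL t = 0"
proof -
  have "2 * s * (s - B) > 0" using assms(1) by (simp add: algebra_simps)
  hence Bs: "s - B > 0" using s0 by (simp add: zero_less_mult_iff)
  have "t * t \<le> 1" using assms(2) by (metis abs_le_square_iff abs_one mult_1 power2_eq_square)
  hence "t * t + A * C \<le> (s - B) * (s - B)" unfolding AC using assms(1) by (simp add: algebra_simps)
  hence "sqrt (max 0 (t * t + A * C)) \<le> s - B" using Bs by (intro real_le_lsqrt) (auto simp: power2_eq_square)
  hence "GG t \<le> mm" unfolding GG_def using mm0(1) by linarith
  thus ?thesis unfolding LL_def by simp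
qed

lemma dens_nonneg: "dens t \<ge> 0"
proof (cases "1 \<le> 2 * s * B - 2 * s * s")
  case True
  note F = dens_large_B[OF True]
  show ?thesis unfolding dens_def using LL_nonneg F(1,2) s0 by auto
next
  case False
  hence "B \<le> s"
  proof -
    have "2 * s * (s - B) > 0" using gap False by (simp add: algebra_simps)
    thus ?thesis using s0 by (simp add: zero_less_mult_iff)
  qed
  thus ?thesis unfolding dens_def using LL_nonneg by auto
qed

text \<open>As \<open>LL\<close> vanishes on [-1, 1], cutting the argument off at 1/2 changes
  nothing and removes the singularity of \<open>1 / t\<^sup>2\<close>; each branch becomes
  continuous on the whole line.\<close>

lemma dens_small_B:
  assumes B: "1 \<le> 2 * s * s - 2 * s * B"
  shows "dens t = (if A > 0 then LL (max t (1/2)) / (4 * (max t (1/2) * max t (1/2))) else 0)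
     + (if C > 0 then LL (max (- t) (1/2)) / (4 * (max (- t) (1/2) * max (- t) (1/2))) else 0)"
proof -
  have "2 * s * (s - B) > 0" using B by (simp add: algebra_simps)
  hence Bs: "s - B > 0" using s0 by (simp add: zero_less_mult_iff)
  have z: "LL x = 0" if "\<bar>x\<bar> \<le> 1" for x using LL_small_B[OF B that] .
  have h: "LL (1/2) = 0" by (rule z) simp
  consider "t > 1/2" | "t < - 1/2" | "\<bar>t\<bar> \<le> 1/2" by linarith
  thus ?thesis
  proof cases
    case 1 thus ?thesis unfolding dens_def using h by (simp add: max_def)
  next
    case 2 thus ?thesis unfolding dens_def using h by (simp add: max_def)
  next
    case 3
    have "LL t = 0" "LL (- t) = 0" by (rule z; use 3 in simp)+
    thus ?thesis unfolding dens_def using h 3 Bs by (auto simp: max_def)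
  qed
qed

lemma dens_continuous: "continuous_on UNIV dens"
proof (cases "1 \<le> 2 * s * B - 2 * s * s")
  case True
  note F = dens_large_B[OF True]
  show ?thesis
  proof (cases "A > 0")
    case A: True
    have W0: "(sqrt (t * t + kk * kk) + kk) * (B + kk) > 0" for t
      using F(1,2) s0 by (intro mult_pos_pos add_nonneg_pos) auto
    have "continuous_on UNIV (\<lambda>t. ln_quot (t * t / ((sqrt (t * t + kk * kk) + kk) * (B + kk))))"
    proof (rule continuous_on_compose2[OF continuous_on_ln_quot])
      show "continuous_on UNIV (\<lambda>t. t * t / ((sqrt (t * t + kk * kk) + kk) * (B + kk)))"
        using W0 by (intro continuous_intros) (metis less_irrefl)
      show "range (\<lambda>t. t * t / ((sqrt (t * t + kk * kk) + kk) * (B + kk))) \<subseteq> {0..}"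
        using W0 by (auto intro!: divide_nonneg_pos)
    qed
    moreover have "continuous_on UNIV (\<lambda>t. 4 * ((sqrt (t * t + kk * kk) + kk) * (B + kk)))" by (intro continuous_intros)
    moreover have "\<forall>t\<in>UNIV. 4 * ((sqrt (t * t + kk * kk) + kk) * (B + kk)) \<noteq> 0"
    proof
      fix t :: real
      show "4 * ((sqrt (t * t + kk * kk) + kk) * (B + kk)) \<noteq> 0" using W0[of t] by linarith
    qed
    ultimately have "continuous_on UNIV (\<lambda>t. ln_quot (t * t / ((sqrt (t * t + kk * kk) + kk) * (B + kk))) / (4 * ((sqrt (t * t + kk * kk) + kk) * (B + kk))))"
      by (rule continuous_on_divide)
    moreover have "dens = (\<lambda>t. ln_quot (t * t / ((sqrt (t * t + kk * kk) + kk) * (B + kk))) / (4 * ((sqrt (t * t + kk * kk) + kk) * (B + kk))))"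
      by (intro ext) (rule F(4)[OF A])
    ultimately show ?thesis by simp
  next
    case False
    hence "dens = (\<lambda>_. 0)" using F(3) unfolding dens_def by (auto simp: fun_eq_iff)
    thus ?thesis by simp
  qed
next
  case False
  hence B: "1 \<le> 2 * s * s - 2 * s * B" using gap by simp
  have cm: "continuous_on UNIV (\<lambda>t. LL (max (f t) (1/2)) / (4 * (max (f t) (1/2) * max (f t) (1/2))))"
    if f: "continuous_on UNIV f" for f :: "real \<Rightarrow> real"
  proof -
    have m: "continuous_on UNIV (\<lambda>t. max (f t) (1/2))" by (intro continuous_on_max f continuous_on_const)
    have "max (f t) (1/2) > 0" for t by (simp add: max_def)
    hence "\<forall>t\<in>UNIV. 4 * (max (f t) (1/2) * max (f t) (1/2)) \<noteq> 0" by (metis less_irrefl mult_eq_0_iff zero_neq_numeral)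
    thus ?thesis
      by (intro continuous_on_divide continuous_on_mult continuous_on_const m continuous_on_compose2[OF LL_continuous[of UNIV] m]) auto
  qed
  have "continuous_on UNIV (\<lambda>t. LL (max t (1/2)) / (4 * (max t (1/2) * max t (1/2))))"
    by (rule cm[OF continuous_on_id])
  moreover have "continuous_on UNIV (\<lambda>t. LL (max (- t) (1/2)) / (4 * (max (- t) (1/2) * max (- t) (1/2))))"
    by (rule cm) (intro continuous_intros)
  ultimately have "continuous_on UNIV (\<lambda>t. (if A > 0 then LL (max t (1/2)) / (4 * (max t (1/2) * max t (1/2))) else 0)
     + (if C > 0 then LL (max (- t) (1/2)) / (4 * (max (- t) (1/2) * max (- t) (1/2))) else 0))"
    by (cases "A > 0"; cases "C > 0") (auto intro!: continuous_intros)
  moreover have "dens = (\<lambda>t. (if A > 0 then LL (max t (1/2)) / (4 * (max t (1/2) * max t (1/2))) else 0)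
     + (if C > 0 then LL (max (- t) (1/2)) / (4 * (max (- t) (1/2) * max (- t) (1/2))) else 0))"
    by (intro ext) (rule dens_small_B[OF B])
  ultimately show ?thesis by (simp only:)
qed

text \<open>For \<open>B > s\<close> and \<open>A > 0\<close> the density is at most
  \<open>s1\<close> everywhere and at least \<open>s1 / 4\<close> on [0, 1]. For
  \<open>B < s\<close> it vanishes on [-1, 1], and since \<open>LL\<close> increases, its values on
  the unit interval beyond \<open>T\<close>, on the side of \<open>t\<close>, are at least
  \<open>dens t / (T + 1)\<^sup>2\<close>. The constant is the same for all pairs, as the summation
  over orbits requires.\<close>

lemma dens_bound:
  assumes T: "T \<ge> 1" "\<bar>t\<bar> \<le> T"
  shows "dens t \<le> (T + 1)\<^sup>2 * integral {-(T + 1)..T + 1} dens"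
proof -
  define I where "I = integral {-(T + 1)..T + 1} dens"
  have I0: "I \<ge> 0" unfolding I_def
    using dens_continuous dens_nonneg by (intro integral_nonneg integrable_continuous_interval) (auto intro: continuous_on_subset)
  have T2: "(T + 1)\<^sup>2 \<ge> 4" using T(1) power_mono[of 2 "T + 1" 2] by simp
  show ?thesis
  proof (cases "1 \<le> 2 * s * B - 2 * s * s")
    case True
    note F = dens_large_B[OF True]
    show ?thesis
    proof (cases "A > 0")
      case A: True
      define s1 where "s1 = 1 / (8 * kk * (B + kk))"
      have Bk: "B + kk > 0" using F(1,2) s0 by linarith
      have up: "dens t \<le> s1"
      proof -
        define r where "r = sqrt (t * t + kk * kk)"
        have r: "r \<ge> kk" unfolding r_def using F(2) by (auto intro: real_le_rsqrt simp: power2_eq_square)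
        define W where "W = (r + kk) * (B + kk)"
        have W: "W \<ge> 2 * kk * (B + kk)" unfolding W_def using r Bk by (intro mult_right_mono) auto
        have W0: "2 * kk * (B + kk) > 0" using F(2) Bk by simp
        have "dens t = ln_quot (t * t / W) / (4 * W)" using F(4)[OF A] unfolding W_def r_def by simp
        also have "\<dots> \<le> 1 / (4 * W)" using W W0 by (intro divide_right_mono ln_quot_bounds) auto
        also have "\<dots> \<le> 1 / (4 * (2 * kk * (B + kk)))" using W W0 by (intro divide_left_mono) auto
        finally show ?thesis unfolding s1_def by simp
      qed
      \<comment> \<open>On [0, 1] one has \<open>u \<le> 1 \<le> kk\<close>, so
        \<open>r \<le> 2 * kk\<close>, and \<open>W + u * u\<close> is at most four times the value
        \<open>2 * kk * (B + kk)\<close> of \<open>W\<close> at 0.\<close>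
      have lo: "s1 / 4 \<le> dens u" if "0 \<le> u" "u \<le> 0 + 1" for u
      proof -
        define r where "r = sqrt (u * u + kk * kk)"
        have "u * u \<le> 1 * 1" using that by (intro mult_mono) auto
        moreover have "1 * 1 \<le> kk * kk" using F(2) by (intro mult_mono) auto
        ultimately have "u * u + kk * kk \<le> (2 * kk) * (2 * kk)" by (simp add: algebra_simps)
        hence r2: "r \<le> 2 * kk" unfolding r_def using F(2) by (intro real_le_lsqrt) (auto simp: power2_eq_square)
        have r: "r \<ge> kk" "r * r = u * u + kk * kk" unfolding r_def using F(2) by (auto intro: real_le_rsqrt simp: power2_eq_square)
        define W where "W = (r + kk) * (B + kk)"
        have W0: "W > 0" unfolding W_def using r Bk F(2) by simp
        have W: "W + u * u \<le> (r + kk) * (B + r)"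
        proof -
          have "(r + kk) * (B + r) - W = (r + kk) * (r - kk)" unfolding W_def by (simp add: algebra_simps)
          also have "\<dots> = u * u" using r(2) by (simp add: algebra_simps)
          finally show ?thesis by simp
        qed
        have "dens u = ln_quot (u * u / W) / (4 * W)" using F(4)[OF A] unfolding W_def r_def by simp
        also have "\<dots> \<ge> 1 / (1 + u * u / W) / (4 * W)" using W0 by (intro divide_right_mono ln_quot_bounds) auto
        also have "1 / (1 + u * u / W) / (4 * W) = 1 / (4 * (W + u * u))"
        proof -
          have "1 + u * u / W = (W + u * u) / W" using W0 by (simp add: add_divide_distrib)
          thus ?thesis using W0 by simp
        qed
        finally have "dens u \<ge> 1 / (4 * (W + u * u))" .
        moreover have "1 / (4 * (8 * kk * (B + kk))) \<le> 1 / (4 * (W + u * u))"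
        proof (intro divide_left_mono mult_left_mono)
          have "(r + kk) * (B + r) \<le> (3 * kk) * (2 * (B + kk))" using r2 r F(1,2) s0 Bk by (intro mult_mono) auto
          also have "\<dots> \<le> 8 * kk * (B + kk)" using F(2) Bk by simp
          finally show "W + u * u \<le> 8 * kk * (B + kk)" using W by simp
        qed (use W0 F(2) Bk in \<open>auto intro!: mult_pos_pos add_pos_nonneg\<close>)
        ultimately show ?thesis unfolding s1_def by simp
      qed
      have "s1 / 4 \<le> I" unfolding I_def
        by (rule integral_ge_on_unit[of _ _ 0]) (use dens_continuous dens_nonneg lo T in auto)
      hence "dens t \<le> 4 * I" using up by simp
      also have "\<dots> \<le> (T + 1)\<^sup>2 * I" using T2 I0 by (intro mult_right_mono) auto
      finally show ?thesis unfolding I_def .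
    next
      case False
      hence "dens t = 0" using F(3) unfolding dens_def by auto
      thus ?thesis using I0 unfolding I_def by simp
    qed
  next
    case False
    hence B: "1 \<le> 2 * s * s - 2 * s * B" using gap by simp
    have key: "dens t \<le> (T + 1)\<^sup>2 * I"
      if c: "\<bar>t\<bar> > 1" "dens t = LL \<bar>t\<bar> / (4 * (t * t))" "\<And>u. T \<le> u \<Longrightarrow> dens (sgn t * u) = LL u / (4 * (u * u))"
    proof -
      define v where "v = dens t / (T + 1)\<^sup>2"
      have tt: "t * t \<ge> 1" using c(1) by (metis abs_le_square_iff abs_one less_imp_le mult_1 power2_eq_square)
      have LLt: "dens t \<le> LL \<bar>t\<bar> / 4" unfolding c(2) using tt LL_nonneg[of "\<bar>t\<bar>"] by (intro divide_left_mono) auto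
      have *: "v \<le> dens (sgn t * u)" if u: "T \<le> u" "u \<le> T + 1" for u
      proof -
        have uu: "u * u \<le> (T + 1)\<^sup>2" "u * u > 0" unfolding power2_eq_square using u T by (auto intro!: mult_mono mult_pos_pos)
        have "dens t \<le> LL u / 4" using LLt LL_mono[of "\<bar>t\<bar>" u] u T by linarith
        hence "v \<le> LL u / 4 / (T + 1)\<^sup>2" unfolding v_def by (intro divide_right_mono) auto
        also have "\<dots> \<le> LL u / 4 / (u * u)" using uu T2 u T LL_nonneg[of u] by (intro divide_left_mono mult_pos_pos) auto
        finally show ?thesis using c(3)[OF u(1)] by simp
      qed
      have "v \<le> I"
      proof (cases "t > 0")
        case True
        show ?thesis unfolding I_def
          by (rule integral_ge_on_unit[of _ _ T]) (use dens_continuous dens_nonneg * T True in auto)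
      next
        case False
        hence sg: "sgn t = -1" using c(1) by (auto simp: sgn_if)
        have "v \<le> dens x" if "-(T+1) \<le> x" "x \<le> -(T+1) + 1" for x using *[of "- x"] that sg by simp
        thus ?thesis unfolding I_def
          by (intro integral_ge_on_unit[of _ _ "-(T+1)"]) (use dens_continuous dens_nonneg T in auto)
      qed
      thus ?thesis unfolding v_def using T by (simp add: field_simps)
    qed
    show ?thesis
    proof (cases "dens t = 0")
      case True thus ?thesis using I0 unfolding I_def by simp
    next
      case False
      have t1: "\<bar>t\<bar> > 1"
      proof (rule ccontr)
        assume "\<not> \<bar>t\<bar> > 1"
        hence "LL t = 0" "LL (- t) = 0" by (intro LL_small_B[OF B]; simp)+
        moreover have "B \<le> s"
        proof -
          have "2 * s * (s - B) > 0" using B by (simp add: algebra_simps)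
          thus ?thesis using s0 by (simp add: zero_less_mult_iff)
        qed
        ultimately show False using False unfolding dens_def by (auto split: if_splits)
      qed
      show ?thesis
      proof (cases "t > 0")
        case True
        have "A > 0" using False True unfolding dens_def by (auto split: if_splits)
        thus ?thesis using key t1 True T unfolding I_def dens_def by simp
      next
        case F2: False
        have "C > 0" using False F2 t1 unfolding dens_def by (auto split: if_splits)
        thus ?thesis using key t1 F2 T unfolding I_def dens_def by simp
      qed
    qed
  qed
qed

end

context pair_area_gap
begin

lemma dens_integral:
  assumes "c \<ge> 0"
  shows "(\<integral>\<^sup>+t. (if \<alpha> \<le> t \<and> t \<le> \<beta> then ennreal (c * dens t) else 0) \<partial>lborel) = ennreal (c * integral {\<alpha>..\<beta>} dens)"
proof -
  have "(dens has_integral integral {\<alpha>..\<beta>} dens) {\<alpha>..\<beta>}"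
    using dens_continuous by (intro integrable_integral integrable_continuous_interval) (auto intro: continuous_on_subset)
  hence "((\<lambda>t. c * dens t) has_integral c * integral {\<alpha>..\<beta>} dens) {\<alpha>..\<beta>}" by (rule has_integral_mult_right)
  hence "((\<lambda>t. if t \<in> {\<alpha>..\<beta>} then c * dens t else 0) has_integral c * integral {\<alpha>..\<beta>} dens) UNIV"
    by (simp only: has_integral_restrict_UNIV)
  moreover have "(\<lambda>t. if t \<in> {\<alpha>..\<beta>} then c * dens t else 0) \<in> borel_measurable borel"
  proof -
    have [measurable]: "dens \<in> borel_measurable borel" using dens_continuous by (rule borel_measurable_continuous_onI)
    show ?thesis by measurable
  qed
  ultimately have "(\<integral>\<^sup>+t. ennreal (if t \<in> {\<alpha>..\<beta>} then c * dens t else 0) \<partial>lborel) = ennreal (c * integral {\<alpha>..\<beta>} dens)"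
    using assms dens_nonneg by (intro nn_integral_has_integral_lborel) auto
  moreover have "(\<integral>\<^sup>+t. ennreal (if t \<in> {\<alpha>..\<beta>} then c * dens t else 0) \<partial>lborel) = (\<integral>\<^sup>+t. (if \<alpha> \<le> t \<and> t \<le> \<beta> then ennreal (c * dens t) else 0) \<partial>lborel)"
    by (intro nn_integral_cong) auto
  ultimately show ?thesis by simp
qed

text \<open>The region is split by the sign of \<open>K\<close>. The part \<open>K < 0\<close> is
  the mirror image of a region \<open>Reg\<close> for the exchanged coordinates with bounds
  \<open>-\<beta>\<close> and \<open>-\<alpha>\<close>; the part \<open>K = 0\<close> is null
  because \<open>A \<noteq> 0\<close>.\<close>

lemma Full_area:
  "emeasure lborel (Full \<alpha> \<beta>) = ennreal (2 * a * s * integral {\<alpha>..\<beta>} dens)"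
proof -
  define P where "P = Reg (max \<alpha> 0) \<beta>"
  define M where "M = {z. (snd z, fst z) \<in> swap.Reg (max (- \<beta>) 0) (- \<alpha>)}"
  define Z where "Z = Full \<alpha> \<beta> \<inter> {z. KK (fst z) (snd z) = 0}"
  have sw: "swap.NN v u = NN u v" "swap.KK v u = - KK u v" "swap.RR v u = RR u v" for u v
    unfolding swap.NN_def NN_def swap.KK_def KK_def swap.RR_def RR_def by (simp_all add: algebra_simps minus_divide_left)
  have RRpos: "RR (fst z) (snd z) > 0" if "fst z > 0" "snd z > 0" "2 * s * (fst z * snd z) \<le> NN (fst z) (snd z)" for z
  proof -
    have "2 * s * (fst z * snd z) > 0" using that s0 by simp
    hence "NN (fst z) (snd z) > 0" using that by linarith
    thus ?thesis unfolding RR_def using that s0 a0 by simp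
  qed
  have P_eq: "P = Full \<alpha> \<beta> \<inter> {z. KK (fst z) (snd z) > 0}"
  proof (intro set_eqI iffI)
    fix z assume z: "z \<in> P"
    have "RR (fst z) (snd z) > 0" using z RRpos[of z] unfolding P_def Reg_def by auto
    hence "\<alpha> * RR (fst z) (snd z) \<le> max \<alpha> 0 * RR (fst z) (snd z)" by (intro mult_right_mono) auto
    thus "z \<in> Full \<alpha> \<beta> \<inter> {z. KK (fst z) (snd z) > 0}" using z unfolding P_def Reg_def Full_def by auto
  next
    fix z assume z: "z \<in> Full \<alpha> \<beta> \<inter> {z. KK (fst z) (snd z) > 0}"
    thus "z \<in> P" unfolding P_def Reg_def Full_def by (auto simp: max_def)
  qed
  have M_eq: "M = Full \<alpha> \<beta> \<inter> {z. KK (fst z) (snd z) < 0}"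
  proof (intro set_eqI iffI)
    fix z assume z: "z \<in> M"
    have c: "fst z > 0" "snd z > 0" "2 * s * (fst z * snd z) \<le> NN (fst z) (snd z)" "NN (fst z) (snd z) \<le> 2 * s * a"
       "0 < - KK (fst z) (snd z)" "max (- \<beta>) 0 * RR (fst z) (snd z) \<le> - KK (fst z) (snd z)" "- KK (fst z) (snd z) \<le> - \<alpha> * RR (fst z) (snd z)"
      using z unfolding M_def swap.Reg_def by (auto simp: sw mult.commute)
    have "- \<beta> * RR (fst z) (snd z) \<le> max (- \<beta>) 0 * RR (fst z) (snd z)" using RRpos[OF c(1-3)] by (intro mult_right_mono) auto
    thus "z \<in> Full \<alpha> \<beta> \<inter> {z. KK (fst z) (snd z) < 0}" using c unfolding Full_def by auto
  next
    fix z assume z: "z \<in> Full \<alpha> \<beta> \<inter> {z. KK (fst z) (snd z) < 0}"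
    thus "z \<in> M" unfolding M_def swap.Reg_def Full_def by (auto simp: sw max_def mult.commute)
  qed
  have Zn: "emeasure lborel Z = 0"
  proof -
    define Z' where "Z' = {z :: real \<times> real. A * fst z * fst z - C * snd z * snd z = 0}"
    have "Z \<subseteq> Z'" unfolding Z_def Z'_def KK_def using a0 by auto
    moreover have cl: "closed Z'" unfolding Z'_def by (intro closed_Collect_eq continuous_intros)
    moreover have "emeasure lborel Z' = 0"
    proof (rule null_slices[OF cl])
      fix y :: real
      have "A \<noteq> 0" using AC0 by auto
      hence "[:- (C * y * y), 0, A:] \<noteq> 0" by simp
      hence "finite {x. (A * x * x - C * y * y) = 0}"
        by (intro finite_poly_zeros[of _ "[:- (C * y * y), 0, A:]"]) (auto simp: algebra_simps)
      thus "finite {x. (x, y) \<in> Z'}" unfolding Z'_def by simp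
    qed
    ultimately show ?thesis using emeasure_mono[of Z Z' lborel] by auto
  qed
  have mP: "P \<in> sets borel" unfolding P_def by (rule borel_regions)
  have mM: "M \<in> sets borel"
  proof -
    have "(\<lambda>z. (snd z, fst z)) \<in> borel_measurable (borel :: (real \<times> real) measure)"
      by (intro borel_measurable_continuous_onI continuous_intros)
    from measurable_sets[OF this swap.borel_regions(1)] show ?thesis unfolding M_def by (simp add: vimage_def)
  qed
  have mZ: "Z \<in> sets borel" unfolding Z_def using borel_regions(2)[of \<alpha> \<beta>] borel_fns(2) by (auto intro!: sets.Int)
  have full: "Full \<alpha> \<beta> = (P \<union> M) \<union> Z" unfolding P_eq M_eq Z_def by auto
  have d: "(P \<union> M) \<inter> Z = {}" "P \<inter> M = {}" unfolding P_eq M_eq Z_def by auto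
  have "emeasure lborel (Full \<alpha> \<beta>) = emeasure lborel (P \<union> M) + emeasure lborel Z"
    unfolding full by (rule plus_emeasure[symmetric]) (use mP mM mZ d(1) in simp_all)
  also have "\<dots> = emeasure lborel (P \<union> M)" unfolding Zn by simp
  also have "\<dots> = emeasure lborel P + emeasure lborel M"
    by (rule plus_emeasure[symmetric]) (use mP mM d(2) in simp_all)
  also have "emeasure lborel M = emeasure lborel (swap.Reg (max (- \<beta>) 0) (- \<alpha>))"
    unfolding M_def by (rule emeasure_swap) (rule swap.borel_regions)
  also have "\<dots> = (\<integral>\<^sup>+t. (if max (- \<beta>) 0 \<le> t \<and> t \<le> - \<alpha> \<and> 0 < t
     then ennreal (2 * a * s * (if C > 0 then LL t / (4 * (t * t)) else 0)) else 0) \<partial>lborel)"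
    unfolding swap_LL[symmetric] by (rule swap.Reg_area) simp
  also have "\<dots> = ennreal \<bar>-1\<bar> * (\<integral>\<^sup>+t. (if max (- \<beta>) 0 \<le> 0 + -1 * t \<and> 0 + -1 * t \<le> - \<alpha> \<and> 0 < 0 + -1 * t
     then ennreal (2 * a * s * (if C > 0 then LL (0 + -1 * t) / (4 * ((0 + -1 * t) * (0 + -1 * t))) else 0)) else 0) \<partial>lborel)"
  proof (rule nn_integral_real_affine)
    have [measurable]: "LL \<in> borel_measurable borel" using LL_continuous[of UNIV] by (rule borel_measurable_continuous_onI)
    show "(\<lambda>t. if max (- \<beta>) 0 \<le> t \<and> t \<le> - \<alpha> \<and> 0 < t then ennreal (2 * a * s * (if C > 0 then LL t / (4 * (t * t)) else 0)) else 0) \<in> borel_measurable borel"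
      by measurable
  qed simp
  also have "\<dots> = (\<integral>\<^sup>+t. (if \<alpha> \<le> t \<and> t \<le> \<beta> \<and> t < 0 then ennreal (2 * a * s * dens t) else 0) \<partial>lborel)"
  proof -
    have "(if max (- \<beta>) 0 \<le> 0 + -1 * t \<and> 0 + -1 * t \<le> - \<alpha> \<and> 0 < 0 + -1 * t
     then ennreal (2 * a * s * (if C > 0 then LL (0 + -1 * t) / (4 * ((0 + -1 * t) * (0 + -1 * t))) else 0)) else 0)
     = (if \<alpha> \<le> t \<and> t \<le> \<beta> \<and> t < 0 then ennreal (2 * a * s * dens t) else 0)" for t
      unfolding dens_def by auto
    thus ?thesis by simp
  qed
  also have "emeasure lborel P = (\<integral>\<^sup>+t. (if \<alpha> \<le> t \<and> t \<le> \<beta> \<and> t > 0 then ennreal (2 * a * s * dens t) else 0) \<partial>lborel)"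
    unfolding P_def by (subst Reg_area) (auto intro!: nn_integral_cong simp: dens_def)
  also have "(\<integral>\<^sup>+t. (if \<alpha> \<le> t \<and> t \<le> \<beta> \<and> t > 0 then ennreal (2 * a * s * dens t) else 0) \<partial>lborel)
     + (\<integral>\<^sup>+t. (if \<alpha> \<le> t \<and> t \<le> \<beta> \<and> t < 0 then ennreal (2 * a * s * dens t) else 0) \<partial>lborel)
     = (\<integral>\<^sup>+t. (if \<alpha> \<le> t \<and> t \<le> \<beta> \<and> t > 0 then ennreal (2 * a * s * dens t) else 0) + (if \<alpha> \<le> t \<and> t \<le> \<beta> \<and> t < 0 then ennreal (2 * a * s * dens t) else 0) \<partial>lborel)"
  proof (rule nn_integral_add[symmetric])
    have [measurable]: "dens \<in> borel_measurable borel" using dens_continuous by (rule borel_measurable_continuous_onI)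
    show "(\<lambda>t. if \<alpha> \<le> t \<and> t \<le> \<beta> \<and> t > 0 then ennreal (2 * a * s * dens t) else 0) \<in> borel_measurable lborel"
      "(\<lambda>t. if \<alpha> \<le> t \<and> t \<le> \<beta> \<and> t < 0 then ennreal (2 * a * s * dens t) else 0) \<in> borel_measurable lborel" by measurable
  qed
  also have "\<dots> = (\<integral>\<^sup>+t. (if \<alpha> \<le> t \<and> t \<le> \<beta> then ennreal (2 * a * s * dens t) else 0) \<partial>lborel)"
  proof (rule nn_integral_cong_AE)
    have "AE t in lborel. t \<noteq> (0::real)" by (rule AE_lborel_singleton)
    thus "AE t in lborel. (if \<alpha> \<le> t \<and> t \<le> \<beta> \<and> t > 0 then ennreal (2 * a * s * dens t) else 0) + (if \<alpha> \<le> t \<and> t \<le> \<beta> \<and> t < 0 then ennreal (2 * a * s * dens t) else 0)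
      = (if \<alpha> \<le> t \<and> t \<le> \<beta> then ennreal (2 * a * s * dens t) else 0)"
      by eventually_elim auto
  qed
  also have "\<dots> = ennreal (2 * a * s * integral {\<alpha>..\<beta>} dens)"
    by (rule dens_integral) (use a0 s0 in simp)
  finally show ?thesis .
qed

end

subsection \<open>Pairs of forms\<close>

text \<open>One quarter of the Jacobian determinant of the two forms, a covariant of the pair with
  value \<open>a1 h2 - a2 h1\<close> at \<open>(1, 0)\<close>.\<close>

fun kf :: "form \<Rightarrow> form \<Rightarrow> int \<Rightarrow> int \<Rightarrow> int" where
  "kf (a1, h1, c1) (a2, h2, c2) x y = (a1 * h2 - a2 * h1) * x * x + (a1 * c2 - a2 * c1) * x * y + (h1 * c2 - h2 * c1) * y * y"

fun rkf :: "form \<Rightarrow> form \<Rightarrow> real \<Rightarrow> real \<Rightarrow> real" where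
  "rkf (a1, h1, c1) (a2, h2, c2) x y = of_int (a1 * h2 - a2 * h1) * x * x + of_int (a1 * c2 - a2 * c1) * x * y
     + of_int (h1 * c2 - h2 * c1) * y * y"

text \<open>The polarization of the discriminant, an invariant of the pair; for two equal forms it
  is twice the discriminant.\<close>

fun bb :: "form \<Rightarrow> form \<Rightarrow> int" where
  "bb (a1, h1, c1) (a2, h2, c2) = 2 * h1 * h2 - a1 * c2 - a2 * c1"

lemma rkf_of_int: "rkf P Q (real_of_int x) (real_of_int y) = real_of_int (kf P Q x y)"
  by (cases P; cases Q) simp

lemma kf_act:
  assumes "g \<in> Gamma0 n"
  shows "fst (act P g) * fst (snd (act Q g)) - fst (act Q g) * fst (snd (act P g)) = kf P Q (fst (col g)) (snd (col g))"
proof -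
  obtain p r q s where g: "g = (p, r, q, s)" by (cases g)
  obtain a1 h1 c1 where P: "P = (a1, h1, c1)" by (cases P)
  obtain a2 h2 c2 where Q: "Q = (a2, h2, c2)" by (cases Q)
  have det: "p * s - r * q = 1" using assms unfolding g Gamma0_def by auto
  have "fst (act P g) * fst (snd (act Q g)) - fst (act Q g) * fst (snd (act P g)) = kf P Q p q * (p * s - r * q)"
    unfolding P Q g act.simps kf.simps fst_conv snd_conv by algebra
  thus ?thesis unfolding det by (simp add: g col_def)
qed

context root_setup
begin

definition gpair :: "form \<Rightarrow> form \<Rightarrow> bool" where
  "gpair P Q \<longleftrightarrow> P \<in> rforms \<and> Q \<in> rforms \<and> fst P > 0 \<and> fst Q > 0 \<and> P \<noteq> Q"

text \<open>Chosen so that \<open>pA u\<^sup>2 + 2 pB u v + pC v\<^sup>2\<close> is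
  \<open>2 * sqrt D * fst P\<close> times \<open>Q\<close> in the coordinates
  \<open>u = xi P\<close>, \<open>v = eta P\<close>.\<close>

definition pB where "pB P Q = real_of_int (bb P Q) / (2 * sqrt D)"
definition pA where "pA P Q = (sqrt D * real_of_int (fst Q) + real_of_int (kf P Q 1 0)) / real_of_int (fst P) - pB P Q"
definition pC where "pC P Q = (sqrt D * real_of_int (fst Q) - real_of_int (kf P Q 1 0)) / real_of_int (fst P) - pB P Q"

text \<open>The proportions make all coefficients proportional; equal discriminants and positive
  leading coefficients make the factor 1.\<close>

lemma proportional_forms:
  fixes a1 h1 c1 a2 h2 c2 :: int
  assumes "a1 > 0" "a2 > 0" "h1 * h1 - a1 * c1 = D" "h2 * h2 - a2 * c2 = D" "a1 * h2 = a2 * h1" "a1 * c2 = a2 * c1"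
  shows "a1 = a2 \<and> h1 = h2 \<and> c1 = c2"
proof -
  have "a1 * a1 * (h2 * h2 - a2 * c2) = (a1 * h2) * (a1 * h2) - a1 * a2 * (a1 * c2)" by algebra
  also have "\<dots> = a2 * a2 * (h1 * h1 - a1 * c1)" unfolding assms(5,6) by algebra
  finally have "a1 * a1 = a2 * a2" using assms(3,4) D1 by simp
  hence "a1 = a2" using assms(1,2) by (simp add: square_eq_iff)
  thus ?thesis using assms by simp
qed

text \<open>All follows from \<open>e\<^sup>2 = D (a1\<^sup>2 + a2\<^sup>2) - b a1 a2\<close> with
  \<open>e = a1 h2 - a2 h1\<close> and the joint invariant \<open>b\<close>. For
  \<open>b = 2 D\<close> the right side is \<open>D (a1 - a2)\<^sup>2\<close>, so
  \<open>e = 0\<close>, \<open>a1 = a2\<close> and the forms coincide; for \<open>b = - 2 D\<close>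
  it is \<open>D (a1 + a2)\<^sup>2\<close>, against positivity. Both exclusions give
  \<open>A * C \<noteq> 0\<close>, the former gives the gap.\<close>

lemma pair_interp:
  assumes "gpair P Q"
  shows "pair_area_gap (sqrt D) (real_of_int (fst P)) (pA P Q) (pB P Q) (pC P Q)"
proof -
  obtain a1 h1 c1 where P: "P = (a1, h1, c1)" by (cases P)
  obtain a2 h2 c2 where Q: "Q = (a2, h2, c2)" by (cases Q)
  have h: "h1 * h1 - a1 * c1 = D" "h2 * h2 - a2 * c2 = D" "a1 > 0" "a2 > 0" "P \<noteq> Q"
    using assms dsc_rforms unfolding gpair_def P Q by auto
  define s where "s = sqrt (real_of_int D)"
  have s: "s * s = D" "s > 0" using sqD unfolding s_def by auto
  define b where "b = bb P Q"
  define e where "e = a1 * h2 - a2 * h1"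
  have syz: "e * e = D * (a1 * a1 + a2 * a2) - b * a1 * a2"
  proof -
    have "e * e = (h1 * h1 - a1 * c1) * (a2 * a2) + (h2 * h2 - a2 * c2) * (a1 * a1) - b * a1 * a2"
      unfolding e_def b_def P Q bb.simps by algebra
    thus ?thesis using h by (simp add: algebra_simps)
  qed
  have b1: "b \<noteq> 2 * D"
  proof
    assume "b = 2 * D"
    hence "e * e = D * ((a1 - a2) * (a1 - a2))" using syz by (simp add: algebra_simps)
    hence "e = 0" "a1 = a2" using square_multiple[of e "a1 - a2"] by auto
    hence "h1 = h2" using h unfolding e_def by (simp add: mult.commute)
    have "h1 * h1 - a1 * c1 = h2 * h2 - a2 * c2" using h by simp
    hence "a1 * c1 = a1 * c2" unfolding \<open>a1 = a2\<close> \<open>h1 = h2\<close> by linarith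
    thus False using h \<open>a1 = a2\<close> \<open>h1 = h2\<close> unfolding P Q by simp
  qed
  have b2: "b \<noteq> - 2 * D"
  proof
    assume "b = - 2 * D"
    hence "e * e = D * ((a1 + a2) * (a1 + a2))" using syz by (simp add: algebra_simps)
    thus False using square_multiple(1)[of e "a1 + a2"] h by auto
  qed
  have e_kf: "kf P Q 1 0 = e" unfolding P Q e_def by simp
  have Bs: "2 * s * pB P Q = b" unfolding pB_def b_def s_def[symmetric] using s by simp
  have BB: "4 * real_of_int D * (pB P Q * pB P Q) = b * b"
  proof -
    have "4 * real_of_int D * (pB P Q * pB P Q) = (2 * s * pB P Q) * (2 * s * pB P Q)" using s(1)[symmetric] by simp
    thus ?thesis unfolding Bs by simp
  qed
  define R1 R2 E BR where "R1 = real_of_int a1" and "R2 = real_of_int a2" and "E = real_of_int e" and "BR = pB P Q"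
  have R1: "R1 > 0" unfolding R1_def using h by simp
  have syzr: "E * E = D * (R1 * R1 + R2 * R2) - 2 * s * BR * R1 * R2"
    using arg_cong[OF syz, of real_of_int] unfolding R1_def R2_def E_def BR_def Bs by simp
  have A: "R1 * pA P Q = s * R2 + E - BR * R1" unfolding pA_def e_kf
    unfolding s_def[symmetric] BR_def R1_def R2_def E_def P Q using h by (simp add: field_simps)
  have C: "R1 * pC P Q = s * R2 - E - BR * R1" unfolding pC_def e_kf
    unfolding s_def[symmetric] BR_def R1_def R2_def E_def P Q using h by (simp add: field_simps)
  have "(R1 * R1) * (pA P Q * pC P Q) = (R1 * pA P Q) * (R1 * pC P Q)" by algebra
  also have "\<dots> = (R1 * R1) * (BR * BR - s * s)"
    unfolding A C using syzr s(1) by algebra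
  finally have AC: "pA P Q * pC P Q = pB P Q * pB P Q - s * s" using R1 unfolding BR_def by simp
  have ACn: "pA P Q * pC P Q \<noteq> 0"
  proof
    assume "pA P Q * pC P Q = 0"
    hence "4 * real_of_int D * (pB P Q * pB P Q) = 4 * real_of_int D * real_of_int D" using AC s(1) by simp
    hence "real_of_int (b * b) = real_of_int ((2 * D) * (2 * D))" unfolding BB by simp
    hence "b * b = (2 * D) * (2 * D)" by (simp only: of_int_eq_iff)
    hence "b = 2 * D \<or> b = - (2 * D)" by (simp only: square_eq_iff)
    thus False using b1 b2 by auto
  qed
  have "1 \<le> 2 * D - b \<or> 1 \<le> b - 2 * D" using b1 by linarith
  hence "1 \<le> real_of_int (2 * D - b) \<or> 1 \<le> real_of_int (b - 2 * D)" by (simp only: of_int_1_le_iff)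
  hence "1 \<le> 2 * s * s - 2 * s * pB P Q \<or> 1 \<le> 2 * s * pB P Q - 2 * s * s" using Bs s(1) by (simp add: mult.assoc)
  thus ?thesis using s R1 AC ACn unfolding s_def[symmetric] R1_def P by unfold_locales auto
qed

text \<open>With \<open>X = a1 x + h1 y\<close> one has \<open>u = X + s y\<close> and
  \<open>v = X - s y\<close>; for \<open>Q\<close> and \<open>K\<close> both sides are compared as
  quadratic forms in \<open>X\<close> and \<open>y\<close>.\<close>

lemma pair_coords:
  assumes "gpair P Q"
  defines "u \<equiv> \<lambda>x y. xi P x y" and "v \<equiv> \<lambda>x y. eta P x y"
  shows "pA P Q * u x y * u x y + 2 * pB P Q * u x y * v x y + pC P Q * v x y * v x y = 2 * sqrt D * real_of_int (fst P) * rqf Q x y"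
    "(pA P Q * u x y * u x y - pC P Q * v x y * v x y) / (2 * real_of_int (fst P)) = rkf P Q x y"
    "u x y * v x y / real_of_int (fst P) = rqf P x y"
proof -
  obtain a1 h1 c1 where P: "P = (a1, h1, c1)" by (cases P)
  obtain a2 h2 c2 where Q: "Q = (a2, h2, c2)" by (cases Q)
  have h: "h1 * h1 - a1 * c1 = D" "h2 * h2 - a2 * c2 = D" "a1 > 0" "a2 > 0"
    using assms(1) dsc_rforms unfolding gpair_def P Q by auto
  define s where "s = sqrt (real_of_int D)"
  define d where "d = real_of_int D"
  have s: "s * s = d" "s > 0" using sqD unfolding s_def d_def by auto
  define R1 H1 C1 R2 H2 C2 where "R1 = real_of_int a1" and "H1 = real_of_int h1" and "C1 = real_of_int c1"
    and "R2 = real_of_int a2" and "H2 = real_of_int h2" and "C2 = real_of_int c2"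
  have R1: "R1 > 0" unfolding R1_def using h by simp
  have d1: "d = H1 * H1 - R1 * C1" unfolding d_def H1_def R1_def C1_def using h(1) by (metis of_int_diff of_int_mult)
  define E Bt where "E = R1 * H2 - R2 * H1" and "Bt = 2 * H1 * H2 - R1 * C2 - R2 * C1"
  define X where "X = R1 * x + H1 * y"
  have uX: "u x y = X + s * y" and vX: "v x y = X - s * y"
    unfolding u_def v_def xi_def eta_def X_def P R1_def H1_def s_def by (simp_all add: algebra_simps)
  have sB: "2 * s * pB P Q = Bt" unfolding pB_def s_def[symmetric] Bt_def P Q H1_def H2_def R1_def R2_def C1_def C2_def using s by simp
  have A: "2 * s * R1 * pA P Q = 2 * d * R2 + 2 * s * E - R1 * Bt"
  proof -
    have "R1 * pA P Q = s * R2 + E - R1 * pB P Q" unfolding pA_def s_def[symmetric] P Q R1_def R2_def E_def H1_def H2_def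
      using h by (simp add: field_simps)
    hence "2 * s * R1 * pA P Q = 2 * s * (s * R2 + E) - R1 * (2 * s * pB P Q)" by algebra
    thus ?thesis unfolding sB using s(1) by (simp add: algebra_simps)
  qed
  have C: "2 * s * R1 * pC P Q = 2 * d * R2 - 2 * s * E - R1 * Bt"
  proof -
    have "R1 * pC P Q = s * R2 - E - R1 * pB P Q" unfolding pC_def s_def[symmetric] P Q R1_def R2_def E_def H1_def H2_def
      using h by (simp add: field_simps)
    hence "2 * s * R1 * pC P Q = 2 * s * (s * R2 - E) - R1 * (2 * s * pB P Q)" by algebra
    thus ?thesis unfolding sB using s(1) by (simp add: algebra_simps)
  qed
  have rq: "rqf Q x y = R2 * x * x + 2 * H2 * x * y + C2 * y * y" unfolding Q R2_def H2_def C2_def by simp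
  have rk: "rkf P Q x y = E * x * x + (R1 * C2 - R2 * C1) * x * y + (H1 * C2 - H2 * C1) * y * y"
    unfolding P Q E_def R1_def R2_def H1_def H2_def C1_def C2_def by simp
  have i1: "R1 * R1 * rqf Q x y = R2 * (X * X + d * (y * y)) - R1 * Bt * (y * y) + 2 * E * X * y"
    unfolding rq X_def E_def Bt_def d1 by algebra
  have i2: "R1 * R1 * rkf P Q x y = E * (X * X + d * (y * y)) + (2 * d * R2 - R1 * Bt) * X * y"
    unfolding rk X_def E_def Bt_def d1 by algebra
  have "(2 * s * R1) * (pA P Q * u x y * u x y + 2 * pB P Q * u x y * v x y + pC P Q * v x y * v x y)
      = (2 * s * R1 * pA P Q) * (u x y * u x y) + 2 * R1 * (2 * s * pB P Q) * (u x y * v x y) + (2 * s * R1 * pC P Q) * (v x y * v x y)"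
    by algebra
  also have "\<dots> = 4 * d * (R2 * (X * X + d * (y * y)) - R1 * Bt * (y * y) + 2 * E * X * y)"
    unfolding A C sB uX vX s(1)[symmetric] by algebra
  also have "\<dots> = 4 * d * (R1 * R1 * rqf Q x y)" unfolding i1 ..
  also have "\<dots> = (2 * s * R1) * (2 * s * R1 * rqf Q x y)" unfolding s(1)[symmetric] by algebra
  finally show "pA P Q * u x y * u x y + 2 * pB P Q * u x y * v x y + pC P Q * v x y * v x y = 2 * sqrt D * real_of_int (fst P) * rqf Q x y"
    using s(2) R1 unfolding s_def[symmetric] P R1_def by simp
  have "(2 * s * R1) * (pA P Q * u x y * u x y - pC P Q * v x y * v x y)
      = (2 * s * R1 * pA P Q) * (u x y * u x y) - (2 * s * R1 * pC P Q) * (v x y * v x y)" by algebra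
  also have "\<dots> = 4 * s * (E * (X * X + d * (y * y)) + (2 * d * R2 - R1 * Bt) * X * y)"
    unfolding A C uX vX s(1)[symmetric] by algebra
  also have "\<dots> = (2 * s * R1) * (2 * R1 * rkf P Q x y)" unfolding i2[symmetric] by algebra
  finally have "pA P Q * u x y * u x y - pC P Q * v x y * v x y = 2 * R1 * rkf P Q x y" using s(2) R1 by simp
  thus "(pA P Q * u x y * u x y - pC P Q * v x y * v x y) / (2 * real_of_int (fst P)) = rkf P Q x y"
    using R1 unfolding P R1_def by simp
  show "u x y * v x y / real_of_int (fst P) = rqf P x y"
    using xi_eta[of P x y] h R1 unfolding u_def v_def P R1_def by simp
qed

text \<open>The flag \<open>e\<close> selects the weak or the strict comparison of the forms. One
  order of the moduli will use the weak, the other the strict one, so that equal moduli are not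
  counted twice.\<close>

definition Om :: "bool \<Rightarrow> form \<Rightarrow> form \<Rightarrow> real \<Rightarrow> real \<Rightarrow> (real \<times> real) set" where
  "Om e P Q \<alpha> \<beta> = {z. 0 < xi P (fst z) (snd z) \<and> 0 < eta P (fst z) (snd z)
     \<and> (if e then rqf P (fst z) (snd z) \<le> rqf Q (fst z) (snd z) else rqf P (fst z) (snd z) < rqf Q (fst z) (snd z))
     \<and> rqf Q (fst z) (snd z) \<le> 1
     \<and> \<alpha> * (rqf P (fst z) (snd z) * rqf Q (fst z) (snd z)) \<le> rkf P Q (fst z) (snd z)
     \<and> rkf P Q (fst z) (snd z) \<le> \<beta> * (rqf P (fst z) (snd z) * rqf Q (fst z) (snd z))}"

definition pdens :: "form \<Rightarrow> form \<Rightarrow> real \<Rightarrow> real" where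
  "pdens P Q = pair_area_gap.dens (sqrt D) (pA P Q) (pB P Q) (pC P Q)"

lemma cont_forms:
  "continuous_on UNIV (\<lambda>z. xi P (fst z) (snd z))" "continuous_on UNIV (\<lambda>z. eta P (fst z) (snd z))"
  "continuous_on UNIV (\<lambda>z. rqf P (fst z) (snd z))" "continuous_on UNIV (\<lambda>z. rkf P Q (fst z) (snd z))"
  unfolding xi_def eta_def by (cases P; cases Q; simp; intro continuous_intros)+

lemma Om_borel: "Om e P Q \<alpha> \<beta> \<in> sets borel"
proof -
  note [measurable] = cont_forms[THEN borel_measurable_continuous_onI]
  show ?thesis unfolding Om_def by (cases e) (simp_all, measurable)
qed

text \<open>The bounds for \<open>Q\<close> and for \<open>u v\<close> control
  \<open>A u\<^sup>2 + C v\<^sup>2\<close>, and the bound for \<open>K\<close> controls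
  \<open>A u\<^sup>2 - C v\<^sup>2\<close>; hence both squares are bounded, as neither
  \<open>A\<close> nor \<open>C\<close> is 0.\<close>

lemma Om_bounded:
  assumes "gpair P Q"
  shows "bounded (Om e P Q \<alpha> \<beta>)"
proof -
  interpret pa: pair_area_gap "sqrt D" "real_of_int (fst P)" "pA P Q" "pB P Q" "pC P Q" by (rule pair_interp[OF assms])
  define a where "a = real_of_int (fst P)"
  define s where "s = sqrt (real_of_int D)"
  define c where "c = max \<bar>\<alpha>\<bar> \<bar>\<beta>\<bar>"
  define S where "S = 2 * s * a + 2 * \<bar>pB P Q\<bar> * a + 2 * a * c"
  have a0: "a > 0" and s0: "s > 0" and c0: "c \<ge> 0" using pa.a0 pa.s0 unfolding a_def s_def c_def by auto
  have AC: "pA P Q \<noteq> 0" "pC P Q \<noteq> 0" using pa.AC0 by auto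
  show ?thesis
  proof (rule xi_eta_bound[of P _ "sqrt (S / \<bar>pA P Q\<bar>) + sqrt (S / \<bar>pC P Q\<bar>)"])
    show "fst P \<noteq> 0" using assms unfolding gpair_def by auto
    fix z assume z: "z \<in> Om e P Q \<alpha> \<beta>"
    define x y where "x = fst z" and "y = snd z"
    define u v where "u = xi P x y" and "v = eta P x y"
    have pos: "u > 0" "v > 0" and le: "rqf P x y \<le> rqf Q x y" "rqf Q x y \<le> 1"
      and k: "\<alpha> * (rqf P x y * rqf Q x y) \<le> rkf P Q x y" "rkf P Q x y \<le> \<beta> * (rqf P x y * rqf Q x y)"
      using z unfolding Om_def x_def y_def u_def v_def by (auto split: if_splits)
    note co = pair_coords[OF assms, of x y, folded u_def v_def a_def s_def]
    have rp: "rqf P x y > 0" using co(3) pos a0 by (metis divide_pos_pos mult_pos_pos)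
    have uv: "u * v \<le> a" using co(3) le a0 by (simp add: field_simps)
    have pr: "0 \<le> rqf P x y * rqf Q x y" "rqf P x y * rqf Q x y \<le> 1"
      using rp le mult_le_one[of "rqf P x y" "rqf Q x y"] by auto
    have kk: "\<bar>rkf P Q x y\<bar> \<le> c"
    proof -
      have "\<bar>\<beta> * (rqf P x y * rqf Q x y)\<bar> \<le> \<bar>\<beta>\<bar> * 1" "\<bar>\<alpha> * (rqf P x y * rqf Q x y)\<bar> \<le> \<bar>\<alpha>\<bar> * 1"
        unfolding abs_mult using pr by (intro mult_left_mono; simp)+
      thus ?thesis using k unfolding c_def by linarith
    qed
    define N where "N = pA P Q * u * u + 2 * pB P Q * u * v + pC P Q * v * v"
    have N: "0 \<le> N" "N \<le> 2 * s * a"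
      unfolding N_def co(1) using le rp s0 a0 by (auto intro!: mult_nonneg_nonneg simp: mult_le_cancel_left1)
    have K: "pA P Q * u * u - pC P Q * v * v = 2 * a * rkf P Q x y" using co(2) a0 by (simp add: field_simps)
    have Kb: "\<bar>pA P Q * u * u - pC P Q * v * v\<bar> \<le> 2 * a * c" unfolding K using kk a0 by (simp add: abs_mult)
    have Bb: "\<bar>2 * pB P Q * u * v\<bar> \<le> 2 * \<bar>pB P Q\<bar> * a"
      using uv pos mult_left_mono[of "u * v" a "2 * \<bar>pB P Q\<bar>"] by (simp add: abs_mult mult.assoc)
    have "\<bar>pA P Q * u * u + pC P Q * v * v\<bar> \<le> 2 * s * a + 2 * \<bar>pB P Q\<bar> * a" using N Bb unfolding N_def by linarith
    hence "\<bar>pA P Q * u * u\<bar> \<le> S" "\<bar>pC P Q * v * v\<bar> \<le> S" using Kb unfolding S_def by linarith+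
    hence "u * u \<le> S / \<bar>pA P Q\<bar>" "v * v \<le> S / \<bar>pC P Q\<bar>" using AC pos by (auto simp: field_simps abs_mult)
    hence "u \<le> sqrt (S / \<bar>pA P Q\<bar>)" "v \<le> sqrt (S / \<bar>pC P Q\<bar>)" by (auto intro!: real_le_rsqrt simp: power2_eq_square)
    moreover have "0 \<le> sqrt (S / \<bar>pA P Q\<bar>)" "0 \<le> sqrt (S / \<bar>pC P Q\<bar>)" using calculation pos by linarith+
    ultimately show "\<bar>xi P (fst z) (snd z)\<bar> \<le> sqrt (S / \<bar>pA P Q\<bar>) + sqrt (S / \<bar>pC P Q\<bar>)
        \<and> \<bar>eta P (fst z) (snd z)\<bar> \<le> sqrt (S / \<bar>pA P Q\<bar>) + sqrt (S / \<bar>pC P Q\<bar>)"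
      using pos unfolding u_def v_def x_def y_def by auto
  qed
qed

text \<open>In the last case the polynomial has degree 4 for \<open>t \<noteq> 0\<close>; for
  \<open>t = 0\<close> it is \<open>K\<close>, which does not vanish identically on the line because
  distinct forms are not proportional.\<close>

lemma Om_slices:
  fixes t y :: real
  assumes g: "gpair P Q" and y: "y \<noteq> 0"
  shows "finite {x. rqf Q x y - rqf P x y = 0}" "finite {x. 1 - rqf Q x y = 0}"
    "finite {x. rkf P Q x y - t * (rqf P x y * rqf Q x y) = 0}"
proof -
  obtain a1 h1 c1 where P: "P = (a1, h1, c1)" by (cases P)
  obtain a2 h2 c2 where Q: "Q = (a2, h2, c2)" by (cases Q)
  have h: "h1 * h1 - a1 * c1 = D" "h2 * h2 - a2 * c2 = D" "a1 > 0" "a2 > 0" "P \<noteq> Q"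
    using g dsc_rforms unfolding gpair_def P Q by auto
  show "finite {x. rqf Q x y - rqf P x y = 0}"
    by (rule finite_poly_zeros[of _ "[:of_int (c2 - c1) * y * y, 2 * of_int (h2 - h1) * y, of_int (a2 - a1):]"])
       (use h y in \<open>auto simp: P Q algebra_simps\<close>)
  show "finite {x. 1 - rqf Q x y = 0}"
    by (rule finite_poly_zeros[of _ "[:1 - of_int c2 * y * y, - (2 * of_int h2 * y), - of_int a2:]"])
       (use h in \<open>auto simp: Q algebra_simps\<close>)
  have nz: "a1 * h2 - a2 * h1 \<noteq> 0 \<or> a1 * c2 - a2 * c1 \<noteq> 0"
    using proportional_forms[OF h(3,4,1,2)] h(5) unfolding P Q by auto
  define p where "p = [:of_int (h1 * c2 - h2 * c1) * y * y, of_int (a1 * c2 - a2 * c1) * y, of_int (a1 * h2 - a2 * h1):]"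
  define p1 where "p1 = [:of_int c1 * y * y, 2 * of_int h1 * y, of_int a1:]"
  define p2 where "p2 = [:of_int c2 * y * y, 2 * of_int h2 * y, of_int a2:]"
  show "finite {x. rkf P Q x y - t * (rqf P x y * rqf Q x y) = 0}"
  proof (rule finite_poly_zeros[of _ "p - smult t (p1 * p2)"])
    show "rkf P Q x y - t * (rqf P x y * rqf Q x y) = poly (p - smult t (p1 * p2)) x" for x
    proof -
      have "poly p x = rkf P Q x y" "poly p1 x = rqf P x y" "poly p2 x = rqf Q x y"
        unfolding p_def p1_def p2_def P Q by (auto simp: algebra_simps)
      thus ?thesis by simp
    qed
    have p0: "p \<noteq> 0" unfolding p_def using nz y by (auto simp del: of_int_diff of_int_mult)
    have dp: "degree p \<le> 2" unfolding p_def by (simp add: degree_pCons_le)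
    have d12: "degree p1 = 2" "degree p2 = 2" unfolding p1_def p2_def using h by auto
    have dd: "degree (p1 * p2) = 4" using d12 by (subst degree_mult_eq) auto
    show "p - smult t (p1 * p2) \<noteq> 0"
    proof (cases "t = 0")
      case True thus ?thesis using p0 by simp
    next
      case False
      have "coeff (p - smult t (p1 * p2)) 4 = - t * coeff (p1 * p2) 4"
        using dp by (simp add: coeff_eq_0)
      also have "coeff (p1 * p2) 4 \<noteq> 0" using dd by (metis degree_0 leading_coeff_0_iff zero_neq_numeral)
      hence "- t * coeff (p1 * p2) 4 \<noteq> 0" using False by simp
      finally show ?thesis by (metis coeff_0)
    qed
  qed
qed

lemma Om_frontier:
  assumes g: "gpair P Q"
  shows "emeasure lborel (frontier (Om e P Q \<alpha> \<beta>)) = 0"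
proof -
  define f :: "nat \<Rightarrow> real \<times> real \<Rightarrow> real" where "f i z = [xi P (fst z) (snd z), eta P (fst z) (snd z),
    rqf Q (fst z) (snd z) - rqf P (fst z) (snd z), 1 - rqf Q (fst z) (snd z),
    rkf P Q (fst z) (snd z) - \<alpha> * (rqf P (fst z) (snd z) * rqf Q (fst z) (snd z)),
    \<beta> * (rqf P (fst z) (snd z) * rqf Q (fst z) (snd z)) - rkf P Q (fst z) (snd z)] ! i" for i z
  show ?thesis
  proof (rule frontier_sign_conditions[of "{..<6}" f])
    fix i :: nat assume "i \<in> {..<6}"
    hence i: "i = 0 \<or> i = 1 \<or> i = 2 \<or> i = 3 \<or> i = 4 \<or> i = 5" by auto
    show "continuous_on UNIV (f i)"
      using i by (elim disjE; simp add: f_def; intro continuous_intros cont_forms)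
    fix y :: real assume y: "y \<noteq> 0"
    let ?h = "real_of_int (fst (snd P))" and ?w = "sqrt (real_of_int D)" and ?a = "real_of_int (fst P)"
    have a0: "fst P > 0" using g unfolding gpair_def by simp
    show "finite {x. f i (x, y) = 0}"
      using i
    proof (elim disjE)
      assume "i = 0"
      thus ?thesis
        by (intro finite_poly_zeros[of _ "[:(?h + ?w) * y, ?a:]"]) (use a0 in \<open>auto simp: f_def xi_def\<close>)
    next
      assume "i = 1"
      thus ?thesis
        by (intro finite_poly_zeros[of _ "[:(?h - ?w) * y, ?a:]"]) (use a0 in \<open>auto simp: f_def eta_def\<close>)
    next
      assume "i = 2" thus ?thesis using Om_slices(1)[OF g y] by (simp add: f_def)
    next
      assume "i = 3" thus ?thesis using Om_slices(2)[OF g y] by (simp add: f_def)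
    next
      assume "i = 4" thus ?thesis using Om_slices(3)[OF g y, of \<alpha>] by (simp add: f_def)
    next
      assume i: "i = 5"
      have "{x. f i (x, y) = 0} = {x. rkf P Q x y - \<beta> * (rqf P x y * rqf Q x y) = 0}" by (auto simp: f_def i)
      thus ?thesis using Om_slices(3)[OF g y, of \<beta>] by simp
    qed
  next
    fix z z' assume "\<And>i. i \<in> {..<6::nat} \<Longrightarrow> sgn (f i z) = sgn (f i z')"
    hence "(0 < f i z \<longleftrightarrow> 0 < f i z') \<and> (0 \<le> f i z \<longleftrightarrow> 0 \<le> f i z')" if "i < 6" for i
      using that by (intro sgn_eq_iffs) auto
    from this[of 0] this[of 1] this[of 2] this[of 3] this[of 4] this[of 5]
    have "0 < f 0 z \<and> 0 < f 1 z \<and> (if e then 0 \<le> f 2 z else 0 < f 2 z) \<and> 0 \<le> f 3 z \<and> 0 \<le> f 4 z \<and> 0 \<le> f 5 z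
        \<longleftrightarrow> 0 < f 0 z' \<and> 0 < f 1 z' \<and> (if e then 0 \<le> f 2 z' else 0 < f 2 z') \<and> 0 \<le> f 3 z' \<and> 0 \<le> f 4 z' \<and> 0 \<le> f 5 z'" by simp
    moreover have "z \<in> Om e P Q \<alpha> \<beta> \<longleftrightarrow> 0 < f 0 z \<and> 0 < f 1 z \<and> (if e then 0 \<le> f 2 z else 0 < f 2 z) \<and> 0 \<le> f 3 z \<and> 0 \<le> f 4 z \<and> 0 \<le> f 5 z" for z
      unfolding Om_def f_def by simp
    ultimately show "z \<in> Om e P Q \<alpha> \<beta> \<longleftrightarrow> z' \<in> Om e P Q \<alpha> \<beta>" by blast
  qed auto
qed

lemma Om_area:
  assumes g: "gpair P Q"
  shows "measure lborel (Om e P Q \<alpha> \<beta>) = integral {\<alpha>..\<beta>} (pdens P Q)"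
proof -
  interpret pa: pair_area_gap "sqrt D" "real_of_int (fst P)" "pA P Q" "pB P Q" "pC P Q" by (rule pair_interp[OF g])
  define a where "a = real_of_int (fst P)"
  define s where "s = sqrt (real_of_int D)"
  define I where "I = integral {\<alpha>..\<beta>} (pdens P Q)"
  have a0: "a > 0" and s0: "s > 0" using pa.a0 pa.s0 unfolding a_def s_def by auto
  have I0: "I \<ge> 0" unfolding I_def pdens_def
    using pa.dens_continuous pa.dens_nonneg by (intro integral_nonneg integrable_continuous_interval) (auto intro: continuous_on_subset)
  have Om_eq: "Om True P Q \<alpha> \<beta> = {z. (a * fst z + (real_of_int (fst (snd P)) + s) * snd z, a * fst z + (real_of_int (fst (snd P)) - s) * snd z) \<in> pa.Full \<alpha> \<beta>}"
  proof (rule set_eqI)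
    fix z :: "real \<times> real"
    define x y where "x = fst z" and "y = snd z"
    define u v where "u = xi P x y" and "v = eta P x y"
    note co = pair_coords[OF g, of x y, folded u_def v_def a_def s_def]
    have uv: "a * x + (real_of_int (fst (snd P)) + s) * y = u" "a * x + (real_of_int (fst (snd P)) - s) * y = v"
      unfolding u_def v_def xi_def eta_def a_def s_def by auto
    have N: "pa.NN u v = 2 * s * a * rqf Q x y" unfolding pa.NN_def co(1)[symmetric] by (simp add: a_def s_def)
    have K: "pa.KK u v = rkf P Q x y" unfolding pa.KK_def co(2)[symmetric] by (simp add: a_def)
    have R: "pa.RR u v = rqf P x y * rqf Q x y"
      unfolding pa.RR_def N using co(3) a0 s0 by (simp add: a_def[symmetric] s_def[symmetric])
    have 1: "2 * s * (u * v) \<le> pa.NN u v \<longleftrightarrow> rqf P x y \<le> rqf Q x y"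
    proof -
      have "2 * s * (u * v) = 2 * s * a * rqf P x y" using co(3) a0 by (simp add: field_simps)
      thus ?thesis unfolding N using a0 s0 by simp
    qed
    have 2: "pa.NN u v \<le> 2 * s * a \<longleftrightarrow> rqf Q x y \<le> 1"
    proof -
      have "2 * s * a > 0" using a0 s0 by simp
      from mult_le_cancel_left_pos[OF this, of "rqf Q x y" 1] show ?thesis by (simp only: mult_1_right N)
    qed
    have "z \<in> Om True P Q \<alpha> \<beta> \<longleftrightarrow> (u, v) \<in> pa.Full \<alpha> \<beta>"
      unfolding pa.Full_def Om_def mem_Collect_eq fst_conv snd_conv K R
      unfolding a_def[symmetric] s_def[symmetric] 1 2
      unfolding x_def[symmetric] y_def[symmetric] u_def[symmetric] v_def[symmetric] by simp
    thus "z \<in> Om True P Q \<alpha> \<beta> \<longleftrightarrow> z \<in> {z. (a * fst z + (real_of_int (fst (snd P)) + s) * snd z, a * fst z + (real_of_int (fst (snd P)) - s) * snd z) \<in> pa.Full \<alpha> \<beta>}"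
      unfolding mem_Collect_eq x_def[symmetric] y_def[symmetric] uv .
  qed
  have "ennreal (2 * a * s * I) = ennreal (2 * s * a) * emeasure lborel (Om True P Q \<alpha> \<beta>)"
    using pa.Full_area[of \<alpha> \<beta>] linear_area[OF pa.borel_regions(2)[of \<alpha> \<beta>] a0 s0]
    unfolding Om_eq a_def[symmetric] s_def[symmetric] I_def pdens_def by metis
  moreover have "emeasure lborel (Om True P Q \<alpha> \<beta>) < \<infinity>" by (rule emeasure_bounded_finite[OF Om_bounded[OF g]])
  hence em: "emeasure lborel (Om True P Q \<alpha> \<beta>) = ennreal (measure lborel (Om True P Q \<alpha> \<beta>))"
    by (simp add: emeasure_eq_ennreal_measure less_top)
  ultimately have "ennreal (2 * a * s * I) = ennreal (2 * s * a * measure lborel (Om True P Q \<alpha> \<beta>))"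
    using a0 s0 by (simp add: ennreal_mult)
  hence "2 * a * s * I = 2 * s * a * measure lborel (Om True P Q \<alpha> \<beta>)"
    using a0 s0 I0 by (subst (asm) ennreal_inj) auto
  hence T: "measure lborel (Om True P Q \<alpha> \<beta>) = I" using a0 s0 by simp
  show ?thesis
  proof (cases e)
    case True thus ?thesis using T unfolding I_def by simp
  next
    case False
    \<comment> \<open>The strict and the weak region differ only where the two forms are equal, a
      null set.\<close>
    define Z where "Z = {z :: real \<times> real. rqf Q (fst z) (snd z) - rqf P (fst z) (snd z) = 0}"
    have cl: "closed Z" unfolding Z_def by (intro closed_Collect_eq continuous_intros cont_forms)
    have "emeasure lborel Z = 0"
      by (rule null_slices[OF cl]) (use Om_slices(1)[OF g] in \<open>simp add: Z_def\<close>)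
    hence "Z \<in> null_sets lborel" using cl by (simp add: null_setsI)
    moreover have "Om True P Q \<alpha> \<beta> - Om False P Q \<alpha> \<beta> \<subseteq> Z" "Om False P Q \<alpha> \<beta> \<subseteq> Om True P Q \<alpha> \<beta>" unfolding Om_def Z_def by auto
    ultimately have "emeasure lborel (Om True P Q \<alpha> \<beta>) = emeasure lborel (Om False P Q \<alpha> \<beta>)"
      using Om_borel[of True P Q \<alpha> \<beta>] Om_borel[of False P Q \<alpha> \<beta>]
      by (intro emeasure_eq_AE AE_I'[of Z]) auto
    thus ?thesis using T False unfolding I_def measure_def by simp
  qed
qed

end

context root_setup
begin

subsection \<open>Counting the pairs in one orbit\<close>

definition equivp :: "form \<times> form \<Rightarrow> form \<times> form \<Rightarrow> bool" where
  "equivp p p' \<longleftrightarrow> (\<exists>g\<in>Gamma0 n. p' = (act (fst p) g, act (snd p) g))"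

lemma equivp_refl: "equivp p p"
  unfolding equivp_def by (rule bexI[of _ "(1, 0, 0, 1)"]) (auto simp: act_one Gamma0_one)

lemma equivp_sym: "equivp p p' \<Longrightarrow> equivp p' p"
  unfolding equivp_def using Gamma0_minv act_minv by (metis fst_conv prod.collapse snd_conv)

lemma equivp_trans: "equivp p p' \<Longrightarrow> equivp p' p'' \<Longrightarrow> equivp p p''"
  unfolding equivp_def using Gamma0_mmul act_mmul by (metis fst_conv snd_conv)

text \<open>Only the first form of a pair is normalized. This selects one pair from each class under
  simultaneous translation, while the second form records the integer by which the second root is
  shifted.\<close>

definition normalized :: "form \<Rightarrow> bool" where
  "normalized Q \<longleftrightarrow> 0 \<le> fst (snd Q) \<and> fst (snd Q) < fst Q"

definition ke :: "form \<times> form \<Rightarrow> int" where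
  "ke p = fst (fst p) * fst (snd (snd p)) - fst (snd p) * fst (snd (fst p))"

definition APairs :: "(form \<times> form) set" where
  "APairs = {p. gpair (fst p) (snd p) \<and> normalized (fst p)}"

definition NP :: "bool \<Rightarrow> real \<Rightarrow> real \<Rightarrow> real \<Rightarrow> (form \<times> form) set" where
  "NP e M \<alpha> \<beta> = {p \<in> APairs. (if e then fst (fst p) \<le> fst (snd p) else fst (fst p) < fst (snd p)) \<and> real_of_int (fst (snd p)) \<le> M
     \<and> \<alpha> * real_of_int (fst (fst p) * fst (snd p)) \<le> M * real_of_int (ke p)
     \<and> M * real_of_int (ke p) \<le> \<beta> * real_of_int (fst (fst p) * fst (snd p))}"

text \<open>An automorph with nonzero lower left entry determines its form up to a factor, by
  \<open>automorph_eqs\<close>. A common automorph of distinct forms therefore has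
  \<open>q = 0\<close>, which leaves the scalars 1 and -1.\<close>

lemma pair_stabilizer:
  assumes g: "gpair P Q" and \<sigma>: "\<sigma> \<in> Gamma0 n" "act P \<sigma> = P" "act Q \<sigma> = Q"
  shows "\<sigma> = (1, 0, 0, 1) \<or> \<sigma> = (-1, 0, 0, -1)"
proof -
  obtain a1 h1 c1 where P: "P = (a1, h1, c1)" by (cases P)
  obtain a2 h2 c2 where Q: "Q = (a2, h2, c2)" by (cases Q)
  obtain p r q s where s: "\<sigma> = (p, r, q, s)" by (cases \<sigma>)
  have h: "h1 * h1 - a1 * c1 = D" "h2 * h2 - a2 * c2 = D" "a1 > 0" "a2 > 0" "P \<noteq> Q"
    using g dsc_rforms unfolding gpair_def P Q by auto
  have det: "p * s - r * q = 1" using \<sigma>(1) unfolding s Gamma0_def by auto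
  note e1 = automorph_eqs[OF \<sigma>(2)[unfolded P s] det]
  note e2 = automorph_eqs[OF \<sigma>(3)[unfolded Q s] det]
  have q0: "q = 0"
  proof (rule ccontr)
    assume q: "q \<noteq> 0"
    have "q * (a1 * h2 * 2) = q * (a2 * h1 * 2)" using e1(1) e2(1) by algebra
    hence "a1 * h2 = a2 * h1" using q by simp
    moreover have "q * (a1 * c2) = q * (a2 * c1)" using e1(2) e2(2) by algebra
    hence "a1 * c2 = a2 * c1" using q by simp
    ultimately show False using proportional_forms[OF h(3,4,1,2)] h(5) unfolding P Q by auto
  qed
  have "s = p" "r = 0" using e1 q0 h(3) by auto
  hence "p * p = 1" using det q0 by simp
  hence "p = 1 \<or> p = -1" by (simp add: zmult_eq_1_iff)
  thus ?thesis unfolding s using \<open>s = p\<close> \<open>r = 0\<close> q0 by auto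
qed

definition nrm :: "form \<Rightarrow> int \<times> int \<Rightarrow> mat" where
  "nrm P v = mmul (comp v) (1, - (fst (snd (act P (comp v))) div fst (act P (comp v))), 0, 1)"

lemma Gamma0_translation: "(1, k, 0, 1) \<in> Gamma0 n"
  unfolding Gamma0_def by simp

lemma nrm:
  assumes "dsc P = D" "fst P > 0" "v \<in> vecs P"
  shows "nrm P v \<in> Gamma0 n" "col (nrm P v) = v" "normalized (act P (nrm P v))" "fst (act P (nrm P v)) > 0"
proof -
  have c: "comp v \<in> Gamma0 n" "col (comp v) = v" using assms(3) comp unfolding vecs_def by auto
  show "nrm P v \<in> Gamma0 n" unfolding nrm_def using c Gamma0_translation by (intro Gamma0_mmul)
  show cv: "col (nrm P v) = v" unfolding nrm_def col_translation c ..
  show pos: "fst (act P (nrm P v)) > 0" unfolding fst_act_col cv by (rule qf_pos_vecs[OF assms])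
  obtain a h c' where Q: "act P (comp v) = (a, h, c')" by (cases "act P (comp v)")
  have e: "act P (nrm P v) = (a, h + (- (h div a)) * a, a * (- (h div a)) * (- (h div a)) + 2 * h * (- (h div a)) + c')"
    unfolding nrm_def act_mmul Q fst_conv snd_conv act_translation ..
  have "a > 0" using pos unfolding e by simp
  moreover have "h + (- (h div a)) * a = h mod a" by (simp add: minus_div_mult_eq_mod[symmetric])
  ultimately show "normalized (act P (nrm P v))" unfolding normalized_def e by simp
qed

lemma normalized_translation:
  assumes "normalized Q" "normalized (act Q (1, k, 0, 1))"
  shows "k = 0"
proof -
  obtain a h c where Q: "Q = (a, h, c)" by (cases Q)
  have "0 \<le> h" "h < a" "0 \<le> h + k * a" "h + k * a < a" using assms unfolding Q act_translation normalized_def by auto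
  hence "k * a < 1 * a" "(-1) * a < k * a" "a > 0" by linarith+
  thus ?thesis by (simp only: mult_less_cancel_right) linarith
qed

lemma act_inj: "g \<in> Gamma0 n \<Longrightarrow> act P g = act Q g \<Longrightarrow> P = Q"
  by (metis act_minv(1))

text \<open>Scaling the vector by \<open>1 / sqrt M\<close> divides the forms and \<open>K\<close>
  by \<open>M\<close> and the product of the forms by \<open>M\<^sup>2\<close>; hence the factor
  \<open>M\<close> beside \<open>kf\<close>.\<close>

lemma prim_points_Om:
  assumes "dsc P = D" "fst P > 0" "M > 0"
  shows "prim_points n (sqrt M) (Om e P Q \<alpha> \<beta>) = {v \<in> vecs P.
     (if e then qf P (fst v) (snd v) \<le> qf Q (fst v) (snd v) else qf P (fst v) (snd v) < qf Q (fst v) (snd v))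
     \<and> real_of_int (qf Q (fst v) (snd v)) \<le> M
     \<and> \<alpha> * real_of_int (qf P (fst v) (snd v) * qf Q (fst v) (snd v)) \<le> M * real_of_int (kf P Q (fst v) (snd v))
     \<and> M * real_of_int (kf P Q (fst v) (snd v)) \<le> \<beta> * real_of_int (qf P (fst v) (snd v) * qf Q (fst v) (snd v))}"
proof -
  define X where "X = sqrt M"
  have X: "X > 0" "X * X = M" unfolding X_def using assms(3) by auto
  have rs: "rqf R (x / X) (y / X) = rqf R x y / M" for R x y
    by (cases R) (simp add: X(2)[symmetric] add_divide_distrib)
  have rk: "rkf R S (x / X) (y / X) = rkf R S x y / M" for R S x y
    by (cases R; cases S) (simp add: X(2)[symmetric] add_divide_distrib)
  have "v \<in> scaled_points X (Om e P Q \<alpha> \<beta>) \<longleftrightarrow> xv P v > 0 \<and> ev P v > 0 \<and>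
     (if e then qf P (fst v) (snd v) \<le> qf Q (fst v) (snd v) else qf P (fst v) (snd v) < qf Q (fst v) (snd v))
     \<and> real_of_int (qf Q (fst v) (snd v)) \<le> M
     \<and> \<alpha> * real_of_int (qf P (fst v) (snd v) * qf Q (fst v) (snd v)) \<le> M * real_of_int (kf P Q (fst v) (snd v))
     \<and> M * real_of_int (kf P Q (fst v) (snd v)) \<le> \<beta> * real_of_int (qf P (fst v) (snd v) * qf Q (fst v) (snd v))" for v
  proof -
    define p q k where "p = real_of_int (qf P (fst v) (snd v))" and "q = real_of_int (qf Q (fst v) (snd v))"
      and "k = real_of_int (kf P Q (fst v) (snd v))"
    have MM: "M * M > 0" using assms(3) by simp
    have a: "\<alpha> * (p / M * (q / M)) \<le> k / M \<longleftrightarrow> \<alpha> * (p * q) \<le> M * k"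
      using assms(3) by (simp add: field_simps)
    have b: "k / M \<le> \<beta> * (p / M * (q / M)) \<longleftrightarrow> M * k \<le> \<beta> * (p * q)"
      using assms(3) by (simp add: field_simps)
    have c: "q / M \<le> 1 \<longleftrightarrow> q \<le> M" "p / M \<le> q / M \<longleftrightarrow> p \<le> q" "p / M < q / M \<longleftrightarrow> p < q"
      using assms(3) by (auto simp: divide_le_cancel divide_less_cancel)
    have d: "(0 < xv P v / X) = (0 < xv P v)" "(0 < ev P v / X) = (0 < ev P v)" using X by (auto simp: zero_less_divide_iff)
    have pq: "p \<le> q \<longleftrightarrow> qf P (fst v) (snd v) \<le> qf Q (fst v) (snd v)" "p < q \<longleftrightarrow> qf P (fst v) (snd v) < qf Q (fst v) (snd v)"
      unfolding p_def q_def by auto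
    show ?thesis
      unfolding scaled_points_def Om_def mem_Collect_eq fst_conv snd_conv rs rk xi_scale rqf_of_int rkf_of_int
      unfolding xv_def[symmetric] ev_def[symmetric] of_int_mult p_def[symmetric] q_def[symmetric] k_def[symmetric] a b c d pq ..
  qed
  thus ?thesis unfolding prim_points_def vecs_def X_def by blast
qed

text \<open>A vector \<open>v\<close> goes to the pair moved by the matrix with first column
  \<open>v\<close> that normalizes the first member. It is injective since only 1 and -1 fix a pair
  and positive \<open>xi\<close> decides the sign; it is surjective by the same choice of sign and
  the uniqueness of the normalizing translation.\<close>

lemma pair_count:
  assumes g: "gpair P Q" and M: "M > 0"
  shows "card {p \<in> NP e M \<alpha> \<beta>. equivp (P, Q) p} = card (prim_points n (sqrt M) (Om e P Q \<alpha> \<beta>))"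
proof -
  have P: "dsc P = D" "fst P > 0" "P \<in> rforms" "Q \<in> rforms" "P \<noteq> Q" using g dsc_rforms unfolding gpair_def by auto
  define S where "S = prim_points n (sqrt M) (Om e P Q \<alpha> \<beta>)"
  note S = prim_points_Om[OF P(1,2) M, of e Q \<alpha> \<beta>, folded S_def]
  define \<phi> where "\<phi> v = (act P (nrm P v), act Q (nrm P v))" for v
  have inj: "inj_on \<phi> S"
  proof (rule inj_onI)
    fix v w assume vw: "v \<in> S" "w \<in> S" "\<phi> v = \<phi> w"
    have vv: "v \<in> vecs P" "w \<in> vecs P" using vw unfolding S by auto
    note nv = nrm[OF P(1,2) vv(1)] and nw = nrm[OF P(1,2) vv(2)]
    define \<sigma> where "\<sigma> = mmul (nrm P v) (minv (nrm P w))"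
    have \<sigma>: "\<sigma> \<in> Gamma0 n" unfolding \<sigma>_def using nv nw by (intro Gamma0_mmul Gamma0_minv)
    have "act P \<sigma> = P" "act Q \<sigma> = Q" unfolding \<sigma>_def act_mmul
      using vw(3) act_minv(1)[OF nw(1)] unfolding \<phi>_def by auto
    hence "\<sigma> = (1, 0, 0, 1) \<or> \<sigma> = (-1, 0, 0, -1)" using pair_stabilizer[OF g \<sigma>] by blast
    moreover have "mmul \<sigma> (nrm P w) = nrm P v"
      unfolding \<sigma>_def mmul_assoc minv_cancel[OF nw(1)] mmul_one ..
    hence "v = app \<sigma> w" using col_mmul[of \<sigma> "nrm P w"] nv(2) nw(2) by simp
    moreover have "v \<noteq> app (-1, 0, 0, -1) w"
    proof
      assume "v = app (-1, 0, 0, -1) w"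
      hence "xv P v = - xv P w" unfolding xv_def xi_def by (cases w) simp
      thus False using vv unfolding vecs_def by auto
    qed
    ultimately show "v = w" by (auto simp: app_one)
  qed
  have cond: "\<phi> v \<in> NP e M \<alpha> \<beta> \<longleftrightarrow> v \<in> S" if v: "v \<in> vecs P" for v
  proof -
    note nv = nrm[OF P(1,2) v]
    have f: "fst (act P (nrm P v)) = qf P (fst v) (snd v)" "fst (act Q (nrm P v)) = qf Q (fst v) (snd v)"
      unfolding fst_act_col nv(2) by auto
    have k: "ke (\<phi> v) = kf P Q (fst v) (snd v)" using kf_act[OF nv(1), of P Q] unfolding ke_def \<phi>_def fst_conv snd_conv nv(2) .
    have pos: "qf P (fst v) (snd v) > 0" using qf_pos_vecs[OF P(1,2) v] .
    have "\<phi> v \<in> APairs" if "qf Q (fst v) (snd v) > 0"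
      unfolding APairs_def gpair_def \<phi>_def
      using rforms_act[OF P(3) nv(1)] rforms_act[OF P(4) nv(1)] nv that f act_inj[OF nv(1), of P Q] P(5) by auto
    moreover have "qf Q (fst v) (snd v) > 0" if "v \<in> S" using that pos unfolding S by (auto split: if_splits)
    moreover have "qf Q (fst v) (snd v) > 0" if "\<phi> v \<in> APairs" using that f unfolding APairs_def gpair_def \<phi>_def by auto
    ultimately show ?thesis unfolding NP_def S using k f v unfolding \<phi>_def by auto
  qed
  have "\<phi> ` S = {p \<in> NP e M \<alpha> \<beta>. equivp (P, Q) p}"
  proof (intro equalityI subsetI)
    fix p assume "p \<in> \<phi> ` S"
    then obtain v where v: "v \<in> S" "p = \<phi> v" by auto
    have vv: "v \<in> vecs P" using v unfolding S by auto
    have "equivp (P, Q) p" unfolding v(2) \<phi>_def equivp_def using nrm(1)[OF P(1,2) vv] by auto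
    thus "p \<in> {p \<in> NP e M \<alpha> \<beta>. equivp (P, Q) p}" using cond[OF vv] v by auto
  next
    fix p assume p: "p \<in> {p \<in> NP e M \<alpha> \<beta>. equivp (P, Q) p}"
    then obtain g0 where g0: "g0 \<in> Gamma0 n" "p = (act P g0, act Q g0)" unfolding equivp_def by auto
    have pA: "fst (fst p) > 0" "normalized (fst p)" using p unfolding NP_def APairs_def gpair_def by auto
    have pos: "xv P (col g0) * ev P (col g0) > 0"
      using pA(1) P(2) unfolding xv_ev[OF P(1)] fst_act_col[symmetric] g0(2) by simp
    obtain g1 where g1: "g1 \<in> Gamma0 n" "p = (act P g1, act Q g1)" "xv P (col g1) > 0"
    proof (cases "xv P (col g0) > 0")
      case True thus ?thesis using that g0 by blast
    next
      case False
      have "xv P (col (mneg g0)) = - xv P (col g0)" unfolding xv_def xi_def mneg(3) by simp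
      moreover have "xv P (col g0) \<noteq> 0" using pos by auto
      ultimately show ?thesis using that[OF mneg(2)[OF g0(1)]] g0(2) False by (simp add: mneg(1))
    qed
    define v where "v = col g1"
    have "xv P v * ev P v > 0"
      using pA(1) P(2) unfolding xv_ev[OF P(1)] v_def fst_act_col[symmetric] g1(2) by simp
    hence "ev P v > 0" using g1(3) unfolding v_def by (simp add: zero_less_mult_iff)
    hence vv: "v \<in> vecs P" using coprime_col[OF g1(1)] g1(3) unfolding v_def vecs_def by simp
    note nv = nrm[OF P(1,2) vv]
    obtain k where k: "nrm P v = mmul g1 (1, k, 0, 1)" using same_column[OF g1(1) nv(1)] nv(2) unfolding v_def by auto
    have "k = 0"
      by (rule normalized_translation[of "act P g1"]) (use pA(2) g1(2) nv(3) k in \<open>auto simp: act_mmul\<close>)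
    hence "nrm P v = g1" using k by (simp add: mmul_one)
    hence "p = \<phi> v" unfolding \<phi>_def using g1 by simp
    thus "p \<in> \<phi> ` S" using cond[OF vv] p by auto
  qed
  thus ?thesis using card_image[OF inj] unfolding S_def by simp
qed

definition dl :: real where
  "dl = (SOME \<delta>. \<delta> > 0 \<and> (\<forall>\<Omega>. bounded \<Omega> \<longrightarrow> \<Omega> \<in> sets borel \<longrightarrow> emeasure lborel (frontier \<Omega>) = 0 \<longrightarrow>
     ((\<lambda>X. card (prim_points n X \<Omega>) / X\<^sup>2) \<longlongrightarrow> \<delta> * measure lborel \<Omega>) at_top))"

lemma dl: "dl > 0" "bounded \<Omega> \<Longrightarrow> \<Omega> \<in> sets borel \<Longrightarrow> emeasure lborel (frontier \<Omega>) = 0 \<Longrightarrow>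
     ((\<lambda>X. card (prim_points n X \<Omega>) / X\<^sup>2) \<longlongrightarrow> dl * measure lborel \<Omega>) at_top"
proof -
  have "n > 0" using n1 by simp
  from someI_ex[of "\<lambda>\<delta>. \<delta> > 0 \<and> (\<forall>\<Omega>. bounded \<Omega> \<longrightarrow> \<Omega> \<in> sets borel \<longrightarrow> emeasure lborel (frontier \<Omega>) = 0 \<longrightarrow>
     ((\<lambda>X. card (prim_points n X \<Omega>) / X\<^sup>2) \<longlongrightarrow> \<delta> * measure lborel \<Omega>) at_top)"] prim_count[OF this]
  have *: "dl > 0 \<and> (\<forall>\<Omega>. bounded \<Omega> \<longrightarrow> \<Omega> \<in> sets borel \<longrightarrow> emeasure lborel (frontier \<Omega>) = 0 \<longrightarrow>
     ((\<lambda>X. card (prim_points n X \<Omega>) / X\<^sup>2) \<longlongrightarrow> dl * measure lborel \<Omega>) at_top)" unfolding dl_def by blast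
  show "dl > 0" using * by blast
  show "bounded \<Omega> \<Longrightarrow> \<Omega> \<in> sets borel \<Longrightarrow> emeasure lborel (frontier \<Omega>) = 0 \<Longrightarrow>
     ((\<lambda>X. card (prim_points n X \<Omega>) / X\<^sup>2) \<longlongrightarrow> dl * measure lborel \<Omega>) at_top" using * by blast
qed

lemma pair_limit:
  assumes g: "gpair P Q"
  shows "((\<lambda>M. card {p \<in> NP e M \<alpha> \<beta>. equivp (P, Q) p} / M) \<longlongrightarrow> dl * integral {\<alpha>..\<beta>} (pdens P Q)) at_top"
proof -
  have "((\<lambda>X. card (prim_points n X (Om e P Q \<alpha> \<beta>)) / X\<^sup>2) \<longlongrightarrow> dl * measure lborel (Om e P Q \<alpha> \<beta>)) at_top"
    by (rule dl(2)[OF Om_bounded[OF g] Om_borel Om_frontier[OF g]])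
  from filterlim_compose[OF this sqrt_at_top]
  have "((\<lambda>M. card (prim_points n (sqrt M) (Om e P Q \<alpha> \<beta>)) / (sqrt M)\<^sup>2) \<longlongrightarrow> dl * integral {\<alpha>..\<beta>} (pdens P Q)) at_top"
    unfolding Om_area[OF g] .
  moreover have "\<forall>\<^sub>F M in at_top. card (prim_points n (sqrt M) (Om e P Q \<alpha> \<beta>)) / (sqrt M)\<^sup>2 = card {p \<in> NP e M \<alpha> \<beta>. equivp (P, Q) p} / M"
    using eventually_gt_at_top[of 0] by eventually_elim (simp add: pair_count[OF g])
  ultimately show ?thesis by (rule Lim_transform_eventually)
qed

subsection \<open>Uniform bounds for close pairs\<close>

text \<open>A common majorant of all \<open>NP\<close> with window inside \<open>[-T, T]\<close>,
  which also admits two equal forms; \<open>T\<close> is an integer to match the reduction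
  lemmas.\<close>

definition NPT :: "real \<Rightarrow> int \<Rightarrow> (form \<times> form) set" where
  "NPT M T = {p. fst p \<in> rforms \<and> snd p \<in> rforms \<and> normalized (fst p) \<and> fst (fst p) \<le> fst (snd p) \<and> real_of_int (fst (snd p)) \<le> M
     \<and> \<bar>M * real_of_int (ke p)\<bar> \<le> real_of_int (T * (fst (fst p) * fst (snd p)))}"

lemma NP_subset_NPT:
  assumes "\<bar>\<alpha>\<bar> \<le> of_int T" "\<bar>\<beta>\<bar> \<le> of_int T"
  shows "NP e M \<alpha> \<beta> \<subseteq> NPT M T"
proof
  fix p assume p: "p \<in> NP e M \<alpha> \<beta>"
  define a where "a = real_of_int (fst (fst p) * fst (snd p))"
  have "a > 0" using p unfolding NP_def APairs_def gpair_def a_def by auto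
  hence "\<bar>\<alpha> * a\<bar> \<le> of_int T * a" "\<bar>\<beta> * a\<bar> \<le> of_int T * a" using assms by (auto simp: abs_mult)
  moreover have "\<alpha> * a \<le> M * real_of_int (ke p)" "M * real_of_int (ke p) \<le> \<beta> * a" using p unfolding NP_def a_def by auto
  ultimately have "\<bar>M * real_of_int (ke p)\<bar> \<le> of_int T * a" by linarith
  thus "p \<in> NPT M T" using p unfolding NP_def APairs_def gpair_def NPT_def a_def by (auto split: if_splits)
qed

text \<open>Forms whose slopes are within \<open>T / M\<close> of that of \<open>Q1\<close> have
  slopes within \<open>2 T / M\<close> of each other. As their leading coefficients share a dyadic
  range, the matrix attached to one of them reduces them all into one finite set. The anchor is a
  member \<open>Q0\<close> of the set, since \<open>fst Q1\<close> may be of quite another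
  size.\<close>

lemma spacing:
  fixes T :: int
  assumes T: "T \<ge> 0"
  shows "\<exists>c0::nat. \<forall>M Q1 X. fst Q1 > 0 \<longrightarrow> X \<le> M \<longrightarrow>
    finite {Q \<in> rforms. X < 2 * real_of_int (fst Q) \<and> real_of_int (fst Q) \<le> X \<and> \<bar>M * real_of_int (ke (Q1, Q))\<bar> \<le> real_of_int (T * (fst Q1 * fst Q))} \<and>
    card {Q \<in> rforms. X < 2 * real_of_int (fst Q) \<and> real_of_int (fst Q) \<le> X \<and> \<bar>M * real_of_int (ke (Q1, Q))\<bar> \<le> real_of_int (T * (fst Q1 * fst Q))} \<le> c0"
proof -
  obtain F where F: "finite F" "\<forall>a1 h1 c1. a1 > 0 \<longrightarrow> h1 * h1 - a1 * c1 = D \<longrightarrow> (\<exists>g\<in>Gamma0 n. \<forall>a h c.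
     h * h - a * c = D \<longrightarrow> a1 \<le> 2 * a \<longrightarrow> a \<le> 2 * a1 \<longrightarrow> \<bar>h * a1 - h1 * a\<bar> \<le> (2 * T) * a \<longrightarrow>
     act (a, h, c) g \<in> F)" using finite_reduction[of 2 "2 * T"] T by auto
  have "finite S \<and> card S \<le> card F"
    if Q1: "fst Q1 > 0" and X: "X \<le> M" and S_def: "S = {Q \<in> rforms. X < 2 * real_of_int (fst Q) \<and> real_of_int (fst Q) \<le> X \<and> \<bar>M * real_of_int (ke (Q1, Q))\<bar> \<le> real_of_int (T * (fst Q1 * fst Q))}"
    for M X Q1 S
  proof (cases "S = {}")
    case False
    then obtain Q0 where Q0: "Q0 \<in> S" by auto
    obtain a0 h0 c0 where q0: "Q0 = (a0, h0, c0)" by (cases Q0)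
    obtain a1 h1 c1 where q1: "Q1 = (a1, h1, c1)" by (cases Q1)
    have a1: "a1 > 0" using Q1 unfolding q1 by simp
    have m0: "h0 * h0 - a0 * c0 = D" "X < 2 * real_of_int a0" "real_of_int a0 \<le> X"
        "\<bar>M * real_of_int (a1 * h0 - a0 * h1)\<bar> \<le> real_of_int (T * (a1 * a0))"
      using Q0 dsc_rforms[of Q0] unfolding S_def q0 q1 ke_def by auto
    have a0: "a0 > 0" using m0(2,3) by linarith
    have M: "M > 0" using a0 m0(3) X by linarith
    obtain g where g: "g \<in> Gamma0 n" "\<And>a h c. h * h - a * c = D \<Longrightarrow> a0 \<le> 2 * a \<Longrightarrow> a \<le> 2 * a0 \<Longrightarrow> \<bar>h * a0 - h0 * a\<bar> \<le> (2 * T) * a \<Longrightarrow>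
       act (a, h, c) g \<in> F" using F(2) a0 m0(1) by blast
    have "act Q g \<in> F" if "Q \<in> S" for Q
    proof -
      obtain a h c where q: "Q = (a, h, c)" by (cases Q)
      have m: "h * h - a * c = D" "X < 2 * real_of_int a" "real_of_int a \<le> X"
        "\<bar>M * real_of_int (a1 * h - a * h1)\<bar> \<le> real_of_int (T * (a1 * a))"
        using that dsc_rforms[of Q] unfolding S_def q q1 ke_def by auto
      have a: "a > 0" using m(2,3) by linarith
      define t where "t = real_of_int (T * a * a0)"
      define U where "U = real_of_int a0 * (M * real_of_int (a1 * h - a * h1))"
      define V where "V = real_of_int a * (M * real_of_int (a1 * h0 - a0 * h1))"
      have "\<bar>U\<bar> \<le> real_of_int a0 * real_of_int (T * (a1 * a))"
        unfolding U_def abs_mult[of "real_of_int a0"] using m(4) a0 by (intro mult_mono) auto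
      hence U: "\<bar>U\<bar> \<le> real_of_int a1 * t" unfolding t_def by (simp add: algebra_simps)
      have "\<bar>V\<bar> \<le> real_of_int a * real_of_int (T * (a1 * a0))"
        unfolding V_def abs_mult[of "real_of_int a"] using m0(4) a by (intro mult_mono) auto
      hence V: "\<bar>V\<bar> \<le> real_of_int a1 * t" unfolding t_def by (simp add: algebra_simps)
      have "\<bar>U - V\<bar> \<le> real_of_int a1 * t + real_of_int a1 * t" using U V by linarith
      \<comment> \<open>The slope of \<open>Q1\<close> is eliminated:
        \<open>a0 (a1 h - a h1) - a (a1 h0 - a0 h1) = a1 (h a0 - h0 a)\<close>.\<close>
      moreover have "U - V = real_of_int a1 * (M * real_of_int (h * a0 - h0 * a))"
        unfolding U_def V_def by (simp add: algebra_simps)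
      ultimately have "real_of_int a1 * \<bar>M * real_of_int (h * a0 - h0 * a)\<bar> \<le> real_of_int a1 * (2 * t)"
        using a1 by (simp add: abs_mult)
      hence "\<bar>M * real_of_int (h * a0 - h0 * a)\<bar> \<le> 2 * t" using a1 by (subst (asm) mult_le_cancel_left_pos) auto
      hence "\<bar>M * real_of_int (h * a0 - h0 * a)\<bar> \<le> real_of_int (2 * (T * a * a0))" unfolding t_def by simp
      also have "real_of_int (2 * (T * a * a0)) \<le> M * real_of_int (2 * T * a)"
      proof -
        have "real_of_int (2 * T * a) * real_of_int a0 \<le> real_of_int (2 * T * a) * M"
          using m0(3) X T a by (intro mult_left_mono) auto
        thus ?thesis by (simp add: algebra_simps)
      qed
      finally have "M * \<bar>real_of_int (h * a0 - h0 * a)\<bar> \<le> M * real_of_int (2 * T * a)" using M by (simp add: abs_mult)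
      hence "\<bar>real_of_int (h * a0 - h0 * a)\<bar> \<le> real_of_int (2 * T * a)" using M by simp
      hence "\<bar>h * a0 - h0 * a\<bar> \<le> 2 * T * a" by linarith
      moreover have "a0 \<le> 2 * a" "a \<le> 2 * a0" using m m0 by linarith+
      ultimately show ?thesis unfolding q using g(2) m(1) by blast
    qed
    hence sub: "(\<lambda>Q. act Q g) ` S \<subseteq> F" by auto
    moreover have inj: "inj_on (\<lambda>Q. act Q g) S" using act_inj[OF g(1)] by (auto simp: inj_on_def)
    ultimately show ?thesis using F(1) by (meson card_inj_on_le finite_imageD finite_subset)
  qed simp
  thus ?thesis by (intro exI[of _ "card F"]) blast
qed

text \<open>The limit controls large \<open>X\<close>, monotonicity the middle range, and there is
  no root of modulus less than 1.\<close>

lemma root_count_bound: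
  assumes "[\<nu>\<^sup>2 = D] (mod n)"
  shows "\<exists>c1>0. \<forall>X>0. real (card {\<rho> \<in> root_pairs D \<nu> n. real_of_int (fst \<rho>) \<le> X}) \<le> c1 * X"
proof -
  define N where "N X = real (card {\<rho> \<in> root_pairs D \<nu> n. real_of_int (fst \<rho>) \<le> X})" for X
  obtain c where c: "((\<lambda>M. N M / M) \<longlongrightarrow> c) at_top" using root_count[OF assms] unfolding N_def by blast
  have "\<forall>\<^sub>F M in at_top. N M / M < c + 1" using c by (rule order_tendstoD) simp
  then obtain X0 where X0: "\<And>X. X \<ge> X0 \<Longrightarrow> N X / X < c + 1" unfolding eventually_at_top_linorder by blast
  define c1 where "c1 = max 1 (max (c + 1) (N (max X0 1)))"
  have "N X \<le> c1 * X" if X: "X > 0" for X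
  proof (cases "X \<ge> X0")
    case True
    have "N X \<le> (c + 1) * X" using X0[OF True] X by (simp add: field_simps)
    also have "\<dots> \<le> c1 * X" using X unfolding c1_def by (intro mult_right_mono) auto
    finally show ?thesis .
  next
    case False
    show ?thesis
    proof (cases "X \<ge> 1")
      case True
      have "N X \<le> N (max X0 1)" unfolding N_def of_nat_le_iff
        by (intro card_mono finite_roots_le) (use False in auto)
      also have "\<dots> \<le> c1 * 1" unfolding c1_def by simp
      also have "\<dots> \<le> c1 * X" using True unfolding c1_def by (intro mult_left_mono) auto
      finally show ?thesis .
    next
      case F: False
      have "{\<rho> \<in> root_pairs D \<nu> n. real_of_int (fst \<rho>) \<le> X} = {}" using F unfolding root_pairs_def by auto
      hence "N X = 0" unfolding N_def by (simp only: card.empty of_nat_0)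
      moreover have "c1 \<ge> 0" unfolding c1_def by simp
      ultimately show ?thesis using X by simp
    qed
  qed
  moreover have "c1 > 0" unfolding c1_def by simp
  ultimately show ?thesis unfolding N_def by blast
qed

end

lemma dyadic_index:
  fixes M :: real and a :: int
  assumes "a > 0" "real_of_int a \<le> M"
  obtains i :: nat where "2 ^ i * real_of_int a \<le> M" "M < 2 ^ (i + 1) * real_of_int a"
proof -
  define k where "k = nat \<lfloor>M / a\<rfloor>"
  have "1 \<le> M / a" using assms by (simp add: field_simps)
  hence k1: "k \<ge> 1" and fl: "real k = of_int \<lfloor>M / a\<rfloor>" unfolding k_def by linarith+
  obtain i where i: "2 ^ i \<le> k" "k < 2 ^ (i + 1)" using ex_power_ivl1[of 2 k] k1 by auto
  have "(2::real) ^ i \<le> real k" using i(1) by (metis of_nat_le_iff of_nat_numeral of_nat_power)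
  hence 1: "2 ^ i \<le> M / a" using fl of_int_floor_le[of "M / a"] by linarith
  have "Suc k \<le> 2 ^ (i + 1)" using i(2) by simp
  hence "real (Suc k) \<le> 2 ^ (i + 1)" by (metis of_nat_le_iff of_nat_numeral of_nat_power)
  moreover have "real (Suc k) = real k + 1" by simp
  ultimately have 2: "M / a < 2 ^ (i + 1)" using fl floor_correct[of "M / a"] by linarith
  show ?thesis using that[of i] 1 2 assms(1) by (simp add: field_simps)
qed

text \<open>Telescoping: the right side is the full tail of the infinite series.\<close>

lemma sum_dyadic_tail: "(\<Sum>i = k..I. (real i + 1) / 2 ^ i) \<le> (2 * real k + 4) / 2 ^ k"
proof -
  have t: "(real j + 1) / 2 ^ j = (2 * real j + 4) / 2 ^ j - (2 * real (Suc j) + 4) / 2 ^ Suc j" for j :: nat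
    by (simp add: field_simps)
  have "(\<Sum>i = k..I. (real i + 1) / 2 ^ i) = (2 * real k + 4) / 2 ^ k - (2 * real (Suc I) + 4) / 2 ^ Suc I" if "k \<le> I"
    using that
  proof (induction I rule: dec_induct)
    case base thus ?case using t[of k] by simp
  next
    case (step m)
    have "(\<Sum>i = k..Suc m. (real i + 1) / 2 ^ i) = (\<Sum>i = k..m. (real i + 1) / 2 ^ i) + (real (Suc m) + 1) / 2 ^ Suc m"
      using step(1) by simp
    thus ?case unfolding step(3) t[of "Suc m"] by simp
  qed
  thus ?thesis by (cases "k \<le> I") auto
qed

locale nonsquare_roots = root_setup +
  assumes nu: "[\<nu>\<^sup>2 = D] (mod n)"
begin

lemma normalized_count:
  "finite {Q \<in> rforms. normalized Q \<and> real_of_int (fst Q) \<le> X}"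
  "card {Q \<in> rforms. normalized Q \<and> real_of_int (fst Q) \<le> X} \<le> card {\<rho> \<in> root_pairs D \<nu> n. real_of_int (fst \<rho>) \<le> X}"
proof -
  let ?A = "{Q \<in> rforms. normalized Q \<and> real_of_int (fst Q) \<le> X}"
  have inj: "inj_on root_of ?A"
  proof (rule inj_onI)
    fix Q Q' assume Q: "Q \<in> ?A" "Q' \<in> ?A" "root_of Q = root_of Q'"
    have "dsc Q = dsc Q'" "fst Q \<noteq> 0" using Q dsc_rforms unfolding normalized_def by auto
    then obtain k where k: "Q' = act Q (1, k, 0, 1)" using root_of_eq[OF Q(3)] by blast
    hence "k = 0" using normalized_translation[of Q k] Q by auto
    thus "Q = Q'" using k by (simp add: act_one)
  qed
  have sub: "root_of ` ?A \<subseteq> {\<rho> \<in> root_pairs D \<nu> n. real_of_int (fst \<rho>) \<le> X}"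
  proof (rule image_subsetI)
    fix Q assume Q: "Q \<in> ?A"
    have "root_of Q \<in> root_pairs D \<nu> n" by (rule root_of_in) (use Q in \<open>auto simp: normalized_def\<close>)
    moreover have "fst (root_of Q) = fst Q" by (simp add: root_of_def)
    ultimately show "root_of Q \<in> {\<rho> \<in> root_pairs D \<nu> n. real_of_int (fst \<rho>) \<le> X}" using Q by simp
  qed
  show "finite ?A" using finite_imageD[OF finite_subset[OF sub finite_roots_le] inj] .
  show "card ?A \<le> card {\<rho> \<in> root_pairs D \<nu> n. real_of_int (fst \<rho>) \<le> X}"
    by (rule card_inj_on_le[OF inj sub finite_roots_le])
qed

text \<open>Pairs are sorted by the dyadic sizes \<open>2\<^sup>-\<^sup>i M\<close> and \<open>2\<^sup>-\<^sup>l M\<close> of their leading coefficients;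
  by the spacing lemma each form has boundedly many partners in each dyadic range.\<close>

lemma tail_bound:
  fixes T :: int
  assumes T: "T \<ge> 0"
  shows "\<exists>c>0. \<forall>k M. M \<ge> 1 \<longrightarrow> finite {p \<in> NPT M T. 2 ^ k * real_of_int (fst (fst p)) \<le> M} \<and>
     real (card {p \<in> NPT M T. 2 ^ k * real_of_int (fst (fst p)) \<le> M}) \<le> c * M * ((2 * real k + 4) / 2 ^ k)"
proof -
  obtain c0 where c0: "\<forall>M Q1 X. fst Q1 > 0 \<longrightarrow> X \<le> M \<longrightarrow>
    finite {Q \<in> rforms. X < 2 * real_of_int (fst Q) \<and> real_of_int (fst Q) \<le> X \<and> \<bar>M * real_of_int (ke (Q1, Q))\<bar> \<le> real_of_int (T * (fst Q1 * fst Q))} \<and>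
    card {Q \<in> rforms. X < 2 * real_of_int (fst Q) \<and> real_of_int (fst Q) \<le> X \<and> \<bar>M * real_of_int (ke (Q1, Q))\<bar> \<le> real_of_int (T * (fst Q1 * fst Q))} \<le> (c0 :: nat)"
    using spacing[OF T] by blast
  obtain c1 where c1: "c1 > 0" "\<And>X. X > 0 \<Longrightarrow> real (card {\<rho> \<in> root_pairs D \<nu> n. real_of_int (fst \<rho>) \<le> X}) \<le> c1 * X"
    using root_count_bound[OF nu] by blast
  define c where "c = (real c0 + 1) * c1"
  have "finite {p \<in> NPT M T. 2 ^ k * real_of_int (fst (fst p)) \<le> M} \<and>
     real (card {p \<in> NPT M T. 2 ^ k * real_of_int (fst (fst p)) \<le> M}) \<le> c * M * ((2 * real k + 4) / 2 ^ k)"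
    if M: "M \<ge> 1" for k :: nat and M :: real
  proof -
    define S where "S i l = {p \<in> NPT M T. 2 ^ i * real_of_int (fst (fst p)) \<le> M \<and> 2 ^ l * real_of_int (fst (snd p)) \<le> M
      \<and> M < 2 ^ (l + 1) * real_of_int (fst (snd p))}" for i l :: nat
    define I where "I = nat \<lfloor>M\<rfloor>"
    have S_bound: "finite (S i l) \<and> real (card (S i l)) \<le> c * M / 2 ^ i" for i l
    proof -
      define A where "A = {Q \<in> rforms. normalized Q \<and> real_of_int (fst Q) \<le> M / 2 ^ i}"
      define B where "B Q1 = {Q \<in> rforms. M / 2 ^ l < 2 * real_of_int (fst Q) \<and> real_of_int (fst Q) \<le> M / 2 ^ l \<and> \<bar>M * real_of_int (ke (Q1, Q))\<bar> \<le> real_of_int (T * (fst Q1 * fst Q))}" for Q1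
      have Ml: "M / 2 ^ l \<le> M" using M by (simp add: field_simps)
      have B: "finite (B Q1)" "card (B Q1) \<le> c0" if "Q1 \<in> A" for Q1
      proof -
        have "fst Q1 > 0" using that unfolding A_def normalized_def by auto
        from c0[rule_format, OF this Ml] show "finite (B Q1)" "card (B Q1) \<le> c0" unfolding B_def by blast+
      qed
      have finA: "finite A" unfolding A_def by (rule normalized_count)
      have "S i l \<subseteq> Sigma A B"
      proof
        fix p assume p: "p \<in> S i l"
        obtain Q1 Q2 where q: "p = (Q1, Q2)" by (cases p)
        have "Q1 \<in> A" using p unfolding S_def NPT_def A_def q by (auto simp: field_simps)
        moreover have "Q2 \<in> B Q1" using p unfolding S_def NPT_def B_def q by (auto simp: field_simps)
        ultimately show "p \<in> Sigma A B" unfolding q by auto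
      qed
      moreover have fS: "finite (Sigma A B)" using finA B by auto
      ultimately have "finite (S i l)" "card (S i l) \<le> card (Sigma A B)" by (auto intro: finite_subset card_mono)
      moreover have "card (Sigma A B) \<le> card A * c0"
      proof -
        have "card (Sigma A B) = (\<Sum>Q\<in>A. card (B Q))" using finA B by (intro card_SigmaI) auto
        also have "\<dots> \<le> (\<Sum>Q\<in>A. c0)" using B by (intro sum_mono) auto
        finally show ?thesis by simp
      qed
      moreover have "real (card A) \<le> c1 * (M / 2 ^ i)"
        using normalized_count(2)[of "M / 2 ^ i"] c1(2)[of "M / 2 ^ i"] M unfolding A_def by simp
      ultimately have "real (card (S i l)) \<le> c1 * (M / 2 ^ i) * real c0"
        by (smt (verit) mult_right_mono of_nat_0_le_iff of_nat_le_iff of_nat_mult)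
      also have "\<dots> \<le> c1 * (M / 2 ^ i) * (real c0 + 1)" using c1(1) M by (intro mult_left_mono) auto
      finally show ?thesis using \<open>finite (S i l)\<close> unfolding c_def by (simp add: mult_ac)
    qed
    have sub: "{p \<in> NPT M T. 2 ^ k * real_of_int (fst (fst p)) \<le> M} \<subseteq> (\<Union>i\<in>{k..I}. \<Union>l\<in>{0..i}. S i l)"
    proof
      fix p assume p: "p \<in> {p \<in> NPT M T. 2 ^ k * real_of_int (fst (fst p)) \<le> M}"
      define a1 a2 where "a1 = fst (fst p)" and "a2 = fst (snd p)"
      have a: "a1 > 0" "a1 \<le> a2" "real_of_int a2 \<le> M" "2 ^ k * real_of_int a1 \<le> M"
        using p unfolding NPT_def a1_def a2_def normalized_def by auto
      have "real_of_int a1 \<le> M" using a by linarith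
      then obtain i where i: "2 ^ i * real_of_int a1 \<le> M" "M < 2 ^ (i + 1) * real_of_int a1" using dyadic_index[OF a(1)] by blast
      have "a2 > 0" using a by linarith
      then obtain l where l: "2 ^ l * real_of_int a2 \<le> M" "M < 2 ^ (l + 1) * real_of_int a2" using dyadic_index a(3) by blast
      have "(2::real) ^ k * real_of_int a1 < 2 ^ (i + 1) * real_of_int a1" using a(4) i(2) by linarith
      hence "(2::real) ^ k < 2 ^ (i + 1)" using a(1) by (auto simp only: mult_less_cancel_right of_int_less_0_iff)
      hence "k < i + 1" by (rule power_less_imp_less_exp[rotated]) simp
      hence ki: "k \<le> i" by simp
      have "2 ^ (i + 1) * real_of_int a1 \<le> 2 ^ (i + 1) * real_of_int a2" using a(2) by (intro mult_left_mono) auto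
      hence "2 ^ l * real_of_int a2 < 2 ^ (i + 1) * real_of_int a2" using l(1) i(2) by linarith
      hence "(2::real) ^ l < 2 ^ (i + 1)" using \<open>a2 > 0\<close> by (auto simp only: mult_less_cancel_right of_int_less_0_iff)
      hence "l < i + 1" by (rule power_less_imp_less_exp[rotated]) simp
      hence li: "l \<le> i" by simp
      \<comment> \<open>\<open>2 ^ i \<le> M\<close> limits the number of ranges. The bound
        \<open>l \<le> i\<close>, due to the second leading coefficient being the larger, leaves
        \<open>i + 1\<close> values of \<open>l\<close>, hence the convergent series of
        \<open>(i + 1) / 2 ^ i\<close>.\<close>
      have "real i \<le> 2 ^ i" by (metis less_exp less_imp_le of_nat_le_iff of_nat_power of_nat_numeral)
      also have "(2::real) ^ i \<le> 2 ^ i * real_of_int a1" using a(1) by simp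
      finally have "i \<le> I" using i(1) unfolding I_def by linarith
      hence "i \<in> {k..I}" "l \<in> {0..i}" using ki li by auto
      moreover have "p \<in> S i l" using p i l unfolding S_def a1_def a2_def by simp
      ultimately show "p \<in> (\<Union>i\<in>{k..I}. \<Union>l\<in>{0..i}. S i l)" by blast
    qed
    have fin: "finite (\<Union>i\<in>{k..I}. \<Union>l\<in>{0..i}. S i l)" using S_bound by auto
    have "card {p \<in> NPT M T. 2 ^ k * real_of_int (fst (fst p)) \<le> M} \<le> card (\<Union>i\<in>{k..I}. \<Union>l\<in>{0..i}. S i l)"
      by (rule card_mono[OF fin sub])
    also have "\<dots> \<le> (\<Sum>i\<in>{k..I}. card (\<Union>l\<in>{0..i}. S i l))" by (rule card_UN_le) auto
    also have "\<dots> \<le> (\<Sum>i\<in>{k..I}. \<Sum>l\<in>{0..i}. card (S i l))" by (intro sum_mono card_UN_le) auto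
    finally have "real (card {p \<in> NPT M T. 2 ^ k * real_of_int (fst (fst p)) \<le> M}) \<le> real (\<Sum>i\<in>{k..I}. \<Sum>l\<in>{0..i}. card (S i l))"
      by (simp only: of_nat_le_iff)
    also have "\<dots> = (\<Sum>i\<in>{k..I}. \<Sum>l\<in>{0..i}. real (card (S i l)))" by simp
    also have "\<dots> \<le> (\<Sum>i\<in>{k..I}. \<Sum>l\<in>{0..i}. c * M / 2 ^ i)" using S_bound by (intro sum_mono) auto
    also have "\<dots> = c * M * (\<Sum>i\<in>{k..I}. (real i + 1) / 2 ^ i)" by (simp add: sum_distrib_left mult_ac add_ac)
    also have "\<dots> \<le> c * M * ((2 * real k + 4) / 2 ^ k)"
      using c1 M unfolding c_def by (intro mult_left_mono sum_dyadic_tail) auto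
    finally show ?thesis using finite_subset[OF sub fin] by blast
  qed
  moreover have "c > 0" unfolding c_def using c1 by simp
  ultimately show ?thesis by blast
qed

text \<open>Both leading coefficients lie between \<open>M / 2 ^ k\<close> and \<open>M\<close>, so
  they are comparable, and the slopes differ by at most \<open>T / M\<close>; the matrix attached to
  the first form reduces both into one finite set.\<close>

lemma good_classes:
  fixes T :: int
  assumes T: "T \<ge> 0"
  shows "\<exists>F. finite F \<and> (\<forall>M p. p \<in> NPT M T \<longrightarrow> M \<le> 2 ^ k * real_of_int (fst (fst p)) \<longrightarrow> (\<exists>q\<in>F. equivp p q))"
proof -
  obtain F where F: "finite F" "\<forall>a1 h1 c1. a1 > 0 \<longrightarrow> h1 * h1 - a1 * c1 = D \<longrightarrow> (\<exists>g\<in>Gamma0 n. \<forall>a h c.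
     h * h - a * c = D \<longrightarrow> a1 \<le> 2 ^ k * a \<longrightarrow> a \<le> 2 ^ k * a1 \<longrightarrow> \<bar>h * a1 - h1 * a\<bar> \<le> T * a \<longrightarrow>
     act (a, h, c) g \<in> F)" using finite_reduction[of "2 ^ k" T] T by auto
  have "\<exists>q\<in>F \<times> F. equivp p q" if p: "p \<in> NPT M T" "M \<le> 2 ^ k * real_of_int (fst (fst p))" for M p
  proof -
    obtain a1 h1 c1 a2 h2 c2 where q: "p = ((a1, h1, c1), (a2, h2, c2))" by (metis prod.exhaust)
    have h: "h1 * h1 - a1 * c1 = D" "h2 * h2 - a2 * c2 = D" "a1 > 0" "a1 \<le> a2" "real_of_int a2 \<le> M"
      "\<bar>M * real_of_int (a1 * h2 - a2 * h1)\<bar> \<le> real_of_int (T * (a1 * a2))" "M \<le> 2 ^ k * real_of_int a1"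
      using p dsc_rforms[of "(a1, h1, c1)"] dsc_rforms[of "(a2, h2, c2)"] unfolding NPT_def q normalized_def ke_def by auto
    have M: "M > 0" using h by linarith
    have "real_of_int a2 \<le> real_of_int (2 ^ k * a1)" using h by simp
    hence a21: "a2 \<le> 2 ^ k * a1" by (simp only: of_int_le_iff)
    have a12: "a \<le> 2 ^ k * a" if "a \<ge> 0" for a :: int using that by (simp add: mult_le_cancel_right1)
    have "M * \<bar>real_of_int (a1 * h2 - a2 * h1)\<bar> = \<bar>M * real_of_int (a1 * h2 - a2 * h1)\<bar>"
      using M by (simp only: abs_mult abs_of_pos)
    also have "\<dots> \<le> real_of_int (T * (a1 * a2))" by (rule h(6))
    also have "\<dots> = real_of_int (T * a2) * real_of_int a1" by simp
    also have "\<dots> \<le> real_of_int (T * a2) * M" using h T by (intro mult_left_mono) auto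
    finally have "M * \<bar>real_of_int (a1 * h2 - a2 * h1)\<bar> \<le> M * real_of_int (T * a2)" by (simp add: mult.commute)
    hence "\<bar>real_of_int (a1 * h2 - a2 * h1)\<bar> \<le> real_of_int (T * a2)" using M by simp
    hence "\<bar>a1 * h2 - a2 * h1\<bar> \<le> T * a2" by (simp only: of_int_abs[symmetric] of_int_le_iff)
    hence k2: "\<bar>h2 * a1 - h1 * a2\<bar> \<le> T * a2" by (simp add: mult.commute)
    obtain g where g: "g \<in> Gamma0 n" "\<And>a h c. h * h - a * c = D \<Longrightarrow> a1 \<le> 2 ^ k * a \<Longrightarrow> a \<le> 2 ^ k * a1 \<Longrightarrow> \<bar>h * a1 - h1 * a\<bar> \<le> T * a \<Longrightarrow>
       act (a, h, c) g \<in> F" using F(2) h by blast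
    have "act (a1, h1, c1) g \<in> F" by (rule g(2)) (use h a12[of a1] T in auto)
    moreover have "a2 \<le> 2 ^ k * a2" by (rule a12) (use h in linarith)
    from order_trans[OF h(4) this] have "act (a2, h2, c2) g \<in> F" by (rule g(2)[OF h(2) _ a21 k2])
    ultimately show ?thesis unfolding q equivp_def using g(1) by (intro bexI[of _ "(act (a1, h1, c1) g, act (a2, h2, c2) g)"]) auto
  qed
  thus ?thesis using F(1) by (intro exI[of _ "F \<times> F"]) blast
qed

subsection \<open>Summation over the orbits\<close>

definition classes :: "(form \<times> form) set set" where
  "classes = (\<lambda>p. {q \<in> APairs. equivp p q}) ` APairs"

definition rp :: "(form \<times> form) set \<Rightarrow> form \<times> form" where
  "rp C = (SOME p. p \<in> C)"

lemma rp:
  assumes "C \<in> classes"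
  shows "rp C \<in> APairs" "C = {q \<in> APairs. equivp (rp C) q}"
proof -
  obtain p where p: "p \<in> APairs" "C = {q \<in> APairs. equivp p q}" using assms unfolding classes_def by auto
  have "p \<in> C" using p equivp_refl by simp
  hence r: "rp C \<in> C" unfolding rp_def by (rule someI)
  thus "rp C \<in> APairs" using p by simp
  show "C = {q \<in> APairs. equivp (rp C) q}" using r p equivp_sym equivp_trans by blast
qed

lemma classes_disjoint:
  assumes "C \<in> classes" "C' \<in> classes" "p \<in> C" "p \<in> C'"
  shows "C = C'"
proof -
  have "p \<in> {q \<in> APairs. equivp (rp C) q}" using assms(3) rp(2)[OF assms(1)] by blast
  moreover have "p \<in> {q \<in> APairs. equivp (rp C') q}" using assms(4) rp(2)[OF assms(2)] by blast
  ultimately have e: "equivp (rp C) (rp C')" using equivp_sym equivp_trans by blast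
  have "C = {q \<in> APairs. equivp (rp C) q}" by (rule rp(2)[OF assms(1)])
  also have "\<dots> = {q \<in> APairs. equivp (rp C') q}" using e equivp_sym equivp_trans by blast
  also have "\<dots> = C'" by (rule rp(2)[OF assms(2), symmetric])
  finally show ?thesis .
qed

definition cd :: "(form \<times> form) set \<Rightarrow> real \<Rightarrow> real" where
  "cd C t = dl * pdens (fst (rp C)) (snd (rp C)) t"

lemma cd:
  assumes "C \<in> classes"
  shows "continuous_on UNIV (cd C)" "cd C t \<ge> 0"
    "T \<ge> 1 \<Longrightarrow> \<bar>t\<bar> \<le> T \<Longrightarrow> cd C t \<le> (T + 1)\<^sup>2 * integral {-(T + 1)..T + 1} (cd C)"
    "((\<lambda>M. card (NP e M \<alpha> \<beta> \<inter> C) / M) \<longlongrightarrow> integral {\<alpha>..\<beta>} (cd C)) at_top"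
proof -
  define P Q where "P = fst (rp C)" and "Q = snd (rp C)"
  have g: "gpair P Q" using rp(1)[OF assms] unfolding APairs_def P_def Q_def by auto
  interpret pa: pair_area_gap "sqrt D" "real_of_int (fst P)" "pA P Q" "pB P Q" "pC P Q" by (rule pair_interp[OF g])
  have cd_eq: "cd C = (\<lambda>t. dl * pdens P Q t)" unfolding cd_def P_def Q_def by auto
  note d = pa.dens_continuous[folded pdens_def] pa.dens_nonneg[folded pdens_def] pa.dens_bound[folded pdens_def]
  show "continuous_on UNIV (cd C)" unfolding cd_eq by (intro continuous_intros d(1))
  show "cd C t \<ge> 0" unfolding cd_eq using d(2) dl(1) by simp
  have int: "integral S (cd C) = dl * integral S (pdens P Q)" for S unfolding cd_eq by simp
  show "cd C t \<le> (T + 1)\<^sup>2 * integral {-(T + 1)..T + 1} (cd C)" if "T \<ge> 1" "\<bar>t\<bar> \<le> T"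
    using mult_left_mono[OF d(3)[OF that], of dl] dl(1) unfolding int by (simp add: cd_eq mult_ac)
  have "NP e M \<alpha> \<beta> \<inter> C = {p \<in> NP e M \<alpha> \<beta>. equivp (P, Q) p}" for M
    using rp(2)[OF assms] unfolding P_def Q_def NP_def by auto
  thus "((\<lambda>M. card (NP e M \<alpha> \<beta> \<inter> C) / M) \<longlongrightarrow> integral {\<alpha>..\<beta>} (cd C)) at_top"
    unfolding int using pair_limit[OF g, of e \<alpha> \<beta>] by simp
qed

lemma NPT_le:
  assumes "p \<in> NPT M T"
  shows "2 ^ 0 * real_of_int (fst (fst p)) \<le> M"
proof -
  have "fst (fst p) \<le> fst (snd p)" "real_of_int (fst (snd p)) \<le> M" using assms unfolding NPT_def by auto
  thus ?thesis by simp
qed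

lemma NP_finite:
  assumes "M \<ge> 1"
  shows "finite (NP e M \<alpha> \<beta>)"
proof -
  define T where "T = \<lceil>max \<bar>\<alpha>\<bar> \<bar>\<beta>\<bar>\<rceil>"
  have T: "T \<ge> 0" "\<bar>\<alpha>\<bar> \<le> of_int T" "\<bar>\<beta>\<bar> \<le> of_int T" unfolding T_def by linarith+
  obtain c where "\<forall>k M. M \<ge> 1 \<longrightarrow> finite {p \<in> NPT M T. 2 ^ k * real_of_int (fst (fst p)) \<le> M} \<and>
     real (card {p \<in> NPT M T. 2 ^ k * real_of_int (fst (fst p)) \<le> M}) \<le> c * M * ((2 * real k + 4) / 2 ^ k)"
    using tail_bound[OF T(1)] by blast
  hence "finite {p \<in> NPT M T. 2 ^ 0 * real_of_int (fst (fst p)) \<le> M}" using assms by blast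
  moreover have "NP e M \<alpha> \<beta> \<subseteq> {p \<in> NPT M T. 2 ^ 0 * real_of_int (fst (fst p)) \<le> M}"
    using NP_subset_NPT[OF T(2,3), of e M] NPT_le by blast
  ultimately show ?thesis by (rule finite_subset[rotated])
qed

lemma class_sum_le:
  assumes "finite F" "F \<subseteq> classes" "M \<ge> 1"
  shows "(\<Sum>C\<in>F. card (NP e M \<alpha> \<beta> \<inter> C)) = card (NP e M \<alpha> \<beta> \<inter> \<Union>F)"
proof -
  have "NP e M \<alpha> \<beta> \<inter> \<Union>F = (\<Union>C\<in>F. NP e M \<alpha> \<beta> \<inter> C)" by auto
  moreover have "card (\<Union>C\<in>F. NP e M \<alpha> \<beta> \<inter> C) = (\<Sum>C\<in>F. card (NP e M \<alpha> \<beta> \<inter> C))"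
    by (rule card_UN_disjoint) (use assms NP_finite classes_disjoint in blast)+
  ultimately show ?thesis by simp
qed

text \<open>Finite sums of integrals are limits of counts of pairs in disjoint orbits, and all close
  pairs together number at most a constant times \<open>M\<close>.\<close>

lemma class_integral_bound:
  assumes "S \<ge> (0::real)"
  shows "\<exists>K. \<forall>F. finite F \<longrightarrow> F \<subseteq> classes \<longrightarrow> (\<Sum>C\<in>F. integral {-S..S} (cd C)) \<le> K"
proof -
  define T where "T = \<lceil>S\<rceil>"
  have T: "T \<ge> 0" "\<bar>- S\<bar> \<le> of_int T" "\<bar>S\<bar> \<le> of_int T" unfolding T_def using assms by linarith+
  obtain c where c: "\<forall>k M. M \<ge> 1 \<longrightarrow> finite {p \<in> NPT M T. 2 ^ k * real_of_int (fst (fst p)) \<le> M} \<and>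
     real (card {p \<in> NPT M T. 2 ^ k * real_of_int (fst (fst p)) \<le> M}) \<le> c * M * ((2 * real k + 4) / 2 ^ k)"
    using tail_bound[OF T(1)] by blast
  \<comment> \<open>The factor 4 is \<open>(2 * k + 4) / 2 ^ k\<close> at \<open>k = 0\<close>,
    where the condition on the first modulus holds for every pair.\<close>
  have "(\<Sum>C\<in>F. integral {-S..S} (cd C)) \<le> c * 4" if F: "finite F" "F \<subseteq> classes" for F
  proof (rule tendsto_upperbound)
    show "((\<lambda>M. \<Sum>C\<in>F. card (NP True M (-S) S \<inter> C) / M) \<longlongrightarrow> (\<Sum>C\<in>F. integral {-S..S} (cd C))) at_top"
      using F by (intro tendsto_sum cd(4)) auto
    show "\<forall>\<^sub>F M in at_top. (\<Sum>C\<in>F. card (NP True M (-S) S \<inter> C) / M) \<le> c * 4"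
      using eventually_ge_at_top[of 1]
    proof eventually_elim
      case (elim M)
      have "card (NP True M (-S) S \<inter> \<Union>F) \<le> card {p \<in> NPT M T. 2 ^ 0 * real_of_int (fst (fst p)) \<le> M}"
      proof (rule card_mono)
        show "finite {p \<in> NPT M T. 2 ^ 0 * real_of_int (fst (fst p)) \<le> M}" using c elim by blast
        show "NP True M (-S) S \<inter> \<Union>F \<subseteq> {p \<in> NPT M T. 2 ^ 0 * real_of_int (fst (fst p)) \<le> M}"
          using NP_subset_NPT[OF T(2,3), of True M] NPT_le by blast
      qed
      moreover have "real (card {p \<in> NPT M T. 2 ^ 0 * real_of_int (fst (fst p)) \<le> M}) \<le> c * M * ((2 * real 0 + 4) / 2 ^ 0)"
        using c elim by blast
      ultimately have "real (card (NP True M (-S) S \<inter> \<Union>F)) \<le> c * M * 4" by simp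
      thus ?case unfolding sum_divide_distrib[symmetric] of_nat_sum[symmetric] class_sum_le[OF F elim]
        using elim by (simp add: field_simps)
    qed
  qed simp
  thus ?thesis by blast
qed

definition WW :: "real \<Rightarrow> real" where
  "WW t = (\<Sum>\<^sub>\<infinity>C\<in>classes. cd C t)"

text \<open>Weierstrass test: the majorants are \<open>(T + 1)\<^sup>2\<close> times integrals over
  \<open>{-(T + 1)..T + 1}\<close>, whose finite sums are bounded.\<close>

lemma WW_uniform:
  assumes T: "T \<ge> 1"
  shows "uniform_limit {-T..T} (\<lambda>F t. \<Sum>C\<in>F. cd C t) WW (finite_subsets_at_top classes)"
proof -
  obtain K where K: "\<And>F. finite F \<Longrightarrow> F \<subseteq> classes \<Longrightarrow> (\<Sum>C\<in>F. integral {-(T + 1)..T + 1} (cd C)) \<le> K"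
    using class_integral_bound[of "T + 1"] T by auto
  have int0: "integral {-(T + 1)..T + 1} (cd C) \<ge> 0" if "C \<in> classes" for C
    using cd(1,2)[OF that] by (intro integral_nonneg integrable_continuous_interval) (auto intro: continuous_on_subset)
  show ?thesis unfolding WW_def
  proof (rule Weierstrass_m_test_general)
    show "norm (cd C t) \<le> (T + 1)\<^sup>2 * integral {-(T + 1)..T + 1} (cd C)" if "C \<in> classes" "t \<in> {-T..T}" for C t
      using cd(3)[OF that(1) T, of t] cd(2)[OF that(1), of t] that(2) by (auto simp: abs_le_iff)
    show "(\<lambda>C. (T + 1)\<^sup>2 * integral {-(T + 1)..T + 1} (cd C)) summable_on classes"
    proof (rule nonneg_bdd_above_summable_on)
      show "0 \<le> (T + 1)\<^sup>2 * integral {-(T + 1)..T + 1} (cd C)" if "C \<in> classes" for C using int0[OF that] by simp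
      show "bdd_above (sum (\<lambda>C. (T + 1)\<^sup>2 * integral {-(T + 1)..T + 1} (cd C)) ` {F. F \<subseteq> classes \<and> finite F})"
        by (rule bdd_aboveI2[of _ _ "(T + 1)\<^sup>2 * K"]) (use K in \<open>auto simp: sum_distrib_left[symmetric] intro!: mult_left_mono\<close>)
    qed
  qed
qed

lemma WW_continuous: "continuous_on UNIV WW"
proof -
  have cc: "continuous_on {-T..T} WW" if "T \<ge> 1" for T
  proof (rule uniform_limit_theorem[OF _ WW_uniform[OF that]])
    show "\<forall>\<^sub>F F in finite_subsets_at_top classes. continuous_on {-T..T} (\<lambda>t. \<Sum>C\<in>F. cd C t)"
      by (rule eventually_finite_subsets_at_top_weakI)
         (auto intro!: continuous_on_sum continuous_on_subset[OF cd(1)])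
  qed simp
  have c: "continuous_on {-T<..<T} WW" if "T \<ge> 1" for T
    by (rule continuous_on_subset[OF cc[OF that]]) auto
  show ?thesis
  proof (rule continuous_at_imp_continuous_on, rule ballI)
    fix t :: real
    have "t \<in> {-(\<bar>t\<bar> + 1)<..<\<bar>t\<bar> + 1}" by auto
    thus "isCont WW t" using c[of "\<bar>t\<bar> + 1"] by (simp add: continuous_on_eq_continuous_at)
  qed
qed

lemma WW_nonneg: "WW t \<ge> 0"
  unfolding WW_def by (intro infsum_nonneg cd(2))

text \<open>Pairs with first modulus at most \<open>M / 2 ^ k\<close> contribute at most
  \<open>\<epsilon> * M / 4\<close>; the others lie in finitely many orbits that do not depend on
  \<open>M\<close>. The finite set \<open>G\<close> contains these orbits and enough others for its
  densities to approximate \<open>WW\<close> uniformly; the integrals over it and the counts in it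
  cost \<open>\<epsilon> / 4\<close> each.\<close>

lemma NP_limit:
  assumes \<alpha>\<beta>: "\<alpha> \<le> \<beta>"
  shows "((\<lambda>M. card (NP e M \<alpha> \<beta>) / M) \<longlongrightarrow> integral {\<alpha>..\<beta>} WW) at_top"
proof (rule tendstoI)
  fix \<epsilon> :: real assume \<epsilon>: "\<epsilon> > 0"
  define T where "T = \<lceil>max \<bar>\<alpha>\<bar> \<bar>\<beta>\<bar>\<rceil> + 1"
  have T: "T \<ge> 0" "\<bar>\<alpha>\<bar> \<le> of_int T" "\<bar>\<beta>\<bar> \<le> of_int T" "real_of_int T \<ge> 1" unfolding T_def by linarith+
  obtain c where c: "c > 0" "\<forall>k M. M \<ge> 1 \<longrightarrow> finite {p \<in> NPT M T. 2 ^ k * real_of_int (fst (fst p)) \<le> M} \<and>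
     real (card {p \<in> NPT M T. 2 ^ k * real_of_int (fst (fst p)) \<le> M}) \<le> c * M * ((2 * real k + 4) / 2 ^ k)"
    using tail_bound[OF T(1)] by blast
  have "(\<lambda>k. c * ((2 * real k + 4) / 2 ^ k)) \<longlonglongrightarrow> 0" by real_asymp
  hence "\<forall>\<^sub>F k in sequentially. c * ((2 * real k + 4) / 2 ^ k) < \<epsilon> / 4" using \<epsilon> by (intro order_tendstoD) auto
  then obtain k where k: "c * ((2 * real k + 4) / 2 ^ k) < \<epsilon> / 4" by (meson eventually_happens trivial_limit_sequentially)
  obtain F1 where F1: "finite F1" "\<forall>M p. p \<in> NPT M T \<longrightarrow> M \<le> 2 ^ k * real_of_int (fst (fst p)) \<longrightarrow> (\<exists>q\<in>F1. equivp p q)"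
    using good_classes[OF T(1)] by blast
  \<comment> \<open>The representatives in \<open>F1\<close> come from reduction and may fail to be
    admissible pairs; the intersection keeps those whose orbit is one of the classes.\<close>
  define G1 where "G1 = (\<lambda>q. {p \<in> APairs. equivp q p}) ` F1 \<inter> classes"
  \<comment> \<open>The added 1 keeps \<open>d\<close> positive when
    \<open>\<alpha> = \<beta>\<close>.\<close>
  define d where "d = \<beta> - \<alpha> + 1"
  define \<eta> where "\<eta> = \<epsilon> / (4 * d)"
  have d: "d > 0" "\<beta> - \<alpha> \<le> d" unfolding d_def using \<alpha>\<beta> by auto
  have \<eta>: "\<eta> > 0" unfolding \<eta>_def using \<epsilon> d by simp
  obtain G0 where "finite G0 \<and> G0 \<subseteq> classes \<and> (\<forall>G. finite G \<and> G0 \<subseteq> G \<and> G \<subseteq> classes \<longrightarrow>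
      (\<forall>t\<in>{-of_int T..of_int T}. dist (\<Sum>C\<in>G. cd C t) (WW t) < \<eta>))"
    using uniform_limitD[OF WW_uniform[OF T(4)] \<eta>] unfolding eventually_finite_subsets_at_top ..
  hence G0: "finite G0" "G0 \<subseteq> classes"
    "\<And>G. finite G \<Longrightarrow> G0 \<subseteq> G \<Longrightarrow> G \<subseteq> classes \<Longrightarrow> \<forall>t\<in>{-of_int T..of_int T}. dist (\<Sum>C\<in>G. cd C t) (WW t) < \<eta>"
    by auto
  define G where "G = G0 \<union> G1"
  have G: "finite G" "G \<subseteq> classes" unfolding G_def G1_def using F1 G0 by auto
  have close: "\<bar>(\<Sum>C\<in>G. cd C t) - WW t\<bar> \<le> \<eta>" if "t \<in> {\<alpha>..\<beta>}" for t
  proof -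
    have "t \<in> {-of_int T..of_int T}" using that T by auto
    thus ?thesis using G0(3)[OF G(1) _ G(2)] unfolding G_def by (auto simp: dist_real_def less_imp_le)
  qed
  have intW: "WW integrable_on {\<alpha>..\<beta>}" using WW_continuous by (intro integrable_continuous_interval) (auto intro: continuous_on_subset)
  have intC: "cd C integrable_on {\<alpha>..\<beta>}" if "C \<in> classes" for C
    using cd(1)[OF that] by (intro integrable_continuous_interval) (auto intro: continuous_on_subset)
  define L where "L = (\<Sum>C\<in>G. integral {\<alpha>..\<beta>} (cd C))"
  have "\<bar>L - integral {\<alpha>..\<beta>} WW\<bar> \<le> \<eta> * (\<beta> - \<alpha>)"
  proof -
    have L: "L = integral {\<alpha>..\<beta>} (\<lambda>t. \<Sum>C\<in>G. cd C t)" unfolding L_def using G intC by (intro integral_sum[symmetric]) auto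
    have ii: "(\<lambda>t. \<Sum>C\<in>G. cd C t) integrable_on {\<alpha>..\<beta>}" using G intC by (intro integrable_sum) auto
    have "norm (integral {\<alpha>..\<beta>} (\<lambda>t. (\<Sum>C\<in>G. cd C t) - WW t)) \<le> integral {\<alpha>..\<beta>} (\<lambda>_. \<eta>)"
      by (rule integral_norm_bound_integral) (use ii intW close in \<open>auto intro!: integrable_diff\<close>)
    thus ?thesis unfolding L using ii intW \<alpha>\<beta> by (simp add: integral_diff mult.commute)
  qed
  also have "\<eta> * (\<beta> - \<alpha>) \<le> \<eta> * d" using \<eta> d by (intro mult_left_mono) auto
  also have "\<dots> = \<epsilon> / 4" unfolding \<eta>_def using d by simp
  finally have LW: "\<bar>L - integral {\<alpha>..\<beta>} WW\<bar> \<le> \<epsilon> / 4" .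
  have "((\<lambda>M. \<Sum>C\<in>G. card (NP e M \<alpha> \<beta> \<inter> C) / M) \<longlongrightarrow> L) at_top"
    unfolding L_def using G by (intro tendsto_sum cd(4)) auto
  from tendstoD[OF this, of "\<epsilon> / 4"]
  have "\<forall>\<^sub>F M in at_top. \<bar>(\<Sum>C\<in>G. card (NP e M \<alpha> \<beta> \<inter> C) / M) - L\<bar> < \<epsilon> / 4"
    unfolding dist_real_def using \<epsilon> by simp
  thus "\<forall>\<^sub>F M in at_top. dist (card (NP e M \<alpha> \<beta>) / M) (integral {\<alpha>..\<beta>} WW) < \<epsilon>"
    using eventually_ge_at_top[of 1]
  proof eventually_elim
    case (elim M)
    define N where "N = NP e M \<alpha> \<beta>"
    have finN: "finite N" unfolding N_def by (rule NP_finite[OF elim(2)])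
    have rest: "N - \<Union>G \<subseteq> {p \<in> NPT M T. 2 ^ k * real_of_int (fst (fst p)) \<le> M}"
    proof
      fix p assume p: "p \<in> N - \<Union>G"
      have pT: "p \<in> NPT M T" using p NP_subset_NPT[OF T(2,3)] unfolding N_def by blast
      have pA: "p \<in> APairs" using p unfolding N_def NP_def by auto
      have "2 ^ k * real_of_int (fst (fst p)) \<le> M"
      proof (rule ccontr)
        assume "\<not> 2 ^ k * real_of_int (fst (fst p)) \<le> M"
        hence "M \<le> 2 ^ k * real_of_int (fst (fst p))" by linarith
        then obtain q where q: "q \<in> F1" "equivp p q" using F1(2) pT by blast
        have "{r \<in> APairs. equivp q r} = {r \<in> APairs. equivp p r}" using q(2) equivp_sym equivp_trans by blast
        moreover have "{r \<in> APairs. equivp p r} \<in> classes" unfolding classes_def using pA by blast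
        ultimately have "{r \<in> APairs. equivp q r} \<in> classes" by (simp only:)
        hence "{r \<in> APairs. equivp q r} \<in> G1" unfolding G1_def using imageI[OF q(1)] by (intro IntI)
        moreover have "p \<in> {r \<in> APairs. equivp q r}" using pA q(2) equivp_sym by blast
        ultimately show False using p unfolding G_def by blast
      qed
      thus "p \<in> {p \<in> NPT M T. 2 ^ k * real_of_int (fst (fst p)) \<le> M}" using pT by blast
    qed
    have "real (card (N - \<Union>G)) \<le> c * M * ((2 * real k + 4) / 2 ^ k)"
      using card_mono[OF _ rest] c(2) elim(2) by (meson of_nat_le_iff order_trans)
    also have "\<dots> = M * (c * ((2 * real k + 4) / 2 ^ k))" by simp
    also have "\<dots> \<le> M * (\<epsilon> / 4)" using k elim(2) by (intro mult_left_mono) auto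
    finally have r: "real (card (N - \<Union>G)) / M \<le> \<epsilon> / 4" using elim(2) by (simp add: field_simps)
    have "card N = card (N \<inter> \<Union>G) + card (N - \<Union>G)"
      using finN by (metis Int_Diff_Un Int_Diff_disjoint card_Un_disjoint finite_Diff finite_Int)
    hence "real (card N) / M = real (card (N \<inter> \<Union>G)) / M + real (card (N - \<Union>G)) / M" by (simp add: add_divide_distrib)
    moreover have "real (card (N \<inter> \<Union>G)) / M = (\<Sum>C\<in>G. card (NP e M \<alpha> \<beta> \<inter> C) / M)"
      unfolding N_def class_sum_le[OF G elim(2), symmetric] by (simp add: sum_divide_distrib)
    moreover have "real (card (N - \<Union>G)) / M \<ge> 0" using elim(2) by simp
    ultimately have "\<bar>real (card N) / M - integral {\<alpha>..\<beta>} WW\<bar> < \<epsilon>" using r elim(1) LW \<epsilon> by linarith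
    thus ?case unfolding N_def dist_real_def .
  qed
qed

end

context nonsquare_roots
begin

subsection \<open>From pairs of forms to pairs of roots\<close>

definition rpairs :: "bool \<Rightarrow> real \<Rightarrow> real \<Rightarrow> real \<Rightarrow> ((int \<times> int) \<times> (int \<times> int)) set" where
  "rpairs e M \<alpha> \<beta> = {(\<rho>, \<rho>'). \<rho> \<in> root_pairs D \<nu> n \<and> \<rho>' \<in> root_pairs D \<nu> n \<and> \<rho> \<noteq> \<rho>'
     \<and> (if e then fst \<rho> \<le> fst \<rho>' else fst \<rho> < fst \<rho>') \<and> real_of_int (fst \<rho>') \<le> M
     \<and> (\<exists>k::int. \<alpha> / M \<le> root_point \<rho>' - root_point \<rho> + k \<and> root_point \<rho>' - root_point \<rho> + k \<le> \<beta> / M)}"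

definition slope :: "form \<Rightarrow> real" where
  "slope Q = real_of_int (fst (snd Q)) / real_of_int (fst Q)"

lemma slope_root: "fst Q \<noteq> 0 \<Longrightarrow> slope Q = root_point (root_of Q) + of_int (fst (snd Q) div fst Q)"
proof -
  assume a: "fst Q \<noteq> 0"
  have "real_of_int (fst (snd Q)) = real_of_int (fst (snd Q) mod fst Q + fst (snd Q) div fst Q * fst Q)" by simp
  also have "\<dots> = real_of_int (fst (snd Q) mod fst Q) + real_of_int (fst (snd Q) div fst Q) * real_of_int (fst Q)"
    by (simp only: of_int_add of_int_mult)
  finally show ?thesis using a unfolding slope_def root_point_def root_of_def by (simp add: add_divide_distrib)
qed

lemma slope_translation: "fst Q \<noteq> 0 \<Longrightarrow> slope (act Q (1, k, 0, 1)) = slope Q + of_int k"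
  by (cases Q) (simp add: slope_def field_simps)

lemma NP_slope:
  assumes "M > 0"
  shows "p \<in> NP e M \<alpha> \<beta> \<longleftrightarrow> p \<in> APairs \<and> (if e then fst (fst p) \<le> fst (snd p) else fst (fst p) < fst (snd p))
     \<and> real_of_int (fst (snd p)) \<le> M \<and> \<alpha> / M \<le> slope (snd p) - slope (fst p) \<and> slope (snd p) - slope (fst p) \<le> \<beta> / M"
proof (cases "p \<in> APairs")
  case True
  define a b where "a = real_of_int (fst (fst p))" and "b = real_of_int (fst (snd p))"
  have ab: "a > 0" "b > 0" using True unfolding APairs_def gpair_def a_def b_def by auto
  have ke: "slope (snd p) - slope (fst p) = real_of_int (ke p) / (a * b)"
    using ab unfolding slope_def ke_def a_def b_def by (simp add: field_simps)
  have "\<alpha> / M \<le> real_of_int (ke p) / (a * b) \<longleftrightarrow> \<alpha> * (a * b) \<le> M * real_of_int (ke p)"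
    "real_of_int (ke p) / (a * b) \<le> \<beta> / M \<longleftrightarrow> M * real_of_int (ke p) \<le> \<beta> * (a * b)"
    using ab assms by (auto simp: field_simps)
  thus ?thesis unfolding ke NP_def a_def b_def by simp
qed (simp add: NP_def)

text \<open>For large \<open>M\<close> the window is shorter than 1, so at most one integer shift
  brings a given pair of roots into it and the second form is determined. The window also lies
  inside (-1, 1), so distinct forms of a pair cannot have the same root, as their slopes would
  differ by a nonzero integer.\<close>

lemma rpairs_card:
  assumes M: "M > \<bar>\<alpha>\<bar>" "M > \<bar>\<beta>\<bar>" "M > \<beta> - \<alpha>"
  shows "card (rpairs e M \<alpha> \<beta>) = card (NP e M \<alpha> \<beta>)"
proof -
  have M0: "M > 0" using M(1) by linarith
  define f where "f p = (root_of (fst p), root_of (snd p))" for p :: "form \<times> form"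
  have lt1: "\<bar>\<alpha> / M\<bar> < 1" "\<bar>\<beta> / M\<bar> < 1" "\<beta> / M - \<alpha> / M < 1" using M M0 by (auto simp: field_simps)
  have facts: "fst p \<in> rforms" "snd p \<in> rforms" "fst (fst p) > 0" "fst (snd p) > 0" "fst p \<noteq> snd p" "normalized (fst p)"
    "\<alpha> / M \<le> slope (snd p) - slope (fst p)" "slope (snd p) - slope (fst p) \<le> \<beta> / M" if "p \<in> NP e M \<alpha> \<beta>" for p
    using that unfolding NP_slope[OF M0] APairs_def gpair_def by auto
  have int0: "k = 0" if "\<bar>real_of_int k\<bar> < 1" for k :: int using that by linarith
  have inj: "inj_on f (NP e M \<alpha> \<beta>)"
  proof (rule inj_onI)
    fix p p' assume p: "p \<in> NP e M \<alpha> \<beta>" "p' \<in> NP e M \<alpha> \<beta>" "f p = f p'"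
    note F = facts[OF p(1)] and F' = facts[OF p(2)]
    have r: "root_of (fst p) = root_of (fst p')" "root_of (snd p) = root_of (snd p')" using p(3) unfolding f_def by auto
    obtain k where k: "fst p' = act (fst p) (1, k, 0, 1)"
      using root_of_eq[OF r(1)] dsc_rforms F F' by (metis less_irrefl)
    have "k = 0" using normalized_translation[of "fst p" k] F(6) F'(6) unfolding k by blast
    hence e1: "fst p' = fst p" using k by (simp add: act_one)
    obtain l where l: "snd p' = act (snd p) (1, l, 0, 1)"
      using root_of_eq[OF r(2)] dsc_rforms F F' by (metis less_irrefl)
    have "slope (snd p') = slope (snd p) + of_int l" unfolding l using F(4) by (intro slope_translation) simp
    hence "\<bar>real_of_int l\<bar> < 1" using F(7,8) F'(7,8) lt1(3) unfolding e1 by linarith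
    hence "l = 0" by (rule int0)
    hence "snd p' = snd p" using l by (simp add: act_one)
    thus "p = p'" using e1 by (simp add: prod_eq_iff)
  qed
  have "f ` NP e M \<alpha> \<beta> = rpairs e M \<alpha> \<beta>"
  proof (intro equalityI subsetI)
    fix z assume "z \<in> f ` NP e M \<alpha> \<beta>"
    then obtain p where p: "p \<in> NP e M \<alpha> \<beta>" "z = f p" by auto
    note F = facts[OF p(1)]
    have "root_of (fst p) \<noteq> root_of (snd p)"
    proof
      assume "root_of (fst p) = root_of (snd p)"
      then obtain k where k: "snd p = act (fst p) (1, k, 0, 1)"
        using root_of_eq[of "fst p" "snd p"] dsc_rforms F by (metis less_irrefl)
      have "slope (snd p) = slope (fst p) + of_int k" unfolding k using F(3) by (intro slope_translation) simp
      hence "\<bar>real_of_int k\<bar> < 1" using F(7,8) lt1 by linarith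
      hence "k = 0" by (rule int0)
      thus False using k F(5) by (simp add: act_one)
    qed
    moreover have "slope (snd p) - slope (fst p) = root_point (root_of (snd p)) - root_point (root_of (fst p))
        + of_int (fst (snd (snd p)) div fst (snd p) - fst (snd (fst p)) div fst (fst p))"
      using slope_root[of "fst p"] slope_root[of "snd p"] F(3,4) by simp
    hence "\<exists>k::int. \<alpha> / M \<le> root_point (root_of (snd p)) - root_point (root_of (fst p)) + k \<and> root_point (root_of (snd p)) - root_point (root_of (fst p)) + k \<le> \<beta> / M"
      using F(7,8) by (intro exI[of _ "fst (snd (snd p)) div fst (snd p) - fst (snd (fst p)) div fst (fst p)"]) linarith
    moreover have "fst (root_of Q) = fst Q" for Q unfolding root_of_def by simp
    moreover have "(if e then fst (fst p) \<le> fst (snd p) else fst (fst p) < fst (snd p)) \<and> real_of_int (fst (snd p)) \<le> M"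
      using p(1) unfolding NP_slope[OF M0] by blast
    ultimately show "z \<in> rpairs e M \<alpha> \<beta>"
      unfolding p(2) f_def rpairs_def using root_of_in F(1-4) by simp
  next
    fix z assume z: "z \<in> rpairs e M \<alpha> \<beta>"
    obtain \<rho> \<rho>' where zz: "z = (\<rho>, \<rho>')" by (cases z)
    obtain k :: int where k: "\<alpha> / M \<le> root_point \<rho>' - root_point \<rho> + k" "root_point \<rho>' - root_point \<rho> + k \<le> \<beta> / M"
      using z unfolding zz rpairs_def by auto
    have r: "\<rho> \<in> root_pairs D \<nu> n" "\<rho>' \<in> root_pairs D \<nu> n" "\<rho> \<noteq> \<rho>'" using z unfolding zz rpairs_def by auto
    note F = form_of[OF r(1)] and F' = form_of[OF r(2)]
    define Q where "Q = act (form_of \<rho>') (1, k, 0, 1)"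
    have Q: "Q \<in> rforms" "fst Q = fst \<rho>'" "root_of Q = \<rho>'"
    proof -
      show "Q \<in> rforms" unfolding Q_def by (rule rforms_act[OF F'(1) Gamma0_translation])
      show "fst Q = fst \<rho>'" unfolding Q_def form_of_def act_translation by simp
      show "root_of Q = \<rho>'" unfolding Q_def root_of_translation by (rule F'(4))
    qed
    have sl: "slope (form_of \<rho>) = root_point \<rho>" "slope Q = root_point \<rho>' + k"
      using slope_translation[of "form_of \<rho>'" k] F'(2,3) unfolding Q_def
      by (auto simp: slope_def form_of_def root_point_def)
    have "(form_of \<rho>, Q) \<in> APairs"
      unfolding APairs_def gpair_def normalized_def using F Q F'(3) r
      by (auto simp: form_of_def root_pairs_def)
    hence "(form_of \<rho>, Q) \<in> NP e M \<alpha> \<beta>"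
      unfolding NP_slope[OF M0] using sl k Q(2) F(2) z unfolding zz rpairs_def by simp
    moreover have "f (form_of \<rho>, Q) = z" unfolding f_def zz using F(4) Q(3) by simp
    ultimately show "z \<in> f ` NP e M \<alpha> \<beta>" by (metis image_eqI)
  qed
  thus ?thesis using card_image[OF inj] by simp
qed

definition tot :: "real \<Rightarrow> real \<Rightarrow> real \<Rightarrow> ((int \<times> int) \<times> (int \<times> int)) set" where
  "tot M \<alpha> \<beta> = {(\<rho>, \<rho>'). \<rho> \<in> root_pairs D \<nu> n \<and> \<rho>' \<in> root_pairs D \<nu> n \<and> \<rho> \<noteq> \<rho>' \<and> real_of_int (fst \<rho>) \<le> M \<and> real_of_int (fst \<rho>') \<le> M
     \<and> (\<exists>k::int. \<alpha> / M \<le> root_point \<rho> - root_point \<rho>' + k \<and> root_point \<rho> - root_point \<rho>' + k \<le> \<beta> / M)}"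

lemma finite_tot: "finite (tot M \<alpha> \<beta>)"
  by (rule finite_subset[OF _ finite_SigmaI[OF finite_roots_le[of M] finite_roots_le[of M]]]) (auto simp: tot_def)

text \<open>The two terms are the two orders of the moduli; exchanging the points reverses the
  difference.\<close>

definition VV :: "real \<Rightarrow> real" where
  "VV t = WW t + WW (- t)"

lemma VV_continuous: "continuous_on S VV"
  unfolding VV_def
  by (intro continuous_intros continuous_on_compose2[OF WW_continuous]) (auto intro: continuous_on_subset[OF WW_continuous])

lemma tot_limit:
  assumes \<alpha>\<beta>: "\<alpha> \<le> \<beta>"
  shows "((\<lambda>M. card (tot M \<alpha> \<beta>) / M) \<longlongrightarrow> integral {\<alpha>..\<beta>} VV) at_top"
proof -
  have "((\<lambda>M. card (NP True M \<alpha> \<beta>) / M + card (NP False M (-\<beta>) (-\<alpha>)) / M) \<longlongrightarrow> integral {\<alpha>..\<beta>} WW + integral {-\<beta>..-\<alpha>} WW) at_top"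
    using \<alpha>\<beta> by (intro tendsto_add NP_limit) auto
  moreover have "integral {-\<beta>..-\<alpha>} WW = integral {\<alpha>..\<beta>} (\<lambda>t. WW (- t))"
    using Henstock_Kurzweil_Integration.integral_reflect_real[where a = \<alpha> and b = \<beta> and f = "\<lambda>t. WW (- t)"] by simp
  moreover have "integral {\<alpha>..\<beta>} WW + integral {\<alpha>..\<beta>} (\<lambda>t. WW (- t)) = integral {\<alpha>..\<beta>} VV"
    unfolding VV_def
    by (intro integral_add[symmetric] integrable_continuous_interval continuous_on_compose2[OF WW_continuous] continuous_intros)
       (auto intro: continuous_on_subset[OF WW_continuous])
  ultimately have lim: "((\<lambda>M. card (NP True M \<alpha> \<beta>) / M + card (NP False M (-\<beta>) (-\<alpha>)) / M) \<longlongrightarrow> integral {\<alpha>..\<beta>} VV) at_top" by simp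
  have "\<forall>\<^sub>F M in at_top. card (NP True M \<alpha> \<beta>) / M + card (NP False M (-\<beta>) (-\<alpha>)) / M = card (tot M \<alpha> \<beta>) / M"
    using eventually_gt_at_top[of "\<bar>\<alpha>\<bar>"] eventually_gt_at_top[of "\<bar>\<beta>\<bar>"] eventually_gt_at_top[of "\<beta> - \<alpha>"]
  proof eventually_elim
    case (elim M)
    have M0: "M > 0" using elim(1) by linarith
    define sw :: "(int \<times> int) \<times> (int \<times> int) \<Rightarrow> _" where "sw = (\<lambda>(x, y). (y, x))"
    have fin: "finite (sw ` rpairs True M \<alpha> \<beta>)" "finite (rpairs False M (-\<beta>) (-\<alpha>))"
    proof -
      have sub: "rpairs e M a b \<subseteq> {\<rho> \<in> root_pairs D \<nu> n. real_of_int (fst \<rho>) \<le> M} \<times> {\<rho> \<in> root_pairs D \<nu> n. real_of_int (fst \<rho>) \<le> M}" for e a b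
        unfolding rpairs_def by (auto split: if_splits)
      have "finite (rpairs e M a b)" for e a b
        by (rule finite_subset[OF sub]) (intro finite_cartesian_product finite_roots_le)
      thus "finite (sw ` rpairs True M \<alpha> \<beta>)" "finite (rpairs False M (-\<beta>) (-\<alpha>))" by auto
    qed
    \<comment> \<open>The first part holds the pairs whose second modulus is at most the first, with
      the two roots exchanged; the strict comparison in the other part keeps them disjoint.\<close>
    have "tot M \<alpha> \<beta> = sw ` rpairs True M \<alpha> \<beta> \<union> rpairs False M (-\<beta>) (-\<alpha>)"
    proof (intro set_eqI iffI)
      fix z assume z: "z \<in> tot M \<alpha> \<beta>"
      obtain \<rho> \<rho>' where zz: "z = (\<rho>, \<rho>')" by (cases z)
      obtain k :: int where k: "\<alpha> / M \<le> root_point \<rho> - root_point \<rho>' + k" "root_point \<rho> - root_point \<rho>' + k \<le> \<beta> / M"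
        using z unfolding zz tot_def by auto
      show "z \<in> sw ` rpairs True M \<alpha> \<beta> \<union> rpairs False M (-\<beta>) (-\<alpha>)"
      proof (cases "fst \<rho>' \<le> fst \<rho>")
        case True
        have "(\<rho>', \<rho>) \<in> rpairs True M \<alpha> \<beta>" using z True k unfolding zz tot_def rpairs_def by auto
        thus ?thesis unfolding zz sw_def by force
      next
        case False
        have "-\<beta> / M \<le> root_point \<rho>' - root_point \<rho> + of_int (- k)" "root_point \<rho>' - root_point \<rho> + of_int (- k) \<le> -\<alpha> / M"
          using k by auto
        hence "\<exists>k::int. -\<beta> / M \<le> root_point \<rho>' - root_point \<rho> + k \<and> root_point \<rho>' - root_point \<rho> + k \<le> -\<alpha> / M" by blast
        hence "(\<rho>, \<rho>') \<in> rpairs False M (-\<beta>) (-\<alpha>)" using z False unfolding zz tot_def rpairs_def by simp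
        thus ?thesis unfolding zz by simp
      qed
    next
      fix z assume z: "z \<in> sw ` rpairs True M \<alpha> \<beta> \<union> rpairs False M (-\<beta>) (-\<alpha>)"
      obtain \<rho> \<rho>' where zz: "z = (\<rho>, \<rho>')" by (cases z)
      consider "(\<rho>', \<rho>) \<in> rpairs True M \<alpha> \<beta>" | "(\<rho>, \<rho>') \<in> rpairs False M (-\<beta>) (-\<alpha>)" using z unfolding zz sw_def by auto
      thus "z \<in> tot M \<alpha> \<beta>"
      proof cases
        case 1 thus ?thesis unfolding zz tot_def rpairs_def by auto
      next
        case 2
        then obtain k :: int where k: "-\<beta> / M \<le> root_point \<rho>' - root_point \<rho> + k" "root_point \<rho>' - root_point \<rho> + k \<le> -\<alpha> / M"
          unfolding rpairs_def by auto
        have "\<alpha> / M \<le> root_point \<rho> - root_point \<rho>' + of_int (- k)" "root_point \<rho> - root_point \<rho>' + of_int (- k) \<le> \<beta> / M"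
          using k by auto
        hence "\<exists>k::int. \<alpha> / M \<le> root_point \<rho> - root_point \<rho>' + k \<and> root_point \<rho> - root_point \<rho>' + k \<le> \<beta> / M" by blast
        thus ?thesis using 2 unfolding zz tot_def rpairs_def by simp
      qed
    qed
    moreover have "sw ` rpairs True M \<alpha> \<beta> \<inter> rpairs False M (-\<beta>) (-\<alpha>) = {}" unfolding sw_def rpairs_def by auto
    ultimately have "card (tot M \<alpha> \<beta>) = card (sw ` rpairs True M \<alpha> \<beta>) + card (rpairs False M (-\<beta>) (-\<alpha>))"
      using fin by (simp add: card_Un_disjoint)
    also have "card (sw ` rpairs True M \<alpha> \<beta>) = card (rpairs True M \<alpha> \<beta>)"
      by (intro card_image) (auto simp: inj_on_def sw_def)
    also have "\<dots> = card (NP True M \<alpha> \<beta>)" by (rule rpairs_card) (use elim in auto)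
    also have "card (rpairs False M (-\<beta>) (-\<alpha>)) = card (NP False M (-\<beta>) (-\<alpha>))" by (rule rpairs_card) (use elim in auto)
    finally show ?case by (simp add: add_divide_distrib)
  qed
  with lim show ?thesis by (rule Lim_transform_eventually)
qed

end

context nonsquare_roots
begin

subsection \<open>From the size of the modulus to the index\<close>

context
  fixes e :: "nat \<Rightarrow> int \<times> int"
  assumes en: "root_enumeration D \<nu> n e"
begin

definition MN :: "nat \<Rightarrow> real" where
  "MN N = real_of_int (fst (e N))"

lemma enum: "i \<ge> 1 \<Longrightarrow> e i \<in> root_pairs D \<nu> n" "i \<ge> 1 \<Longrightarrow> i \<le> j \<Longrightarrow> fst (e i) \<le> fst (e j)" "inj_on e {1..}"
  "\<rho> \<in> root_pairs D \<nu> n \<Longrightarrow> \<exists>i\<ge>1. e i = \<rho>"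
  using en unfolding root_enumeration_def bij_betw_def by (auto simp: image_iff) (metis atLeast_iff imageE)

text \<open>Points of equal modulus come in arbitrary order, so the first \<open>N\<close> points
  may split the last modulus; moduli being integers, all roots of modulus at most
  \<open>MN N - 1\<close> have appeared.\<close>

lemma index_sandwich:
  assumes N: "N \<ge> 1"
  shows "{\<rho> \<in> root_pairs D \<nu> n. real_of_int (fst \<rho>) \<le> MN N - 1} \<subseteq> e ` {1..N}"
    "e ` {1..N} \<subseteq> {\<rho> \<in> root_pairs D \<nu> n. real_of_int (fst \<rho>) \<le> MN N}"
proof
  fix \<rho> assume \<rho>: "\<rho> \<in> {\<rho> \<in> root_pairs D \<nu> n. real_of_int (fst \<rho>) \<le> MN N - 1}"
  then obtain i where i: "i \<ge> 1" "e i = \<rho>" using enum(4) by blast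
  have "i \<le> N"
  proof (rule ccontr)
    assume "\<not> i \<le> N"
    hence "fst (e N) \<le> fst (e i)" using enum(2)[of N i] N by simp
    thus False using \<rho> i unfolding MN_def by simp
  qed
  thus "\<rho> \<in> e ` {1..N}" using i by auto
next
  show "e ` {1..N} \<subseteq> {\<rho> \<in> root_pairs D \<nu> n. real_of_int (fst \<rho>) \<le> MN N}"
    using enum(1,2) unfolding MN_def by auto
qed

definition cnt :: "real \<Rightarrow> real" where
  "cnt X = real (card {\<rho> \<in> root_pairs D \<nu> n. real_of_int (fst \<rho>) \<le> X})"

lemma cnt_sandwich:
  assumes N: "N \<ge> 1"
  shows "cnt (MN N - 1) \<le> real N" "real N \<le> cnt (MN N)"
proof -
  have c: "card (e ` {1..N}) = N" using card_image[OF inj_on_subset[OF enum(3)], of "{1..N}"] by auto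
  have "card {\<rho> \<in> root_pairs D \<nu> n. real_of_int (fst \<rho>) \<le> MN N - 1} \<le> N"
    using card_mono[OF _ index_sandwich(1)[OF N]] c by simp
  thus "cnt (MN N - 1) \<le> real N" unfolding cnt_def by simp
  have "N \<le> card {\<rho> \<in> root_pairs D \<nu> n. real_of_int (fst \<rho>) \<le> MN N}"
    using card_mono[OF finite_roots_le index_sandwich(2)[OF N]] c by simp
  thus "real N \<le> cnt (MN N)" unfolding cnt_def by simp
qed

lemma MN_top: "filterlim MN at_top sequentially"
proof -
  obtain c1 where c1: "c1 > 0" "\<And>X. X > 0 \<Longrightarrow> cnt X \<le> c1 * X" using root_count_bound[OF nu] unfolding cnt_def by blast
  have "\<forall>\<^sub>F N in sequentially. real N / c1 \<le> MN N"
    using eventually_ge_at_top[of 1]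
  proof eventually_elim
    case (elim N)
    have "MN N > 0" using enum(1)[OF elim] unfolding MN_def root_pairs_def by auto
    hence "real N \<le> c1 * MN N" using c1(2) cnt_sandwich(2)[OF elim] by force
    thus ?case using c1(1) by (simp add: field_simps)
  qed
  moreover have "filterlim (\<lambda>N. real N / c1) at_top sequentially" using c1(1) by real_asymp
  ultimately show ?thesis using filterlim_at_top_mono by blast
qed

text \<open>\<open>N\<close> lies between the counts at \<open>MN N - 1\<close> and at
  \<open>MN N\<close>, which are both asymptotic to \<open>c * MN N\<close>.\<close>

lemma MN_ratio:
  assumes c: "((\<lambda>X. cnt X / X) \<longlongrightarrow> c) at_top" "c > 0"
  shows "(\<lambda>N. real N / MN N) \<longlonglongrightarrow> c" "(\<lambda>N. real N / (MN N - 1)) \<longlonglongrightarrow> c"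
proof -
  have top1: "filterlim (\<lambda>N. MN N - 1) at_top sequentially"
    using filterlim_tendsto_add_at_top[OF tendsto_const[of "-1"] MN_top] by (simp add: add.commute)
  have q: "(\<lambda>N. (MN N - 1) / MN N) \<longlonglongrightarrow> 1"
  proof -
    have "((\<lambda>X::real. (X - 1) / X) \<longlongrightarrow> 1) at_top" by real_asymp
    from filterlim_compose[OF this MN_top] show ?thesis .
  qed
  have up: "(\<lambda>N. cnt (MN N) / MN N) \<longlonglongrightarrow> c" by (rule filterlim_compose[OF c(1) MN_top])
  have lo: "(\<lambda>N. cnt (MN N - 1) / (MN N - 1)) \<longlonglongrightarrow> c" by (rule filterlim_compose[OF c(1) top1])
  have ev: "\<forall>\<^sub>F N in sequentially. MN N > 1 \<and> N \<ge> 1"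
    using MN_top eventually_ge_at_top[of "1::nat"] unfolding filterlim_at_top_dense by (auto simp: eventually_conj_iff)
  show 1: "(\<lambda>N. real N / MN N) \<longlonglongrightarrow> c"
  proof (rule tendsto_sandwich[OF _ _ _ up])
    show "(\<lambda>N. cnt (MN N - 1) / (MN N - 1) * ((MN N - 1) / MN N)) \<longlonglongrightarrow> c" using tendsto_mult[OF lo q] by simp
    show "\<forall>\<^sub>F N in sequentially. cnt (MN N - 1) / (MN N - 1) * ((MN N - 1) / MN N) \<le> real N / MN N"
      using ev by eventually_elim (use cnt_sandwich in \<open>auto intro: divide_right_mono\<close>)
    show "\<forall>\<^sub>F N in sequentially. real N / MN N \<le> cnt (MN N) / MN N"
      using ev by eventually_elim (use cnt_sandwich in \<open>auto intro: divide_right_mono\<close>)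
  qed
  have "(\<lambda>N. real N / MN N / ((MN N - 1) / MN N)) \<longlonglongrightarrow> c / 1" by (intro tendsto_divide 1 q) simp
  moreover have "\<forall>\<^sub>F N in sequentially. real N / MN N / ((MN N - 1) / MN N) = real N / (MN N - 1)"
    using ev by eventually_elim auto
  ultimately have "(\<lambda>N. real N / (MN N - 1)) \<longlonglongrightarrow> c / 1" by (rule Lim_transform_eventually)
  thus "(\<lambda>N. real N / (MN N - 1)) \<longlonglongrightarrow> c" by simp
qed

definition PC :: "nat \<Rightarrow> real set \<Rightarrow> (nat \<times> nat) set" where
  "PC N I = {(i, j). i \<in> {1..N} \<and> j \<in> {1..N} \<and> i \<noteq> j \<and>
     root_point (e i) - root_point (e j) \<in> {t / real N + of_int k | t k. t \<in> I}}"

lemma PC_upper: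
  assumes N: "N \<ge> 1" and M0: "MN N > 0" and sub: "\<And>t. t \<in> I \<Longrightarrow> \<alpha> / MN N \<le> t / real N \<and> t / real N \<le> \<beta> / MN N"
  shows "card (PC N I) \<le> card (tot (MN N) \<alpha> \<beta>)"
proof (rule card_inj_on_le)
  show "inj_on (\<lambda>(i, j). (e i, e j)) (PC N I)"
    using enum(3) unfolding PC_def inj_on_def by auto
  show "(\<lambda>(i, j). (e i, e j)) ` PC N I \<subseteq> tot (MN N) \<alpha> \<beta>"
  proof
    fix z assume "z \<in> (\<lambda>(i, j). (e i, e j)) ` PC N I"
    then obtain i j t k where ij: "z = (e i, e j)" "i \<in> {1..N}" "j \<in> {1..N}" "i \<noteq> j" "t \<in> I"
      "root_point (e i) - root_point (e j) = t / real N + of_int k" unfolding PC_def by auto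
    have "e i \<noteq> e j" using ij enum(3) unfolding inj_on_def by auto
    moreover have "\<alpha> / MN N \<le> root_point (e i) - root_point (e j) + of_int (- k) \<and> root_point (e i) - root_point (e j) + of_int (- k) \<le> \<beta> / MN N"
      using sub[OF ij(5)] ij(6) by simp
    hence "\<exists>k::int. \<alpha> / MN N \<le> root_point (e i) - root_point (e j) + k \<and> root_point (e i) - root_point (e j) + k \<le> \<beta> / MN N" by blast
    moreover have "e i \<in> {\<rho> \<in> root_pairs D \<nu> n. real_of_int (fst \<rho>) \<le> MN N}" "e j \<in> {\<rho> \<in> root_pairs D \<nu> n. real_of_int (fst \<rho>) \<le> MN N}"
      using subsetD[OF index_sandwich(2)[OF N] imageI[OF ij(2)]] subsetD[OF index_sandwich(2)[OF N] imageI[OF ij(3)]] by auto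
    ultimately show "z \<in> tot (MN N) \<alpha> \<beta>" unfolding ij(1) tot_def by simp
  qed
  show "finite (tot (MN N) \<alpha> \<beta>)" by (rule finite_tot)
qed

lemma finite_PC: "finite (PC N I)"
  by (rule finite_subset[of _ "{1..N} \<times> {1..N}"]) (auto simp: PC_def)

lemma PC_lower:
  assumes N: "N \<ge> 1" and M1: "MN N > 1" and sub: "\<And>y. \<alpha> \<le> y \<Longrightarrow> y \<le> \<beta> \<Longrightarrow> real N / (MN N - 1) * y \<in> I"
  shows "card (tot (MN N - 1) \<alpha> \<beta>) \<le> card (PC N I)"
proof -
  have "tot (MN N - 1) \<alpha> \<beta> \<subseteq> (\<lambda>(i, j). (e i, e j)) ` PC N I"
  proof
    fix z assume z: "z \<in> tot (MN N - 1) \<alpha> \<beta>"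
    obtain \<rho> \<rho>' where zz: "z = (\<rho>, \<rho>')" by (cases z)
    have r: "\<rho> \<in> e ` {1..N}" "\<rho>' \<in> e ` {1..N}" using z index_sandwich(1)[OF N] unfolding zz tot_def by auto
    obtain i where i: "i \<in> {1..N}" "e i = \<rho>" using r(1) by blast
    obtain j where j: "j \<in> {1..N}" "e j = \<rho>'" using r(2) by blast
    obtain k :: int where k: "\<alpha> / (MN N - 1) \<le> root_point \<rho> - root_point \<rho>' + k" "root_point \<rho> - root_point \<rho>' + k \<le> \<beta> / (MN N - 1)"
      using z unfolding zz tot_def by auto
    define y where "y = (MN N - 1) * (root_point \<rho> - root_point \<rho>' + k)"
    have "\<alpha> \<le> y" "y \<le> \<beta>" unfolding y_def using k M1 by (auto simp: field_simps)
    hence I: "real N / (MN N - 1) * y \<in> I" by (rule sub)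
    have "root_point \<rho> - root_point \<rho>' = (real N / (MN N - 1) * y) / real N + of_int (- k)"
      unfolding y_def using N M1 by simp
    hence "\<exists>t k. root_point \<rho> - root_point \<rho>' = t / real N + of_int k \<and> t \<in> I" using I by blast
    moreover have "i \<noteq> j" using z i j unfolding zz tot_def by auto
    ultimately have "(i, j) \<in> PC N I" unfolding PC_def using i j by simp
    thus "z \<in> (\<lambda>(i, j). (e i, e j)) ` PC N I" unfolding zz using i j by (intro image_eqI[of _ _ "(i, j)"]) auto
  qed
  hence "card (tot (MN N - 1) \<alpha> \<beta>) \<le> card ((\<lambda>(i, j). (e i, e j)) ` PC N I)" by (intro card_mono finite_imageI finite_PC)
  also have "\<dots> \<le> card (PC N I)" by (rule card_image_le[OF finite_PC])
  finally show ?thesis .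
qed

end

lemma VV_nonneg: "VV t \<ge> 0"
  unfolding VV_def using WW_nonneg by (simp add: add_nonneg_nonneg)

lemma VV_integral_bounds:
  assumes "\<forall>t\<in>{a - 1..b + 1}. VV t \<le> K" "a \<le> b" "0 \<le> \<delta>" "\<delta> \<le> 1"
  shows "integral {a - \<delta>..b + \<delta>} VV \<le> integral {a..b} VV + 2 * \<delta> * K"
    "a + \<delta> \<le> b - \<delta> \<Longrightarrow> integral {a..b} VV \<le> integral {a + \<delta>..b - \<delta>} VV + 2 * \<delta> * K"
    "integral {a..b} VV \<le> (b - a) * K"
proof -
  have int: "VV integrable_on {x..y}" for x y by (intro integrable_continuous_interval VV_continuous)
  have le: "integral {x..y} VV \<le> (y - x) * K" if "a - 1 \<le> x" "y \<le> b + 1" "x \<le> y" for x y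
  proof -
    have "integral {x..y} VV \<le> integral {x..y} (\<lambda>_. K)" by (rule integral_le) (use int assms that in auto)
    thus ?thesis using that by simp
  qed
  have split: "integral {x..z} VV = integral {x..y} VV + integral {y..z} VV" if "x \<le> y" "y \<le> z" for x y z
    using Henstock_Kurzweil_Integration.integral_combine[OF that int] by simp
  show "integral {a..b} VV \<le> (b - a) * K" by (rule le) (use assms in auto)
  have "integral {a - \<delta>..b + \<delta>} VV = integral {a - \<delta>..a} VV + (integral {a..b} VV + integral {b..b + \<delta>} VV)"
    using split[of "a - \<delta>" a "b + \<delta>"] split[of a b "b + \<delta>"] assms by simp
  moreover have "integral {a - \<delta>..a} VV \<le> (a - (a - \<delta>)) * K" "integral {b..b + \<delta>} VV \<le> (b + \<delta> - b) * K"
    by (rule le; use assms in simp)+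
  ultimately show "integral {a - \<delta>..b + \<delta>} VV \<le> integral {a..b} VV + 2 * \<delta> * K" by simp
  assume ab: "a + \<delta> \<le> b - \<delta>"
  have "integral {a..b} VV = integral {a..a + \<delta>} VV + (integral {a + \<delta>..b - \<delta>} VV + integral {b - \<delta>..b} VV)"
    using split[of a "a + \<delta>" b] split[of "a + \<delta>" "b - \<delta>" b] assms ab by simp
  moreover have "integral {a..a + \<delta>} VV \<le> (a + \<delta> - a) * K" "integral {b - \<delta>..b} VV \<le> (b - (b - \<delta>)) * K"
    by (rule le; use assms ab in simp)+
  ultimately show "integral {a..b} VV \<le> integral {a + \<delta>..b - \<delta>} VV + 2 * \<delta> * K" by simp
qed

text \<open>The ratio of \<open>N\<close> to the largest modulus only tends to \<open>c\<close>, so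
  the window for index \<open>N\<close> is enclosed between windows on the scale of the moduli that
  are shrunk and enlarged by a fixed \<open>\<delta>\<close>; since \<open>VV\<close> is locally
  bounded, this changes the limit by little.\<close>

lemma correlation_limit:
  assumes en: "root_enumeration D \<nu> n e" and c: "((\<lambda>X. card {\<rho> \<in> root_pairs D \<nu> n. real_of_int (fst \<rho>) \<le> X} / X) \<longlongrightarrow> c) at_top" "c > 0"
    and \<alpha>\<beta>: "\<alpha> \<le> \<beta>" and I: "I \<subseteq> {\<alpha>..\<beta>}" "{\<alpha><..<\<beta>} \<subseteq> I"
  shows "(\<lambda>N. pair_correlation (\<lambda>j. root_point (e j)) N I) \<longlonglongrightarrow> integral {\<alpha> / c..\<beta> / c} VV / c"
proof (rule tendstoI)
  fix \<epsilon> :: real assume \<epsilon>: "\<epsilon> > 0"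
  define a b where "a = \<alpha> / c" and "b = \<beta> / c"
  have ab: "a \<le> b" "\<alpha> = c * a" "\<beta> = c * b" unfolding a_def b_def using \<alpha>\<beta> c(2) by (auto simp: divide_right_mono)
  define L where "L = integral {a..b} VV / c"
  have "compact (VV ` {a - 1..b + 1})" by (intro compact_continuous_image VV_continuous) auto
  then obtain K0 where K0: "\<forall>y\<in>VV ` {a - 1..b + 1}. norm y \<le> K0" using compact_imp_bounded bounded_iff by blast
  define K where "K = max 1 K0"
  have K: "\<forall>t\<in>{a - 1..b + 1}. VV t \<le> K"
  proof
    fix t assume "t \<in> {a - 1..b + 1}"
    hence "norm (VV t) \<le> K0" using K0 by blast
    thus "VV t \<le> K" unfolding K_def by simp
  qed
  have K1: "K \<ge> 1" unfolding K_def by simp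
  \<comment> \<open>\<open>K\<close> bounds \<open>VV\<close> around the window; the choice makes
    the error \<open>2 * \<delta> * K / c\<close> at most \<open>\<epsilon> / 4\<close>.\<close>
  define \<delta> where "\<delta> = min 1 (\<epsilon> * c / (8 * K))"
  have \<delta>: "0 < \<delta>" "\<delta> \<le> 1" unfolding \<delta>_def using \<epsilon> c(2) K1 by auto
  have "\<delta> * (8 * K) \<le> \<epsilon> * c" unfolding \<delta>_def using K1 by (simp add: min_def field_simps)
  hence \<delta>K: "2 * \<delta> * K / c \<le> \<epsilon> / 4" using c(2) by (simp add: field_simps)
  note VB = VV_integral_bounds[OF K ab(1) less_imp_le[OF \<delta>(1)] \<delta>(2)]
  define m where "m = MN e"
  note mN = MN_top[OF en, folded m_def] and ra = MN_ratio[OF en c(1)[folded cnt_def[OF en]] c(2), folded m_def]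
  have top1: "filterlim (\<lambda>N. m N - 1) at_top sequentially"
    using filterlim_tendsto_add_at_top[OF tendsto_const[of "-1"] mN] by (simp add: add.commute)
  have inv: "(\<lambda>N. m N / real N) \<longlonglongrightarrow> 1 / c" "(\<lambda>N. (m N - 1) / real N) \<longlonglongrightarrow> 1 / c"
    using tendsto_divide[OF tendsto_const[of 1] ra(1)] tendsto_divide[OF tendsto_const[of 1] ra(2)] c(2) by auto
  have pc: "pair_correlation (\<lambda>j. root_point (e j)) N I = card (PC e N I) / real N" for N
    unfolding pair_correlation_def PC_def[OF en] ..
  have ev: "\<forall>\<^sub>F N in sequentially. m N > 1" "\<forall>\<^sub>F N in sequentially. N \<ge> (1::nat)"
    using mN unfolding filterlim_at_top_dense by (auto simp: eventually_ge_at_top)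
  have up: "\<forall>\<^sub>F N in sequentially. pair_correlation (\<lambda>j. root_point (e j)) N I < L + \<epsilon>"
  proof -
    have "(\<lambda>N. card (tot (m N) (a - \<delta>) (b + \<delta>)) / m N * (m N / real N)) \<longlonglongrightarrow> integral {a - \<delta>..b + \<delta>} VV * (1 / c)"
      by (intro tendsto_mult inv(1) filterlim_compose[OF tot_limit mN]) (use ab \<delta> in auto)
    moreover have "integral {a - \<delta>..b + \<delta>} VV * (1 / c) < L + \<epsilon>"
    proof -
      have "integral {a - \<delta>..b + \<delta>} VV * (1 / c) \<le> (integral {a..b} VV + 2 * \<delta> * K) * (1 / c)"
        using VB(1) c(2) by (intro mult_right_mono) auto
      also have "\<dots> = L + 2 * \<delta> * K / c" unfolding L_def by (simp add: add_divide_distrib)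
      finally show ?thesis using \<delta>K \<epsilon> by linarith
    qed
    ultimately have 1: "\<forall>\<^sub>F N in sequentially. card (tot (m N) (a - \<delta>) (b + \<delta>)) / m N * (m N / real N) < L + \<epsilon>"
      by (rule order_tendstoD)
    have l1: "(\<lambda>N. \<alpha> * (m N / real N)) \<longlonglongrightarrow> \<alpha> * (1 / c)" "(\<lambda>N. \<beta> * (m N / real N)) \<longlonglongrightarrow> \<beta> * (1 / c)"
      by (intro tendsto_intros inv(1))+
    have 2: "\<forall>\<^sub>F N in sequentially. \<alpha> * (m N / real N) > a - \<delta>"
      by (rule order_tendstoD(1)[OF l1(1)]) (use \<delta> in \<open>simp add: a_def\<close>)
    have 3: "\<forall>\<^sub>F N in sequentially. \<beta> * (m N / real N) < b + \<delta>"
      by (rule order_tendstoD(2)[OF l1(2)]) (use \<delta> in \<open>simp add: b_def\<close>)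
    show ?thesis using 1 2 3 ev
    proof eventually_elim
      case (elim N)
      have "card (PC e N I) \<le> card (tot (m N) (a - \<delta>) (b + \<delta>))"
        unfolding m_def
      proof (rule PC_upper[OF en elim(5)])
        show "0 < MN e N" using elim(4) unfolding m_def by simp
        fix t assume "t \<in> I"
        hence t: "\<alpha> \<le> t" "t \<le> \<beta>" using I by auto
        have mp: "m N / real N > 0" using elim(4,5) by simp
        have "a - \<delta> \<le> t * (m N / real N)" using elim(2) mult_right_mono[OF t(1), of "m N / real N"] mp by linarith
        moreover have "t * (m N / real N) \<le> b + \<delta>" using elim(3) mult_right_mono[OF t(2), of "m N / real N"] mp by linarith
        ultimately show "(a - \<delta>) / MN e N \<le> t / real N \<and> t / real N \<le> (b + \<delta>) / MN e N"
          using elim(4,5) unfolding m_def[symmetric] by (simp add: field_simps)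
      qed
      hence "pair_correlation (\<lambda>j. root_point (e j)) N I \<le> card (tot (m N) (a - \<delta>) (b + \<delta>)) / real N"
        unfolding pc by (intro divide_right_mono) auto
      also have "\<dots> = card (tot (m N) (a - \<delta>) (b + \<delta>)) / m N * (m N / real N)" using elim(4) by simp
      finally show ?case using elim(1) by linarith
    qed
  qed
  have lo: "\<forall>\<^sub>F N in sequentially. pair_correlation (\<lambda>j. root_point (e j)) N I > L - \<epsilon>"
  proof (cases "a + \<delta> \<le> b - \<delta>")
    \<comment> \<open>A window shorter than \<open>2 * \<delta>\<close> has so small a limit
      \<open>L\<close> that the lower bound \<open>L - \<epsilon>\<close> is negative.\<close>
    case False
    have "L \<le> (b - a) * K / c" unfolding L_def using VB(3) c(2) by (intro divide_right_mono) auto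
    also have "\<dots> \<le> 2 * \<delta> * K / c" using False K1 c(2) by (intro divide_right_mono mult_right_mono) auto
    finally have "L - \<epsilon> < 0" using \<delta>K \<epsilon> by linarith
    moreover have "pair_correlation (\<lambda>j. root_point (e j)) N I \<ge> 0" for N unfolding pc by simp
    ultimately show ?thesis by (intro always_eventually allI) (meson less_le_trans)
  next
    case True
    have "(\<lambda>N. card (tot (m N - 1) (a + \<delta>) (b - \<delta>)) / (m N - 1) * ((m N - 1) / real N)) \<longlonglongrightarrow> integral {a + \<delta>..b - \<delta>} VV * (1 / c)"
      by (intro tendsto_mult inv(2) filterlim_compose[OF tot_limit top1]) (use True in auto)
    moreover have "integral {a + \<delta>..b - \<delta>} VV * (1 / c) > L - \<epsilon>"
    proof -
      have "L = integral {a..b} VV * (1 / c)" unfolding L_def by simp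
      also have "\<dots> \<le> (integral {a + \<delta>..b - \<delta>} VV + 2 * \<delta> * K) * (1 / c)"
        using VB(2)[OF True] c(2) by (intro mult_right_mono) auto
      also have "\<dots> = integral {a + \<delta>..b - \<delta>} VV * (1 / c) + 2 * \<delta> * K / c" by (simp add: add_divide_distrib)
      finally show ?thesis using \<delta>K \<epsilon> by linarith
    qed
    ultimately have 1: "\<forall>\<^sub>F N in sequentially. card (tot (m N - 1) (a + \<delta>) (b - \<delta>)) / (m N - 1) * ((m N - 1) / real N) > L - \<epsilon>"
      by (rule order_tendstoD)
    have l1: "(\<lambda>N. real N / (m N - 1) * (a + \<delta>)) \<longlonglongrightarrow> c * (a + \<delta>)" "(\<lambda>N. real N / (m N - 1) * (b - \<delta>)) \<longlonglongrightarrow> c * (b - \<delta>)"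
      by (intro tendsto_intros ra(2))+
    have 2: "\<forall>\<^sub>F N in sequentially. real N / (m N - 1) * (a + \<delta>) > \<alpha>"
      by (rule order_tendstoD(1)[OF l1(1)]) (use \<delta> c(2) ab in \<open>simp add: algebra_simps\<close>)
    have 3: "\<forall>\<^sub>F N in sequentially. real N / (m N - 1) * (b - \<delta>) < \<beta>"
      by (rule order_tendstoD(2)[OF l1(2)]) (use \<delta> c(2) ab in \<open>simp add: algebra_simps\<close>)
    show ?thesis using 1 2 3 ev
    proof eventually_elim
      case (elim N)
      have "card (tot (m N - 1) (a + \<delta>) (b - \<delta>)) \<le> card (PC e N I)"
        unfolding m_def
      proof (rule PC_lower[OF en elim(5)])
        show "1 < MN e N" using elim(4) unfolding m_def .
        fix y assume y: "a + \<delta> \<le> y" "y \<le> b - \<delta>"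
        define q where "q = real N / (m N - 1)"
        have q: "q \<ge> 0" unfolding q_def using elim(4) by simp
        have "\<alpha> < q * y" using elim(2) mult_left_mono[OF y(1) q] unfolding q_def by linarith
        moreover have "q * y < \<beta>" using elim(3) mult_left_mono[OF y(2) q] unfolding q_def by linarith
        ultimately show "real N / (MN e N - 1) * y \<in> I" using I(2) unfolding q_def m_def by auto
      qed
      hence "card (tot (m N - 1) (a + \<delta>) (b - \<delta>)) / real N \<le> pair_correlation (\<lambda>j. root_point (e j)) N I"
        unfolding pc by (intro divide_right_mono) auto
      moreover have "card (tot (m N - 1) (a + \<delta>) (b - \<delta>)) / real N = card (tot (m N - 1) (a + \<delta>) (b - \<delta>)) / (m N - 1) * ((m N - 1) / real N)"
        using elim(4) by simp
      ultimately show ?case using elim(1) by linarith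
    qed
  qed
  show "\<forall>\<^sub>F N in sequentially. dist (pair_correlation (\<lambda>j. root_point (e j)) N I) (integral {\<alpha> / c..\<beta> / c} VV / c) < \<epsilon>"
    using up lo unfolding L_def a_def b_def by eventually_elim (simp add: dist_real_def abs_less_iff)
qed

end

section \<open>Conclusion for bounded intervals\<close>

lemma interval_hull:
  fixes I :: "real set"
  assumes "is_interval I" "bounded I" "I \<noteq> {}"
  shows "I \<subseteq> {Inf I..Sup I}" "{Inf I<..<Sup I} \<subseteq> I" "Inf I \<le> Sup I"
proof -
  have b: "bdd_below I" "bdd_above I" using assms(2) by (auto intro: bounded_imp_bdd_below bounded_imp_bdd_above)
  show s: "I \<subseteq> {Inf I..Sup I}" using b by (auto intro: cInf_lower cSup_upper)
  show "Inf I \<le> Sup I" using s assms(3) by fastforce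
  show "{Inf I<..<Sup I} \<subseteq> I"
  proof
    fix x assume x: "x \<in> {Inf I<..<Sup I}"
    obtain y where y: "y \<in> I" "y < x" using x cInf_less_iff[OF assms(3) b(1)] by auto
    obtain z where z: "z \<in> I" "x < z" using x less_cSup_iff[OF assms(3) b(2)] by auto
    show "x \<in> I" using assms(1) y z unfolding is_interval_1 by (meson less_imp_le)
  qed
qed

theorem theorem1p2:
  fixes D n \<nu> :: int
  assumes "D > 1" and "squarefree D" and "[D = 1] (mod 4)"
    and "n \<ge> 1" and "[\<nu>\<^sup>2 = D] (mod n)"
  shows "\<exists>\<omega> :: real \<Rightarrow> real.
           (\<forall>t. \<omega> t \<ge> 0) \<and> (\<forall>t. \<omega> (- t) = \<omega> t) \<and> continuous_on UNIV \<omega> \<and>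
           (\<forall>e. root_enumeration D \<nu> n e \<longrightarrow>
             (\<forall>I :: real set. is_interval I \<and> bounded I \<longrightarrow>
               (\<lambda>N. pair_correlation (\<lambda>j. root_point (e j)) N I) \<longlonglongrightarrow> integral I \<omega>))"
proof -
  \<comment> \<open>A square root of \<open>D\<close> has its square dividing a squarefree number,
    so it would be a unit, against \<open>D > 1\<close>.\<close>
  have nsq: "k * k \<noteq> D" for k :: int
  proof
    assume k: "k * k = D"
    hence "k\<^sup>2 dvd D" by (simp add: power2_eq_square)
    hence "k dvd 1" using assms(2) unfolding squarefree_def by blast
    hence "k * k = 1" by (auto simp: zdvd1_eq abs_if split: if_splits)
    thus False using k assms(1) by simp
  qed
  interpret nonsquare_roots D n \<nu>
    by unfold_locales (use assms nsq in auto)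
  obtain c where c: "c > 0" "((\<lambda>M. card {\<rho> \<in> root_pairs D \<nu> n. real_of_int (fst \<rho>) \<le> M} / M) \<longlongrightarrow> c) at_top"
    using root_count[OF assms(5)] by blast
  \<comment> \<open>With \<open>N\<close> asymptotic to \<open>c * M\<close>, the difference
    \<open>t / N\<close> is close to \<open>(t / c) / M\<close>: the substitution gives one factor
    \<open>1 / c\<close>, and dividing the count by \<open>N\<close> instead of \<open>M\<close>
    gives the other.\<close>
  define \<omega> where "\<omega> t = VV (t / c) / c\<^sup>2" for t
  have cont: "continuous_on S \<omega>" for S
  proof -
    have "continuous_on S (\<lambda>t. VV (t / c))"
      by (rule continuous_on_compose2[OF VV_continuous[of UNIV]]) (use c(1) in \<open>auto intro!: continuous_intros\<close>)
    thus ?thesis unfolding \<omega>_def using c(1) by (intro continuous_intros) auto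
  qed
  have lim: "(\<lambda>N. pair_correlation (\<lambda>j. root_point (e j)) N I) \<longlonglongrightarrow> integral I \<omega>"
    if en: "root_enumeration D \<nu> n e" and I: "is_interval I" "bounded I" for e I
  proof (cases "I = {}")
    case True
    thus ?thesis by (simp add: pair_correlation_def)
  next
    case False
    define \<alpha> \<beta> where "\<alpha> = Inf I" and "\<beta> = Sup I"
    note H = interval_hull[OF I False, folded \<alpha>_def \<beta>_def]
    have "((\<lambda>x. (1 / c) *\<^sub>R VV (x / c)) has_integral integral {\<alpha> / c..\<beta> / c} VV) {\<alpha>..\<beta>}"
    proof (rule has_integral_substitution[where c = "\<alpha> / c" and d = "\<beta> / c"])
      show "\<alpha> \<le> \<beta>" "\<alpha> / c \<le> \<beta> / c" "(\<lambda>x. x / c) ` {\<alpha>..\<beta>} \<subseteq> {\<alpha> / c..\<beta> / c}" "continuous_on {\<alpha> / c..\<beta> / c} VV"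
        using H(3) c(1) VV_continuous by (auto intro!: divide_right_mono)
      show "((\<lambda>x. x / c) has_real_derivative 1 / c) (at x within {\<alpha>..\<beta>})" for x
        using c(1) by (auto intro!: derivative_eq_intros)
    qed
    from has_integral_mult_right[OF this, of "1 / c"]
    have "(\<omega> has_integral integral {\<alpha> / c..\<beta> / c} VV / c) {\<alpha>..\<beta>}"
      unfolding \<omega>_def by (simp add: power2_eq_square)
    hence "integral {\<alpha>..\<beta>} \<omega> = integral {\<alpha> / c..\<beta> / c} VV / c" by (rule integral_unique)
    moreover have "integral I \<omega> = integral {\<alpha>..\<beta>} \<omega>"
    proof (rule integral_spike_set)
      have "{\<alpha>..\<beta>} - I \<subseteq> {\<alpha>, \<beta>}" using H(2) by force
      hence "{x \<in> {\<alpha>..\<beta>} - I. \<omega> x \<noteq> 0} \<subseteq> {\<alpha>, \<beta>}" by blast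
      moreover have "negligible {\<alpha>, \<beta>}" by (rule negligible_finite) simp
      ultimately show "negligible {x \<in> {\<alpha>..\<beta>} - I. \<omega> x \<noteq> 0}" by (rule negligible_subset[rotated])
      have "{x \<in> I - {\<alpha>..\<beta>}. \<omega> x \<noteq> 0} = {}" using H(1) by blast
      thus "negligible {x \<in> I - {\<alpha>..\<beta>}. \<omega> x \<noteq> 0}" by (simp only: negligible_empty)
    qed
    ultimately show ?thesis using correlation_limit[OF en c(2,1) H(3,1,2)] by simp
  qed
  have "\<omega> t \<ge> 0" "\<omega> (- t) = \<omega> t" for t
    unfolding \<omega>_def using VV_nonneg by (auto simp: VV_def add.commute)
  thus ?thesis using cont[of UNIV] lim by blast
qed

end
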